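(* Fix $i\in I$. Let $j\in I\setminus\{i\}$ and let $m\ge0$. If $n>-mc_{i,j}$, then the complex $\mathrm{Ad}_{E_i}^{(n)}(E_j^m)$ is null-homotopic (i.e. its identity morphism is homotopic to zero).
   Context: Let $I$ be a nonempty set and $\cdot:\mathbb{Z}I\otimes\mathbb{Z}I\to\mathbb{Z}$ a symmetric bilinear form with $i\cdot i\in 2\mathbb{Z}_{>0}$ for all $i\in I$ and $c_{i,j}:=2(i\cdot j)/(i\cdot i)\in\mathbb{Z}_{\le 0}$ for $i\neq j$ (and $c_{i,i}=2$). Put $d_i=(i\cdot i)/2$, $Q=\bigoplus_{i\in I}\mathbb{Z}i$, $Q^+=\bigoplus_{i\in I}\mathbb{Z}_{\ge 0}i$, and let $\langle i^\vee,-\rangle:Q\to\mathbb{Z}$ be the linear map with $\langle i^\vee,j\rangle=c_{i,j}$. The height of $\beta=\sum n_i i\in Q^+$ is $|\beta|=\sum n_i$, and $I^\beta=\{\nu\in I^{|\beta|}:\sum_k\nu_k=\beta\}$. Components of tuples are numbered from right to left, $\nu=(\nu_n,\dots,\nu_1)$, and $s_k$ exchanges $\nu_k$ and $\nu_{k+1}$. $K$ is a commutative ring, $\otimes=\otimes_K$. For a graded $K$-module $M$, $(qM)_d=M_{d+1}$; $q_i=q^{d_i}$. For $i,j\in I$ fix $Q_{i,j}(u,v)\in K[u,v]$ with $Q_{i,i}=0$, $Q_{i,j}(u,v)=Q_{j,i}(v,u)$, and for $i\ne j$: if $c_{i,j}<0$, $Q_{i,j}(u,v)\in t_{i,j}u^{-c_{i,j}}+t_{j,i}v^{-c_{j,i}}+\sum_{s,t>0,\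 d_is+d_jt=-i\cdot j}Ku^sv^t$ with $t_{i,j},t_{j,i}\in K^\times$; if $c_{i,j}=0$, $Q_{i,j}$ is an invertible constant. KLR algebra. For $\beta\in Q^+$ of height $n$, $H_\beta$ is the unital $K$-algebra generated by $1_\nu$ ($\nu\in I^\beta$), $x_1,\dots,x_n$, $\tau_1,\dots,\tau_{n-1}$ with relations: $1_\nu1_{\nu'}=\delta_{\nu,\nu'}1_\nu$, $\sum_\nu1_\nu=1_\beta$ (the unit); $x_k1_\nu=1_\nu x_k$; $\tau_k1_\nu=1_{s_k(\nu)}\tau_k$; $x_kx_\ell=x_\ell x_k$; $\tau_k^21_\nu=Q_{\nu_k,\nu_{k+1}}(x_k,x_{k+1})1_\nu$; $(\tau_kx_\ell-x_{s_k(\ell)}\tau_k)1_\nu$ equals $1_\nu$ if $\ell=k+1,\nu_k=\nu_{k+1}$, equals $-1_\nu$ if $\ell=k,\nu_k=\nu_{k+1}$, and is $0$ otherwise; $\tau_k\tau_\ell=\tau_\ell\tau_k$ if $|k-\ell|>1$; $(\tau_{k+1}\tau_k\tau_{k+1}-\tau_k\tau_{k+1}\tau_k)1_\nu=\delta_{\nu_k,\nu_{k+2}}\frac{Q_{\nu_k,\nu_{k+1}}(x_{k+2},x_{k+1})-Q_{\nu_k,\nu_{k+1}}(x_k,x_{k+1})}{x_{k+2}-x_k}1_\nu$. Grading: $\deg 1_\nu=0$, $\deg x_k1_\nu=\nu_k\cdot\nu_k$, $\deg\tau_k1_\nu=-\nu_k\cdot\nu_{k+1}$. Write $\tau_{[k\uparrow\ell]}=\tau_k\tau_{k+1}\cdots\tau_\ell$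 (equal to $1$ if $k>\ell$). Monoidal structure. For $|\beta|=m$, $|\gamma|=n$ there is a non-unital morphism $H_\beta\otimes H_\gamma\to H_{\beta+\gamma}$, $y\otimes z\mapsto y\diamond z$, where $1_\mu\diamond1_\nu=1_{\mu\nu}$ (concatenation), generators $x_k,\tau_\ell$ of the left factor $H_\beta$ are sent to $x_{n+k},\tau_{n+\ell}$ and those of the right factor $H_\gamma$ to $x_k,\tau_\ell$. Put $1_{\beta_1,\dots,\beta_s}=1_{\beta_1}\diamond\cdots\diamond1_{\beta_s}$; set $1_{\beta-i,i}=0$ if $\beta-i\notin Q^+$. $\mathcal H=\bigoplus_{\beta\in Q^+}H_\beta\text{-mod}$ is the category of finitely generated graded modules with degree preserving morphisms. For $M\in H_\beta$-mod, $N\in H_\gamma$-mod, $MN=H_{\beta+\gamma}1_{\beta,\gamma}\otimes_{H_\beta\otimes H_\gamma}(M\otimes N)$. $E_j$ is the free $H_j$-module of rank one; $E_j^m$ is its $m$-fold product, the free $H_{mj}$-module of rank one ($E_j^0=K=H_0$). Elements of $H_{ni}$ act on $E_i^n$ as endomorphisms by right multiplication. $E_i^aME_i^b\simeq H_{\beta+(a+b)i}1_{ai,\beta,bi}\otimes_{H_\beta}M$ via $y\mapsto 1_{ai}\diamond y\diamond1_{bi}$. Divided powers. Let $\omega_0[1,n]$ be the longest element of $\mathfrak S_n$, $\tau_{\omega_0[1,n]}=\tau_{k_1}\cdots\tau_{k_s}$ for any reduced expression, $e_n=x_2x_3^2\cdots x_n^{n-1}\tau_{\omega_0[1,n]}\in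 H_{ni}$ (an idempotent), and $E_i^{(n)}=q_i^{-n(n-1)/2}E_i^ne_n$. $H_\beta^i=H_\beta/(1_{\beta-i,i})$ (quotient by the two-sided ideal), $\mathcal H[i]=\bigoplus_{\beta}H_\beta^i\text{-mod}$ (finitely generated graded modules); $E_j^m\in\mathcal H[i]$ for $j\neq i$. For $M\in H^i_\beta$-mod, $|\beta|=r$, there is a well-defined $H_{\beta+i}$-morphism $\tau_{E_i,M}:ME_i\to E_iM$, $h1_{\beta,i}\otimes m\mapsto h\tau_{[1\uparrow r]}1_{i,\beta}\otimes m$. The complex. For $M\in H_\beta^i$-mod, $|\beta|=r$, $w=\langle i^\vee,\beta\rangle$, $\mathrm{Ad}_{E_i}^{(n)}(M)$ is the cochain complex of graded $H_{\beta+ni}$-modules $$0\to q_i^{n(n+w-1)}ME_i^{(n)}\to\cdots\to q_i^{k(n+w-1)}E_i^{(n-k)}ME_i^{(k)}\xrightarrow{d_k}q_i^{(k-1)(n+w-1)}E_i^{(n-k+1)}ME_i^{(k-1)}\to\cdots\to E_i^{(n)}M\to0$$ with $E_i^{(n-k)}ME_i^{(k)}$ in cohomological degree $-k$, where $d_k$ is the restriction to $E_i^{(n-k)}ME_i^{(k)}\subseteq E_i^{n-k}ME_i^k$ of $(-1)^{k-1}(\tau_{[1\uparrow n-k]}ME_i^{k-1})\circ(E_i^{n-k}\tau_{E_i,M}E_i^{k-1}):E_i^{n-k}ME_i^k\to E_i^{n-k+1}ME_i^{k-1}$, i.e. of $h1_{(n-k)i,\beta,ki}\otimes m\mapsto(-1)^{k-1}h\,\tau_{[k\uparrow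 n+r-1]}1_{(n-k+1)i,\beta,(k-1)i}\otimes m$; this map does land in $E_i^{(n-k+1)}ME_i^{(k-1)}$ and $d_{k-1}d_k=0$. *)

theory Defs
  imports
    "HOL-Computational_Algebra.Polynomial"
    "HOL-Combinatorics.Transposition"
    "HOL-Combinatorics.Multiset_Permutations"
    "HOL-Algebra.QuotRing"
    "HOL-Algebra.Module"
    "HOL-Algebra.Generated_Groups"
    "HOL-Algebra.Free_Abelian_Groups"
begin

section \<open>Cartan data and the polynomials Q\<close>

text \<open>
  The index set \<open>I\<close> is the type \<open>'i\<close>; \<open>Q\<^sup>+\<close> is \<open>'i multiset\<close>, with height \<^const>\<open>size\<close>; the
  bilinear form on \<open>\<int>I\<close> is given by its Gram matrix \<open>ip\<close> on the basis \<open>I\<close>.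
  A tuple \<open>(\<nu>\<^sub>n, \<dots>, \<nu>\<^sub>1)\<close> is the list \<open>[\<nu>\<^sub>n, \<dots>, \<nu>\<^sub>1]\<close>, so that concatenation of tuples is
  \<open>(@)\<close>, components are counted from the right, starting with 1, and
  \<open>I\<^sup>\<beta>\<close> is \<^term>\<open>permutations_of_multiset \<beta>\<close>.
\<close>

definition half_norm :: "('i \<Rightarrow> 'i \<Rightarrow> int) \<Rightarrow> 'i \<Rightarrow> int" where
  "half_norm ip i = ip i i div 2"

definition cartan :: "('i \<Rightarrow> 'i \<Rightarrow> int) \<Rightarrow> 'i \<Rightarrow> 'i \<Rightarrow> int" where
  "cartan ip i j = 2 * ip i j div ip i i"

definition coroot_pairing :: "('i \<Rightarrow> 'i \<Rightarrow> int) \<Rightarrow> 'i \<Rightarrow> 'i multiset \<Rightarrow> int" where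
  "coroot_pairing ip i \<beta> = (\<Sum>j\<in>#\<beta>. cartan ip i j)"

definition cpt :: "'i list \<Rightarrow> nat \<Rightarrow> 'i" where
  "cpt \<nu> k = \<nu> ! (length \<nu> - k)"

definition swap_cpt :: "nat \<Rightarrow> 'i list \<Rightarrow> 'i list" where
  "swap_cpt k \<nu> = \<nu>[length \<nu> - k := cpt \<nu> (Suc k), length \<nu> - Suc k := cpt \<nu> k]"

text \<open>
  In \<open>'k poly poly\<close> the outer variable is \<open>u\<close> and the inner one is \<open>v\<close>: the coefficient of
  \<open>u\<^sup>a v\<^sup>b\<close> in \<open>P\<close> is \<^term>\<open>coeff (coeff P a) b\<close>.
\<close>

locale klr_datum =
  fixes ip :: "'i \<Rightarrow> 'i \<Rightarrow> int"
    and t :: "'i \<Rightarrow> 'i \<Rightarrow> 'k::comm_ring_1"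
    and Q :: "'i \<Rightarrow> 'i \<Rightarrow> 'k poly poly"
  assumes ip_sym: "ip i j = ip j i"
    and ip_even: "even (ip i i)"
    and ip_pos: "ip i i > 0"
    and cartan_integral: "i \<noteq> j \<Longrightarrow> ip i i dvd 2 * ip i j"
    and cartan_nonpos: "i \<noteq> j \<Longrightarrow> cartan ip i j \<le> 0"
    and Q_diag: "Q i i = 0"
    and Q_sym: "coeff (coeff (Q i j) a) b = coeff (coeff (Q j i) b) a"
    and t_unit: "i \<noteq> j \<Longrightarrow> cartan ip i j < 0 \<Longrightarrow> t i j dvd 1"
    and Q_neg: "i \<noteq> j \<Longrightarrow> cartan ip i j < 0 \<Longrightarrow>
      \<exists>P. Q i j = monom [:t i j:] (nat (- cartan ip i j))
                 + [:monom (t j i) (nat (- cartan ip j i)):] + P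
        \<and> (\<forall>a b. coeff (coeff P a) b \<noteq> 0 \<longrightarrow>
              0 < a \<and> 0 < b \<and> half_norm ip i * int a + half_norm ip j * int b = - ip i j)"
    and Q_zero: "i \<noteq> j \<Longrightarrow> cartan ip i j = 0 \<Longrightarrow> \<exists>c. c dvd 1 \<and> Q i j = [:[:c:]:]"

section \<open>KLR algebras\<close>

datatype 'i klr_gen = IdemG "'i list" | XG nat | TauG nat

text \<open>Words form a (multiplicative) monoid, written additively because \<^typ>\<open>'a \<Rightarrow>\<^sub>0 'b\<close> takes
  its convolution product from an additive monoid of exponents.\<close>

datatype 'a fword = Word (letters: "'a list")

instantiation fword :: (type) monoid_add
begin
definition "0 = Word []"
definition "v + w = Word (letters v @ letters w)"
instance by standard (simp_all add: zero_fword_def plus_fword_def)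
end

type_synonym ('i, 'k) free_alg = "'i klr_gen fword \<Rightarrow>\<^sub>0 'k"

definition gen :: "'i klr_gen \<Rightarrow> ('i, 'k::comm_ring_1) free_alg" where
  "gen g = Poly_Mapping.single (Word [g]) 1"

abbreviation idm :: "'i list \<Rightarrow> ('i, 'k::comm_ring_1) free_alg" where
  "idm \<nu> \<equiv> gen (IdemG \<nu>)"

abbreviation xv :: "nat \<Rightarrow> ('i, 'k::comm_ring_1) free_alg" where
  "xv k \<equiv> gen (XG k)"

abbreviation tau :: "nat \<Rightarrow> ('i, 'k::comm_ring_1) free_alg" where
  "tau k \<equiv> gen (TauG k)"

definition scalar :: "'k \<Rightarrow> ('i, 'k::comm_ring_1) free_alg" where
  "scalar c = Poly_Mapping.single 0 c"

definition klr_gens :: "'i multiset \<Rightarrow> 'i klr_gen set" where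
  "klr_gens \<beta> = IdemG ` permutations_of_multiset \<beta> \<union> XG ` {1..size \<beta>} \<union> TauG ` {1..<size \<beta>}"

definition klr_free :: "'i multiset \<Rightarrow> ('i, 'k::comm_ring_1) free_alg ring" where
  "klr_free \<beta> =
    \<lparr>carrier = {f. \<forall>w \<in> Poly_Mapping.keys f. set (letters w) \<subseteq> klr_gens \<beta>},
     mult = (*), one = 1, ring.zero = 0, add = (+)\<rparr>"

text \<open>\<^term>\<open>eval2 P a b\<close> is \<open>P(a, b)\<close>, and \<^term>\<open>divdiff P a b c\<close> is
  \<open>(P(a, b) - P(c, b)) / (a - c)\<close>, by
  \<open>(a\<^sup>s - c\<^sup>s) / (a - c) = \<Sum>\<^sub>p\<^sub><\<^sub>s a\<^sup>p c\<^sup>s\<^sup>-\<^sup>1\<^sup>-\<^sup>p\<close>; the arguments are only ever commuting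
  elements modulo the relations.\<close>

definition eval2 :: "'k::comm_ring_1 poly poly \<Rightarrow> ('i, 'k) free_alg \<Rightarrow> ('i, 'k) free_alg
    \<Rightarrow> ('i, 'k) free_alg" where
  "eval2 P a b = (\<Sum>s\<le>degree P. \<Sum>r\<le>degree (coeff P s).
     scalar (coeff (coeff P s) r) * a ^ s * b ^ r)"

definition divdiff :: "'k::comm_ring_1 poly poly \<Rightarrow> ('i, 'k) free_alg \<Rightarrow> ('i, 'k) free_alg
    \<Rightarrow> ('i, 'k) free_alg \<Rightarrow> ('i, 'k) free_alg" where
  "divdiff P a b c = (\<Sum>s\<le>degree P. \<Sum>r\<le>degree (coeff P s).
     scalar (coeff (coeff P s) r) * (\<Sum>p<s. a ^ p * c ^ (s - 1 - p)) * b ^ r)"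

inductive klr_rel :: "('i \<Rightarrow> 'i \<Rightarrow> 'k::comm_ring_1 poly poly) \<Rightarrow> 'i multiset \<Rightarrow>
    ('i, 'k) free_alg \<Rightarrow> ('i, 'k) free_alg \<Rightarrow> bool" for Q \<beta> where
  idem_idem: "\<nu> \<in> permutations_of_multiset \<beta> \<Longrightarrow> \<mu> \<in> permutations_of_multiset \<beta> \<Longrightarrow>
    klr_rel Q \<beta> (idm \<nu> * idm \<mu>) (if \<nu> = \<mu> then idm \<nu> else 0)"
| unit: "klr_rel Q \<beta> (\<Sum>\<nu>\<in>permutations_of_multiset \<beta>. idm \<nu>) 1"
| x_idem: "\<nu> \<in> permutations_of_multiset \<beta> \<Longrightarrow> k \<in> {1..size \<beta>} \<Longrightarrow>
    klr_rel Q \<beta> (xv k * idm \<nu>) (idm \<nu> * xv k)"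
| tau_idem: "\<nu> \<in> permutations_of_multiset \<beta> \<Longrightarrow> k \<in> {1..<size \<beta>} \<Longrightarrow>
    klr_rel Q \<beta> (tau k * idm \<nu>) (idm (swap_cpt k \<nu>) * tau k)"
| x_x: "k \<in> {1..size \<beta>} \<Longrightarrow> l \<in> {1..size \<beta>} \<Longrightarrow> klr_rel Q \<beta> (xv k * xv l) (xv l * xv k)"
| tau_square: "\<nu> \<in> permutations_of_multiset \<beta> \<Longrightarrow> k \<in> {1..<size \<beta>} \<Longrightarrow>
    klr_rel Q \<beta> (tau k ^ 2 * idm \<nu>)
      (eval2 (Q (cpt \<nu> k) (cpt \<nu> (k + 1))) (xv k) (xv (k + 1)) * idm \<nu>)"
| tau_x: "\<nu> \<in> permutations_of_multiset \<beta> \<Longrightarrow> k \<in> {1..<size \<beta>} \<Longrightarrow> l \<in> {1..size \<beta>} \<Longrightarrow>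
    klr_rel Q \<beta> ((tau k * xv l - xv (transpose k (k + 1) l) * tau k) * idm \<nu>)
      (if l = k + 1 \<and> cpt \<nu> k = cpt \<nu> (k + 1) then idm \<nu>
       else if l = k \<and> cpt \<nu> k = cpt \<nu> (k + 1) then - idm \<nu>
       else 0)"
| tau_tau: "k \<in> {1..<size \<beta>} \<Longrightarrow> l \<in> {1..<size \<beta>} \<Longrightarrow> k + 1 < l \<or> l + 1 < k \<Longrightarrow>
    klr_rel Q \<beta> (tau k * tau l) (tau l * tau k)"
| braid: "\<nu> \<in> permutations_of_multiset \<beta> \<Longrightarrow> 1 \<le> k \<Longrightarrow> k + 1 < size \<beta> \<Longrightarrow>
    klr_rel Q \<beta>
      ((tau (k + 1) * tau k * tau (k + 1) - tau k * tau (k + 1) * tau k) * idm \<nu>)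
      (if cpt \<nu> k = cpt \<nu> (k + 2)
       then divdiff (Q (cpt \<nu> k) (cpt \<nu> (k + 1))) (xv (k + 2)) (xv (k + 1)) (xv k) * idm \<nu>
       else 0)"

definition klr_ideal :: "('i \<Rightarrow> 'i \<Rightarrow> 'k::comm_ring_1 poly poly) \<Rightarrow> 'i multiset \<Rightarrow>
    ('i, 'k) free_alg set" where
  "klr_ideal Q \<beta> = genideal (klr_free \<beta>) {a - b |a b. klr_rel Q \<beta> a b}"

type_synonym ('i, 'k) klr_elt = "('i, 'k) free_alg set"

definition klr :: "('i \<Rightarrow> 'i \<Rightarrow> 'k::comm_ring_1 poly poly) \<Rightarrow> 'i multiset \<Rightarrow>
    ('i, 'k) klr_elt ring" where
  "klr Q \<beta> = klr_free \<beta> Quot klr_ideal Q \<beta>"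

definition klr_class :: "('i \<Rightarrow> 'i \<Rightarrow> 'k::comm_ring_1 poly poly) \<Rightarrow> 'i multiset \<Rightarrow>
    ('i, 'k) free_alg \<Rightarrow> ('i, 'k) klr_elt" where
  "klr_class Q \<beta> f = klr_ideal Q \<beta> +>\<^bsub>klr_free \<beta>\<^esub> f"

lemma klr_free_simps [simp]:
  "f \<otimes>\<^bsub>klr_free \<beta>\<^esub> g = f * g" "\<one>\<^bsub>klr_free \<beta>\<^esub> = 1"
  "f \<oplus>\<^bsub>klr_free \<beta>\<^esub> g = f + g" "\<zero>\<^bsub>klr_free \<beta>\<^esub> = 0"
  by (simp_all add: klr_free_def)

lemma klr_free_closed [intro]:
  fixes f g :: "('i, 'k::comm_ring_1) free_alg"
  shows "(0 :: ('i, 'k) free_alg) \<in> carrier (klr_free \<beta>)"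
    "(1 :: ('i, 'k) free_alg) \<in> carrier (klr_free \<beta>)"
    and "f \<in> carrier (klr_free \<beta>) \<Longrightarrow> g \<in> carrier (klr_free \<beta>) \<Longrightarrow> f + g \<in> carrier (klr_free \<beta>)"
    and "f \<in> carrier (klr_free \<beta>) \<Longrightarrow> g \<in> carrier (klr_free \<beta>) \<Longrightarrow> f - g \<in> carrier (klr_free \<beta>)"
    and "f \<in> carrier (klr_free \<beta>) \<Longrightarrow> - f \<in> carrier (klr_free \<beta>)"
    and "f \<in> carrier (klr_free \<beta>) \<Longrightarrow> g \<in> carrier (klr_free \<beta>) \<Longrightarrow> f * g \<in> carrier (klr_free \<beta>)"
    and "(scalar c :: ('i, 'k) free_alg) \<in> carrier (klr_free \<beta>)"
    and "h \<in> klr_gens \<beta> \<Longrightarrow> (gen h :: ('i, 'k) free_alg) \<in> carrier (klr_free \<beta>)"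
proof -
  have minus: "Poly_Mapping.keys (- f) = Poly_Mapping.keys f" for f :: "('i, 'k) free_alg"
    by (auto simp: in_keys_iff)
  have add: "f \<in> carrier (klr_free \<beta>) \<Longrightarrow> g \<in> carrier (klr_free \<beta>) \<Longrightarrow> f + g \<in> carrier (klr_free \<beta>)"
    for f g :: "('i, 'k) free_alg"
    using keys_add[of f g] by (fastforce simp: klr_free_def)
  have neg: "f \<in> carrier (klr_free \<beta>) \<Longrightarrow> - f \<in> carrier (klr_free \<beta>)" for f :: "('i, 'k) free_alg"
    by (simp add: klr_free_def minus)
  show "f \<in> carrier (klr_free \<beta>) \<Longrightarrow> g \<in> carrier (klr_free \<beta>) \<Longrightarrow> f + g \<in> carrier (klr_free \<beta>)"
    by (rule add)
  show "f \<in> carrier (klr_free \<beta>) \<Longrightarrow> - f \<in> carrier (klr_free \<beta>)"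
    by (rule neg)
  show "f \<in> carrier (klr_free \<beta>) \<Longrightarrow> g \<in> carrier (klr_free \<beta>) \<Longrightarrow> f - g \<in> carrier (klr_free \<beta>)"
    using add[of f "- g"] neg[of g] by simp
  show "f \<in> carrier (klr_free \<beta>) \<Longrightarrow> g \<in> carrier (klr_free \<beta>) \<Longrightarrow> f * g \<in> carrier (klr_free \<beta>)"
  proof -
    assume fg: "f \<in> carrier (klr_free \<beta>)" "g \<in> carrier (klr_free \<beta>)"
    have "set (letters w) \<subseteq> klr_gens \<beta>" if w: "w \<in> Poly_Mapping.keys (f * g)" for w
    proof -
      obtain u v where "w = u + v" "u \<in> Poly_Mapping.keys f" "v \<in> Poly_Mapping.keys g"
        using w keys_mult[of f g] by blast
      then show ?thesis using fg by (auto simp: klr_free_def plus_fword_def)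
    qed
    then show ?thesis by (simp add: klr_free_def)
  qed
qed (auto simp: klr_free_def scalar_def gen_def zero_fword_def simp flip: single_one)

lemma ring_klr_free: "ring (klr_free \<beta>)"
proof (rule ringI)
  show "abelian_group (klr_free \<beta> :: ('a, 'b::comm_ring_1) free_alg ring)"
  proof (rule abelian_groupI)
    fix f :: "('a, 'b) free_alg" assume "f \<in> carrier (klr_free \<beta>)"
    then show "\<exists>g\<in>carrier (klr_free \<beta>). g \<oplus>\<^bsub>klr_free \<beta>\<^esub> f = \<zero>\<^bsub>klr_free \<beta>\<^esub>"
      by (intro bexI[of _ "- f"]) auto
  qed (auto simp: algebra_simps)
  show "Group.monoid (klr_free \<beta> :: ('a, 'b) free_alg ring)"
    by (rule monoidI) (auto simp: algebra_simps)
qed (auto simp: algebra_simps)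

lemma length_permutation: "\<nu> \<in> permutations_of_multiset \<beta> \<Longrightarrow> length \<nu> = size \<beta>"
  by (auto simp: permutations_of_multiset_def)

lemma swap_cpt_permutation:
  assumes "\<nu> \<in> permutations_of_multiset \<beta>" "k \<in> {1..<size \<beta>}"
  shows "swap_cpt k \<nu> \<in> permutations_of_multiset \<beta>"
proof -
  have "mset (\<nu>[length \<nu> - k := \<nu> ! (length \<nu> - Suc k), length \<nu> - Suc k := \<nu> ! (length \<nu> - k)])
    = mset \<nu>"
    using assms length_permutation[OF assms(1)] by (intro mset_swap) auto
  then show ?thesis using assms by (simp add: permutations_of_multiset_def swap_cpt_def cpt_def)
qed

lemma klr_free_sum [intro]:
  "(\<And>a. a \<in> A \<Longrightarrow> F a \<in> carrier (klr_free \<beta>)) \<Longrightarrow> sum F A \<in> carrier (klr_free \<beta>)"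
  by (induction A rule: infinite_finite_induct) auto

lemma klr_free_power [intro]: "f \<in> carrier (klr_free \<beta>) \<Longrightarrow> f ^ s \<in> carrier (klr_free \<beta>)"
  by (induction s) auto

text \<open>The relations live in the free algebra on the generators of \<open>H\<^sub>\<beta>\<close>, so that
  \<^const>\<open>genideal\<close> does produce an ideal there.\<close>

lemma klr_rel_closed:
  assumes "klr_rel Q \<beta> a b"
  shows "a \<in> carrier (klr_free \<beta>) \<and> b \<in> carrier (klr_free \<beta>)"
proof -
  have i: "idm \<nu> \<in> carrier (klr_free \<beta>)" if "\<nu> \<in> permutations_of_multiset \<beta>" for \<nu>
    using that by (intro klr_free_closed) (auto simp: klr_gens_def)
  have x: "xv k \<in> carrier (klr_free \<beta>)" if "k \<in> {1..size \<beta>}" for k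
    using that by (intro klr_free_closed) (auto simp: klr_gens_def)
  have t: "tau k \<in> carrier (klr_free \<beta>)" if "k \<in> {1..<size \<beta>}" for k
    using that by (intro klr_free_closed) (auto simp: klr_gens_def)
  note ops = klr_free_closed(1-7) klr_free_sum klr_free_power
  have e: "eval2 P a b \<in> carrier (klr_free \<beta>)"
    if "a \<in> carrier (klr_free \<beta>)" "b \<in> carrier (klr_free \<beta>)" for P :: "'b poly poly" and a b
    unfolding eval2_def by (intro ops that)
  have d: "divdiff P a b c \<in> carrier (klr_free \<beta>)"
    if "a \<in> carrier (klr_free \<beta>)" "b \<in> carrier (klr_free \<beta>)" "c \<in> carrier (klr_free \<beta>)"
    for P :: "'b poly poly" and a b c
    unfolding divdiff_def by (intro ops that)
  show ?thesis
    using assms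
  proof cases
    case (tau_x \<nu> k l)
    then have "transpose k (k + 1) l \<in> {1..size \<beta>}" by (auto simp: transpose_def)
    then show ?thesis unfolding tau_x(1,2) using tau_x by (auto intro!: ops i x t)
  qed (simp; intro conjI impI ops e d i x t swap_cpt_permutation; simp)+
qed

lemma ideal_klr_ideal: "ideal (klr_ideal Q \<beta>) (klr_free \<beta>)"
  unfolding klr_ideal_def
  by (rule ring.genideal_ideal[OF ring_klr_free]) (auto dest: klr_rel_closed)

lemma ring_klr: "ring (klr Q \<beta>)"
  unfolding klr_def by (rule ideal.quotient_is_ring[OF ideal_klr_ideal])

text \<open>\<^term>\<open>klr_homog ip Q \<beta> d a\<close> means that \<open>a\<close> is homogeneous of degree \<open>d\<close>: the grading is
  the smallest one that is compatible with the \<open>K\<close>-algebra structure and gives the generators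
  their prescribed degrees.\<close>

inductive klr_homog :: "('i \<Rightarrow> 'i \<Rightarrow> int) \<Rightarrow> ('i \<Rightarrow> 'i \<Rightarrow> 'k::comm_ring_1 poly poly) \<Rightarrow>
    'i multiset \<Rightarrow> int \<Rightarrow> ('i, 'k) klr_elt \<Rightarrow> bool" for ip Q \<beta> where
  zero: "klr_homog ip Q \<beta> d \<zero>\<^bsub>klr Q \<beta>\<^esub>"
| idem: "\<nu> \<in> permutations_of_multiset \<beta> \<Longrightarrow> klr_homog ip Q \<beta> 0 (klr_class Q \<beta> (idm \<nu>))"
| x: "\<nu> \<in> permutations_of_multiset \<beta> \<Longrightarrow> k \<in> {1..size \<beta>} \<Longrightarrow>
    klr_homog ip Q \<beta> (ip (cpt \<nu> k) (cpt \<nu> k)) (klr_class Q \<beta> (xv k * idm \<nu>))"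
| tau: "\<nu> \<in> permutations_of_multiset \<beta> \<Longrightarrow> k \<in> {1..<size \<beta>} \<Longrightarrow>
    klr_homog ip Q \<beta> (- ip (cpt \<nu> k) (cpt \<nu> (k + 1))) (klr_class Q \<beta> (tau k * idm \<nu>))"
| add: "klr_homog ip Q \<beta> d a \<Longrightarrow> klr_homog ip Q \<beta> d b \<Longrightarrow>
    klr_homog ip Q \<beta> d (a \<oplus>\<^bsub>klr Q \<beta>\<^esub> b)"
| scale: "klr_homog ip Q \<beta> d a \<Longrightarrow>
    klr_homog ip Q \<beta> d (klr_class Q \<beta> (scalar c) \<otimes>\<^bsub>klr Q \<beta>\<^esub> a)"
| mult: "klr_homog ip Q \<beta> d a \<Longrightarrow> klr_homog ip Q \<beta> e b \<Longrightarrow>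
    klr_homog ip Q \<beta> (d + e) (a \<otimes>\<^bsub>klr Q \<beta>\<^esub> b)"

section \<open>The morphism from the tensor product of two KLR algebras\<close>

definition free_subst :: "('i klr_gen \<Rightarrow> ('i, 'k::comm_ring_1) free_alg) \<Rightarrow>
    ('i, 'k) free_alg \<Rightarrow> ('i, 'k) free_alg" where
  "free_subst \<phi> f = (\<Sum>w\<in>Poly_Mapping.keys f.
     scalar (Poly_Mapping.lookup f w) * prod_list (map \<phi> (letters w)))"

fun left_gen :: "'i multiset \<Rightarrow> 'i klr_gen \<Rightarrow> ('i, 'k::comm_ring_1) free_alg" where
  "left_gen \<gamma> (IdemG \<mu>) = (\<Sum>\<nu>\<in>permutations_of_multiset \<gamma>. idm (\<mu> @ \<nu>))"
| "left_gen \<gamma> (XG k) = xv (size \<gamma> + k)"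
| "left_gen \<gamma> (TauG k) = tau (size \<gamma> + k)"

fun right_gen :: "'i multiset \<Rightarrow> 'i klr_gen \<Rightarrow> ('i, 'k::comm_ring_1) free_alg" where
  "right_gen \<beta> (IdemG \<nu>) = (\<Sum>\<mu>\<in>permutations_of_multiset \<beta>. idm (\<mu> @ \<nu>))"
| "right_gen \<beta> (XG k) = xv k"
| "right_gen \<beta> (TauG k) = tau k"

definition idem2 :: "'i multiset \<Rightarrow> 'i multiset \<Rightarrow> ('i, 'k::comm_ring_1) free_alg" where
  "idem2 \<beta> \<gamma> = (\<Sum>\<mu>\<in>permutations_of_multiset \<beta>. \<Sum>\<nu>\<in>permutations_of_multiset \<gamma>. idm (\<mu> @ \<nu>))"

text \<open>The images of the generators are truncated by the idempotent \<open>1\<^sub>\<beta>\<^sub>,\<^sub>\<gamma>\<close>, which commutes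
  with all of them. As usual for maps out of a quotient, \<^const>\<open>the_elem\<close> picks the common value
  on all representatives.\<close>

definition diamond :: "('i \<Rightarrow> 'i \<Rightarrow> 'k::comm_ring_1 poly poly) \<Rightarrow> 'i multiset \<Rightarrow> 'i multiset \<Rightarrow>
    ('i, 'k) klr_elt \<Rightarrow> ('i, 'k) klr_elt \<Rightarrow> ('i, 'k) klr_elt" where
  "diamond Q \<beta> \<gamma> y z = the_elem ((\<lambda>(f, g). klr_class Q (\<beta> + \<gamma>)
     (free_subst (left_gen \<gamma>) f * free_subst (right_gen \<beta>) g * idem2 \<beta> \<gamma>)) ` (y \<times> z))"

definition diamond3 :: "('i \<Rightarrow> 'i \<Rightarrow> 'k::comm_ring_1 poly poly) \<Rightarrow>
    'i multiset \<Rightarrow> 'i multiset \<Rightarrow> 'i multiset \<Rightarrow>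
    ('i, 'k) klr_elt \<Rightarrow> ('i, 'k) klr_elt \<Rightarrow> ('i, 'k) klr_elt \<Rightarrow> ('i, 'k) klr_elt" where
  "diamond3 Q \<alpha> \<beta> \<gamma> u y z = diamond Q (\<alpha> + \<beta>) \<gamma> (diamond Q \<alpha> \<beta> u y) z"

text \<open>\<open>\<tau>\<^sub>\<omega>\<^sub>0\<close> is taken with respect to the reduced expression
  \<open>s\<^sub>1 (s\<^sub>2 s\<^sub>1) (s\<^sub>3 s\<^sub>2 s\<^sub>1) \<cdots>\<close> of the longest element.\<close>

definition longest_word :: "nat \<Rightarrow> nat list" where
  "longest_word n = concat (map (\<lambda>k. rev [1..<Suc k]) [1..<n])"

definition div_idem :: "('i \<Rightarrow> 'i \<Rightarrow> 'k::comm_ring_1 poly poly) \<Rightarrow> 'i \<Rightarrow> nat \<Rightarrow>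
    ('i, 'k) klr_elt" where
  "div_idem Q i n = klr_class Q (replicate_mset n i)
     (prod_list (map (\<lambda>k. xv k ^ (k - 1)) [2..<Suc n]) * prod_list (map tau (longest_word n)))"

definition tau_up :: "nat \<Rightarrow> nat \<Rightarrow> ('i, 'k::comm_ring_1) free_alg" where
  "tau_up k l = prod_list (map tau [k..<Suc l])"

section \<open>Tensor products over a noncommutative ring\<close>

text \<open>\<open>N\<close> is a right \<open>R\<close>-module, represented by a record in which \<open>r \<odot>\<^bsub>N\<^esub> n\<close> stands for \<open>n r\<close>;
  \<open>M\<close> is a left \<open>R\<close>-module. The tensor product is the quotient of the free abelian group on
  \<open>N \<times> M\<close> (multiplicatively written in the library).\<close>

definition tensor_null :: "('r, 'x) ring_scheme \<Rightarrow> ('r, 'n, 'y) module_scheme \<Rightarrow>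
    ('r, 'm, 'z) module_scheme \<Rightarrow> ('n \<times> 'm \<Rightarrow>\<^sub>0 int) set" where
  "tensor_null R N M = generate (free_Abelian_group (carrier N \<times> carrier M))
     ({frag_of (a \<oplus>\<^bsub>N\<^esub> b, m) - frag_of (a, m) - frag_of (b, m) |a b m.
         a \<in> carrier N \<and> b \<in> carrier N \<and> m \<in> carrier M} \<union>
      {frag_of (a, m \<oplus>\<^bsub>M\<^esub> l) - frag_of (a, m) - frag_of (a, l) |a m l.
         a \<in> carrier N \<and> m \<in> carrier M \<and> l \<in> carrier M} \<union>
      {frag_of (r \<odot>\<^bsub>N\<^esub> a, m) - frag_of (a, r \<odot>\<^bsub>M\<^esub> m) |r a m.
         r \<in> carrier R \<and> a \<in> carrier N \<and> m \<in> carrier M})"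

definition tensor_class :: "('r, 'x) ring_scheme \<Rightarrow> ('r, 'n, 'y) module_scheme \<Rightarrow>
    ('r, 'm, 'z) module_scheme \<Rightarrow> ('n \<times> 'm \<Rightarrow>\<^sub>0 int) \<Rightarrow> ('n \<times> 'm \<Rightarrow>\<^sub>0 int) set" where
  "tensor_class R N M c =
     tensor_null R N M #>\<^bsub>free_Abelian_group (carrier N \<times> carrier M)\<^esub> c"

definition tensor_group :: "('r, 'x) ring_scheme \<Rightarrow> ('r, 'n, 'y) module_scheme \<Rightarrow>
    ('r, 'm, 'z) module_scheme \<Rightarrow> ('n \<times> 'm \<Rightarrow>\<^sub>0 int) set monoid" where
  "tensor_group R N M = free_Abelian_group (carrier N \<times> carrier M) Mod tensor_null R N M"

text \<open>The map \<open>f \<otimes> M\<close> with values in \<open>N \<otimes> M\<close>, for a homomorphism \<open>f\<close> of right modules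
  with codomain \<open>N\<close>.\<close>

definition tensor_map :: "('r, 'x) ring_scheme \<Rightarrow> ('r, 'n, 'y) module_scheme \<Rightarrow>
    ('r, 'm, 'z) module_scheme \<Rightarrow> ('n \<Rightarrow> 'n) \<Rightarrow>
    ('n \<times> 'm \<Rightarrow>\<^sub>0 int) set \<Rightarrow> ('n \<times> 'm \<Rightarrow>\<^sub>0 int) set" where
  "tensor_map R N M f T = the_elem
     ((\<lambda>c. tensor_class R N M (frag_extend (\<lambda>(a, m). frag_of (f a, m)) c)) ` T)"

section \<open>Graded modules and null-homotopic complexes\<close>

text \<open>\<^term>\<open>hcomp M d\<close> is the homogeneous component of degree \<open>d\<close>; the multiplication and unit
  fields of the library's module record play no role for modules.\<close>

record ('r, 'm) graded_module = "('r, 'm) module" +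
  hcomp :: "int \<Rightarrow> 'm set"

definition graded_hom :: "('r, 'x) ring_scheme \<Rightarrow> ('r, 'm) graded_module \<Rightarrow>
    ('r, 'n) graded_module \<Rightarrow> ('m \<Rightarrow> 'n) set" where
  "graded_hom R M N = {f \<in> carrier M \<rightarrow> carrier N.
     (\<forall>a\<in>carrier M. \<forall>b\<in>carrier M. f (a \<oplus>\<^bsub>M\<^esub> b) = f a \<oplus>\<^bsub>N\<^esub> f b) \<and>
     (\<forall>r\<in>carrier R. \<forall>a\<in>carrier M. f (r \<odot>\<^bsub>M\<^esub> a) = r \<odot>\<^bsub>N\<^esub> f a) \<and>
     (\<forall>d. f ` hcomp M d \<subseteq> hcomp N d)}"

text \<open>A cochain complex is given by its objects \<open>C p\<close> and its differentials
  \<open>d p\<close> from \<open>C p\<close> to \<open>C (p + 1)\<close>; its identity is to be homotopic to zero, through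
  degree preserving \<open>R\<close>-linear maps.\<close>

definition null_homotopic :: "('r, 'x) ring_scheme \<Rightarrow> (int \<Rightarrow> ('r, 'm) graded_module) \<Rightarrow>
    (int \<Rightarrow> 'm \<Rightarrow> 'm) \<Rightarrow> bool" where
  "null_homotopic R C d \<longleftrightarrow>
     (\<exists>s. (\<forall>p. s p \<in> graded_hom R (C p) (C (p - 1))) \<and>
          (\<forall>p. \<forall>a\<in>carrier (C p). a = d (p - 1) (s p a) \<oplus>\<^bsub>C p\<^esub> s (p + 1) (d p a)))"

text \<open>The grading shift \<open>q\<^sup>r M\<close>.\<close>

definition q_shift :: "int \<Rightarrow> ('r, 'm) graded_module \<Rightarrow> ('r, 'm) graded_module" where
  "q_shift r M = M\<lparr>hcomp := \<lambda>d. hcomp M (d + r)\<rparr>"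

text \<open>A zero module on the element type used below.\<close>

definition zero_gmod :: "('r, 'm set) graded_module" where
  "zero_gmod = \<lparr>carrier = {{}}, mult = \<lambda>_ _. {}, one = {}, ring.zero = {}, add = \<lambda>_ _. {},
     smult = \<lambda>_ _. {}, hcomp = \<lambda>_. {{}}\<rparr>"

section \<open>The modules \<open>E\<^sub>i\<^sup>a M E\<^sub>i\<^sup>b\<close> and their divided powers\<close>

text \<open>\<open>E\<^sub>j\<^sup>m\<close>, the free \<open>H\<^sub>m\<^sub>j\<close>-module of rank one.\<close>

definition E_pow :: "('i \<Rightarrow> 'i \<Rightarrow> int) \<Rightarrow> ('i \<Rightarrow> 'i \<Rightarrow> 'k::comm_ring_1 poly poly) \<Rightarrow> 'i \<Rightarrow> nat \<Rightarrow>
    (('i, 'k) klr_elt, ('i, 'k) klr_elt) graded_module" where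
  "E_pow ip Q j m = (let H = klr Q (replicate_mset m j) in
     \<lparr>carrier = carrier H, mult = mult H, one = one H, ring.zero = ring.zero H, add = add H,
      smult = mult H, hcomp = \<lambda>d. {a. klr_homog ip Q (replicate_mset m j) d a}\<rparr>)"

abbreviation flank :: "'i \<Rightarrow> nat \<Rightarrow> 'i multiset \<Rightarrow> nat \<Rightarrow> 'i multiset" where
  "flank i a \<beta> b \<equiv> replicate_mset a i + \<beta> + replicate_mset b i"

definition flank_idem :: "('i \<Rightarrow> 'i \<Rightarrow> 'k::comm_ring_1 poly poly) \<Rightarrow> 'i \<Rightarrow> nat \<Rightarrow> 'i multiset \<Rightarrow>
    nat \<Rightarrow> ('i, 'k) klr_elt" where
  "flank_idem Q i a \<beta> b = diamond3 Q (replicate_mset a i) \<beta> (replicate_mset b i)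
     \<one>\<^bsub>klr Q (replicate_mset a i)\<^esub> \<one>\<^bsub>klr Q \<beta>\<^esub> \<one>\<^bsub>klr Q (replicate_mset b i)\<^esub>"

text \<open>\<open>H 1\<^sub>a\<^sub>i\<^sub>,\<^sub>\<beta>\<^sub>,\<^sub>b\<^sub>i\<close> as a right \<open>H\<^sub>\<beta>\<close>-module, via \<open>y \<mapsto> 1\<^sub>a\<^sub>i \<diamondop> y \<diamondop> 1\<^sub>b\<^sub>i\<close>.\<close>

definition flank_bimod :: "('i \<Rightarrow> 'i \<Rightarrow> 'k::comm_ring_1 poly poly) \<Rightarrow> 'i \<Rightarrow> nat \<Rightarrow> 'i multiset \<Rightarrow>
    nat \<Rightarrow> (('i, 'k) klr_elt, ('i, 'k) klr_elt) module" where
  "flank_bimod Q i a \<beta> b = (let H = klr Q (flank i a \<beta> b) in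
     \<lparr>carrier = (\<lambda>h. h \<otimes>\<^bsub>H\<^esub> flank_idem Q i a \<beta> b) ` carrier H,
      mult = mult H, one = flank_idem Q i a \<beta> b, ring.zero = ring.zero H, add = add H,
      smult = \<lambda>y h. h \<otimes>\<^bsub>H\<^esub> diamond3 Q (replicate_mset a i) \<beta> (replicate_mset b i)
        \<one>\<^bsub>klr Q (replicate_mset a i)\<^esub> y \<one>\<^bsub>klr Q (replicate_mset b i)\<^esub>\<rparr>)"

type_synonym ('i, 'k, 'm) flank_elt = "(('i, 'k) klr_elt \<times> 'm \<Rightarrow>\<^sub>0 int) set"

text \<open>\<open>E\<^sub>i\<^sup>a M E\<^sub>i\<^sup>b = H 1\<^sub>a\<^sub>i\<^sub>,\<^sub>\<beta>\<^sub>,\<^sub>b\<^sub>i \<otimes>\<^bsub>H\<^sub>\<beta>\<^esub> M\<close>.\<close>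

definition EME :: "('i \<Rightarrow> 'i \<Rightarrow> int) \<Rightarrow> ('i \<Rightarrow> 'i \<Rightarrow> 'k::comm_ring_1 poly poly) \<Rightarrow> 'i \<Rightarrow> nat \<Rightarrow>
    'i multiset \<Rightarrow> (('i, 'k) klr_elt, 'm) graded_module \<Rightarrow> nat \<Rightarrow>
    (('i, 'k) klr_elt, ('i, 'k, 'm) flank_elt) graded_module" where
  "EME ip Q i a \<beta> M b =
    (let H = klr Q (flank i a \<beta> b); N = flank_bimod Q i a \<beta> b; T = tensor_group (klr Q \<beta>) N M in
     \<lparr>carrier = carrier T, mult = \<lambda>_ _. \<one>\<^bsub>T\<^esub>, one = \<one>\<^bsub>T\<^esub>, ring.zero = \<one>\<^bsub>T\<^esub>, add = mult T,
      smult = \<lambda>h. tensor_map (klr Q \<beta>) N M (\<lambda>g. h \<otimes>\<^bsub>H\<^esub> g),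
      hcomp = \<lambda>d. generate T {tensor_class (klr Q \<beta>) N M (frag_of (g, m)) |g m p q.
        g \<in> carrier N \<and> klr_homog ip Q (flank i a \<beta> b) p g \<and> m \<in> hcomp M q \<and> p + q = d}\<rparr>)"

text \<open>\<open>E\<^sub>i\<^sup>(\<^sup>a\<^sup>) M E\<^sub>i\<^sup>(\<^sup>b\<^sup>)\<close>: the image of the right multiplication by \<open>e\<^sub>a \<diamondop> 1\<^sub>\<beta> \<diamondop> e\<^sub>b\<close> on
  \<open>E\<^sub>i\<^sup>a M E\<^sub>i\<^sup>b\<close>, as a graded submodule, shifted by \<open>q\<^sub>i\<close> to the power
  \<open>- a (a - 1) / 2 - b (b - 1) / 2\<close>.\<close>

definition EME_div :: "('i \<Rightarrow> 'i \<Rightarrow> int) \<Rightarrow> ('i \<Rightarrow> 'i \<Rightarrow> 'k::comm_ring_1 poly poly) \<Rightarrow> 'i \<Rightarrow> nat \<Rightarrow>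
    'i multiset \<Rightarrow> (('i, 'k) klr_elt, 'm) graded_module \<Rightarrow> nat \<Rightarrow>
    (('i, 'k) klr_elt, ('i, 'k, 'm) flank_elt) graded_module" where
  "EME_div ip Q i a \<beta> M b =
    (let H = klr Q (flank i a \<beta> b); N = flank_bimod Q i a \<beta> b; V = EME ip Q i a \<beta> M b;
         \<epsilon> = diamond3 Q (replicate_mset a i) \<beta> (replicate_mset b i)
               (div_idem Q i a) \<one>\<^bsub>klr Q \<beta>\<^esub> (div_idem Q i b);
         W = tensor_map (klr Q \<beta>) N M (\<lambda>g. g \<otimes>\<^bsub>H\<^esub> \<epsilon>) ` carrier V
     in q_shift (- half_norm ip i * int (a * (a - 1) div 2 + b * (b - 1) div 2))
          (V\<lparr>carrier := W, hcomp := \<lambda>d. W \<inter> hcomp V d\<rparr>))"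

section \<open>The complex\<close>

definition Ad_obj :: "('i \<Rightarrow> 'i \<Rightarrow> int) \<Rightarrow> ('i \<Rightarrow> 'i \<Rightarrow> 'k::comm_ring_1 poly poly) \<Rightarrow> 'i \<Rightarrow> nat \<Rightarrow>
    'i multiset \<Rightarrow> (('i, 'k) klr_elt, 'm) graded_module \<Rightarrow> int \<Rightarrow>
    (('i, 'k) klr_elt, ('i, 'k, 'm) flank_elt) graded_module" where
  "Ad_obj ip Q i n \<beta> M p =
    (if - int n \<le> p \<and> p \<le> 0 then
       let k = nat (- p) in
       q_shift (half_norm ip i * (int k * (int n + coroot_pairing ip i \<beta> - 1)))
         (EME_div ip Q i (n - k) \<beta> M k)
     else zero_gmod)"

definition Ad_diff :: "('i \<Rightarrow> 'i \<Rightarrow> int) \<Rightarrow> ('i \<Rightarrow> 'i \<Rightarrow> 'k::comm_ring_1 poly poly) \<Rightarrow> 'i \<Rightarrow> nat \<Rightarrow>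
    'i multiset \<Rightarrow> (('i, 'k) klr_elt, 'm) graded_module \<Rightarrow> int \<Rightarrow>
    ('i, 'k, 'm) flank_elt \<Rightarrow> ('i, 'k, 'm) flank_elt" where
  "Ad_diff ip Q i n \<beta> M p v =
    (if - int n \<le> p \<and> p < 0 then
       let k = nat (- p); H = klr Q (\<beta> + replicate_mset n i) in
       tensor_map (klr Q \<beta>) (flank_bimod Q i (n - k + 1) \<beta> (k - 1)) M
         (\<lambda>h. h \<otimes>\<^bsub>H\<^esub> klr_class Q (\<beta> + replicate_mset n i)
                    (scalar ((- 1) ^ (k - 1)) * tau_up k (n + size \<beta> - 1))
                \<otimes>\<^bsub>H\<^esub> flank_idem Q i (n - k + 1) \<beta> (k - 1)) v
     else ring.zero (Ad_obj ip Q i n \<beta> M (p + 1)))"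

end

theory Submission
  imports Defs
begin

text \<open>
  Put \<open>\<nu>\<^sub>k = (i\<^sup>n\<^sup>-\<^sup>k, j\<^sup>m, i\<^sup>k)\<close> and \<open>\<epsilon>\<^sub>k = e\<^sub>n\<^sub>-\<^sub>k \<diamondop> 1 \<diamondop> e\<^sub>k\<close>. The term of the complex in degree \<open>-k\<close> is the
  left module \<open>H \<epsilon>\<^sub>k\<close>, and the differential is right multiplication by \<open>\<plusminus>\<tau>\<^sub>k \<cdots> \<tau>\<^sub>n\<^sub>+\<^sub>m\<^sub>-\<^sub>1\<close>. A contracting
  homotopy is right multiplication by a scalar multiple of
  \<open>\<tau>\<^sub>k\<^sub>+\<^sub>m \<cdots> \<tau>\<^sub>k\<^sub>+\<^sub>1 x\<^sub>k\<^sub>+\<^sub>1\<^sup>p \<tau>\<^sub>k \<cdots> \<tau>\<^sub>1\<close> with \<open>p = n - 1 + m c\<^sub>i\<^sub>j\<close>; this exponent makes it homogeneous of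
  degree zero, and it is nonnegative exactly when \<open>n > -m c\<^sub>i\<^sub>j\<close>.

  Indeed, pulling a strand \<open>i\<close> across the \<open>m\<close> strands \<open>j\<close> and back multiplies by
  \<open>P(u) = \<Prod>\<^sub>l Q\<^sub>i\<^sub>j(u, y\<^sub>l)\<close>, whose leading coefficient, in degree \<open>-m c\<^sub>i\<^sub>j\<close>, is a unit of \<open>K\<close>. By the braid
  relations, the two terms of the homotopy identity combine to the divided difference of \<open>u\<^sup>p P(u)\<close>, a
  polynomial of degree \<open>n - 1\<close> in \<open>u\<close>, at the two strands \<open>i\<close> adjacent to the \<open>j\<close>'s. An element
  \<open>z\<close> of \<open>H \<epsilon>\<^sub>k\<close> is annihilated by every \<open>\<tau>\<close> inside the blocks of \<open>i\<close>, hence \<open>z x\<^sub>k\<^sup>q \<tau>\<^sub>k\<^sub>-\<^sub>1 \<cdots> \<tau>\<^sub>1\<close>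
  vanishes for \<open>q < k - 1\<close> and equals \<open>z\<close> for \<open>q = k - 1\<close>, and similarly on the other block. Therefore only
  the leading coefficient survives, and the sum is a unit multiple of \<open>z\<close>.
\<close>

section \<open>Computations with the KLR relations\<close>

text \<open>The degree \<open>n - 1\<close> is a count of operators: the divided difference at the
  two adjacent strands lowers the degree by one, and the words left over in the blocks, of lengths
  \<open>k - 1\<close> and \<open>n - k - 1\<close>, lower it by the rest. In the extreme degrees of
  the complex one block is empty, one term of the homotopy identity is missing, and the polynomial
  itself replaces its divided difference. The coefficients of \<open>P\<close> are not scalars but
  polynomials in the \<open>x\<close> of the strands \<open>j\<close>. They commute with everything
  inside the blocks of \<open>i\<close>, so they can be carried to the right end; this is why
  polynomials are treated through values and divided differences in a noncommutative ring. The
  surviving unit carries the sign \<open>(-1)^(n-k-1)\<close>, which the alternating signs of the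
  differential make independent of \<open>k\<close>, so one scalar serves all degrees. For right
  multiplication to be a homotopy it must also respect the right action on the strands
  \<open>j\<close>, so that it passes to the tensor product; it must preserve the images of the
  idempotents, which is the purpose of the factor \<open>\<tau>_k ... \<tau>_1\<close>; and its
  degree must match the shifts.\<close>

lemma cpt_swap_cpt:
  assumes "1 \<le> k" "Suc k \<le> length \<nu>" "1 \<le> p" "p \<le> length \<nu>"
  shows "cpt (swap_cpt k \<nu>) p = cpt \<nu> (transpose k (Suc k) p)"
proof -
  have *: "length \<nu> - Suc k < length \<nu>" "length \<nu> - k < length \<nu>" "length \<nu> - p < length \<nu>"
    "length \<nu> - p = length \<nu> - Suc k \<longleftrightarrow> p = Suc k" "length \<nu> - p = length \<nu> - k \<longleftrightarrow> p = k"
    using assms by auto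
  then show ?thesis
    by (auto simp: swap_cpt_def cpt_def transpose_def nth_list_update)
qed

lemma length_swap_cpt [simp]: "length (swap_cpt k \<nu>) = length \<nu>"
  by (simp add: swap_cpt_def)

lemma cpt_ext:
  assumes "length \<mu> = length \<nu>" "\<And>p. 1 \<le> p \<Longrightarrow> p \<le> length \<nu> \<Longrightarrow> cpt \<mu> p = cpt \<nu> p"
  shows "\<mu> = \<nu>"
proof (rule nth_equalityI[OF assms(1)])
  fix q assume "q < length \<mu>"
  then show "\<mu> ! q = \<nu> ! q"
    using assms(2)[of "length \<mu> - q"] assms(1) by (simp add: cpt_def)
qed

lemma swap_cpt_same:
  assumes "1 \<le> k" "Suc k \<le> length \<nu>" "cpt \<nu> k = cpt \<nu> (Suc k)"
  shows "swap_cpt k \<nu> = \<nu>"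
  by (rule cpt_ext) (use assms in \<open>auto simp: cpt_swap_cpt transpose_def\<close>)

lemma cpt_append:
  assumes "1 \<le> p" "p \<le> length \<mu> + length \<nu>"
  shows "cpt (\<mu> @ \<nu>) p = (if p \<le> length \<nu> then cpt \<nu> p else cpt \<mu> (p - length \<nu>))"
  using assms by (auto simp: cpt_def nth_append)

section \<open>Intertwiners and two-variable polynomials in a noncommutative ring\<close>

text \<open>For fixed \<open>w\<close> such pairs are closed under sums and products. A polynomial
  expression therefore passes through \<open>w\<close> as soon as its variables and scalars
  do.\<close>

definition intertwines :: "'r::times \<Rightarrow> 'r \<Rightarrow> 'r \<Rightarrow> bool" where
  "intertwines w a b \<longleftrightarrow> a * w = w * b"

context
  fixes w :: "'r::{ring,monoid_mult}"
begin

lemma intertwines_mult: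
  "intertwines w a b \<Longrightarrow> intertwines w a' b' \<Longrightarrow> intertwines w (a * a') (b * b')"
  by (metis intertwines_def mult.assoc)

lemma intertwines_comp:
  "intertwines w a b \<Longrightarrow> intertwines w' b c \<Longrightarrow> intertwines (w * w') a c"
  by (metis intertwines_def mult.assoc)

lemma intertwines_1 [simp]: "intertwines w 1 1" "intertwines 1 w w"
  by (simp_all add: intertwines_def)

lemma intertwines_0 [simp]: "intertwines w 0 0"
  by (simp add: intertwines_def)

lemma intertwines_add:
  "intertwines w a b \<Longrightarrow> intertwines w a' b' \<Longrightarrow> intertwines w (a + a') (b + b')"
  by (simp add: intertwines_def distrib_left distrib_right)

lemma intertwines_sum:
  "(\<And>x. x \<in> A \<Longrightarrow> intertwines w (f x) (g x)) \<Longrightarrow> intertwines w (sum f A) (sum g A)"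
  by (simp add: intertwines_def sum_distrib_left sum_distrib_right)

lemma intertwines_power: "intertwines w a b \<Longrightarrow> intertwines w (a ^ n) (b ^ n)"
  by (induction n) (auto intro: intertwines_mult)

end

lemma intertwines_commute: "intertwines w a a \<Longrightarrow> intertwines a w w"
  by (simp add: intertwines_def)

text \<open>The counterparts of \<open>eval2\<close> and \<open>divdiff\<close> outside the free
  algebra. The map \<open>sc\<close> supplies the scalars, since the target ring is not a
  \<open>K\<close>-algebra by its type.\<close>

definition ev2 :: "('k \<Rightarrow> 'r::{ring,monoid_mult}) \<Rightarrow> 'k::comm_ring_1 poly poly \<Rightarrow> 'r \<Rightarrow> 'r \<Rightarrow> 'r" where
  "ev2 sc P a b = (\<Sum>s\<le>degree P. \<Sum>r\<le>degree (coeff P s).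
     sc (coeff (coeff P s) r) * a ^ s * b ^ r)"

definition dd2 :: "('k \<Rightarrow> 'r::{ring,monoid_mult}) \<Rightarrow> 'k::comm_ring_1 poly poly \<Rightarrow> 'r \<Rightarrow> 'r \<Rightarrow> 'r \<Rightarrow> 'r" where
  "dd2 sc P a b c = (\<Sum>s\<le>degree P. \<Sum>r\<le>degree (coeff P s).
     sc (coeff (coeff P s) r) * (\<Sum>p<s. a ^ p * c ^ (s - 1 - p)) * b ^ r)"

lemma intertwines_ev2:
  assumes "intertwines w a a'" "intertwines w b b'" "\<And>c. intertwines w (sc c) (sc c)"
  shows "intertwines w (ev2 sc P a b) (ev2 sc P a' b')"
  unfolding ev2_def using assms by (intro intertwines_sum intertwines_mult intertwines_power) auto

lemma intertwines_dd2:
  assumes "intertwines w a a'" "intertwines w b b'" "intertwines w c c'"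
    "\<And>c. intertwines w (sc c) (sc c)"
  shows "intertwines w (dd2 sc P a b c) (dd2 sc P a' b' c')"
  unfolding dd2_def using assms
  by (intro intertwines_sum intertwines_mult intertwines_power) auto

text \<open>The relations are stated in a ring of type class \<^class>\<open>ring\<close>. Instead of \<open>\<Sum>\<^sub>\<nu> 1\<^sub>\<nu> = 1\<close> only its
  consequences \<open>X_unit\<close>, \<open>T_unit\<close> and \<open>sc_1_E\<close> are required, because the embedding \<open>ring_emb\<close> of
  \<open>H\<^sub>\<beta>\<close> into such a ring is not unital.\<close>

locale klr_relations =
  fixes \<beta> :: "'i multiset"
    and Q :: "'i \<Rightarrow> 'i \<Rightarrow> 'k::comm_ring_1 poly poly"
    and E :: "'i list \<Rightarrow> 'r::{ring,monoid_mult}"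
    and X T :: "nat \<Rightarrow> 'r"
    and sc :: "'k \<Rightarrow> 'r"
  assumes E_E: "\<nu> \<in> permutations_of_multiset \<beta> \<Longrightarrow> \<mu> \<in> permutations_of_multiset \<beta> \<Longrightarrow>
      E \<nu> * E \<mu> = (if \<nu> = \<mu> then E \<nu> else 0)"
    and X_E: "\<nu> \<in> permutations_of_multiset \<beta> \<Longrightarrow> k \<in> {1..size \<beta>} \<Longrightarrow> X k * E \<nu> = E \<nu> * X k"
    and T_E: "\<nu> \<in> permutations_of_multiset \<beta> \<Longrightarrow> k \<in> {1..<size \<beta>} \<Longrightarrow>
      T k * E \<nu> = E (swap_cpt k \<nu>) * T k"
    and X_X: "k \<in> {1..size \<beta>} \<Longrightarrow> l \<in> {1..size \<beta>} \<Longrightarrow> X k * X l = X l * X k"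
    and T_T_E: "\<nu> \<in> permutations_of_multiset \<beta> \<Longrightarrow> k \<in> {1..<size \<beta>} \<Longrightarrow>
      T k * T k * E \<nu> = ev2 sc (Q (cpt \<nu> k) (cpt \<nu> (k + 1))) (X k) (X (k + 1)) * E \<nu>"
    and T_X_E: "\<nu> \<in> permutations_of_multiset \<beta> \<Longrightarrow> k \<in> {1..<size \<beta>} \<Longrightarrow> l \<in> {1..size \<beta>} \<Longrightarrow>
      (T k * X l - X (transpose k (k + 1) l) * T k) * E \<nu> =
      (if l = k + 1 \<and> cpt \<nu> k = cpt \<nu> (k + 1) then E \<nu>
       else if l = k \<and> cpt \<nu> k = cpt \<nu> (k + 1) then - E \<nu> else 0)"
    and T_T: "k \<in> {1..<size \<beta>} \<Longrightarrow> l \<in> {1..<size \<beta>} \<Longrightarrow> k + 1 < l \<or> l + 1 < k \<Longrightarrow>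
      T k * T l = T l * T k"
    and braid: "\<nu> \<in> permutations_of_multiset \<beta> \<Longrightarrow> 1 \<le> k \<Longrightarrow> k + 1 < size \<beta> \<Longrightarrow>
      (T (k + 1) * T k * T (k + 1) - T k * T (k + 1) * T k) * E \<nu> =
      (if cpt \<nu> k = cpt \<nu> (k + 2)
       then dd2 sc (Q (cpt \<nu> k) (cpt \<nu> (k + 1))) (X (k + 2)) (X (k + 1)) (X k) * E \<nu> else 0)"
    and X_unit: "k \<in> {1..size \<beta>} \<Longrightarrow> X k * (\<Sum>\<nu>\<in>permutations_of_multiset \<beta>. E \<nu>) = X k"
    and T_unit: "k \<in> {1..<size \<beta>} \<Longrightarrow> T k * (\<Sum>\<nu>\<in>permutations_of_multiset \<beta>. E \<nu>) = T k"
    and sc_add: "sc (a + b) = sc a + sc b"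
    and sc_mult: "sc (a * b) = sc a * sc b"
    and sc_1_E: "\<nu> \<in> permutations_of_multiset \<beta> \<Longrightarrow> sc 1 * E \<nu> = E \<nu>"
    and sc_E: "\<nu> \<in> permutations_of_multiset \<beta> \<Longrightarrow> sc c * E \<nu> = E \<nu> * sc c"
    and sc_X: "k \<in> {1..size \<beta>} \<Longrightarrow> sc c * X k = X k * sc c"
    and sc_T: "k \<in> {1..<size \<beta>} \<Longrightarrow> sc c * T k = T k * sc c"
begin

lemma sc_sc: "sc a * sc b = sc b * sc a"
  by (metis sc_mult mult.commute)

lemma sc_0 [simp]: "sc 0 = 0"
  using sc_add[of 0 0] by simp

lemma sc_uminus: "sc (- a) = - sc a"
  using sc_add[of a "- a"] by (simp add: eq_neg_iff_add_eq_0 add.commute)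

text \<open>The relation is only given after right multiplication by an idempotent. Summing over all
  tuples removes the idempotent, by \<open>X_unit\<close> and \<open>T_unit\<close>.\<close>

lemma T_X_commute:
  assumes "k \<in> {1..<size \<beta>}" "l \<in> {1..size \<beta>}" "l \<noteq> k" "l \<noteq> k + 1"
  shows "T k * X l = X l * T k"
proof -
  have *: "T k * X l * E \<nu> = X l * T k * E \<nu>" if "\<nu> \<in> permutations_of_multiset \<beta>" for \<nu>
    using T_X_E[OF that assms(1,2)] assms by (simp add: algebra_simps transpose_def)
  have "T k * X l = T k * X l * (\<Sum>\<nu>\<in>permutations_of_multiset \<beta>. E \<nu>)"
    using X_unit[OF assms(2)] by (simp add: mult.assoc)
  also have "\<dots> = X l * T k * (\<Sum>\<nu>\<in>permutations_of_multiset \<beta>. E \<nu>)"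
    unfolding sum_distrib_left by (rule sum.cong) (auto simp: *)
  finally show ?thesis using T_unit[OF assms(1)] by (simp add: mult.assoc)
qed

section \<open>Ascending and descending words in the crossings\<close>

text \<open>The words are indexed by first place and length instead of first and last index, so that
  the empty word is covered and \<open>up_add\<close>, \<open>dn_add\<close> hold
  unconditionally.\<close>

definition up :: "nat \<Rightarrow> nat \<Rightarrow> 'r" where "up k l = prod_list (map T [k..<k + l])"
definition dn :: "nat \<Rightarrow> nat \<Rightarrow> 'r" where "dn k l = prod_list (map T (rev [k..<k + l]))"

lemma up_0 [simp]: "up k 0 = 1" and dn_0 [simp]: "dn k 0 = 1"
  by (simp_all add: up_def dn_def)

lemma up_add: "up k (a + b) = up k a * up (k + a) b"
  using upt_add_eq_append[of k "k + a" b] by (simp add: up_def add.assoc)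

lemma dn_add: "dn k (a + b) = dn (k + a) b * dn k a"
  using upt_add_eq_append[of k "k + a" b] by (simp add: dn_def add.assoc)

lemma up_1: "up k (Suc 0) = T k" and dn_1: "dn k (Suc 0) = T k"
  by (simp_all add: up_def dn_def)

lemma up_Suc: "up k (Suc l) = up k l * T (k + l)" and dn_Suc: "dn k (Suc l) = T (k + l) * dn k l"
  using up_add[of k l 1] dn_add[of k l 1] by (simp_all add: up_1 dn_1)

lemma up_Suc': "up k (Suc l) = T k * up (Suc k) l" and dn_Suc': "dn k (Suc l) = dn (Suc k) l * T k"
  using up_add[of k 1 l] dn_add[of k 1 l] by (simp_all add: up_1 dn_1)

lemma commute_up:
  assumes "\<And>r. k \<le> r \<Longrightarrow> r < k + l \<Longrightarrow> w * T r = T r * w"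
  shows "w * up k l = up k l * w"
  using assms
proof (induction l)
  case (Suc l)
  then have "w * up k l = up k l * w" "w * T (k + l) = T (k + l) * w" by auto
  then show ?case by (metis up_Suc mult.assoc)
qed simp

lemma commute_dn:
  assumes "\<And>r. k \<le> r \<Longrightarrow> r < k + l \<Longrightarrow> w * T r = T r * w"
  shows "w * dn k l = dn k l * w"
  using assms
proof (induction l)
  case (Suc l)
  then have "w * dn k l = dn k l * w" "w * T (k + l) = T (k + l) * w" by auto
  then show ?case by (metis dn_Suc mult.assoc)
qed simp

lemma T_up_commute:
  assumes "1 \<le> k" "k + l \<le> size \<beta>" "q \<in> {1..<size \<beta>}" "q + 1 < k \<or> k + l < q"
  shows "T q * up k l = up k l * T q" "T q * dn k l = dn k l * T q"
  by (rule commute_up commute_dn, rule T_T, use assms in auto)+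

lemma X_up_commute:
  assumes "1 \<le> k" "k + l \<le> size \<beta>" "q \<in> {1..size \<beta>}" "q < k \<or> k + l < q"
  shows "X q * up k l = up k l * X q" "X q * dn k l = dn k l * X q"
  by (rule commute_up commute_dn, rule T_X_commute[symmetric], use assms in auto)+

lemma sc_up_commute:
  assumes "1 \<le> k" "k + l \<le> size \<beta>"
  shows "sc c * up k l = up k l * sc c" "sc c * dn k l = dn k l * sc c"
  by (rule commute_up commute_dn, rule sc_T, use assms in auto)+

lemma up_up_commute:
  assumes "1 \<le> k" "k + l < q" "q + p \<le> size \<beta>"
  shows "up k l * up q p = up q p * up k l" "dn k l * up q p = up q p * dn k l"
    "up k l * dn q p = dn q p * up k l" "dn k l * dn q p = dn q p * dn k l"
  by (rule commute_up commute_dn, rule T_up_commute[symmetric], use assms in auto)+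

text \<open>The effect of \<open>dn k l\<close> on tuples. Its rightmost letter acts first, so the
  strand in place \<open>k\<close> travels leftwards across the next \<open>l\<close>
  strands.\<close>

primrec swap_dn :: "nat \<Rightarrow> nat \<Rightarrow> 'i list \<Rightarrow> 'i list" where
  "swap_dn k 0 \<nu> = \<nu>"
| "swap_dn k (Suc l) \<nu> = swap_cpt (k + l) (swap_dn k l \<nu>)"

lemma swap_dn_perm:
  "\<nu> \<in> permutations_of_multiset \<beta> \<Longrightarrow> 1 \<le> k \<Longrightarrow> k + l \<le> size \<beta> \<Longrightarrow>
    swap_dn k l \<nu> \<in> permutations_of_multiset \<beta>"
  by (induction l) (auto intro: swap_cpt_permutation)

lemma dn_E:
  assumes "\<nu> \<in> permutations_of_multiset \<beta>" "1 \<le> k" "k + l \<le> size \<beta>"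
  shows "dn k l * E \<nu> = E (swap_dn k l \<nu>) * dn k l"
  using assms(3)
proof (induction l)
  case (Suc l)
  have "T (k + l) * E (swap_dn k l \<nu>) = E (swap_cpt (k + l) (swap_dn k l \<nu>)) * T (k + l)"
    using assms Suc.prems by (intro T_E swap_dn_perm) auto
  then show ?case using Suc by (simp add: dn_Suc) (metis mult.assoc)
qed simp

lemma cpt_swap_dn:
  assumes "length \<nu> = size \<beta>" "1 \<le> k" "k + l \<le> size \<beta>" "1 \<le> p" "p \<le> size \<beta>"
  shows "cpt (swap_dn k l \<nu>) p =
    (if p = k + l then cpt \<nu> k else if k \<le> p \<and> p < k + l then cpt \<nu> (p + 1) else cpt \<nu> p)"
proof -
  have len: "length (swap_dn k l \<nu>) = size \<beta>" for l
    using assms(1) by (induction l) auto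
  show ?thesis using assms(3-5)
  proof (induction l arbitrary: p)
    case (Suc l)
    have "cpt (swap_dn k (Suc l) \<nu>) p = cpt (swap_dn k l \<nu>) (transpose (k + l) (Suc (k + l)) p)"
      using Suc.prems assms len by (simp add: cpt_swap_cpt)
    also have "\<dots> = (let p' = transpose (k + l) (Suc (k + l)) p in
      if p' = k + l then cpt \<nu> k else if k \<le> p' \<and> p' < k + l then cpt \<nu> (p' + 1) else cpt \<nu> p')"
      unfolding Let_def using Suc.prems assms(2) by (intro Suc.IH) (auto simp: transpose_def)
    finally show ?case by (auto simp: transpose_def)
  qed auto
qed

text \<open>Between strands of different colours a dot slides through the crossing without
  correction term.\<close>

lemma X_T_E:
  assumes "\<nu> \<in> permutations_of_multiset \<beta>" "k \<in> {1..<size \<beta>}" "l \<in> {1..size \<beta>}"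
    "cpt \<nu> k \<noteq> cpt \<nu> (k + 1)"
  shows "intertwines (T k * E \<nu>) (X (transpose k (k + 1) l)) (X l)"
  using T_X_E[OF assms(1-3)] X_E[OF assms(1,3)] assms(4)
  by (simp add: intertwines_def algebra_simps)

text \<open>Every crossing in the word involves the travelling strand and a strand of another
  colour, so the dot on the travelling strand rides along from place \<open>k\<close> to place
  \<open>k + l\<close>.\<close>

lemma X_dn_E:
  assumes \<nu>: "\<nu> \<in> permutations_of_multiset \<beta>" and k: "1 \<le> k" "k + l \<le> size \<beta>"
    and ne: "\<And>p. p \<in> {k<..k + l} \<Longrightarrow> cpt \<nu> p \<noteq> cpt \<nu> k"
  shows "intertwines (dn k l * E \<nu>) (X (k + l)) (X k)"
  using k(2) ne
proof (induction l)
  case 0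
  then show ?case using X_E[OF \<nu>, of k] k by (auto simp: intertwines_def)
next
  case (Suc l)
  let ?\<mu> = "swap_dn k l \<nu>"
  have \<mu>: "?\<mu> \<in> permutations_of_multiset \<beta>" using Suc.prems \<nu> k by (intro swap_dn_perm) auto
  have len: "length \<nu> = size \<beta>" using \<nu> by (rule length_permutation)
  have "cpt ?\<mu> (k + l) \<noteq> cpt ?\<mu> (k + l + 1)"
    using cpt_swap_dn[OF len k(1), of l] Suc.prems(1) Suc.prems(2)[of "k + l + 1"] k(1) by simp
  then have "intertwines (T (k + l) * E ?\<mu>) (X (transpose (k + l) (k + l + 1) (k + l))) (X (k + l))"
    using \<mu> Suc.prems k by (intro X_T_E) auto
  then have step: "intertwines (T (k + l) * E ?\<mu>) (X (k + Suc l)) (X (k + l))"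
    by (simp add: transpose_def)
  have "intertwines (dn k l * E \<nu>) (X (k + l)) (X k)"
    using Suc by auto
  from intertwines_comp[OF step this]
  have "intertwines ((T (k + l) * E ?\<mu>) * (dn k l * E \<nu>)) (X (k + Suc l)) (X k)" .
  \<comment> \<open>The inserted idempotent \<open>E ?\<mu>\<close> is absorbed, so the composite of
    the two intertwiners is the longer word.\<close>
  moreover have "(T (k + l) * E ?\<mu>) * (dn k l * E \<nu>) = dn k (Suc l) * E \<nu>"
  proof -
    have *: "dn k l * E \<nu> = E ?\<mu> * dn k l"
      using dn_E[OF \<nu> k(1), of l] Suc.prems by simp
    have "E ?\<mu> * (dn k l * E \<nu>) = E ?\<mu> * dn k l * E \<nu>"
      by (simp only: mult.assoc)
    also have "\<dots> = dn k l * (E \<nu> * E \<nu>)"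
      by (simp only: *[symmetric] mult.assoc)
    finally have "E ?\<mu> * (dn k l * E \<nu>) = dn k l * (E \<nu> * E \<nu>)" .
    then show ?thesis using E_E[OF \<nu> \<nu>] by (simp add: dn_Suc mult.assoc)
  qed
  ultimately show ?case by simp
qed

end

text \<open>For commuting arguments this is \<open>(v\<^sup>N - u\<^sup>N) / (v - u)\<close>.\<close>

definition hs :: "'r::{ring,monoid_mult} \<Rightarrow> 'r \<Rightarrow> nat \<Rightarrow> 'r" where
  "hs u v N = (\<Sum>p<N. v ^ p * u ^ (N - 1 - p))"

lemma hs_0 [simp]: "hs u v 0 = 0"
  by (simp add: hs_def)

lemma hs_Suc: "hs u v (Suc N) = hs u v N * u + v ^ N"
proof -
  have "v ^ p * u ^ (N - p) = v ^ p * u ^ (N - 1 - p) * u" if "p < N" for p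
  proof -
    have "N - p = Suc (N - 1 - p)" using that by simp
    then show ?thesis by (simp add: mult.assoc power_commutes)
  qed
  then show ?thesis by (simp add: hs_def sum_distrib_right)
qed

lemma hs_Suc': "hs u v (Suc N) = u ^ N + v * hs u v N"
  unfolding hs_def sum.lessThan_Suc_shift by (simp add: sum_distrib_left mult.assoc)

lemma intertwines_hs:
  "intertwines w a a' \<Longrightarrow> intertwines w b b' \<Longrightarrow> intertwines w (hs a b N) (hs a' b' N)"
  unfolding hs_def by (intro intertwines_sum intertwines_mult intertwines_power)

lemma power_commute: "a * b = b * a \<Longrightarrow> a ^ n * b = b * a ^ n" for a :: "'r::monoid_mult"
  by (metis power_commuting_commutes)

text \<open>Leibniz rule for the divided difference of the monomial of degree
  \<open>N + M\<close>.\<close>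

lemma hs_add:
  assumes uv: "u * v = v * u"
  shows "hs u v (N + M) = hs u v N * v ^ M + u ^ N * hs u v M"
proof (induction M)
  case (Suc M)
  have "hs u v (N + Suc M) = u ^ (N + M) + v * hs u v (N + M)" using hs_Suc'[of u v "N + M"] by simp
  also have "\<dots> = u ^ N * u ^ M + v * (hs u v N * v ^ M) + v * u ^ N * hs u v M"
    by (simp add: Suc power_add distrib_left mult.assoc)
  also have "v * u ^ N = u ^ N * v" using power_commute[OF uv, of N] by simp
  also have "v * (hs u v N * v ^ M) = hs u v N * v ^ Suc M"
  proof -
    have "intertwines v (hs u v N) (hs u v N)"
      by (rule intertwines_hs) (auto simp: intertwines_def uv)
    then have "v * hs u v N = hs u v N * v" by (simp add: intertwines_def)
    then show ?thesis by (metis mult.assoc power_Suc)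
  qed
  finally show ?case by (simp add: hs_Suc' distrib_left mult.assoc algebra_simps)
qed simp

text \<open>\<^term>\<open>bipoly C u v d a p p' r\<close>: there is a polynomial \<open>f\<close> with coefficients in \<open>C\<close>, of degree at
  most \<open>d\<close> and with coefficient \<open>a\<close> in degree \<open>d\<close>, such that \<open>p = f(u)\<close>, \<open>p' = f(v)\<close> and
  \<open>r = (f(v) - f(u)) / (v - u)\<close>.\<close>

inductive bipoly :: "'r::{ring,monoid_mult} set \<Rightarrow> 'r \<Rightarrow> 'r \<Rightarrow> nat \<Rightarrow> 'r \<Rightarrow> 'r \<Rightarrow> 'r \<Rightarrow> 'r \<Rightarrow> bool"
  for C u v d where
  zero: "bipoly C u v d 0 0 0 0"
| mono: "c \<in> C \<Longrightarrow> N \<le> d \<Longrightarrow>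
    bipoly C u v d (if N = d then c else 0) (c * u ^ N) (c * v ^ N) (c * hs u v N)"
| add: "bipoly C u v d a p p' r \<Longrightarrow> bipoly C u v d b q q' s \<Longrightarrow>
    bipoly C u v d (a + b) (p + q) (p' + q') (r + s)"

lemma bipoly_sum:
  "(\<And>x. x \<in> A \<Longrightarrow> bipoly C u v d (a x) (p x) (p' x) (r x)) \<Longrightarrow>
    bipoly C u v d (sum a A) (sum p A) (sum p' A) (sum r A)"
  by (induction A rule: infinite_finite_induct) (auto intro: bipoly.intros)

text \<open>The Leibniz rule \<open>(f(v) g(v) - f(u) g(u)) / (v - u) = r * q' + p * s\<close>,
  reduced to \<open>hs_add\<close> on monomials. Since \<open>d\<close> and \<open>e\<close> only
  bound the degrees, the coefficient in degree \<open>d + e\<close> is the product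
  \<open>a * b\<close> even if a factor vanishes.\<close>

lemma bipoly_mult:
  assumes C: "\<And>a b. a \<in> C \<Longrightarrow> b \<in> C \<Longrightarrow> a * b \<in> C"
    and comm: "\<And>c. c \<in> C \<Longrightarrow> c * u = u * c \<and> c * v = v * c" and uv: "u * v = v * u"
    and P: "bipoly C u v d a p p' r" and Q: "bipoly C u v e b q q' s"
  shows "bipoly C u v (d + e) (a * b) (p * q) (p' * q') (r * q' + p * s)"
  using P
proof induction
  case (mono c N)
  from Q show ?case
  proof induction
    case (mono c' M)
    have c': "u ^ N * c' = c' * u ^ N" "v ^ N * c' = c' * v ^ N" "hs u v N * c' = c' * hs u v N"
      using comm[OF mono(1)] power_commute[of u c' N] power_commute[of v c' N]
        intertwines_hs[of c' u u v v N] by (auto simp: intertwines_def)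
    have p: "(c * w ^ N) * (c' * w ^ M) = (c * c') * w ^ (N + M)"
      if "w ^ N * c' = c' * w ^ N" for w
      using that by (metis mult.assoc power_add)
    have "(c * hs u v N) * (c' * v ^ M) + (c * u ^ N) * (c' * hs u v M)
        = c * (hs u v N * c') * v ^ M + c * (u ^ N * c') * hs u v M"
      by (simp only: mult.assoc)
    also have "\<dots> = c * c' * hs u v (N + M)"
      unfolding c' hs_add[OF uv] by (simp add: mult.assoc distrib_left)
    finally have h: "(c * hs u v N) * (c' * v ^ M) + (c * u ^ N) * (c' * hs u v M)
      = c * c' * hs u v (N + M)" .
    have e: "(if N = d then c else 0) * (if M = e then c' else 0)
        = (if N + M = d + e then c * c' else 0)"
      using \<open>N \<le> d\<close> \<open>M \<le> e\<close> by auto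
    show ?case
      unfolding h e p[OF c'(1)] p[OF c'(2)]
      using mono \<open>c \<in> C\<close> \<open>N \<le> d\<close> C by (intro bipoly.mono) auto
  next
    case (add b1 q1 q1' s1 b2 q2 q2' s2)
    from bipoly.add[OF add.IH] show ?case by (simp add: distrib_left add_ac)
  qed (auto simp: bipoly.zero)
next
  case (add a1 p1 p1' r1 a2 p2 p2' r2)
  from bipoly.add[OF add.IH] show ?case by (simp add: distrib_right add_ac)
qed (auto simp: bipoly.zero)

text \<open>Kept apart from \<open>klr_relations\<close> because the well-definedness of
  \<open>diamond\<close> is established for an arbitrary family \<open>Q\<close>.\<close>

locale klr_relations_sym = klr_relations \<beta> Q E X T sc
  for \<beta> :: "'i multiset" and Q :: "'i \<Rightarrow> 'i \<Rightarrow> 'k::comm_ring_1 poly poly"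
    and E :: "'i list \<Rightarrow> 'r::{ring,monoid_mult}" and X T sc +
  assumes Q_diag: "Q i i = 0"
    and Q_sym: "coeff (coeff (Q i j) a) b = coeff (coeff (Q j i) b) a"
begin

text \<open>Common bounds for both sums allow polynomials of different degrees to be compared, such
  as \<open>Q i j\<close> and \<open>Q j i\<close>; the additional terms vanish by
  \<open>sc_0\<close>.\<close>

lemma ev2_wider:
  assumes "degree P \<le> A" "\<And>s. degree (coeff P s) \<le> B"
  shows "ev2 sc P a b = (\<Sum>s\<le>A. \<Sum>r\<le>B. sc (coeff (coeff P s) r) * a ^ s * b ^ r)"
proof -
  have "(\<Sum>r\<le>B. sc (coeff (coeff P s) r) * a ^ s * b ^ r)
      = (\<Sum>r\<le>degree (coeff P s). sc (coeff (coeff P s) r) * a ^ s * b ^ r)" for s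
    using assms(2)[of s] by (intro sum.mono_neutral_right) (auto simp: coeff_eq_0)
  moreover have "(\<Sum>s\<le>A. \<Sum>r\<le>degree (coeff P s). sc (coeff (coeff P s) r) * a ^ s * b ^ r) = ev2 sc P a b"
    unfolding ev2_def
    using assms(1) by (intro sum.mono_neutral_right) (auto simp: coeff_eq_0)
  ultimately show ?thesis by simp
qed

lemma dd2_wider:
  assumes "degree P \<le> A" "\<And>s. degree (coeff P s) \<le> B"
  shows "dd2 sc P a b c = (\<Sum>s\<le>A. \<Sum>r\<le>B. sc (coeff (coeff P s) r) * hs c a s * b ^ r)"
proof -
  have "(\<Sum>r\<le>B. sc (coeff (coeff P s) r) * hs c a s * b ^ r)
      = (\<Sum>r\<le>degree (coeff P s). sc (coeff (coeff P s) r) * hs c a s * b ^ r)" for s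
    using assms(2)[of s] by (intro sum.mono_neutral_right) (auto simp: coeff_eq_0)
  moreover have "(\<Sum>s\<le>A. \<Sum>r\<le>degree (coeff P s). sc (coeff (coeff P s) r) * hs c a s * b ^ r) = dd2 sc P a b c"
    unfolding dd2_def hs_def
    using assms(1) by (intro sum.mono_neutral_right) (auto simp: coeff_eq_0)
  ultimately show ?thesis by simp
qed

lemma inner_degree_bound:
  fixes P :: "'k poly poly"
  obtains B where "\<And>s. degree (coeff P s) \<le> B"
proof
  fix s
  show "degree (coeff P s) \<le> (\<Sum>s\<le>degree P. degree (coeff P s))"
  proof (cases "s \<le> degree P")
    case True
    then show ?thesis by (intro member_le_sum) auto
  qed (simp add: coeff_eq_0)
qed

lemma ev2_swap:
  assumes "a * b = b * a"
  shows "ev2 sc (Q i j) a b = ev2 sc (Q j i) b a"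
proof -
  obtain B1 where B1: "degree (coeff (Q i j) s) \<le> B1" for s using inner_degree_bound by blast
  obtain B2 where B2: "degree (coeff (Q j i) s) \<le> B2" for s using inner_degree_bound by blast
  have "a ^ s * b ^ r = b ^ r * a ^ s" for r s
    using assms by (metis power_commute)
  then have *: "sc c * a ^ s * b ^ r = sc c * b ^ r * a ^ s" for c s r by (metis mult.assoc)
  have "ev2 sc (Q i j) a b = (\<Sum>s\<le>B2 + degree (Q i j). \<Sum>r\<le>B1 + degree (Q j i).
      sc (coeff (coeff (Q i j) s) r) * a ^ s * b ^ r)"
    by (rule ev2_wider) (auto intro: trans_le_add1 B1)
  also have "\<dots> = (\<Sum>r\<le>B1 + degree (Q j i). \<Sum>s\<le>B2 + degree (Q i j).
      sc (coeff (coeff (Q j i) r) s) * b ^ r * a ^ s)"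
    by (subst sum.swap, intro sum.cong refl) (metis * Q_sym)
  also have "\<dots> = ev2 sc (Q j i) b a"
    by (rule ev2_wider[symmetric]) (auto intro: trans_le_add1 B2)
  finally show ?thesis .
qed

text \<open>The polynomial is read in its first variable, so its coefficients are polynomials in
  \<open>y\<close>; hence \<open>y\<close> must belong to \<open>C\<close>. Only the top coefficient
  is a scalar, because \<open>coeff P d\<close> is constant in the second variable.\<close>

lemma ev2_bipoly:
  assumes P: "\<And>s. s > d \<Longrightarrow> coeff P s = 0" "coeff P d = [:lam:]"
    and C: "\<And>a b. a \<in> C \<Longrightarrow> b \<in> C \<Longrightarrow> a * b \<in> C" "1 \<in> C" "\<And>c. sc c \<in> C" "y \<in> C"
    and comm: "y * u = u * y" "y * v = v * y"
  shows "bipoly C u v d (sc lam) (ev2 sc P u y) (ev2 sc P v y) (dd2 sc P v y u)"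
proof -
  obtain B where B: "degree (coeff P s) \<le> B" for s using inner_degree_bound by blast
  have d: "degree P \<le> d" using P(1) by (intro degree_le) auto
  have yC: "y ^ r \<in> C" for r using C by (induction r) auto
  have re: "sc c * u ^ s * y ^ r = sc c * y ^ r * u ^ s" "sc c * v ^ s * y ^ r = sc c * y ^ r * v ^ s"
    "sc c * hs u v s * y ^ r = sc c * y ^ r * hs u v s" for c s r
  proof -
    have uv: "intertwines (y ^ r) u u" "intertwines (y ^ r) v v"
      using comm by (auto simp: intertwines_def power_commute)
    show "sc c * u ^ s * y ^ r = sc c * y ^ r * u ^ s" "sc c * v ^ s * y ^ r = sc c * y ^ r * v ^ s"
      "sc c * hs u v s * y ^ r = sc c * y ^ r * hs u v s"
      using intertwines_power[OF uv(1)] intertwines_power[OF uv(2)] intertwines_hs[OF uv]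
      by (auto simp: intertwines_def mult.assoc)
  qed
  have top: "(\<Sum>s\<le>d. \<Sum>r\<le>B. if s = d then sc (coeff (coeff P s) r) * y ^ r else 0) = sc lam"
  proof -
    have "(\<Sum>s\<le>d. \<Sum>r\<le>B. if s = d then sc (coeff (coeff P s) r) * y ^ r else 0)
      = (\<Sum>s\<in>{d}. \<Sum>r\<le>B. if s = d then sc (coeff (coeff P s) r) * y ^ r else 0)"
      by (rule sum.mono_neutral_right) auto
    also have "\<dots> = (\<Sum>r\<le>B. sc (coeff (coeff P d) r) * y ^ r)" by simp
    also have "\<dots> = (\<Sum>r\<in>{0}. sc (coeff (coeff P d) r) * y ^ r)"
      by (rule sum.mono_neutral_right) (auto simp: P(2) coeff_pCons split: nat.splits)
    finally show ?thesis using P(2) by simp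
  qed
  show ?thesis
    unfolding ev2_wider[OF d B] dd2_wider[OF d B] re top[symmetric]
    using C yC by (intro bipoly_sum bipoly.mono) auto
qed

text \<open>\<open>PP q k l u\<close> is \<open>P(u) = \<Prod> q(u, x\<^sub>p)\<close> over \<open>k < p \<le> k + l\<close>, and \<open>DD q k l u v\<close> is
  \<open>(P(v) - P(u)) / (v - u)\<close>, computed by the product rule.\<close>

primrec PP :: "'k poly poly \<Rightarrow> nat \<Rightarrow> nat \<Rightarrow> 'r \<Rightarrow> 'r" where
  "PP q k 0 u = 1"
| "PP q k (Suc l) u = PP q k l u * ev2 sc q u (X (k + l + 1))"

primrec DD :: "'k poly poly \<Rightarrow> nat \<Rightarrow> nat \<Rightarrow> 'r \<Rightarrow> 'r \<Rightarrow> 'r" where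
  "DD q k 0 u v = 0"
| "DD q k (Suc l) u v = DD q k l u v * ev2 sc q v (X (k + l + 1))
     + PP q k l u * dd2 sc q v (X (k + l + 1)) u"

lemma intertwines_PP:
  assumes "intertwines w u u'" "\<And>p. p \<in> {k<..k + l} \<Longrightarrow> intertwines w (X p) (X p)"
    "\<And>c. intertwines w (sc c) (sc c)"
  shows "intertwines w (PP q k l u) (PP q k l u')"
  using assms(2)
proof (induction l)
  case (Suc l)
  then show ?case using assms by (auto intro!: intertwines_mult intertwines_ev2)
qed auto

lemma intertwines_DD:
  assumes "intertwines w u u'" "intertwines w v v'"
    "\<And>p. p \<in> {k<..k + l} \<Longrightarrow> intertwines w (X p) (X p)"
    "\<And>c. intertwines w (sc c) (sc c)"
  shows "intertwines w (DD q k l u v) (DD q k l u' v')"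
  using assms(3)
proof (induction l)
  case (Suc l)
  then show ?case using assms
    by (auto intro!: intertwines_add intertwines_mult intertwines_ev2 intertwines_dd2 intertwines_PP)
qed auto

text \<open>The recursion of \<open>DD\<close> is the Leibniz rule of \<open>bipoly_mult\<close>, so
  each further factor adds \<open>d\<close> to the degree bound and one factor \<open>sc lam\<close>
  to the top coefficient.\<close>

lemma PP_DD_bipoly:
  assumes P: "\<And>s. s > d \<Longrightarrow> coeff P s = 0" "coeff P d = [:lam:]"
    and C: "\<And>a b. a \<in> C \<Longrightarrow> b \<in> C \<Longrightarrow> a * b \<in> C" "1 \<in> C" "\<And>c. sc c \<in> C"
      "\<And>p. p \<in> {k<..k + l} \<Longrightarrow> X p \<in> C"
    and comm: "\<And>c. c \<in> C \<Longrightarrow> c * u = u * c \<and> c * v = v * c" "u * v = v * u"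
  shows "bipoly C u v (l * d) (sc lam ^ l) (PP P k l u) (PP P k l v) (DD P k l u v)"
  using C(4)
proof (induction l)
  case 0
  show ?case using bipoly.mono[OF C(2), of 0 0 u v] by simp
next
  case (Suc l)
  have "X (k + l + 1) \<in> C" using Suc.prems by auto
  then have "bipoly C u v d (sc lam) (ev2 sc P u (X (k + l + 1))) (ev2 sc P v (X (k + l + 1)))
      (dd2 sc P v (X (k + l + 1)) u)"
    by (intro ev2_bipoly[OF P C(1-3)]) (use comm in auto)
  moreover have "bipoly C u v (l * d) (sc lam ^ l) (PP P k l u) (PP P k l v) (DD P k l u v)"
    using Suc by auto
  ultimately have "bipoly C u v (l * d + d) (sc lam ^ l * sc lam) (PP P k (Suc l) u) (PP P k (Suc l) v)
      (DD P k (Suc l) u v)"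
    unfolding PP.simps DD.simps by (intro bipoly_mult C comm)
  then show ?case by (simp add: add.commute power_commutes)
qed

lemma E_T_same:
  assumes "\<nu> \<in> permutations_of_multiset \<beta>" "k \<in> {1..<size \<beta>}" "cpt \<nu> k = cpt \<nu> (k + 1)"
  shows "T k * E \<nu> = E \<nu> * T k"
  using T_E[OF assms(1,2)] swap_cpt_same[of k \<nu>] assms length_permutation[OF assms(1)] by simp

lemma T_E_E:
  assumes "\<nu> \<in> permutations_of_multiset \<beta>" "k \<in> {1..<size \<beta>}"
  shows "T k * E \<nu> = E (swap_cpt k \<nu>) * (T k * E \<nu>)"
  using T_E[OF assms] E_E[OF assms(1,1)] by (metis mult.assoc)

lemma X_X_intertwines:
  "k \<in> {1..size \<beta>} \<Longrightarrow> l \<in> {1..size \<beta>} \<Longrightarrow> intertwines (X k) (X l) (X l)"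
  by (simp add: intertwines_def X_X)

lemma sc_intertwines:
  "k \<in> {1..size \<beta>} \<Longrightarrow> intertwines (X k) (sc c) (sc c)"
  "k \<in> {1..<size \<beta>} \<Longrightarrow> intertwines (T k) (sc c) (sc c)"
  "\<nu> \<in> permutations_of_multiset \<beta> \<Longrightarrow> intertwines (E \<nu>) (sc c) (sc c)"
  by (simp_all add: intertwines_def sc_X sc_T sc_E)

lemma X_E_intertwines:
  "\<nu> \<in> permutations_of_multiset \<beta> \<Longrightarrow> k \<in> {1..size \<beta>} \<Longrightarrow> intertwines (E \<nu>) (X k) (X k)"
  by (simp add: intertwines_def X_E)

lemma X_PP:
  assumes "r \<in> {1..size \<beta>}" "s \<in> {1..size \<beta>}" "k + l \<le> size \<beta>"
  shows "intertwines (X r) (PP q k l (X s)) (PP q k l (X s))"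
  using assms by (intro intertwines_PP X_X_intertwines sc_intertwines) auto

lemma E_PP:
  assumes "\<nu> \<in> permutations_of_multiset \<beta>" "s \<in> {1..size \<beta>}" "k + l \<le> size \<beta>"
  shows "intertwines (E \<nu>) (PP q k l (X s)) (PP q k l (X s))"
  using assms by (intro intertwines_PP X_E_intertwines sc_intertwines) auto

lemma dn_X_commute_E:
  assumes "\<nu> \<in> permutations_of_multiset \<beta>" "1 \<le> k" "k + l \<le> size \<beta>" "q \<in> {1..size \<beta>}"
    "q < k \<or> k + l < q"
  shows "intertwines (dn k l * E \<nu>) (X q) (X q)"
proof (rule intertwines_comp[where b = "X q"])
  show "intertwines (dn k l) (X q) (X q)"
    using X_up_commute[OF assms(2-5)] by (simp add: intertwines_def)
  show "intertwines (E \<nu>) (X q) (X q)"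
    using assms by (intro X_E_intertwines)
qed

lemma dn_sc_E:
  assumes "\<nu> \<in> permutations_of_multiset \<beta>" "1 \<le> k" "k + l \<le> size \<beta>"
  shows "intertwines (dn k l * E \<nu>) (sc c) (sc c)"
proof (rule intertwines_comp[where b = "sc c"])
  show "intertwines (dn k l) (sc c) (sc c)"
    using sc_up_commute[OF assms(2-3)] by (simp add: intertwines_def)
  show "intertwines (E \<nu>) (sc c) (sc c)"
    using assms by (intro sc_intertwines)
qed

section \<open>Carrying a strand across a string of strands of another colour\<close>

text \<open>Induction on the number of strands passed. The farthest crossing is undone first and
  produces one value of \<open>Q i j\<close>; pulling this value to the right through
  \<open>dn k l\<close> turns its variable \<open>X (k + l)\<close> into \<open>X k\<close>.\<close>

lemma up_dn_E:
  assumes \<nu>: "\<nu> \<in> permutations_of_multiset \<beta>" and ij: "i \<noteq> j"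
    and k: "1 \<le> k" "k + l \<le> size \<beta>"
    and i: "cpt \<nu> k = i" and j: "\<And>p. p \<in> {k<..k + l} \<Longrightarrow> cpt \<nu> p = j"
  shows "up k l * dn k l * E \<nu> = PP (Q i j) k l (X k) * E \<nu>"
  using k(2) j
proof (induction l)
  case (Suc l)
  let ?\<mu> = "swap_dn k l \<nu>" and ?s = "k + l"
  have len: "length \<nu> = size \<beta>" using \<nu> by (rule length_permutation)
  have \<mu>: "?\<mu> \<in> permutations_of_multiset \<beta>" using \<nu> k Suc.prems by (intro swap_dn_perm) auto
  have c: "cpt ?\<mu> ?s = i" "cpt ?\<mu> (?s + 1) = j"
    using cpt_swap_dn[OF len k(1), of l] Suc.prems k(1) i by auto
  define w where "w = dn k l * E \<nu>"
  have w: "E ?\<mu> * w = w" "w * E \<nu> = w"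
    using dn_E[OF \<nu> k(1), of l] Suc.prems E_E[OF \<nu> \<nu>] unfolding w_def
    by (metis mult.assoc Suc_leD add_Suc_right, metis mult.assoc)
  have "up k (Suc l) * dn k (Suc l) * E \<nu> = up k l * (T ?s * T ?s * w)"
    by (simp add: up_Suc dn_Suc w_def mult.assoc)
  also have "T ?s * T ?s * w = T ?s * T ?s * E ?\<mu> * w" by (simp add: w mult.assoc)
  also have "\<dots> = ev2 sc (Q i j) (X ?s) (X (?s + 1)) * w"
    using T_T_E[OF \<mu>, of ?s] c Suc.prems k by (simp add: mult.assoc w)
  also have "\<dots> = w * ev2 sc (Q i j) (X k) (X (?s + 1))"
  proof -
    have "intertwines w (X ?s) (X k)"
      unfolding w_def using Suc.prems k ij i by (intro X_dn_E \<nu>) auto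
    moreover have "intertwines w (X (?s + 1)) (X (?s + 1))"
      unfolding w_def using Suc.prems k by (intro dn_X_commute_E \<nu>) auto
    ultimately have "intertwines w (ev2 sc (Q i j) (X ?s) (X (?s + 1))) (ev2 sc (Q i j) (X k) (X (?s + 1)))"
      unfolding w_def using Suc.prems k \<nu> by (intro intertwines_ev2 dn_sc_E) auto
    then show ?thesis by (simp add: intertwines_def)
  qed
  also have "up k l * (w * ev2 sc (Q i j) (X k) (X (?s + 1)))
      = PP (Q i j) k l (X k) * (E \<nu> * ev2 sc (Q i j) (X k) (X (?s + 1)))"
    using Suc by (simp add: w_def mult.assoc[symmetric])
  also have "E \<nu> * ev2 sc (Q i j) (X k) (X (?s + 1)) = ev2 sc (Q i j) (X k) (X (?s + 1)) * E \<nu>"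
    using intertwines_ev2[of "E \<nu>" "X k" "X k" "X (?s + 1)" "X (?s + 1)" sc "Q i j"]
      X_E_intertwines[OF \<nu>] sc_intertwines(3)[OF \<nu>] Suc.prems k by (simp add: intertwines_def)
  finally show ?case by (simp add: mult.assoc)
qed simp

lemma X_T_E_same_side:
  assumes "\<nu> \<in> permutations_of_multiset \<beta>" "s \<in> {1..<size \<beta>}" "q \<in> {1..size \<beta>}" "q \<noteq> s" "q \<noteq> s + 1"
  shows "intertwines (T s * E \<nu>) (X q) (X q)"
proof (rule intertwines_comp[where b = "X q"])
  show "intertwines (T s) (X q) (X q)"
    using T_X_commute[OF assms(2-5)] by (simp add: intertwines_def)
  show "intertwines (E \<nu>) (X q) (X q)"
    using assms by (intro X_E_intertwines)
qed

lemma sc_T_E: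
  assumes "\<nu> \<in> permutations_of_multiset \<beta>" "s \<in> {1..<size \<beta>}"
  shows "intertwines (T s * E \<nu>) (sc c) (sc c)"
  using assms by (intro intertwines_comp[where b = "sc c"] sc_intertwines)

lemma ev2_swap_X:
  assumes "k \<in> {1..size \<beta>}" "l \<in> {1..size \<beta>}"
  shows "ev2 sc (Q i j) (X k) (X l) = ev2 sc (Q j i) (X l) (X k)"
  by (rule ev2_swap) (use X_X assms in auto)

text \<open>Mirror image of \<open>up_dn_E\<close>. Here the crossing added by the induction is the
  one that acts first, so the hypothesis is applied to the swapped tuple. The strand
  \<open>i\<close> now stands to the left of \<open>j\<close>, and the symmetry of \<open>Q\<close>
  restores the order of the variables.\<close>

lemma dn_up_E:
  assumes \<nu>: "\<nu> \<in> permutations_of_multiset \<beta>" and ij: "i \<noteq> j"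
    and k: "k + l + 1 \<le> size \<beta>"
    and i: "cpt \<nu> (k + l + 1) = i" and j: "\<And>p. p \<in> {k<..k + l} \<Longrightarrow> cpt \<nu> p = j"
  shows "dn (k + 1) l * up (k + 1) l * E \<nu> = PP (Q i j) k l (X (k + l + 1)) * E \<nu>"
  using \<nu> k i j
proof (induction l arbitrary: \<nu>)
  case (Suc l)
  let ?s = "k + l + 1"
  let ?\<mu> = "swap_cpt ?s \<nu>"
  have len: "length \<nu> = size \<beta>" using Suc.prems(1) by (rule length_permutation)
  have s: "?s \<in> {1..<size \<beta>}" using Suc.prems by auto
  have \<mu>: "?\<mu> \<in> permutations_of_multiset \<beta>" using Suc.prems s by (intro swap_cpt_permutation) auto
  have c: "cpt ?\<mu> ?s = i" "\<And>p. p \<in> {k<..k + l} \<Longrightarrow> cpt ?\<mu> p = j"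
    using Suc.prems len by (auto simp: cpt_swap_cpt)
  have cs: "cpt \<nu> ?s = j" "cpt \<nu> (?s + 1) = i" using Suc.prems by auto
  define w where "w = T ?s * E \<nu>"
  have w: "E ?\<mu> * w = w" using T_E_E[OF Suc.prems(1) s] by (simp add: w_def)
  let ?P = "PP (Q i j) k l (X (?s + 1))" and ?e = "ev2 sc (Q i j) (X (?s + 1)) (X ?s)"
  have "dn (k + 1) (Suc l) * up (k + 1) (Suc l) * E \<nu> = T ?s * (dn (k + 1) l * up (k + 1) l * E ?\<mu> * w)"
    using w by (simp add: up_Suc dn_Suc w_def mult.assoc)
  also have "\<dots> = T ?s * (PP (Q i j) k l (X ?s) * w)"
    using Suc.IH[OF \<mu>] Suc.prems c w by (simp add: mult.assoc)
  also have "PP (Q i j) k l (X ?s) * w = w * ?P"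
  proof -
    have "intertwines w (X (transpose ?s (?s + 1) (?s + 1))) (X (?s + 1))"
      unfolding w_def using s Suc.prems(1) cs ij by (intro X_T_E) auto
    moreover have "intertwines w (X p) (X p)" if "p \<in> {k<..k + l}" for p
      unfolding w_def using s Suc.prems(1) that by (intro X_T_E_same_side) auto
    ultimately have "intertwines w (PP (Q i j) k l (X ?s)) ?P"
      unfolding w_def using s Suc.prems(1) by (intro intertwines_PP sc_T_E) auto
    then show ?thesis by (simp add: intertwines_def)
  qed
  also have "T ?s * (w * ?P) = (T ?s * T ?s * E \<nu>) * ?P"
    by (simp add: w_def mult.assoc)
  also have "T ?s * T ?s * E \<nu> = ?e * E \<nu>"
    using T_T_E[OF Suc.prems(1) s] cs ev2_swap_X[of "?s + 1" "?s" i j] s Suc.prems(2) by simp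
  also have "?e * E \<nu> * ?P = ?e * ?P * E \<nu>"
    using E_PP[OF Suc.prems(1), of "?s + 1" k l] s Suc.prems(2)
    by (simp add: intertwines_def mult.assoc)
  also have "?e * ?P = ?P * ?e"
  proof -
    have "intertwines (X r) ?P ?P" if "r \<in> {1..size \<beta>}" for r
      using that s Suc.prems(2) by (intro X_PP) auto
    then have "intertwines ?P (X r) (X r)" if "r \<in> {1..size \<beta>}" for r
      using that by (auto simp: intertwines_def)
    moreover have "intertwines (sc c) ?P ?P" for c
      using s Suc.prems(2) sc_intertwines(1)
      by (intro intertwines_PP) (auto simp: intertwines_def sc_sc sc_X)
    then have "intertwines ?P (sc c) (sc c)" for c by (simp add: intertwines_def)
    ultimately have "intertwines ?P ?e ?e"
      using s Suc.prems(2) by (intro intertwines_ev2) auto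
    then show ?thesis by (simp add: intertwines_def)
  qed
  finally show ?case by simp
qed simp

text \<open>The nil affine Hecke relation for two strands of equal colour, iterated: the correction
  term is the divided difference of the \<open>q\<close>-th power.\<close>

lemma X_power_T_E:
  assumes \<nu>: "\<nu> \<in> permutations_of_multiset \<beta>" and s: "s \<in> {1..<size \<beta>}"
    and c: "cpt \<nu> s = cpt \<nu> (s + 1)"
  shows "X (s + 1) ^ q * T s * E \<nu> = T s * X s ^ q * E \<nu> + hs (X s) (X (s + 1)) q * E \<nu>"
    "X s ^ q * T s * E \<nu> = T s * X (s + 1) ^ q * E \<nu> - hs (X s) (X (s + 1)) q * E \<nu>"
proof -
  have EX: "E \<nu> * X r ^ q = X r ^ q * E \<nu>" if "r \<in> {1..size \<beta>}" for r q
    using power_commute[OF X_E[OF \<nu> that]] by simp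
  have 1: "X (s + 1) * T s * E \<nu> = T s * X s * E \<nu> + E \<nu>"
    using T_X_E[OF \<nu> s, of s] s c by (simp add: algebra_simps)
  have 2: "X s * T s * E \<nu> = T s * X (s + 1) * E \<nu> - E \<nu>"
    using T_X_E[OF \<nu> s, of "s + 1"] s c by (simp add: algebra_simps)
  have uv: "X s * X (s + 1) = X (s + 1) * X s" using s by (intro X_X) auto
  have comm: "X (s + 1) * hs (X s) (X (s + 1)) q = hs (X s) (X (s + 1)) q * X (s + 1)"
      "X s * hs (X s) (X (s + 1)) q = hs (X s) (X (s + 1)) q * X s" for q
    using intertwines_commute[OF intertwines_hs[of "X (s + 1)" "X s" "X s" "X (s + 1)" "X (s + 1)" q]]
      intertwines_commute[OF intertwines_hs[of "X s" "X s" "X s" "X (s + 1)" "X (s + 1)" q]] uv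
    by (auto simp: intertwines_def)
  show "X (s + 1) ^ q * T s * E \<nu> = T s * X s ^ q * E \<nu> + hs (X s) (X (s + 1)) q * E \<nu>"
  proof (induction q)
    case (Suc q)
    have "X (s + 1) ^ Suc q * T s * E \<nu> = X (s + 1) * (X (s + 1) ^ q * T s * E \<nu>)"
      by (simp add: mult.assoc)
    also have "\<dots> = X (s + 1) * T s * X s ^ q * E \<nu> + X (s + 1) * hs (X s) (X (s + 1)) q * E \<nu>"
      by (simp only: Suc) (simp add: distrib_left mult.assoc)
    also have "X (s + 1) * T s * X s ^ q * E \<nu> = X (s + 1) * T s * E \<nu> * X s ^ q"
      using EX[of s q] s by (simp add: mult.assoc)
    also have "\<dots> = T s * X s ^ Suc q * E \<nu> + X s ^ q * E \<nu>"
      unfolding 1 using EX[of s q] s by (simp add: distrib_right mult.assoc)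
    finally show ?case by (simp add: hs_Suc' distrib_right add.assoc)
  qed simp
  show "X s ^ q * T s * E \<nu> = T s * X (s + 1) ^ q * E \<nu> - hs (X s) (X (s + 1)) q * E \<nu>"
  proof (induction q)
    case (Suc q)
    have "X s ^ Suc q * T s * E \<nu> = X s * (X s ^ q * T s * E \<nu>)"
      by (simp add: mult.assoc)
    also have "\<dots> = X s * T s * X (s + 1) ^ q * E \<nu> - X s * hs (X s) (X (s + 1)) q * E \<nu>"
      by (simp only: Suc) (simp add: right_diff_distrib mult.assoc)
    also have "X s * T s * X (s + 1) ^ q * E \<nu> = X s * T s * E \<nu> * X (s + 1) ^ q"
      using EX[of "s + 1" q] s by (simp add: mult.assoc)
    also have "\<dots> = T s * X (s + 1) ^ Suc q * E \<nu> - X (s + 1) ^ q * E \<nu>"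
      unfolding 2 using EX[of "s + 1" q] s by (simp add: left_diff_distrib mult.assoc)
    finally show ?case
      by (simp only: hs_Suc comm(2)) (simp add: distrib_right diff_diff_add add.commute)
  qed simp
qed

text \<open>A braid relation for two strands \<open>i\<close> with \<open>l\<close> strands
  \<open>j\<close> between them. When one more strand \<open>j\<close> is inserted, the previous
  error is multiplied by a value of \<open>Q i j\<close> coming from a squared crossing, and the new
  braid relation contributes a divided difference of \<open>Q i j\<close>, multiplied by
  \<open>PP\<close> for the strands already passed. These are the two summands in the recursion of
  \<open>DD\<close>.\<close>

lemma dn_T_up_diff:
  assumes \<nu>: "\<nu> \<in> permutations_of_multiset \<beta>" and ij: "i \<noteq> j"
    and k: "1 \<le> k" "k + l + 1 \<le> size \<beta>"
    and i: "cpt \<nu> k = i" "cpt \<nu> (k + l + 1) = i" and j: "\<And>p. p \<in> {k<..k + l} \<Longrightarrow> cpt \<nu> p = j"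
  shows "dn (k + 1) l * T k * up (k + 1) l * E \<nu> - up k l * T (k + l) * dn k l * E \<nu>
    = DD (Q i j) k l (X k) (X (k + l + 1)) * E \<nu>"
  using \<nu> k(2) i j
proof (induction l arbitrary: \<nu>)
  case (Suc l)
  let ?s = "k + l + 1"
  let ?\<mu> = "swap_cpt ?s \<nu>" and ?\<rho> = "swap_dn k l \<nu>"
  note \<nu> = Suc.prems(1)
  have len: "length \<nu> = size \<beta>" using \<nu> by (rule length_permutation)
  have s: "?s \<in> {1..<size \<beta>}" using Suc.prems by auto
  have \<mu>: "?\<mu> \<in> permutations_of_multiset \<beta>" using \<nu> s by (intro swap_cpt_permutation) auto
  have \<rho>: "?\<rho> \<in> permutations_of_multiset \<beta>" using Suc.prems k(1) by (intro swap_dn_perm) auto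
  have c: "cpt ?\<mu> k = i" "cpt ?\<mu> ?s = i" "\<And>p. p \<in> {k<..k + l} \<Longrightarrow> cpt ?\<mu> p = j"
    using Suc.prems len k(1) by (auto simp: cpt_swap_cpt)
  have cs: "cpt \<nu> ?s = j" "cpt \<nu> (?s + 1) = i" "cpt \<nu> k = i" using Suc.prems by auto
  have c\<rho>: "cpt ?\<rho> (k + l) = i" "cpt ?\<rho> ?s = j" "cpt ?\<rho> (?s + 1) = i"
    using cpt_swap_dn[OF len k(1), of l] Suc.prems k(1) by auto
  define w where "w = T ?s * E \<nu>"
  define z where "z = dn k l * E \<nu>"
  have w: "E ?\<mu> * w = w" using T_E_E[OF \<nu> s] by (simp add: w_def)
  have z: "E ?\<rho> * z = z"
    using dn_E[OF \<nu> k(1), of l] Suc.prems E_E[OF \<nu> \<nu>] unfolding z_def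
    by (metis mult.assoc Suc_leD add_Suc_right add.assoc Suc_eq_plus1)
  let ?q = "Q i j"
  let ?D = "DD ?q k l (X k) (X (?s + 1))" and ?e = "ev2 sc ?q (X (?s + 1)) (X ?s)"
  let ?P = "PP ?q k l (X k)" and ?d = "dd2 sc ?q (X (?s + 1)) (X ?s) (X k)"
  have IH: "dn (k + 1) l * T k * up (k + 1) l * E ?\<mu>
      = up k l * T (k + l) * dn k l * E ?\<mu> + DD ?q k l (X k) (X ?s) * E ?\<mu>"
    using Suc.IH[OF \<mu>] Suc.prems c by (simp add: algebra_simps)
  have "dn (k + 1) (Suc l) * T k * up (k + 1) (Suc l) * E \<nu>
      = T ?s * (dn (k + 1) l * T k * up (k + 1) l * E ?\<mu> * w)"
    using w by (simp add: up_Suc dn_Suc w_def mult.assoc)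
  also have "\<dots> = T ?s * (up k l * T (k + l) * dn k l * w) + T ?s * (DD ?q k l (X k) (X ?s) * w)"
    unfolding IH using w by (simp add: distrib_left distrib_right mult.assoc)
  \<comment> \<open>The previous error: passing through \<open>w\<close> moves its second variable
    from place \<open>?s\<close> to place \<open>?s + 1\<close>, and the two remaining crossings at
    \<open>?s\<close> square to \<open>Q\<close>.\<close>
  also have "T ?s * (DD ?q k l (X k) (X ?s) * w) = ?D * ?e * E \<nu>"
  proof -
    have "intertwines w (X (transpose ?s (?s + 1) (?s + 1))) (X (?s + 1))"
      unfolding w_def using s \<nu> Suc.prems(2) cs ij by (intro X_T_E) auto
    moreover have "intertwines w (X p) (X p)" if "p \<in> {k..k + l}" for p
      unfolding w_def using s \<nu> that k(1) by (intro X_T_E_same_side) auto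
    ultimately have "intertwines w (DD ?q k l (X k) (X ?s)) ?D"
      unfolding w_def using s \<nu> by (intro intertwines_DD sc_T_E) auto
    then have "T ?s * (DD ?q k l (X k) (X ?s) * w) = (T ?s * T ?s * E \<nu>) * ?D"
      by (simp add: intertwines_def w_def mult.assoc)
    also have "T ?s * T ?s * E \<nu> = ?e * E \<nu>"
      using T_T_E[OF \<nu> s] cs ev2_swap_X[of "?s + 1" "?s" i j] s Suc.prems(2) by simp
    also have "E \<nu> * ?D = ?D * E \<nu>"
    proof -
      have "intertwines (E \<nu>) ?D ?D"
        using s k(1) Suc.prems(2) \<nu> by (intro intertwines_DD X_E_intertwines sc_intertwines) auto
      then show ?thesis by (simp add: intertwines_def)
    qed
    then have "?e * E \<nu> * ?D = ?e * ?D * E \<nu>" by (simp add: mult.assoc)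
    also have "?e * ?D = ?D * ?e"
    proof -
      have "intertwines (X r) ?D ?D" if "r \<in> {1..size \<beta>}" for r
        using that s Suc.prems(2) k(1) by (intro intertwines_DD X_X_intertwines sc_intertwines) auto
      then have "intertwines ?D (X r) (X r)" if "r \<in> {1..size \<beta>}" for r
        using that by (auto simp: intertwines_def)
      moreover have "intertwines (sc c) ?D ?D" for c
        using s Suc.prems(2) k(1)
        by (intro intertwines_DD) (auto simp: intertwines_def sc_sc sc_X)
      then have "intertwines ?D (sc c) (sc c)" for c by (simp add: intertwines_def)
      ultimately have "intertwines ?D ?e ?e"
        using s Suc.prems(2) by (intro intertwines_ev2) auto
      then show ?thesis by (simp add: intertwines_def)
    qed
    finally show ?thesis .
  qed
  \<comment> \<open>\<open>T ?s\<close> commutes with both words of length \<open>l\<close>. This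
    exposes the braid \<open>T ?s * T (k + l) * T ?s\<close> at the tuple \<open>?\<rho>\<close>,
    where both outer strands have colour \<open>i\<close>.\<close>
  also have "T ?s * (up k l * T (k + l) * dn k l * w)
      = up k l * (T ?s * T (k + l) * T ?s * E ?\<rho> * z)"
  proof -
    have comm: "T ?s * up k l = up k l * T ?s" "dn k l * T ?s = T ?s * dn k l"
      using T_up_commute[of k l ?s] k(1) s by auto
    have "T ?s * (up k l * T (k + l) * dn k l * w)
        = (T ?s * up k l) * T (k + l) * (dn k l * T ?s) * E \<nu>"
      by (simp only: w_def mult.assoc)
    also have "\<dots> = up k l * (T ?s * T (k + l) * (T ?s * (dn k l * E \<nu>)))"
      unfolding comm by (simp only: mult.assoc)
    finally have "T ?s * (up k l * T (k + l) * dn k l * w)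
        = up k l * (T ?s * T (k + l) * (T ?s * (dn k l * E \<nu>)))" .
    then show ?thesis using z by (simp add: z_def mult.assoc)
  qed
  also have "T ?s * T (k + l) * T ?s * E ?\<rho> = T (k + l) * T ?s * T (k + l) * E ?\<rho>
      + dd2 sc ?q (X (?s + 1)) (X ?s) (X (k + l)) * E ?\<rho>"
    using braid[OF \<rho>, of "k + l"] c\<rho> s k(1) Suc.prems(2) by (simp add: algebra_simps)
  also have "up k l * ((T (k + l) * T ?s * T (k + l) * E ?\<rho>
      + dd2 sc ?q (X (?s + 1)) (X ?s) (X (k + l)) * E ?\<rho>) * z)
      = up k (Suc l) * T (k + Suc l) * dn k (Suc l) * E \<nu>
      + up k l * (dd2 sc ?q (X (?s + 1)) (X ?s) (X (k + l)) * z)"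
    using z by (simp add: distrib_left distrib_right mult.assoc z_def up_Suc dn_Suc)
  \<comment> \<open>The new correction is pulled to the right through \<open>dn k l\<close>, so that
    the word and its reverse become adjacent and \<open>up_dn_E\<close> applies.\<close>
  also have "up k l * (dd2 sc ?q (X (?s + 1)) (X ?s) (X (k + l)) * z) = ?P * ?d * E \<nu>"
  proof -
    have "intertwines z (X (k + l)) (X k)"
      unfolding z_def using Suc.prems k(1) ij by (intro X_dn_E \<nu>) auto
    moreover have "intertwines z (X ?s) (X ?s)" "intertwines z (X (?s + 1)) (X (?s + 1))"
      unfolding z_def using Suc.prems k(1) by (intro dn_X_commute_E \<nu>; auto)+
    ultimately have "intertwines z (dd2 sc ?q (X (?s + 1)) (X ?s) (X (k + l))) ?d"
      unfolding z_def using Suc.prems k(1) \<nu> by (intro intertwines_dd2 dn_sc_E) auto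
    then have "up k l * (dd2 sc ?q (X (?s + 1)) (X ?s) (X (k + l)) * z) = up k l * dn k l * E \<nu> * ?d"
      by (simp add: intertwines_def z_def mult.assoc)
    also have "up k l * dn k l * E \<nu> = ?P * E \<nu>"
      using Suc.prems k(1) by (intro up_dn_E \<nu> ij) auto
    also have "E \<nu> * ?d = ?d * E \<nu>"
      using intertwines_dd2[of "E \<nu>" "X (?s + 1)" "X (?s + 1)" "X ?s" "X ?s" "X k" "X k" sc ?q]
        X_E_intertwines[OF \<nu>] sc_intertwines(3)[OF \<nu>] Suc.prems k(1) by (simp add: intertwines_def)
    then have "?P * E \<nu> * ?d = ?P * ?d * E \<nu>" by (simp add: mult.assoc)
    finally show ?thesis .
  qed
  finally have sum: "dn (k + 1) (Suc l) * T k * up (k + 1) (Suc l) * E \<nu>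
    = up k (Suc l) * T (k + Suc l) * dn k (Suc l) * E \<nu> + ?P * ?d * E \<nu> + ?D * ?e * E \<nu>" .
  have cancel: "a - b = d + c" if "a = b + c + d" for a b c d :: 'r
    using that by simp
  have s1: "k + Suc l + 1 = ?s + 1" by simp
  show ?case unfolding s1 DD.simps distrib_right by (rule cancel) (rule sum)
qed simp

primrec swap_up :: "nat \<Rightarrow> nat \<Rightarrow> 'i list \<Rightarrow> 'i list" where
  "swap_up k 0 \<nu> = \<nu>"
| "swap_up k (Suc l) \<nu> = swap_up k l (swap_cpt (k + l) \<nu>)"

lemma length_swap_up [simp]: "length (swap_up k l \<nu>) = length \<nu>"
  by (induction l arbitrary: \<nu>) auto

lemma up_E:
  assumes "\<nu> \<in> permutations_of_multiset \<beta>" "1 \<le> k" "k + l \<le> size \<beta>"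
  shows "up k l * E \<nu> = E (swap_up k l \<nu>) * up k l"
  using assms
proof (induction l arbitrary: \<nu>)
  case (Suc l)
  have "up k (Suc l) * E \<nu> = up k l * E (swap_cpt (k + l) \<nu>) * T (k + l)"
    using T_E[OF Suc.prems(1), of "k + l"] Suc.prems by (simp add: up_Suc mult.assoc)
  also have "\<dots> = E (swap_up k (Suc l) \<nu>) * up k (Suc l)"
    using Suc.IH[of "swap_cpt (k + l) \<nu>"] Suc.prems swap_cpt_permutation[OF Suc.prems(1), of "k + l"]
    by (simp add: up_Suc mult.assoc)
  finally show ?case .
qed simp

lemma swap_up_perm:
  "\<nu> \<in> permutations_of_multiset \<beta> \<Longrightarrow> 1 \<le> k \<Longrightarrow> k + l \<le> size \<beta> \<Longrightarrow>
    swap_up k l \<nu> \<in> permutations_of_multiset \<beta>"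
  by (induction l arbitrary: \<nu>) (simp_all add: swap_cpt_permutation)

lemma E_absorb:
  assumes "\<nu> \<in> permutations_of_multiset \<beta>" "w * E \<nu> = E \<mu> * w"
  shows "E \<mu> * (w * E \<nu>) = w * E \<nu>"
proof -
  have "E \<mu> * (w * E \<nu>) = (w * E \<nu>) * E \<nu>" by (simp only: assms(2) mult.assoc)
  then show ?thesis using E_E[OF assms(1,1)] by (simp add: mult.assoc)
qed

lemma cpt_swap_up:
  assumes "length \<nu> = size \<beta>" "1 \<le> k" "k + l \<le> size \<beta>" "1 \<le> p" "p \<le> size \<beta>"
  shows "cpt (swap_up k l \<nu>) p =
    (if p = k then cpt \<nu> (k + l) else if k < p \<and> p \<le> k + l then cpt \<nu> (p - 1) else cpt \<nu> p)"
  using assms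
proof (induction l arbitrary: \<nu>)
  case (Suc l)
  have "cpt (swap_up k (Suc l) \<nu>) p = (let \<mu> = swap_cpt (k + l) \<nu> in
    if p = k then cpt \<mu> (k + l) else if k < p \<and> p \<le> k + l then cpt \<mu> (p - 1) else cpt \<mu> p)"
    unfolding Let_def swap_up.simps using Suc.prems by (intro Suc.IH) auto
  then show ?case
    using Suc.prems by (auto simp: cpt_swap_cpt transpose_def Let_def)
qed auto

text \<open>\<open>sc\<close> is not assumed to be unital: \<open>sc 1\<close> acts as the identity
  only next to an idempotent \<open>E \<nu>\<close>.\<close>

lemma sc_1_right:
  assumes "\<nu> \<in> permutations_of_multiset \<beta>" "z * E \<nu> = z"
  shows "z * sc 1 = z"
  using sc_1_E[OF assms(1)] sc_E[OF assms(1), of 1] assms(2) by (metis mult.assoc)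

section \<open>Elements annihilated by the crossings of a block of equal strands\<close>

text \<open>In \<open>X_power_T_E\<close> the summand beginning with \<open>T s\<close> is
  annihilated by \<open>z\<close>, so to the right of \<open>z\<close> a crossing acts as a divided
  difference.\<close>

lemma z_X_power_T:
  assumes \<nu>: "\<nu> \<in> permutations_of_multiset \<beta>" and z: "z * E \<nu> = z" "z * T s = 0"
    and s: "s \<in> {1..<size \<beta>}" and c: "cpt \<nu> s = cpt \<nu> (s + 1)"
  shows "z * X (s + 1) ^ q * T s = z * hs (X s) (X (s + 1)) q"
    "z * X s ^ q * T s = - (z * hs (X s) (X (s + 1)) q)"
proof -
  have EX: "E \<nu> * X r ^ q = X r ^ q * E \<nu>" if "r \<in> {1..size \<beta>}" for r q
    using power_commute[OF X_E[OF \<nu> that]] by simp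
  have h: "hs (X s) (X (s + 1)) q * E \<nu> = E \<nu> * hs (X s) (X (s + 1)) q"
    using intertwines_hs[of "E \<nu>" "X s" "X s" "X (s + 1)" "X (s + 1)" q] X_E_intertwines[OF \<nu>] s
    by (auto simp: intertwines_def)
  have move: "z * X r ^ q * T s = z * (X r ^ q * T s * E \<nu>)" if "r \<in> {1..size \<beta>}" for r
  proof -
    have "z * X r ^ q * T s = z * E \<nu> * X r ^ q * T s" by (simp add: z)
    also have "\<dots> = z * (X r ^ q * (E \<nu> * T s))"
      using EX[OF that] by (simp add: mult.assoc[symmetric]) (simp add: mult.assoc EX[OF that])
    finally show ?thesis by (simp add: E_T_same[OF \<nu> s c] mult.assoc)
  qed
  have zT: "z * (T s * w) = 0" for w
    using z(2) by (simp add: mult.assoc[symmetric])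
  have zE: "z * (E \<nu> * w) = z * w" for w
    using z(1) by (simp add: mult.assoc[symmetric])
  have zh: "z * (hs (X s) (X (s + 1)) q * E \<nu>) = z * hs (X s) (X (s + 1)) q"
    unfolding h by (rule zE)
  have "z * X (s + 1) ^ q * T s = z * (X (s + 1) ^ q * T s * E \<nu>)"
    using s by (intro move) auto
  also have "\<dots> = z * (T s * (X s ^ q * E \<nu>)) + z * (hs (X s) (X (s + 1)) q * E \<nu>)"
    unfolding X_power_T_E[OF \<nu> s c] by (simp only: distrib_left mult.assoc)
  finally show "z * X (s + 1) ^ q * T s = z * hs (X s) (X (s + 1)) q"
    by (simp only: zT zh add_0_left)
  have "z * X s ^ q * T s = z * (X s ^ q * T s * E \<nu>)"
    using s by (intro move) auto
  also have "\<dots> = z * (T s * (X (s + 1) ^ q * E \<nu>)) - z * (hs (X s) (X (s + 1)) q * E \<nu>)"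
    unfolding X_power_T_E[OF \<nu> s c] by (simp only: right_diff_distrib mult.assoc)
  finally show "z * X s ^ q * T s = - (z * hs (X s) (X (s + 1)) q)"
    by (simp only: zT zh diff_0)
qed

lemma power_power_commute: "a * b = b * a \<Longrightarrow> a ^ p * b ^ r = b ^ r * (a ^ p :: 'r)"
  by (rule power_commute[OF power_commute[symmetric], symmetric]) simp

text \<open>Each letter acts as a divided difference and lowers the degree by one, so
  \<open>M\<close> letters leave nothing of a power below \<open>M\<close> and exactly
  \<open>1\<close> of the \<open>M\<close>-th power. In the induction, the variable
  \<open>X (off + Suc M)\<close> of the leftmost strand no longer meets any letter and commutes to
  the end.\<close>

lemma block_right:
  assumes \<nu>: "\<nu> \<in> permutations_of_multiset \<beta>" and z: "z * E \<nu> = z"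
    and "off + Suc M \<le> size \<beta>"
    and "\<And>l. l \<in> {off<..<off + Suc M} \<Longrightarrow> z * T l = 0"
    and "\<And>p. p \<in> {off<..off + Suc M} \<Longrightarrow> cpt \<nu> p = i"
    and "q \<le> M"
  shows "z * X (off + Suc M) ^ q * dn (off + 1) M = (if q = M then z else 0)"
  using assms(3-6)
proof (induction M arbitrary: q)
  case (Suc M)
  let ?s = "off + Suc M"
  have s: "?s \<in> {1..<size \<beta>}" using Suc.prems by auto
  have "z * X (off + Suc (Suc M)) ^ q * dn (off + 1) (Suc M) = z * X (?s + 1) ^ q * T ?s * dn (off + 1) M"
    by (simp add: dn_Suc mult.assoc)
  also have "z * X (?s + 1) ^ q * T ?s = z * hs (X ?s) (X (?s + 1)) q"
    using Suc.prems by (intro z_X_power_T(1)[OF \<nu> z _ s]) auto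
  also have "z * hs (X ?s) (X (?s + 1)) q * dn (off + 1) M
      = (\<Sum>p<q. z * X ?s ^ (q - 1 - p) * dn (off + 1) M * X (?s + 1) ^ p)"
  proof -
    have "intertwines (dn (off + 1) M) (X (?s + 1)) (X (?s + 1))"
      using X_up_commute(2)[of "off + 1" M "?s + 1"] Suc.prems by (simp add: intertwines_def)
    then have 1: "X (?s + 1) ^ p * dn (off + 1) M = dn (off + 1) M * X (?s + 1) ^ p" for p
      using intertwines_power unfolding intertwines_def by blast
    have "X (?s + 1) * X ?s = X ?s * X (?s + 1)"
      using s by (intro X_X) auto
    then have 2: "X (?s + 1) ^ p * X ?s ^ r = X ?s ^ r * X (?s + 1) ^ p" for p r
      by (rule power_power_commute)
    show ?thesis
      unfolding hs_def sum_distrib_left sum_distrib_right 2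
      by (intro sum.cong refl) (simp only: mult.assoc 1)
  qed
  also have "\<dots> = (\<Sum>p<q. if p = 0 \<and> q = Suc M then z else 0)"
  proof (rule sum.cong[OF refl])
    fix p assume p: "p \<in> {..<q}"
    have "z * X ?s ^ (q - 1 - p) * dn (off + 1) M = (if q - 1 - p = M then z else 0)"
      using Suc.prems by (intro Suc.IH) auto
    moreover have "q - 1 - p = M \<longleftrightarrow> p = 0 \<and> q = Suc M" using p Suc.prems(4) by auto
    ultimately show "z * X ?s ^ (q - 1 - p) * dn (off + 1) M * X (?s + 1) ^ p
      = (if p = 0 \<and> q = Suc M then z else 0)" by auto
  qed
  also have "\<dots> = (if q = Suc M then z else 0)"
    by (cases "q = Suc M") auto
  finally show ?case .
qed (use z in auto)

text \<open>Mirror image of \<open>block_right\<close>, starting from the right end of the block.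
  The dot now sits on the other strand of each crossing, so every divided difference comes with a
  minus sign, whence \<open>(- 1) ^ M\<close>.\<close>

lemma block_left:
  assumes \<nu>: "\<nu> \<in> permutations_of_multiset \<beta>" and z: "z * E \<nu> = z"
    and "off + Suc M \<le> size \<beta>"
    and "\<And>l. l \<in> {off<..<off + Suc M} \<Longrightarrow> z * T l = 0"
    and "\<And>p. p \<in> {off<..off + Suc M} \<Longrightarrow> cpt \<nu> p = i"
    and "q \<le> M"
  shows "z * X (off + 1) ^ q * up (off + 1) M = (if q = M then z * sc ((- 1) ^ M) else 0)"
  using assms(3-6)
proof (induction M arbitrary: off q)
  case 0
  then show ?case by (simp add: sc_1_right[OF \<nu> z])
next
  case (Suc M)
  let ?s = "off + 1"
  have s: "?s \<in> {1..<size \<beta>}" using Suc.prems by auto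
  have "z * X (off + 1) ^ q * up (off + 1) (Suc M) = z * X ?s ^ q * T ?s * up (?s + 1) M"
    by (simp add: up_Suc' mult.assoc)
  also have "z * X ?s ^ q * T ?s = - (z * hs (X ?s) (X (?s + 1)) q)"
    using Suc.prems by (intro z_X_power_T(2)[OF \<nu> z _ s]) auto
  also have "- (z * hs (X ?s) (X (?s + 1)) q) * up (?s + 1) M
      = - (\<Sum>p<q. z * X (?s + 1) ^ p * up (?s + 1) M * X ?s ^ (q - 1 - p))"
  proof -
    have "intertwines (up (?s + 1) M) (X ?s) (X ?s)"
      using X_up_commute(1)[of "?s + 1" M "?s"] Suc.prems by (simp add: intertwines_def)
    then have "X ?s ^ p * up (?s + 1) M = up (?s + 1) M * X ?s ^ p" for p
      using intertwines_power unfolding intertwines_def by blast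
    then have "z * hs (X ?s) (X (?s + 1)) q * up (?s + 1) M
      = (\<Sum>p<q. z * X (?s + 1) ^ p * up (?s + 1) M * X ?s ^ (q - 1 - p))"
      unfolding hs_def sum_distrib_left sum_distrib_right
      by (intro sum.cong refl) (simp only: mult.assoc)
    then show ?thesis by simp
  qed
  also have "(\<Sum>p<q. z * X (?s + 1) ^ p * up (?s + 1) M * X ?s ^ (q - 1 - p))
      = (\<Sum>p<q. if p = M \<and> q = Suc M then z * sc ((- 1) ^ M) else 0)"
  proof (rule sum.cong[OF refl])
    fix p assume p: "p \<in> {..<q}"
    have "z * X (?s + 1) ^ p * up (?s + 1) M = (if p = M then z * sc ((- 1) ^ M) else 0)"
      using Suc.prems p by (intro Suc.IH) auto
    moreover have "q = Suc M" if "p = M" using p Suc.prems(4) that by auto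
    ultimately show "z * X (?s + 1) ^ p * up (?s + 1) M * X ?s ^ (q - 1 - p)
      = (if p = M \<and> q = Suc M then z * sc ((- 1) ^ M) else 0)" by auto
  qed
  also have "- \<dots> = (if q = Suc M then z * sc ((- 1) ^ Suc M) else 0)"
    by (cases "q = Suc M") (auto simp: sc_uminus)
  finally show ?case .
qed

text \<open>The word of \<open>e\<^sub>L\<close>, placed on the strands \<open>off + 1, \<dots>, off + L\<close>.\<close>

definition blk :: "nat \<Rightarrow> nat \<Rightarrow> 'r" where
  "blk off L = prod_list (map (\<lambda>q. X (off + q) ^ (q - 1)) [2..<Suc L])
     * prod_list (map (\<lambda>l. T (off + l)) (longest_word L))"

lemma dn_offset: "prod_list (map (\<lambda>l. T (off + l)) (rev [1..<Suc L])) = dn (off + 1) L"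
proof -
  have "[off + 1..<off + 1 + L] = map ((+) off) [1..<Suc L]"
    by (rule nth_equalityI) (auto simp del: upt_Suc)
  then show ?thesis by (simp add: dn_def rev_map o_def del: upt_Suc)
qed

lemma longest_word_Suc: "longest_word (Suc L) = longest_word L @ rev [1..<Suc L]"
  by (cases L) (simp_all add: longest_word_def)

lemma prod_word_Suc:
  "prod_list (map (\<lambda>l. T (off + l)) (longest_word (Suc L)))
    = prod_list (map (\<lambda>l. T (off + l)) (longest_word L)) * dn (off + 1) L"
  unfolding longest_word_Suc map_append prod_list.append dn_offset ..

lemma set_longest_word: "l \<in> set (longest_word L) \<Longrightarrow> 1 \<le> l \<and> l < L"
  by (auto simp: longest_word_def)

lemma commute_prod_list:
  assumes "\<And>x. x \<in> set xs \<Longrightarrow> w * f x = f x * w"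
  shows "w * prod_list (map f xs) = prod_list (map f xs) * (w::'r)"
  using assms
proof (induction xs)
  case (Cons x xs)
  then have "w * f x = f x * w" "w * prod_list (map f xs) = prod_list (map f xs) * w" by auto
  then show ?case by (metis list.simps(9) mult.assoc prod_list.Cons)
qed simp

text \<open>The last power of \<open>X\<close> commutes with the shorter word in \<open>T\<close>,
  so the word for \<open>L + 1\<close> strands is the one for \<open>L\<close> strands followed by
  \<open>X (off + Suc L) ^ L\<close> and a descending word. On \<open>z\<close> the latter two act
  as the identity, by the top degree case of \<open>block_right\<close>.\<close>

lemma absorb_blk:
  assumes \<nu>: "\<nu> \<in> permutations_of_multiset \<beta>" and z: "z * E \<nu> = z"
    and "off + L \<le> size \<beta>"
    and "\<And>l. l \<in> {off<..<off + L} \<Longrightarrow> z * T l = 0"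
    and "\<And>p. p \<in> {off<..off + L} \<Longrightarrow> cpt \<nu> p = i"
  shows "z * blk off L = z"
  using assms(3-5)
proof (induction L)
  case 0
  then show ?case by (simp add: blk_def longest_word_def)
next
  case (Suc L)
  let ?A = "\<lambda>L. prod_list (map (\<lambda>q. X (off + q) ^ (q - 1)) [2..<Suc L])"
    and ?W = "\<lambda>L. prod_list (map (\<lambda>l. T (off + l)) (longest_word L))"
  have A: "?A (Suc L) = ?A L * X (off + Suc L) ^ L"
    by (cases L) (auto simp: numeral_2_eq_2)
  have "X (off + Suc L) * ?W L = ?W L * X (off + Suc L)"
  proof (rule commute_prod_list)
    fix l assume "l \<in> set (longest_word L)"
    then show "X (off + Suc L) * T (off + l) = T (off + l) * X (off + Suc L)"
      using set_longest_word[of l L] Suc.prems(1) by (intro T_X_commute[symmetric]) auto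
  qed
  then have comm: "X (off + Suc L) ^ L * ?W L = ?W L * X (off + Suc L) ^ L"
    by (rule power_commute)
  have "z * blk off (Suc L) = z * ?A L * (X (off + Suc L) ^ L * ?W L) * dn (off + 1) L"
    unfolding blk_def A prod_word_Suc by (simp only: mult.assoc)
  also have "\<dots> = z * blk off L * X (off + Suc L) ^ L * dn (off + 1) L"
    unfolding blk_def comm by (simp only: mult.assoc)
  also have "z * blk off L = z" using Suc by auto
  also have "z * X (off + Suc L) ^ L * dn (off + 1) L = z"
    using block_right[OF \<nu> z, of off L i L] Suc.prems by auto
  finally show ?case .
qed

section \<open>Sliding crossings and dots past a travelling strand\<close>

text \<open>The braid relation has a correction only if the outer strands agree, and then it is a
  divided difference of \<open>Q\<close>, which vanishes if the middle strand agrees as well, by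
  \<open>Q_diag\<close>.\<close>

lemma braid_E:
  assumes "\<nu> \<in> permutations_of_multiset \<beta>" "1 \<le> s" "s + 1 < size \<beta>"
    and "cpt \<nu> s \<noteq> cpt \<nu> (s + 2) \<or> cpt \<nu> s = cpt \<nu> (s + 1)"
  shows "T (s + 1) * T s * T (s + 1) * E \<nu> = T s * T (s + 1) * T s * E \<nu>"
  using braid[OF assms(1-3)] assms(4) by (auto simp: left_diff_distrib Q_diag dd2_def split: if_splits)

text \<open>The travelling strand passes the two strands of the crossing one after the other, and a
  single braid relation exchanges the order of events. When that relation is applied the travelling
  strand stands in place \<open>s\<close>, so condition \<open>c\<close> is exactly the one required
  by \<open>braid_E\<close>.\<close>

lemma dn_T_slide:
  assumes \<nu>: "\<nu> \<in> permutations_of_multiset \<beta>" and k: "1 \<le> k" "k + l \<le> size \<beta>"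
    and s: "k \<le> s" "s + 1 < k + l"
    and c: "cpt \<nu> k \<noteq> cpt \<nu> (s + 2) \<or> cpt \<nu> k = cpt \<nu> (s + 1)"
  shows "dn k l * T (s + 1) * E \<nu> = T s * dn k l * E \<nu>"
proof -
  obtain a where a: "s = k + a" using s(1) le_Suc_ex by blast
  obtain b where b: "k + l = s + 2 + b" using s(2) by (metis Suc_leI Suc_eq_plus1 add_2_eq_Suc' le_Suc_ex)
  let ?D1 = "dn k a" and ?D2 = "dn (s + 2) b" and ?\<mu> = "swap_dn k a \<nu>"
  have l: "l = Suc (Suc a) + b" using a b by simp
  have D: "dn k l = ?D2 * T (s + 1) * T s * ?D1"
    unfolding l dn_add[of k "Suc (Suc a)" b] dn_Suc using a by (simp add: mult.assoc)
  have 1: "?D1 * T (s + 1) = T (s + 1) * ?D1"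
    using T_up_commute(2)[of k a "s + 1"] a b k by auto
  have 2: "?D2 * T s = T s * ?D2"
    using T_up_commute(2)[of "s + 2" b s] a b k by auto
  have 3: "?D1 * E \<nu> = E ?\<mu> * ?D1"
    using a b k by (intro dn_E \<nu>) auto
  have 4: "T (s + 1) * T s * T (s + 1) * E ?\<mu> = T s * T (s + 1) * T s * E ?\<mu>"
  proof (rule braid_E)
    show "?\<mu> \<in> permutations_of_multiset \<beta>" using a b k by (intro swap_dn_perm \<nu>) auto
    show "cpt ?\<mu> s \<noteq> cpt ?\<mu> (s + 2) \<or> cpt ?\<mu> s = cpt ?\<mu> (s + 1)"
      using c a b k cpt_swap_dn[OF length_permutation[OF \<nu>] k(1), of a] by auto
  qed (use a b k in auto)
  have "dn k l * T (s + 1) * E \<nu> = ?D2 * T (s + 1) * T s * (?D1 * T (s + 1)) * E \<nu>"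
    unfolding D by (simp only: mult.assoc)
  also have "\<dots> = ?D2 * (T (s + 1) * T s * T (s + 1) * E ?\<mu>) * ?D1"
    unfolding 1 by (simp only: mult.assoc 3)
  also have "\<dots> = (?D2 * T s) * T (s + 1) * T s * (E ?\<mu> * ?D1)"
    unfolding 4 by (simp only: mult.assoc)
  also have "\<dots> = T s * dn k l * E \<nu>"
    unfolding 2 3[symmetric] D by (simp only: mult.assoc)
  finally show ?thesis .
qed

lemma up_T_slide:
  assumes \<nu>: "\<nu> \<in> permutations_of_multiset \<beta>" and k: "1 \<le> k" "k + l \<le> size \<beta>"
    and s: "k \<le> s" "s + 1 < k + l"
    and c: "cpt \<nu> s \<noteq> cpt \<nu> (k + l)"
  shows "up k l * T s * E \<nu> = T (s + 1) * up k l * E \<nu>"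
proof -
  obtain a where a: "s = k + a" using s(1) le_Suc_ex by blast
  obtain b where b: "k + l = s + 2 + b" using s(2) by (metis Suc_leI Suc_eq_plus1 add_2_eq_Suc' le_Suc_ex)
  let ?U1 = "up k a" and ?U2 = "up (s + 2) b" and ?\<mu> = "swap_up (s + 2) b \<nu>"
  have l: "l = Suc (Suc a) + b" using a b by simp
  have U: "up k l = ?U1 * T s * T (s + 1) * ?U2"
    unfolding l up_add[of k "Suc (Suc a)" b] up_Suc using a by (simp add: mult.assoc)
  have 1: "?U2 * T s = T s * ?U2"
    using T_up_commute(1)[of "s + 2" b s] a b k by auto
  have 2: "?U1 * T (s + 1) = T (s + 1) * ?U1"
    using T_up_commute(1)[of k a "s + 1"] a b k by auto
  have 3: "?U2 * E \<nu> = E ?\<mu> * ?U2"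
    using a b k by (intro up_E \<nu>) auto
  have \<mu>: "?\<mu> \<in> permutations_of_multiset \<beta>"
    using a b k by (intro swap_up_perm \<nu>) auto
  have 4: "T (s + 1) * T s * T (s + 1) * E ?\<mu> = T s * T (s + 1) * T s * E ?\<mu>"
  proof (rule braid_E[OF \<mu>])
    show "cpt ?\<mu> s \<noteq> cpt ?\<mu> (s + 2) \<or> cpt ?\<mu> s = cpt ?\<mu> (s + 1)"
      using c a b k cpt_swap_up[OF length_permutation[OF \<nu>], of "s + 2" b] by auto
  qed (use a b k in auto)
  have "up k l * T s * E \<nu> = ?U1 * T s * T (s + 1) * (?U2 * T s) * E \<nu>"
    unfolding U by (simp only: mult.assoc)
  also have "\<dots> = ?U1 * (T s * T (s + 1) * T s * E ?\<mu>) * ?U2"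
    unfolding 1 by (simp only: mult.assoc 3)
  also have "\<dots> = (?U1 * T (s + 1)) * T s * T (s + 1) * (E ?\<mu> * ?U2)"
    unfolding 4[symmetric] by (simp only: mult.assoc)
  also have "\<dots> = T (s + 1) * up k l * E \<nu>"
    unfolding 2 3[symmetric] U by (simp only: mult.assoc)
  finally show ?thesis .
qed

text \<open>The last letter of the word is \<open>T k\<close>, and \<open>T k\<close> squares to
  \<open>Q\<close> at two equal colours, which is zero.\<close>

lemma dn_T_zero:
  assumes \<nu>: "\<nu> \<in> permutations_of_multiset \<beta>" and k: "1 \<le> k" "k + l \<le> size \<beta>" "0 < l"
    and c: "cpt \<nu> k = cpt \<nu> (k + 1)"
  shows "dn k l * T k * E \<nu> = 0"
proof -
  obtain l' where l: "l = Suc l'" using k(3) by (cases l) auto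
  have "T k * T k * E \<nu> = 0"
    using T_T_E[OF \<nu>, of k] k c by (simp add: Q_diag ev2_def)
  then show ?thesis
    unfolding l dn_Suc' by (simp add: mult.assoc)
qed

text \<open>Complements \<open>X_dn_E\<close>: the dot sits on one of the strands that are passed.
  Only the crossing of its own strand with the travelling one moves it, by one place.\<close>

lemma X_up_E:
  assumes "\<nu> \<in> permutations_of_multiset \<beta>" "1 \<le> k" "k + l \<le> size \<beta>"
    and "p \<in> {k..<k + l}" "\<And>q. q \<in> {k..<k + l} \<Longrightarrow> cpt \<nu> q \<noteq> cpt \<nu> (k + l)"
  shows "intertwines (up k l * E \<nu>) (X (p + 1)) (X p)"
  using assms(2-5)
proof (induction l arbitrary: k)
  case (Suc l)
  let ?\<mu> = "swap_up (k + 1) l \<nu>"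
  have \<mu>: "?\<mu> \<in> permutations_of_multiset \<beta>" using Suc.prems by (intro swap_up_perm assms(1)) auto
  have U: "up (k + 1) l * E \<nu> = E ?\<mu> * up (k + 1) l"
    using Suc.prems by (intro up_E assms(1)) auto
  have "E ?\<mu> * (up (k + 1) l * E \<nu>) = up (k + 1) l * E \<nu>"
    by (rule E_absorb[OF assms(1) U])
  then have w: "up k (Suc l) * E \<nu> = (T k * E ?\<mu>) * (up (k + 1) l * E \<nu>)"
    by (simp add: up_Suc' mult.assoc)
  show ?case
    unfolding w
  proof (cases "p = k")
    case True
    have "cpt ?\<mu> k \<noteq> cpt ?\<mu> (k + 1)"
      using Suc.prems cpt_swap_up[OF length_permutation[OF assms(1)], of "k + 1" l] Suc.prems(4)[of k] by auto
    then have "intertwines (T k * E ?\<mu>) (X (transpose k (k + 1) k)) (X k)"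
      using Suc.prems by (intro X_T_E \<mu>) auto
    then have 1: "intertwines (T k * E ?\<mu>) (X (p + 1)) (X p)" using True by (simp add: transpose_def)
    have "X p * up (k + 1) l = up (k + 1) l * X p"
      using X_up_commute(1)[of "k + 1" l p] True Suc.prems by auto
    then have 2: "intertwines (up (k + 1) l * E \<nu>) (X p) (X p)"
      using Suc.prems(1-3)
      by (intro intertwines_comp[where b = "X p"] X_E_intertwines assms(1)) (auto simp: intertwines_def)
    show "intertwines (T k * E ?\<mu> * (up (k + 1) l * E \<nu>)) (X (p + 1)) (X p)"
      using intertwines_comp[OF 1 2] .
  next
    case False
    then have p: "k + 1 \<le> p" "p < k + 1 + l" using Suc.prems by auto
    have 1: "intertwines (T k * E ?\<mu>) (X (p + 1)) (X (p + 1))"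
      using Suc.prems p by (intro X_T_E_same_side \<mu>) auto
    have 2: "intertwines (up (k + 1) l * E \<nu>) (X (p + 1)) (X p)"
      using Suc.prems(1,2) Suc.prems(4) p by (intro Suc.IH) auto
    show "intertwines (T k * E ?\<mu> * (up (k + 1) l * E \<nu>)) (X (p + 1)) (X p)"
      using intertwines_comp[OF 1 2] .
  qed
qed auto

lemma X_dn_E_passed:
  assumes "\<nu> \<in> permutations_of_multiset \<beta>" "1 \<le> k" "k + l \<le> size \<beta>"
    and "p \<in> {k..<k + l}" "\<And>q. q \<in> {k<..k + l} \<Longrightarrow> cpt \<nu> q \<noteq> cpt \<nu> k"
  shows "intertwines (dn k l * E \<nu>) (X p) (X (p + 1))"
  using assms(3-5)
proof (induction l)
  case (Suc l)
  let ?\<mu> = "swap_dn k l \<nu>"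
  have \<mu>: "?\<mu> \<in> permutations_of_multiset \<beta>" using Suc.prems assms(2) by (intro swap_dn_perm assms(1)) auto
  have U: "dn k l * E \<nu> = E ?\<mu> * dn k l"
    using Suc.prems assms(2) by (intro dn_E assms(1)) auto
  have "E ?\<mu> * (dn k l * E \<nu>) = dn k l * E \<nu>"
    by (rule E_absorb[OF assms(1) U])
  then have w: "dn k (Suc l) * E \<nu> = (T (k + l) * E ?\<mu>) * (dn k l * E \<nu>)"
    by (simp add: dn_Suc mult.assoc)
  show ?case
    unfolding w
  proof (cases "p = k + l")
    case True
    have "cpt ?\<mu> (k + l) \<noteq> cpt ?\<mu> (k + l + 1)"
      using cpt_swap_dn[OF length_permutation[OF assms(1)] assms(2), of l] Suc.prems(1)
        Suc.prems(3)[of "k + l + 1"] assms(2) by simp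
    then have "intertwines (T (k + l) * E ?\<mu>) (X (transpose (k + l) (k + l + 1) (k + l + 1))) (X (k + l + 1))"
      using Suc.prems assms(2) by (intro X_T_E \<mu>) auto
    then have 1: "intertwines (T (k + l) * E ?\<mu>) (X p) (X (p + 1))" using True by (simp add: transpose_def)
    have 2: "intertwines (dn k l * E \<nu>) (X (p + 1)) (X (p + 1))"
      using True Suc.prems assms(2) by (intro dn_X_commute_E assms(1)) auto
    show "intertwines (T (k + l) * E ?\<mu> * (dn k l * E \<nu>)) (X p) (X (p + 1))"
      using intertwines_comp[OF 1 2] .
  next
    case False
    then have p: "k \<le> p" "p < k + l" using Suc.prems by auto
    have 1: "intertwines (T (k + l) * E ?\<mu>) (X p) (X p)"
      using Suc.prems assms(2) p by (intro X_T_E_same_side \<mu>) auto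
    have 2: "intertwines (dn k l * E \<nu>) (X p) (X (p + 1))"
      using Suc.prems p by (intro Suc.IH) auto
    show "intertwines (T (k + l) * E ?\<mu> * (dn k l * E \<nu>)) (X p) (X (p + 1))"
      using intertwines_comp[OF 1 2] .
  qed
qed auto

text \<open>The word of the longest element ends in a descending word. A letter \<open>T l\<close>
  slides through it and becomes \<open>T (l - 1)\<close> next to the shorter word, so the index
  drops until the letter meets its own square, in the case \<open>l = off + 1\<close>.\<close>

lemma word_T_E:
  assumes \<nu>: "\<nu> \<in> permutations_of_multiset \<beta>" and "off + L \<le> size \<beta>"
    and "\<And>p. p \<in> {off<..off + L} \<Longrightarrow> cpt \<nu> p = i" and "l \<in> {off<..<off + L}"
  shows "prod_list (map (\<lambda>l. T (off + l)) (longest_word L)) * T l * E \<nu> = 0"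
  using assms(2-4)
proof (induction L arbitrary: l)
  case (Suc L)
  let ?W = "prod_list (map (\<lambda>l. T (off + l)) (longest_word L))"
  show ?case
  proof (cases "l = off + 1")
    case True
    then show ?thesis
      using dn_T_zero[OF \<nu>, of "off + 1" L] Suc.prems unfolding prod_word_Suc by (simp add: mult.assoc)
  next
    case False
    then obtain s where s: "l = s + 1" "off < s" "s < off + L"
      using Suc.prems by (cases l) auto
    have 3: "dn (off + 1) L * E \<nu> = E \<nu> * dn (off + 1) L"
    proof (rule commute_dn[symmetric])
      fix r assume "off + 1 \<le> r" "r < off + 1 + L"
      then show "E \<nu> * T r = T r * E \<nu>"
        using Suc.prems(1) Suc.prems(2)[of r] Suc.prems(2)[of "r + 1"] by (intro E_T_same[symmetric] \<nu>) auto
    qed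
    have "?W * dn (off + 1) L * T l * E \<nu> = ?W * (dn (off + 1) L * T l * E \<nu>)"
      by (simp only: mult.assoc)
    also have "dn (off + 1) L * T l * E \<nu> = T s * dn (off + 1) L * E \<nu>"
      unfolding s(1) using Suc.prems s by (intro dn_T_slide[OF \<nu>]) auto
    also have "\<dots> = T s * E \<nu> * dn (off + 1) L" by (simp only: mult.assoc 3)
    also have "?W * (T s * E \<nu> * dn (off + 1) L) = (?W * T s * E \<nu>) * dn (off + 1) L"
      by (simp only: mult.assoc)
    also have "?W * T s * E \<nu> = 0" using Suc s by auto
    finally show ?thesis unfolding prod_word_Suc by simp
  qed
qed simp

end

lemma cpt_blocks:
  assumes "1 \<le> p" "p \<le> a + m + b"
  shows "cpt (replicate a i @ replicate m j @ replicate b i) p = (if b < p \<and> p \<le> b + m then j else i)"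
  using assms by (auto simp: cpt_def nth_append)

section \<open>The contracting homotopy\<close>

text \<open>\<open>N\<close> stands for \<open>-c\<^sub>i\<^sub>j\<close>, so that \<open>Q\<^sub>i\<^sub>j(u, v)\<close> has degree \<open>N\<close> in \<open>u\<close>. Up to scalars, right
  multiplication by \<open>\<delta> k\<close> is the differential and right multiplication by \<open>Y k\<close> is the homotopy on
  \<open>H 1\<^sub>\<nu>\<close> with \<open>\<nu> = vtx k\<close>; an element of \<open>H 1\<^sub>\<nu>\<close> is killed if the \<open>\<tau>\<^sub>l\<close> inside the two blocks of
  \<open>i\<close> annihilate it from the right, which holds for the elements of \<open>H \<epsilon>\<close> where
  \<open>\<epsilon> = e\<^sub>n\<^sub>-\<^sub>k \<diamondop> 1 \<diamondop> e\<^sub>k\<close>.\<close>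

locale klr_string = klr_relations_sym \<beta> Q E X T sc
  for \<beta> :: "'i multiset" and Q :: "'i \<Rightarrow> 'i \<Rightarrow> 'k::comm_ring_1 poly poly"
    and E :: "'i list \<Rightarrow> 'r::{ring,monoid_mult}" and X T sc +
  fixes i j :: 'i and m n N :: nat and lam :: 'k
  assumes \<beta>: "\<beta> = replicate_mset m j + replicate_mset n i"
    and ij: "i \<noteq> j"
    and Q_top: "coeff (Q i j) N = [:lam:]"
    and Q_deg: "s > N \<Longrightarrow> coeff (Q i j) s = 0"
    and n: "m * N < n"
begin

definition vtx :: "nat \<Rightarrow> 'i list" where
  "vtx k = replicate (n - k) i @ replicate m j @ replicate k i"

text \<open>The subtraction on natural numbers is exact by \<open>n\<close>, so
  \<open>m * N + x_exp = n - 1\<close>.\<close>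

definition x_exp :: nat where "x_exp = n - 1 - m * N"

definition Y :: "nat \<Rightarrow> 'r" where
  "Y k = dn (k + 1) m * X (k + 1) ^ x_exp * dn 1 k"

definition \<delta> :: "nat \<Rightarrow> 'r" where
  "\<delta> k = up k (m + n - k)"

definition killed :: "nat \<Rightarrow> 'r \<Rightarrow> bool" where
  "killed k z \<longleftrightarrow> z * E (vtx k) = z \<and> (\<forall>l. l \<in> {1..<k} \<or> l \<in> {k + m + 1..<n + m} \<longrightarrow> z * T l = 0)"

lemma size_\<beta> [simp]: "size \<beta> = m + n"
  by (simp add: \<beta>)

lemma length_vtx: "k \<le> n \<Longrightarrow> length (vtx k) = m + n"
  by (simp add: vtx_def)

lemma vtx_perm: "k \<le> n \<Longrightarrow> vtx k \<in> permutations_of_multiset \<beta>"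
proof -
  assume "k \<le> n"
  then have "replicate_mset (n - k) i + replicate_mset k i = replicate_mset n i"
    by (intro multiset_eqI) auto
  then show ?thesis
    by (simp add: vtx_def permutations_of_multiset_def \<beta>)
qed

lemma cpt_vtx:
  assumes "k \<le> n" "1 \<le> p" "p \<le> m + n"
  shows "cpt (vtx k) p = (if k < p \<and> p \<le> k + m then j else i)"
  unfolding vtx_def using assms by (intro cpt_blocks) auto

text \<open>The leftmost strand of the right block crosses all strands \<open>j\<close> and becomes
  the rightmost strand of the left block.\<close>

lemma swap_dn_vtx:
  assumes "k < n"
  shows "swap_dn (k + 1) m (vtx (k + 1)) = vtx k"
proof (rule cpt_ext)
  have "length (swap_dn a b \<nu>) = length \<nu>" for a b \<nu> by (induction b) auto
  then show "length (swap_dn (k + 1) m (vtx (k + 1))) = length (vtx k)"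
    using assms by (simp add: length_vtx)
  show "cpt (swap_dn (k + 1) m (vtx (k + 1))) p = cpt (vtx k) p" if "1 \<le> p" "p \<le> length (vtx k)" for p
    using that assms by (auto simp: cpt_swap_dn length_vtx cpt_vtx)
qed

lemma swap_dn_vtx_right:
  assumes "k < n"
  shows "swap_dn 1 k (vtx (k + 1)) = vtx (k + 1)"
proof (rule cpt_ext)
  have "length (swap_dn a b \<nu>) = length \<nu>" for a b \<nu> by (induction b) auto
  then show "length (swap_dn 1 k (vtx (k + 1))) = length (vtx (k + 1))"
    using assms by (simp add: length_vtx)
  show "cpt (swap_dn 1 k (vtx (k + 1))) p = cpt (vtx (k + 1)) p"
    if "1 \<le> p" "p \<le> length (vtx (k + 1))" for p
    using that assms by (auto simp: cpt_swap_dn length_vtx cpt_vtx)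
qed

lemma dn_vtx:
  assumes "k < n"
  shows "dn (k + 1) m * E (vtx (k + 1)) = E (vtx k) * dn (k + 1) m"
  using dn_E[OF vtx_perm, of "k + 1" "k + 1" m] assms by (simp add: swap_dn_vtx[simplified])

lemma up_vtx:
  assumes "k < n"
  shows "up (k + 1) m * E (vtx k) = E (vtx (k + 1)) * up (k + 1) m"
proof -
  have "swap_up (k + 1) m (vtx k) = vtx (k + 1)"
  proof (rule cpt_ext)
    show "length (swap_up (k + 1) m (vtx k)) = length (vtx (k + 1))"
      using assms by (simp add: length_vtx)
    show "cpt (swap_up (k + 1) m (vtx k)) p = cpt (vtx (k + 1)) p"
      if "1 \<le> p" "p \<le> length (vtx (k + 1))" for p
      using that assms by (auto simp: cpt_swap_up length_vtx cpt_vtx)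
  qed
  then show ?thesis
    using up_E[OF vtx_perm, of k "k + 1" m] assms by simp
qed

lemma dn_up_vtx:
  assumes "k < n"
  shows "dn (k + 1) m * up (k + 1) m * E (vtx k) = E (vtx k) * (dn (k + 1) m * up (k + 1) m)"
proof -
  have "dn (k + 1) m * up (k + 1) m * E (vtx k) = dn (k + 1) m * E (vtx (k + 1)) * up (k + 1) m"
    by (simp only: mult.assoc up_vtx[OF assms])
  then show ?thesis by (simp only: dn_vtx[OF assms] mult.assoc)
qed

lemma up_dn_vtx:
  assumes "k < n"
  shows "up (k + 1) m * dn (k + 1) m * E (vtx (k + 1)) = E (vtx (k + 1)) * (up (k + 1) m * dn (k + 1) m)"
proof -
  have "up (k + 1) m * dn (k + 1) m * E (vtx (k + 1)) = up (k + 1) m * E (vtx k) * dn (k + 1) m"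
    by (simp only: mult.assoc dn_vtx[OF assms])
  then show ?thesis by (simp only: up_vtx[OF assms] mult.assoc)
qed

lemma T_vtx:
  assumes "k \<le> n" "l \<in> {1..<k} \<or> l \<in> {k + m + 1..<n + m}"
  shows "T l * E (vtx k) = E (vtx k) * T l"
  using assms by (intro E_T_same vtx_perm) (auto simp: cpt_vtx)

lemma X_vtx: "k \<le> n \<Longrightarrow> q \<in> {1..m + n} \<Longrightarrow> X q * E (vtx k) = E (vtx k) * X q"
  using X_E[OF vtx_perm] by simp

lemma X_dn_vtx:
  assumes "k < n"
  shows "X (k + m + 1) ^ p * (dn (k + 1) m * E (vtx (k + 1))) = dn (k + 1) m * E (vtx (k + 1)) * X (k + 1) ^ p"
proof -
  have "intertwines (dn (k + 1) m * E (vtx (k + 1))) (X (k + 1 + m)) (X (k + 1))"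
    using assms ij by (intro X_dn_E vtx_perm) (auto simp: cpt_vtx)
  then have "intertwines (dn (k + 1) m * E (vtx (k + 1))) (X (k + 1 + m) ^ p) (X (k + 1) ^ p)"
    by (rule intertwines_power)
  then show ?thesis by (simp add: intertwines_def add.commute add.left_commute)
qed

text \<open>Brings the power of \<open>X\<close> in \<open>Y k\<close> to the front. There it sits
  on strand \<open>k + m + 1\<close>, the variable \<open>v\<close> of the divided
  difference.\<close>

lemma z_dn_X:
  assumes "k < n" "z * E (vtx k) = z"
  shows "z * dn (k + 1) m * X (k + 1) ^ p = z * X (k + m + 1) ^ p * dn (k + 1) m"
proof -
  have X: "X (k + m + 1) ^ p * E (vtx k) = E (vtx k) * X (k + m + 1) ^ p"
    using assms by (intro power_commute X_vtx) auto
  have "z * dn (k + 1) m * X (k + 1) ^ p = z * (E (vtx k) * dn (k + 1) m) * X (k + 1) ^ p"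
    using assms(2) by (simp add: mult.assoc[symmetric])
  also have "\<dots> = z * (dn (k + 1) m * E (vtx (k + 1)) * X (k + 1) ^ p)"
    unfolding dn_vtx[OF assms(1), symmetric] by (simp only: mult.assoc)
  also have "\<dots> = z * X (k + m + 1) ^ p * (dn (k + 1) m * E (vtx (k + 1)))"
    unfolding X_dn_vtx[OF assms(1), symmetric] by (simp only: mult.assoc)
  also have "\<dots> = z * (X (k + m + 1) ^ p * E (vtx k)) * dn (k + 1) m"
    unfolding dn_vtx[OF assms(1)] by (simp only: mult.assoc)
  also have "\<dots> = z * E (vtx k) * X (k + m + 1) ^ p * dn (k + 1) m"
    unfolding X by (simp only: mult.assoc)
  finally show ?thesis by (simp only: assms(2))
qed

text \<open>The factor \<open>dn 1 k\<close> of \<open>Y k\<close> serves this purpose. A letter of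
  the enlarged right block either meets its own square in \<open>dn 1 k\<close> or slides through it
  with index lowered by one; it then commutes with the remaining factors and reaches
  \<open>z\<close>. A letter of the shortened left block commutes with all of
  \<open>Y k\<close>.\<close>

lemma Y_killed:
  assumes k: "k < n" and z: "killed k z"
  shows "killed (k + 1) (z * Y k)"
  unfolding killed_def
proof (intro conjI allI impI)
  have zE: "z * E (vtx k) = z" using z by (simp add: killed_def)
  have dnE: "dn 1 k * E (vtx (k + 1)) = E (vtx (k + 1)) * dn 1 k"
    by (rule commute_dn[symmetric]) (use k in \<open>auto intro!: T_vtx[symmetric]\<close>)
  have XE: "X (k + 1) ^ x_exp * E (vtx (k + 1)) = E (vtx (k + 1)) * X (k + 1) ^ x_exp"
    using k by (intro power_commute X_vtx) auto
  have "z * Y k * E (vtx (k + 1)) = z * dn (k + 1) m * (X (k + 1) ^ x_exp * (dn 1 k * E (vtx (k + 1))))"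
    by (simp only: Y_def mult.assoc)
  also have "\<dots> = z * dn (k + 1) m * (X (k + 1) ^ x_exp * E (vtx (k + 1))) * dn 1 k"
    unfolding dnE by (simp only: mult.assoc)
  also have "\<dots> = z * (dn (k + 1) m * E (vtx (k + 1))) * X (k + 1) ^ x_exp * dn 1 k"
    unfolding XE by (simp only: mult.assoc)
  also have "\<dots> = z * E (vtx k) * Y k"
    unfolding dn_vtx[OF k] by (simp only: Y_def mult.assoc)
  finally show E: "z * Y k * E (vtx (k + 1)) = z * Y k" by (simp only: zE)
  fix l assume l: "l \<in> {1..<k + 1} \<or> l \<in> {k + 1 + m + 1..<n + m}"
  show "z * Y k * T l = 0"
  proof (cases "l \<in> {1..<k + 1}")
    case False
    then have l: "l \<in> {k + 1 + m + 1..<n + m}" using l by auto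
    have 1: "dn 1 k * T l = T l * dn 1 k" and 2: "dn (k + 1) m * T l = T l * dn (k + 1) m"
      using T_up_commute(2)[of 1 k l] T_up_commute(2)[of "k + 1" m l] l k by auto
    have "X (k + 1) * T l = T l * X (k + 1)"
      using T_X_commute[of l "k + 1"] l k by auto
    then have 3: "X (k + 1) ^ x_exp * T l = T l * X (k + 1) ^ x_exp" by (rule power_commute)
    have "z * Y k * T l = z * dn (k + 1) m * (X (k + 1) ^ x_exp * (dn 1 k * T l))"
      by (simp only: Y_def mult.assoc)
    also have "\<dots> = z * dn (k + 1) m * (X (k + 1) ^ x_exp * T l) * dn 1 k"
      unfolding 1 by (simp only: mult.assoc)
    also have "\<dots> = z * (dn (k + 1) m * T l) * X (k + 1) ^ x_exp * dn 1 k"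
      unfolding 3 by (simp only: mult.assoc)
    also have "\<dots> = (z * T l) * Y k"
      unfolding 2 by (simp only: Y_def mult.assoc)
    also have "z * T l = 0" using z l by (auto simp: killed_def)
    finally show ?thesis by simp
  next
    case True
    have TE: "z * Y k * T l = z * Y k * (T l * E (vtx (k + 1)))"
    proof -
      have "T l * E (vtx (k + 1)) = E (vtx (k + 1)) * T l" using True k by (intro T_vtx) auto
      then show ?thesis using E by (simp add: mult.assoc[symmetric])
    qed
    have c: "cpt (vtx (k + 1)) p = i" if "p \<in> {0<..0 + Suc k}" for p
      using that k by (auto simp: cpt_vtx)
    show ?thesis
    proof (cases "l = 1")
      case True
      have "dn 1 k * T 1 * E (vtx (k + 1)) = 0"
        using dn_T_zero[OF vtx_perm, of "k + 1" 1 k] c[of 1] c[of 2] \<open>l \<in> {1..<k + 1}\<close> k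
        by (simp add: numeral_2_eq_2)
      moreover have "z * Y k * T l = z * dn (k + 1) m * X (k + 1) ^ x_exp * (dn 1 k * T 1 * E (vtx (k + 1)))"
        using TE by (simp only: True Y_def mult.assoc)
      ultimately show ?thesis by simp
    next
      case False
      then obtain s where s: "l = s + 1" "0 < s" "s < k" using True by (cases l) auto
      have 0: "dn 1 k * T (s + 1) * E (vtx (k + 1)) = T s * dn 1 k * E (vtx (k + 1))"
        using dn_T_slide[OF vtx_perm, of "k + 1" 1 k s] c[of 1] c[of "s + 1"] s k by simp
      have 2: "dn (k + 1) m * T s = T s * dn (k + 1) m"
        using T_up_commute(2)[of "k + 1" m s] s k by auto
      have "X (k + 1) * T s = T s * X (k + 1)"
        using T_X_commute[of s "k + 1"] s k by auto
      then have 3: "X (k + 1) ^ x_exp * T s = T s * X (k + 1) ^ x_exp" by (rule power_commute)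
      have "z * Y k * T l = z * dn (k + 1) m * (X (k + 1) ^ x_exp * (dn 1 k * T (s + 1) * E (vtx (k + 1))))"
        using TE by (simp only: s(1) Y_def mult.assoc)
      also have "\<dots> = z * dn (k + 1) m * (X (k + 1) ^ x_exp * T s) * dn 1 k * E (vtx (k + 1))"
        unfolding 0 by (simp only: mult.assoc)
      also have "\<dots> = z * (dn (k + 1) m * T s) * X (k + 1) ^ x_exp * dn 1 k * E (vtx (k + 1))"
        unfolding 3 by (simp only: mult.assoc)
      also have "\<dots> = (z * T s) * Y k * E (vtx (k + 1))"
        unfolding 2 by (simp only: Y_def mult.assoc)
      also have "z * T s = 0" using z s by (auto simp: killed_def)
      finally show ?thesis by simp
    qed
  qed
qed

text \<open>For \<open>r = 0\<close> the power \<open>sc a ^ r\<close> is the ambient unit, whereas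
  \<open>sc (a ^ r)\<close> is \<open>sc 1\<close>; the additional factor reconciles the
  two.\<close>

lemma sc_power: "sc a ^ r * sc 1 = sc (a ^ r)"
proof (induction r)
  case (Suc r)
  then show ?case by (simp add: mult.assoc sc_mult)
qed simp

lemma z_sc_power:
  assumes "k \<le> n" "z * E (vtx k) = z"
  shows "z * sc a * sc lam ^ r = z * sc (a * lam ^ r)"
proof -
  have 1: "sc lam ^ r * sc 1 = sc 1 * sc lam ^ r"
    by (rule power_commute) (rule sc_sc)
  have "z * sc a * sc lam ^ r = z * (sc 1 * sc a) * sc lam ^ r"
    using sc_1_right[OF vtx_perm assms(2)] assms(1) by (simp add: mult.assoc[symmetric])
  also have "\<dots> = z * sc a * (sc 1 * sc lam ^ r)"
    by (simp only: sc_sc[of 1 a] mult.assoc)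
  also have "\<dots> = z * (sc a * sc (lam ^ r))"
    unfolding 1[symmetric] sc_power by (simp only: mult.assoc)
  finally show ?thesis by (simp only: sc_mult)
qed

section \<open>Evaluating polynomials on killed elements\<close>

text \<open>The coefficient set for \<open>bipoly\<close>. It contains the scalars and the
  \<open>X\<close> of the strands \<open>j\<close>, hence the coefficients of \<open>P\<close>, and
  its elements can be carried past the dots and crossings in both blocks of
  \<open>i\<close>.\<close>

definition centr :: "nat \<Rightarrow> 'r set" where
  "centr k = {c. (\<forall>l. l \<in> {1..<k} \<or> l \<in> {k + m + 1..<n + m} \<longrightarrow> c * T l = T l * c)
    \<and> (\<forall>q\<in>{1..k} \<union> {k + m + 1..n + m}. c * X q = X q * c)}"

lemma centr_mult: "a \<in> centr k \<Longrightarrow> b \<in> centr k \<Longrightarrow> a * b \<in> centr k"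
proof -
  have "a * b * x = x * (a * b)" if "a * x = x * a" "b * x = x * b" for x
    using that by (metis mult.assoc)
  then show "a \<in> centr k \<Longrightarrow> b \<in> centr k \<Longrightarrow> a * b \<in> centr k"
    by (simp add: centr_def)
qed

lemma centr_1: "1 \<in> centr k"
  by (simp add: centr_def)

lemma centr_sc: "k \<le> n \<Longrightarrow> sc c \<in> centr k"
  by (auto simp: centr_def sc_T sc_X)

lemma centr_X: "k \<le> n \<Longrightarrow> p \<in> {k<..k + m} \<Longrightarrow> X p \<in> centr k"
  by (auto simp: centr_def intro!: X_X T_X_commute[symmetric])

text \<open>The choice of \<open>x_exp\<close> makes the degree bound equal to \<open>n - 1\<close>,
  with top coefficient the scalar \<open>sc lam ^ m\<close>. The case \<open>u = v\<close> is
  included because only one variable occurs at the two ends of the complex.\<close>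

lemma PP_bipoly:
  assumes k: "k \<le> n" and u: "u \<in> X ` ({1..k} \<union> {k + m + 1..n + m})"
    and v: "v \<in> X ` ({1..k} \<union> {k + m + 1..n + m})"
  shows "bipoly (centr k) u v (n - 1) (sc lam ^ m) (PP (Q i j) k m u * u ^ x_exp)
    (PP (Q i j) k m v * v ^ x_exp) (DD (Q i j) k m u v * v ^ x_exp + PP (Q i j) k m u * hs u v x_exp)"
proof -
  have comm: "c * u = u * c \<and> c * v = v * c" if "c \<in> centr k" for c
    using that u v by (auto simp: centr_def)
  have uv: "u * v = v * u"
    using u v k by (auto intro!: X_X)
  have 1: "bipoly (centr k) u v x_exp 1 (u ^ x_exp) (v ^ x_exp) (hs u v x_exp)"
    using bipoly.mono[OF centr_1, of x_exp x_exp k u v] by simp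
  have 2: "bipoly (centr k) u v (m * N) (sc lam ^ m) (PP (Q i j) k m u) (PP (Q i j) k m v) (DD (Q i j) k m u v)"
    using k by (intro PP_DD_bipoly Q_top Q_deg centr_mult centr_1 centr_sc centr_X comm uv) auto
  have "m * N + x_exp = n - 1" using n by (simp add: x_exp_def)
  then show ?thesis
    using bipoly_mult[OF centr_mult comm uv 2 1] by simp
qed

lemma commute_blocks:
  assumes "c \<in> centr k" "k \<le> n"
  shows "c * dn 1 (k - 1) = dn 1 (k - 1) * c" "c * up (k + m + 1) (n - k - 1) = up (k + m + 1) (n - k - 1) * c"
  using assms by (auto intro!: commute_dn commute_up simp: centr_def)

lemma z_right:
  assumes "killed k z" "1 \<le> k" "k \<le> n" "q \<le> k - 1"
  shows "z * X k ^ q * dn 1 (k - 1) = (if q = k - 1 then z else 0)"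
proof -
  have "z * X (0 + Suc (k - 1)) ^ q * dn (0 + 1) (k - 1) = (if q = k - 1 then z else 0)"
  proof (rule block_right[OF vtx_perm])
    show "cpt (vtx k) p = i" if "p \<in> {0<..0 + Suc (k - 1)}" for p
      using that assms by (auto simp: cpt_vtx)
  qed (use assms in \<open>auto simp: killed_def\<close>)
  then show ?thesis using assms(2) by simp
qed

lemma z_left:
  assumes "killed k z" "k < n" "q \<le> n - k - 1"
  shows "z * X (k + m + 1) ^ q * up (k + m + 1) (n - k - 1)
    = (if q = n - k - 1 then z * sc ((- 1) ^ (n - k - 1)) else 0)"
proof (rule block_left[OF vtx_perm])
  show "cpt (vtx k) p = i" if "p \<in> {k + m<..k + m + Suc (n - k - 1)}" for p
    using that assms by (auto simp: cpt_vtx)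
qed (use assms in \<open>auto simp: killed_def\<close>)

text \<open>A monomial \<open>v ^ p * u ^ (M - 1 - p)\<close> survives the right block only if the
  exponent of \<open>u\<close> is at least \<open>k - 1\<close>, and the left block only if
  \<open>p\<close> is at least \<open>n - k - 1\<close>. Their sum is \<open>M - 1\<close>, at most
  \<open>n - 2\<close>, so both must be equalities and \<open>M = n - 1\<close>.\<close>

lemma z_hs:
  assumes z: "killed k z" and k: "1 \<le> k" "k < n" and M: "M \<le> n - 1"
  shows "z * hs (X k) (X (k + m + 1)) M * dn 1 (k - 1) * up (k + m + 1) (n - k - 1)
    = (if M = n - 1 then z * sc ((- 1) ^ (n - k - 1)) else 0)"
proof -
  let ?u = "X k" and ?v = "X (k + m + 1)" and ?D = "dn 1 (k - 1)" and ?U = "up (k + m + 1) (n - k - 1)"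
  have uv: "?v ^ p * ?u ^ r = ?u ^ r * ?v ^ p" for p r
    using k by (intro power_power_commute X_X) auto
  have "?u * ?U = ?U * ?u" using X_up_commute(1)[of "k + m + 1" "n - k - 1" k] k by auto
  then have uU: "?u ^ r * ?U = ?U * ?u ^ r" for r by (rule power_commute)
  have "?v * ?D = ?D * ?v" using X_up_commute(2)[of 1 "k - 1" "k + m + 1"] k by auto
  then have vD: "?v ^ r * ?D = ?D * ?v ^ r" for r by (rule power_commute)
  have DU: "?D * ?U = ?U * ?D"
    using up_up_commute(2)[of 1 "k - 1" "k + m + 1" "n - k - 1"] k by auto
  have summand: "z * (?v ^ p * ?u ^ (M - 1 - p)) * ?D * ?U
      = (if p = n - k - 1 \<and> M = n - 1 then z * sc ((- 1) ^ (n - k - 1)) else 0)" if p: "p < M" for p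
  proof (cases "M - 1 - p \<le> k - 1")
    case True
    have "z * (?v ^ p * ?u ^ (M - 1 - p)) * ?D * ?U = z * ?u ^ (M - 1 - p) * (?v ^ p * ?D) * ?U"
      unfolding uv by (simp only: mult.assoc)
    also have "\<dots> = z * ?u ^ (M - 1 - p) * ?D * ?v ^ p * ?U"
      unfolding vD by (simp only: mult.assoc)
    also have "z * ?u ^ (M - 1 - p) * ?D = (if M - 1 - p = k - 1 then z else 0)"
      using k by (intro z_right[OF z _ _ True]) auto
    also have "(if M - 1 - p = k - 1 then z else 0) * ?v ^ p * ?U
        = (if p = n - k - 1 \<and> M = n - 1 then z * sc ((- 1) ^ (n - k - 1)) else 0)"
    proof (cases "M - 1 - p = k - 1")
      case eq: True
      then have "p \<le> n - k - 1" using M p k by auto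
      then have "z * ?v ^ p * ?U = (if p = n - k - 1 then z * sc ((- 1) ^ (n - k - 1)) else 0)"
        by (intro z_left[OF z k(2)])
      moreover have "M = n - 1" if "p = n - k - 1" using that eq p k M by auto
      ultimately show ?thesis using eq by auto
    next
      case False
      then have "\<not> (p = n - k - 1 \<and> M = n - 1)" using k by auto
      then show ?thesis unfolding if_not_P[OF False] by auto
    qed
    finally show ?thesis .
  next
    case False
    \<comment> \<open>The exponent of \<open>u\<close> is too large for \<open>z_right\<close>, but
      then that of \<open>v\<close> is so small that the left block already annihilates the
      monomial. For this the left word is moved in front of the right one.\<close>
    then have p: "p < n - k - 1" using M p k by auto
    have "z * (?v ^ p * ?u ^ (M - 1 - p)) * ?D * ?U = z * ?v ^ p * (?u ^ (M - 1 - p) * (?D * ?U))"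
      by (simp only: mult.assoc)
    also have "\<dots> = z * ?v ^ p * (?u ^ (M - 1 - p) * ?U) * ?D"
      unfolding DU by (simp only: mult.assoc)
    also have "\<dots> = z * ?v ^ p * ?U * (?u ^ (M - 1 - p) * ?D)"
      unfolding uU by (simp only: mult.assoc)
    also have "z * ?v ^ p * ?U = 0"
      using z_left[OF z k(2), of p] p by simp
    finally show ?thesis using p by simp
  qed
  have "z * hs ?u ?v M * ?D * ?U = (\<Sum>p<M. z * (?v ^ p * ?u ^ (M - 1 - p)) * ?D * ?U)"
    by (simp only: hs_def sum_distrib_left sum_distrib_right)
  also have "\<dots> = (\<Sum>p<M. if p = n - k - 1 \<and> M = n - 1 then z * sc ((- 1) ^ (n - k - 1)) else 0)"
    by (rule sum.cong[OF refl]) (use summand in auto)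
  also have "\<dots> = (if M = n - 1 then z * sc ((- 1) ^ (n - k - 1)) else 0)"
    using k by (cases "M = n - 1") auto
  finally show ?thesis .
qed

text \<open>By additivity a monomial is enough. Its coefficient lies in \<open>centr k\<close> and
  is carried to the far right, which leaves \<open>z_hs\<close>.\<close>

lemma z_bipoly_middle:
  assumes z: "killed k z" and k: "1 \<le> k" "k < n"
    and b: "bipoly (centr k) (X k) (X (k + m + 1)) (n - 1) a p p' r"
  shows "z * r * dn 1 (k - 1) * up (k + m + 1) (n - k - 1) = z * sc ((- 1) ^ (n - k - 1)) * a"
  using b
proof induction
  case (mono c M)
  let ?h = "hs (X k) (X (k + m + 1)) M" and ?D = "dn 1 (k - 1)" and ?U = "up (k + m + 1) (n - k - 1)"
  have "intertwines c (X k) (X k)" "intertwines c (X (k + m + 1)) (X (k + m + 1))"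
    using mono(1) k by (auto simp: intertwines_def centr_def)
  then have c: "c * ?h = ?h * c"
    using intertwines_hs[of c "X k" "X k" "X (k + m + 1)" "X (k + m + 1)" M] by (simp add: intertwines_def)
  have cD: "c * ?D = ?D * c" and cU: "c * ?U = ?U * c"
    using commute_blocks[OF mono(1)] k by auto
  have "z * (c * ?h) * ?D * ?U = z * ?h * (c * ?D) * ?U" unfolding c by (simp only: mult.assoc)
  also have "\<dots> = z * ?h * ?D * (c * ?U)" unfolding cD by (simp only: mult.assoc)
  also have "\<dots> = z * ?h * ?D * ?U * c" unfolding cU by (simp only: mult.assoc)
  also have "\<dots> = (if M = n - 1 then z * sc ((- 1) ^ (n - k - 1)) else 0) * c"
    using z_hs[OF z k mono(2)] by simp
  finally show ?case by simp
next
  case (add a p p' r b q q' s)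
  then show ?case by (simp add: distrib_left distrib_right)
qed simp

text \<open>At \<open>k = n\<close> there is no strand \<open>i\<close> to the left of the strands
  \<open>j\<close>, so the value \<open>f(u)\<close> itself is evaluated, against a word with all
  \<open>n - 1\<close> letters.\<close>

lemma z_bipoly_right:
  assumes z: "killed n z"
    and b: "bipoly (centr n) (X n) v (n - 1) a p p' r"
  shows "z * p * dn 1 (n - 1) = z * a"
  using b
proof induction
  case (mono c M)
  have "c * X n = X n * c" using mono(1) n by (auto simp: centr_def)
  then have c: "X n ^ M * c = c * X n ^ M" by (intro power_commute) simp
  have cD: "c * dn 1 (n - 1) = dn 1 (n - 1) * c"
    using commute_blocks[OF mono(1)] by auto
  have "z * (c * X n ^ M) * dn 1 (n - 1) = z * X n ^ M * (c * dn 1 (n - 1))"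
    unfolding c[symmetric] by (simp only: mult.assoc)
  also have "\<dots> = z * X n ^ M * dn 1 (n - 1) * c" unfolding cD by (simp only: mult.assoc)
  also have "\<dots> = (if M = n - 1 then z else 0) * c"
    using z_right[OF z, of M] mono(2) n by simp
  finally show ?case by simp
next
  case (add a p p' r b q q' s)
  then show ?case by (simp add: distrib_left distrib_right)
qed simp

lemma z_bipoly_left:
  assumes z: "killed 0 z"
    and b: "bipoly (centr 0) (X (m + 1)) v (n - 1) a p p' r"
  shows "z * p * up (m + 1) (n - 1) = z * sc ((- 1) ^ (n - 1)) * a"
  using b
proof induction
  case (mono c M)
  have "c * X (m + 1) = X (m + 1) * c" using mono(1) n by (auto simp: centr_def)
  then have c: "X (m + 1) ^ M * c = c * X (m + 1) ^ M" by (intro power_commute) simp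
  have cU: "c * up (m + 1) (n - 1) = up (m + 1) (n - 1) * c"
    using commute_blocks[OF mono(1)] by auto
  have "z * (c * X (m + 1) ^ M) * up (m + 1) (n - 1) = z * X (m + 1) ^ M * (c * up (m + 1) (n - 1))"
    unfolding c[symmetric] by (simp only: mult.assoc)
  also have "\<dots> = z * X (m + 1) ^ M * up (m + 1) (n - 1) * c" unfolding cU by (simp only: mult.assoc)
  also have "\<dots> = (if M = n - 1 then z * sc ((- 1) ^ (n - 1)) else 0) * c"
    using z_left[OF z, of M] mono(2) n by simp
  finally show ?case by simp
next
  case (add a p p' r b q q' s)
  then show ?case by (simp add: distrib_left distrib_right)
qed simp

section \<open>The homotopy identity at the two ends and in the middle\<close>

text \<open>In degree \<open>0\<close> no differential leaves, so a single product remains: one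
  strand \<open>i\<close> crosses the strands \<open>j\<close> and returns, which gives
  \<open>PP\<close> by \<open>dn_up_E\<close>, and the rest of \<open>\<delta> 1\<close> runs
  through the left block.\<close>

lemma homotopy_left:
  assumes z: "killed 0 z"
  shows "z * Y 0 * \<delta> 1 = z * sc ((- 1) ^ (n - 1) * lam ^ m)"
proof -
  have zE: "z * E (vtx 0) = z" using z by (simp add: killed_def)
  let ?v = "X (m + 1)"
  have \<delta>: "\<delta> 1 = up 1 m * up (m + 1) (n - 1)"
    using up_add[of 1 m "n - 1"] n by (simp add: \<delta>_def)
  have PP: "dn 1 m * up 1 m * E (vtx 0) = PP (Q i j) 0 m ?v * E (vtx 0)"
    using dn_up_E[OF vtx_perm ij, of 0 0 m] n by (auto simp: cpt_vtx)
  have dE: "dn 1 m * up 1 m * E (vtx 0) = E (vtx 0) * (dn 1 m * up 1 m)"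
    using dn_up_vtx[of 0] n by simp
  have PE: "PP (Q i j) 0 m ?v * E (vtx 0) = E (vtx 0) * PP (Q i j) 0 m ?v"
    using E_PP[OF vtx_perm, of 0 "m + 1" 0 m "Q i j"] n by (simp add: intertwines_def)
  have vE: "?v ^ x_exp * E (vtx 0) = E (vtx 0) * ?v ^ x_exp"
    using n by (intro power_commute X_vtx) auto
  have zvE: "z * ?v ^ x_exp = z * ?v ^ x_exp * E (vtx 0)"
    using zE vE by (metis mult.assoc)
  have vP: "?v ^ x_exp * PP (Q i j) 0 m ?v = PP (Q i j) 0 m ?v * ?v ^ x_exp"
  proof (rule power_commute)
    show "?v * PP (Q i j) 0 m ?v = PP (Q i j) 0 m ?v * ?v"
      using X_PP[of "m + 1" "m + 1" 0 m "Q i j"] n by (simp add: intertwines_def)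
  qed
  have "z * Y 0 * \<delta> 1 = z * dn (0 + 1) m * X (0 + 1) ^ x_exp * up 1 m * up (m + 1) (n - 1)"
    unfolding \<delta> by (simp add: Y_def mult.assoc)
  also have "\<dots> = z * ?v ^ x_exp * (E (vtx 0) * (dn 1 m * up 1 m)) * up (m + 1) (n - 1)"
    using z_dn_X[OF _ zE, of x_exp] n zvE by (simp add: mult.assoc[symmetric])
  also have "\<dots> = z * ?v ^ x_exp * (E (vtx 0) * PP (Q i j) 0 m ?v) * up (m + 1) (n - 1)"
    unfolding dE[symmetric] PP PE ..
  also have "\<dots> = z * (PP (Q i j) 0 m ?v * ?v ^ x_exp) * up (m + 1) (n - 1)"
    unfolding vP[symmetric] using zvE by (simp add: mult.assoc[symmetric])
  also have "\<dots> = z * sc ((- 1) ^ (n - 1)) * sc lam ^ m"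
    by (rule z_bipoly_left[OF z PP_bipoly[where v = "X (m + 1)"]]) (use n in auto)
  also have "\<dots> = z * sc ((- 1) ^ (n - 1) * lam ^ m)"
    by (rule z_sc_power[OF _ zE]) simp
  finally show ?thesis .
qed

lemma homotopy_right:
  assumes z: "killed n z"
  shows "z * \<delta> n * Y (n - 1) = z * sc (lam ^ m)"
proof -
  have zE: "z * E (vtx n) = z" using z by (simp add: killed_def)
  let ?u = "X n" and ?D = "dn 1 (n - 1)"
  have uE: "?u ^ x_exp * E (vtx n) = E (vtx n) * ?u ^ x_exp"
    using n by (intro power_commute X_vtx) auto
  have dE: "up n m * dn n m * E (vtx n) = E (vtx n) * (up n m * dn n m)"
    using up_dn_vtx[of "n - 1"] n by simp
  have PP: "up n m * dn n m * E (vtx n) = PP (Q i j) n m ?u * E (vtx n)"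
    using n by (intro up_dn_E vtx_perm ij) (auto simp: cpt_vtx)
  have PE: "PP (Q i j) n m ?u * E (vtx n) = E (vtx n) * PP (Q i j) n m ?u"
    using E_PP[OF vtx_perm, of n n n m "Q i j"] n by (simp add: intertwines_def)
  have "z * \<delta> n * Y (n - 1) = z * (E (vtx n) * (up n m * dn n m)) * ?u ^ x_exp * ?D"
    using n zE by (simp add: Y_def \<delta>_def mult.assoc[symmetric])
  also have "\<dots> = z * (PP (Q i j) n m ?u * ?u ^ x_exp) * ?D"
    unfolding dE[symmetric] PP PE using zE by (simp add: mult.assoc[symmetric])
  also have "\<dots> = z * sc lam ^ m"
    by (rule z_bipoly_right[OF z PP_bipoly[where v = "X n"]]) (use n in auto)
  also have "\<dots> = z * sc (lam ^ m)"
    using z_sc_power[OF _ zE, of 1 m] sc_1_right[OF vtx_perm zE] by simp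
  finally show ?thesis .
qed

text \<open>Both products end in the same words \<open>?D\<close> and \<open>?U\<close> inside the
  blocks. What precedes them is one side of \<open>dn_T_up_diff\<close> each, with the power of
  \<open>?v\<close> in front of \<open>b1\<close> and the power of \<open>?u\<close> behind
  \<open>b2\<close>. Pulling the latter to the front costs \<open>?P * ?h\<close>, and the
  difference becomes the divided difference of \<open>u ^ x_exp * P(u)\<close> in its Leibniz form
  \<open>?r\<close>.\<close>

lemma homotopy_middle:
  assumes z: "killed k z" and k: "1 \<le> k" "k < n"
  shows "z * Y k * \<delta> (k + 1) - z * \<delta> k * Y (k - 1) = z * sc ((- 1) ^ (n - k - 1) * lam ^ m)"
proof -
  have zE: "z * E (vtx k) = z" using z by (simp add: killed_def)
  let ?u = "X k" and ?v = "X (k + m + 1)" and ?D = "dn 1 (k - 1)" and ?U = "up (k + m + 1) (n - k - 1)"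
  let ?E = "E (vtx k)" and ?E' = "E (vtx (k - 1))"
  let ?P = "PP (Q i j) k m ?u" and ?R = "DD (Q i j) k m ?u ?v" and ?h = "hs ?u ?v x_exp"
  define b1 where "b1 = dn (k + 1) m * T k * up (k + 1) m"
  define b2 where "b2 = up k m * T (k + m) * dn k m"
  have \<delta>1: "\<delta> (k + 1) = up (k + 1) m * ?U"
    using up_add[of "k + 1" m "n - k - 1"] k by (simp add: \<delta>_def add_ac)
  have \<delta>0: "\<delta> k = up k m * T (k + m) * ?U"
  proof -
    have "m + n - k = m + Suc (n - k - 1)" using k by simp
    then show ?thesis using up_add[of k m "Suc (n - k - 1)"]
      by (simp add: \<delta>_def up_Suc' mult.assoc)
  qed
  \<comment> \<open>The letter split off here, like \<open>T (k + m)\<close> in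
    \<open>\<delta>0\<close>, is the crossing of the two strands \<open>i\<close> adjacent to the
    strands \<open>j\<close>; the remaining letters stay inside the blocks.\<close>
  have Dk: "dn 1 k = T k * ?D"
    using dn_Suc[of 1 "k - 1"] k by simp
  have c1: "?D * up (k + 1) m = up (k + 1) m * ?D"
    using up_up_commute(2)[of 1 "k - 1" "k + 1" m] k by auto
  have c2: "?U * dn k m = dn k m * ?U"
    using up_up_commute(2)[of k m "k + m + 1" "n - k - 1"] k by auto
  have "?u * ?U = ?U * ?u" using X_up_commute(1)[of "k + m + 1" "n - k - 1" k] k by auto
  then have c3: "?u ^ x_exp * ?U = ?U * ?u ^ x_exp" by (rule power_commute)
  have c4: "?D * ?U = ?U * ?D"
    using up_up_commute(2)[of 1 "k - 1" "k + m + 1" "n - k - 1"] k by auto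
  have A: "z * Y k * \<delta> (k + 1) = z * (?v ^ x_exp * b1) * ?D * ?U"
  proof -
    have "z * Y k * \<delta> (k + 1) = z * dn (k + 1) m * X (k + 1) ^ x_exp * T k * (?D * up (k + 1) m) * ?U"
      unfolding Y_def \<delta>1 Dk by (simp only: mult.assoc)
    then show ?thesis
      unfolding z_dn_X[OF k(2) zE] c1 b1_def by (simp only: mult.assoc)
  qed
  have B: "z * \<delta> k * Y (k - 1) = z * (b2 * ?u ^ x_exp) * ?D * ?U"
  proof -
    have "z * \<delta> k * Y (k - 1) = z * up k m * T (k + m) * (?U * dn k m) * ?u ^ x_exp * ?D"
      using k by (simp add: Y_def \<delta>0 mult.assoc)
    also have "\<dots> = z * b2 * (?U * ?u ^ x_exp) * ?D"
      unfolding c2 b2_def by (simp only: mult.assoc)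
    also have "\<dots> = z * b2 * ?u ^ x_exp * (?U * ?D)"
      unfolding c3[symmetric] by (simp only: mult.assoc)
    finally show ?thesis unfolding c4[symmetric] by (simp only: mult.assoc)
  qed
  have diff: "b1 * ?E - b2 * ?E = ?R * ?E"
    unfolding b1_def b2_def using k by (intro dn_T_up_diff vtx_perm ij) (auto simp: cpt_vtx)
  have vE: "?v ^ x_exp * ?E = ?E * ?v ^ x_exp" and uE: "?u ^ x_exp * ?E = ?E * ?u ^ x_exp"
    using k by (intro power_commute X_vtx; auto)+
  have dn_vtx': "dn k m * ?E = ?E' * dn k m" and up_vtx': "up k m * ?E' = ?E * up k m"
    using dn_vtx[of "k - 1"] up_vtx[of "k - 1"] k by auto
  have dn_vtx1: "dn (k + 1) m * E (vtx (k + 1)) = ?E * dn (k + 1) m"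
    and up_vtx1: "up (k + 1) m * ?E = E (vtx (k + 1)) * up (k + 1) m"
    using dn_vtx[of k] up_vtx[of k] k by auto
  have T1: "T k * E (vtx (k + 1)) = E (vtx (k + 1)) * T k" and T0: "T (k + m) * ?E' = ?E' * T (k + m)"
    using T_vtx[of "k + 1" k] T_vtx[of "k - 1" "k + m"] k by auto
  have b1E: "b1 * ?E = ?E * b1"
  proof -
    have "b1 * ?E = dn (k + 1) m * (T k * E (vtx (k + 1))) * up (k + 1) m"
      unfolding b1_def by (simp only: mult.assoc up_vtx1)
    also have "\<dots> = (dn (k + 1) m * E (vtx (k + 1))) * T k * up (k + 1) m"
      unfolding T1 by (simp only: mult.assoc)
    finally show ?thesis unfolding dn_vtx1 b1_def by (simp only: mult.assoc)
  qed
  have b2E: "b2 * ?E = ?E * b2"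
  proof -
    have "b2 * ?E = up k m * (T (k + m) * ?E') * dn k m"
      unfolding b2_def by (simp only: mult.assoc dn_vtx')
    also have "\<dots> = (up k m * ?E') * T (k + m) * dn k m"
      unfolding T0 by (simp only: mult.assoc)
    finally show ?thesis unfolding up_vtx' b2_def by (simp only: mult.assoc)
  qed
  \<comment> \<open>The power of \<open>?u\<close> rides along \<open>dn k m\<close> to place
    \<open>k + m\<close>, crosses the other strand \<open>i\<close> with a divided difference as
    correction, and then commutes with \<open>up k m\<close> as a power of \<open>?v\<close>. In the
    correction, \<open>up k m\<close> and \<open>dn k m\<close> combine to
    \<open>?P\<close>.\<close>
  have b2u: "b2 * ?u ^ x_exp * ?E = ?v ^ x_exp * (b2 * ?E) - ?P * ?h * ?E"
  proof -
    let ?w = "dn k m * ?E"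
    have iu: "intertwines ?w (X (k + m)) ?u"
      using k ij by (intro X_dn_E vtx_perm) (auto simp: cpt_vtx)
    have iv: "intertwines ?w ?v ?v"
      using k by (intro dn_X_commute_E vtx_perm) auto
    have w: "?E' * ?w = ?w"
      unfolding dn_vtx' using E_E[OF vtx_perm vtx_perm, of "k - 1" "k - 1"] k
      by (simp add: mult.assoc[symmetric])
    have vup: "?v ^ x_exp * up k m = up k m * ?v ^ x_exp"
      using X_up_commute(1)[of k m "k + m + 1"] k by (intro power_commute) auto
    have "b2 * ?u ^ x_exp * ?E = up k m * (T (k + m) * (?w * ?u ^ x_exp))"
      unfolding b2_def by (simp only: mult.assoc uE)
    also have "?w * ?u ^ x_exp = X (k + m) ^ x_exp * (?E' * ?w)"
      unfolding w using intertwines_power[OF iu] by (simp add: intertwines_def)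
    also have "T (k + m) * (X (k + m) ^ x_exp * (?E' * ?w)) = T (k + m) * X (k + m) ^ x_exp * ?E' * ?w"
      by (simp only: mult.assoc)
    also have "T (k + m) * X (k + m) ^ x_exp * ?E'
        = ?v ^ x_exp * T (k + m) * ?E' - hs (X (k + m)) ?v x_exp * ?E'"
    proof -
      have "cpt (vtx (k - 1)) (k + m) = cpt (vtx (k - 1)) (k + m + 1)" using k by (auto simp: cpt_vtx)
      then show ?thesis
        using X_power_T_E(1)[OF vtx_perm, of "k - 1" "k + m" x_exp] k by simp
    qed
    also have "up k m * ((?v ^ x_exp * T (k + m) * ?E' - hs (X (k + m)) ?v x_exp * ?E') * ?w)
        = (up k m * ?v ^ x_exp) * T (k + m) * (?E' * ?w) - up k m * (hs (X (k + m)) ?v x_exp * (?E' * ?w))"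
      by (simp only: left_diff_distrib right_diff_distrib mult.assoc)
    also have "(up k m * ?v ^ x_exp) * T (k + m) * (?E' * ?w) = ?v ^ x_exp * (b2 * ?E)"
      unfolding w vup[symmetric] b2_def by (simp only: mult.assoc)
    also have "hs (X (k + m)) ?v x_exp * (?E' * ?w) = ?w * ?h"
      unfolding w using intertwines_hs[OF iu iv] by (simp add: intertwines_def)
    also have "up k m * (?w * ?h) = up k m * dn k m * ?E * ?h"
      by (simp only: mult.assoc)
    also have "up k m * dn k m * ?E = ?P * ?E"
      using k by (intro up_dn_E vtx_perm ij) (auto simp: cpt_vtx)
    also have "?P * ?E * ?h = ?P * ?h * ?E"
    proof -
      have "intertwines ?E ?h ?h"
        using k by (intro intertwines_hs X_E_intertwines vtx_perm) auto
      then show ?thesis by (simp add: intertwines_def mult.assoc)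
    qed
    finally show ?thesis .
  qed
  have vR: "?v ^ x_exp * ?R = ?R * ?v ^ x_exp"
  proof (rule power_commute)
    have "intertwines ?v ?R ?R"
      using k by (intro intertwines_DD X_X_intertwines sc_intertwines) auto
    then show "?v * ?R = ?R * ?v" by (simp add: intertwines_def)
  qed
  let ?r = "?R * ?v ^ x_exp + ?P * ?h"
  have rE: "?r * ?E = ?E * ?r"
  proof -
    have "intertwines ?E ?r ?r"
      using k by (intro intertwines_add intertwines_mult intertwines_power intertwines_hs intertwines_DD
          intertwines_PP X_E_intertwines sc_intertwines vtx_perm) auto
    then show ?thesis by (simp add: intertwines_def)
  qed
  have "(?v ^ x_exp * b1 - b2 * ?u ^ x_exp) * ?E = ?v ^ x_exp * (b1 * ?E - b2 * ?E) + ?P * ?h * ?E"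
    unfolding left_diff_distrib b2u by (simp add: right_diff_distrib mult.assoc)
  also have "\<dots> = ?r * ?E"
    unfolding diff distrib_right vR[symmetric] by (simp only: mult.assoc)
  finally have r: "(?v ^ x_exp * b1 - b2 * ?u ^ x_exp) * ?E = ?r * ?E" .
  have "intertwines ?E (?v ^ x_exp * b1) (?v ^ x_exp * b1)"
    by (rule intertwines_mult) (simp_all only: intertwines_def vE b1E)
  moreover have "intertwines ?E (b2 * ?u ^ x_exp) (b2 * ?u ^ x_exp)"
    by (rule intertwines_mult) (simp_all only: intertwines_def uE b2E)
  ultimately have "(?v ^ x_exp * b1 - b2 * ?u ^ x_exp) * ?E = ?E * (?v ^ x_exp * b1 - b2 * ?u ^ x_exp)"
    unfolding intertwines_def left_diff_distrib right_diff_distrib by simp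
  then have "?E * (?v ^ x_exp * b1 - b2 * ?u ^ x_exp) = ?E * ?r"
    unfolding r rE by simp
  then have "z * ?E * (?v ^ x_exp * b1 - b2 * ?u ^ x_exp) = z * ?E * ?r"
    by (simp only: mult.assoc)
  then have "z * (?v ^ x_exp * b1 - b2 * ?u ^ x_exp) = z * ?r"
    unfolding zE .
  then have "z * Y k * \<delta> (k + 1) - z * \<delta> k * Y (k - 1) = z * ?r * ?D * ?U"
    unfolding A B left_diff_distrib[symmetric] right_diff_distrib[symmetric] by simp
  also have "\<dots> = z * sc ((- 1) ^ (n - k - 1)) * sc lam ^ m"
    by (rule z_bipoly_middle[OF z _ _ PP_bipoly]) (use k in auto)
  also have "\<dots> = z * sc ((- 1) ^ (n - k - 1) * lam ^ m)"
    by (rule z_sc_power[OF _ zE]) (use k in simp)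
  finally show ?thesis .
qed

section \<open>The idempotents cutting out the divided powers\<close>

lemma commute_blk:
  assumes "\<And>q. q \<in> {off<..off + L} \<Longrightarrow> w * X q = X q * w"
    and "\<And>l. l \<in> {off<..<off + L} \<Longrightarrow> w * T l = T l * w"
  shows "w * blk off L = blk off L * w"
proof -
  let ?A = "prod_list (map (\<lambda>q. X (off + q) ^ (q - 1)) [2..<Suc L])"
    and ?W = "prod_list (map (\<lambda>l. T (off + l)) (longest_word L))"
  have "w * ?A = ?A * w"
    by (rule commute_prod_list) (auto intro!: power_commute[symmetric] assms(1)[symmetric])
  then have "w * (?A * ?W) = ?A * (w * ?W)" by (simp only: mult.assoc[symmetric])
  also have "w * ?W = ?W * w"
    by (rule commute_prod_list) (use assms(2) in \<open>auto dest!: set_longest_word\<close>)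
  finally show ?thesis unfolding blk_def by (simp only: mult.assoc)
qed

definition eps :: "nat \<Rightarrow> 'r" where
  "eps k = blk (k + m) (n - k) * blk 0 k * E (vtx k)"

lemma blk_vtx:
  assumes "k \<le> n"
  shows "E (vtx k) * blk (k + m) (n - k) = blk (k + m) (n - k) * E (vtx k)"
    "E (vtx k) * blk 0 k = blk 0 k * E (vtx k)"
  by (rule commute_blk, use assms in \<open>auto intro!: X_vtx[symmetric] T_vtx[symmetric]\<close>)+

lemma vtx_idem: "k \<le> n \<Longrightarrow> E (vtx k) * E (vtx k) = E (vtx k)"
  using E_E[OF vtx_perm vtx_perm] by simp

lemma eps_vtx:
  assumes "k \<le> n"
  shows "eps k * E (vtx k) = eps k" "E (vtx k) * eps k = eps k"
proof -
  show "eps k * E (vtx k) = eps k"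
    using vtx_idem[OF assms] by (simp add: eps_def mult.assoc)
  have "E (vtx k) * eps k = E (vtx k) * blk (k + m) (n - k) * blk 0 k * E (vtx k)"
    by (simp only: eps_def mult.assoc)
  also have "\<dots> = blk (k + m) (n - k) * (E (vtx k) * blk 0 k) * E (vtx k)"
    unfolding blk_vtx(1)[OF assms] by (simp only: mult.assoc)
  also have "\<dots> = eps k * E (vtx k)"
    unfolding blk_vtx(2)[OF assms] eps_def by (simp only: mult.assoc)
  also have "\<dots> = eps k" by fact
  finally show "E (vtx k) * eps k = eps k" .
qed

text \<open>Reduces to \<open>word_T_E\<close> in the block containing \<open>l\<close>. Together
  with \<open>absorb_eps\<close> it shows that the killed elements are exactly the left multiples of
  \<open>eps k\<close>, so membership in the image of the idempotent can be tested by
  annihilation.\<close>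

lemma killed_eps:
  assumes k: "k \<le> n"
  shows "killed k (h * eps k)"
  unfolding killed_def
proof (intro conjI allI impI)
  show "h * eps k * E (vtx k) = h * eps k"
    using eps_vtx[OF k] by (simp add: mult.assoc)
  fix l assume l: "l \<in> {1..<k} \<or> l \<in> {k + m + 1..<n + m}"
  have TE: "T l * E (vtx k) = E (vtx k) * T l" using k l by (rule T_vtx)
  let ?L = "blk (k + m) (n - k)" and ?R = "blk 0 k"
  have "?L * ?R * (T l * E (vtx k)) = 0"
  proof (cases "l \<in> {1..<k}")
    case True
    have "prod_list (map (\<lambda>l. T (0 + l)) (longest_word k)) * T l * E (vtx k) = 0"
      by (rule word_T_E[OF vtx_perm, where i = i]) (use True k in \<open>auto simp: cpt_vtx\<close>)
    then show ?thesis by (simp add: blk_def mult.assoc)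
  next
    case False
    then have l: "l \<in> {k + m + 1..<n + m}" using l by auto
    have "T l * ?R = ?R * T l"
      by (rule commute_blk) (use l in \<open>auto intro!: T_X_commute T_T\<close>)
    then have "?L * ?R * (T l * E (vtx k)) = ?L * T l * (?R * E (vtx k))"
      by (metis mult.assoc)
    also have "\<dots> = ?L * T l * E (vtx k) * ?R"
      unfolding blk_vtx(2)[OF k, symmetric] by (simp only: mult.assoc)
    also have "?L * T l * E (vtx k) = 0"
    proof -
      have "prod_list (map (\<lambda>l. T (k + m + l)) (longest_word (n - k))) * T l * E (vtx k) = 0"
        by (rule word_T_E[OF vtx_perm, where i = i]) (use l k in \<open>auto simp: cpt_vtx\<close>)
      then show ?thesis by (simp add: blk_def mult.assoc)
    qed
    finally show ?thesis by simp
  qed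
  then show "h * eps k * T l = 0"
    by (simp add: eps_def mult.assoc TE)
qed

lemma absorb_eps:
  assumes k: "k \<le> n" and z: "killed k z"
  shows "z * eps k = z"
proof -
  have zE: "z * E (vtx k) = z" using z by (simp add: killed_def)
  have "z * blk (k + m) (n - k) = z"
    by (rule absorb_blk[OF vtx_perm zE, where i = i]) (use z k in \<open>auto simp: killed_def cpt_vtx\<close>)
  moreover have "z * blk 0 k = z"
    by (rule absorb_blk[OF vtx_perm zE, where i = i]) (use z k in \<open>auto simp: killed_def cpt_vtx\<close>)
  ultimately show ?thesis
    unfolding eps_def by (simp add: mult.assoc[symmetric] zE)
qed

section \<open>Compatibility of the homotopy and the differential with the strands
  \<open>j\<close>\<close>

lemma Y_vtx:
  assumes "k < n"
  shows "Y k * E (vtx (k + 1)) = (dn (k + 1) m * E (vtx (k + 1))) * (X (k + 1) ^ x_exp * dn 1 k)"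
    "Y k * E (vtx (k + 1)) = E (vtx k) * Y k"
proof -
  have dnE: "dn 1 k * E (vtx (k + 1)) = E (vtx (k + 1)) * dn 1 k"
    by (rule commute_dn[symmetric]) (use assms in \<open>auto intro!: T_vtx[symmetric]\<close>)
  have XE: "X (k + 1) ^ x_exp * E (vtx (k + 1)) = E (vtx (k + 1)) * X (k + 1) ^ x_exp"
    using assms by (intro power_commute X_vtx) auto
  have "Y k * E (vtx (k + 1)) = dn (k + 1) m * X (k + 1) ^ x_exp * (dn 1 k * E (vtx (k + 1)))"
    by (simp only: Y_def mult.assoc)
  also have "\<dots> = dn (k + 1) m * (X (k + 1) ^ x_exp * E (vtx (k + 1))) * dn 1 k"
    unfolding dnE by (simp only: mult.assoc)
  finally show 1: "Y k * E (vtx (k + 1)) = (dn (k + 1) m * E (vtx (k + 1))) * (X (k + 1) ^ x_exp * dn 1 k)"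
    unfolding XE by (simp only: mult.assoc)
  show "Y k * E (vtx (k + 1)) = E (vtx k) * Y k"
    unfolding 1 dn_vtx[OF assms] by (simp only: Y_def mult.assoc)
qed

lemma \<delta>_vtx:
  assumes "1 \<le> k" "k \<le> n"
  shows "\<delta> k * E (vtx (k - 1)) = (up k m * E (vtx (k - 1))) * up (k + m) (n - k)"
    "\<delta> k * E (vtx (k - 1)) = E (vtx k) * \<delta> k"
proof -
  have \<delta>: "\<delta> k = up k m * up (k + m) (n - k)"
    using up_add[of k m "n - k"] assms by (simp add: \<delta>_def)
  have "up (k + m) (n - k) * E (vtx (k - 1)) = E (vtx (k - 1)) * up (k + m) (n - k)"
    by (rule commute_up[symmetric]) (use assms in \<open>auto intro!: T_vtx[symmetric]\<close>)
  then show 1: "\<delta> k * E (vtx (k - 1)) = (up k m * E (vtx (k - 1))) * up (k + m) (n - k)"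
    unfolding \<delta> by (simp only: mult.assoc)
  have "up k m * E (vtx (k - 1)) = E (vtx k) * up k m"
    using up_vtx[of "k - 1"] assms by simp
  then show "\<delta> k * E (vtx (k - 1)) = E (vtx k) * \<delta> k"
    unfolding 1 by (simp only: \<delta> mult.assoc)
qed

lemma Y_slide_X:
  assumes "k < n" "q \<in> {1..m}"
  shows "intertwines (Y k * E (vtx (k + 1))) (X (k + q)) (X (k + 1 + q))"
  unfolding Y_vtx(1)[OF assms(1)]
proof (rule intertwines_comp[where b = "X (k + 1 + q)"])
  have "intertwines (dn (k + 1) m * E (vtx (k + 1))) (X (k + q)) (X (k + q + 1))"
    using assms ij by (intro X_dn_E_passed vtx_perm) (auto simp: cpt_vtx)
  then show "intertwines (dn (k + 1) m * E (vtx (k + 1))) (X (k + q)) (X (k + 1 + q))"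
    by (simp add: add_ac)
  show "intertwines (X (k + 1) ^ x_exp * dn 1 k) (X (k + 1 + q)) (X (k + 1 + q))"
  proof (rule intertwines_comp)
    show "intertwines (X (k + 1) ^ x_exp) (X (k + 1 + q)) (X (k + 1 + q))"
      unfolding intertwines_def by (rule power_commute[symmetric]) (use assms in \<open>auto intro!: X_X\<close>)
    show "intertwines (dn 1 k) (X (k + 1 + q)) (X (k + 1 + q))"
      using X_up_commute(2)[of 1 k "k + 1 + q"] assms by (auto simp: intertwines_def)
  qed
qed

text \<open>A crossing of two strands \<open>j\<close> slides past the travelling strand by
  \<open>dn_T_slide\<close>, without correction because \<open>i\<close> and \<open>j\<close>
  differ; the other factors of \<open>Y k\<close> only involve strands \<open>i\<close> to the right
  of it.\<close>

lemma Y_slide_T: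
  assumes "k < n" "q \<in> {1..<m}"
  shows "intertwines (Y k * E (vtx (k + 1))) (T (k + q)) (T (k + 1 + q))"
  unfolding Y_vtx(1)[OF assms(1)]
proof (rule intertwines_comp[where b = "T (k + 1 + q)"])
  have "dn (k + 1) m * T (k + q + 1) * E (vtx (k + 1)) = T (k + q) * dn (k + 1) m * E (vtx (k + 1))"
    using assms ij by (intro dn_T_slide vtx_perm) (auto simp: cpt_vtx)
  moreover have "T (k + 1 + q) * E (vtx (k + 1)) = E (vtx (k + 1)) * T (k + 1 + q)"
    using assms by (intro E_T_same vtx_perm) (auto simp: cpt_vtx)
  ultimately show "intertwines (dn (k + 1) m * E (vtx (k + 1))) (T (k + q)) (T (k + 1 + q))"
    by (simp add: intertwines_def mult.assoc add_ac)
  show "intertwines (X (k + 1) ^ x_exp * dn 1 k) (T (k + 1 + q)) (T (k + 1 + q))"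
  proof (rule intertwines_comp)
    show "intertwines (X (k + 1) ^ x_exp) (T (k + 1 + q)) (T (k + 1 + q))"
      unfolding intertwines_def
      by (rule power_commute[symmetric]) (use assms in \<open>auto intro!: T_X_commute[symmetric]\<close>)
    show "intertwines (dn 1 k) (T (k + 1 + q)) (T (k + 1 + q))"
      using T_up_commute(2)[of 1 k "k + 1 + q"] assms by (auto simp: intertwines_def)
  qed
qed

lemma \<delta>_slide_X:
  assumes "1 \<le> k" "k \<le> n" "q \<in> {1..m}"
  shows "intertwines (\<delta> k * E (vtx (k - 1))) (X (k + q)) (X (k - 1 + q))"
  unfolding \<delta>_vtx(1)[OF assms(1,2)]
proof (rule intertwines_comp[where b = "X (k - 1 + q)"])
  have "intertwines (up k m * E (vtx (k - 1))) (X (k - 1 + q + 1)) (X (k - 1 + q))"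
    using assms ij by (intro X_up_E vtx_perm) (auto simp: cpt_vtx)
  then show "intertwines (up k m * E (vtx (k - 1))) (X (k + q)) (X (k - 1 + q))"
    using assms(1) by simp
  show "intertwines (up (k + m) (n - k)) (X (k - 1 + q)) (X (k - 1 + q))"
    using X_up_commute(1)[of "k + m" "n - k" "k - 1 + q"] assms by (auto simp: intertwines_def)
qed

lemma \<delta>_slide_T:
  assumes "1 \<le> k" "k \<le> n" "q \<in> {1..<m}"
  shows "intertwines (\<delta> k * E (vtx (k - 1))) (T (k + q)) (T (k - 1 + q))"
  unfolding \<delta>_vtx(1)[OF assms(1,2)]
proof (rule intertwines_comp[where b = "T (k - 1 + q)"])
  have "up k m * T (k - 1 + q) * E (vtx (k - 1)) = T (k - 1 + q + 1) * up k m * E (vtx (k - 1))"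
    using assms ij by (intro up_T_slide vtx_perm) (auto simp: cpt_vtx split: if_splits)
  moreover have "T (k - 1 + q) * E (vtx (k - 1)) = E (vtx (k - 1)) * T (k - 1 + q)"
    using assms by (intro E_T_same vtx_perm) (auto simp: cpt_vtx)
  ultimately show "intertwines (up k m * E (vtx (k - 1))) (T (k + q)) (T (k - 1 + q))"
    using assms(1) by (simp add: intertwines_def mult.assoc)
  have "k - 1 + q \<in> {1..<m + n}" using assms by auto
  then show "intertwines (up (k + m) (n - k)) (T (k - 1 + q)) (T (k - 1 + q))"
    using T_up_commute(1)[of "k + m" "n - k" "k - 1 + q"] assms by (auto simp: intertwines_def)
qed

end

section \<open>Embedding rings with carriers into a type class ring\<close>

text \<open>The product of all rings with elements of type \<^typ>\<open>'a\<close>. Every \<^term>\<open>R :: 'a ring\<close> embeds into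
  this single type of class \<^class>\<open>ring\<close> as one of its factors, which makes type class arithmetic
  available for computations in \<open>R\<close>.\<close>

typedef 'a ring_product = "{F :: 'a ring \<Rightarrow> 'a. \<forall>R. if ring R then F R \<in> carrier R else F R = undefined}"
  by (rule exI[of _ "\<lambda>R. if ring R then \<zero>\<^bsub>R\<^esub> else undefined"]) (auto simp: ring.ring_simprules)

setup_lifting type_definition_ring_product

lemma Rep_ring_product_closed: "ring R \<Longrightarrow> Rep_ring_product F R \<in> carrier R"
  using Rep_ring_product[of F] by (auto dest: spec[of _ R])

text \<open>At records that are not rings every element has the value \<open>undefined\<close>, so
  only the genuine factors have to be compared.\<close>

lemma ring_product_eqI:
  assumes "\<And>R. ring R \<Longrightarrow> Rep_ring_product F R = Rep_ring_product G R"
  shows "F = G"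
proof -
  have "Rep_ring_product F R = Rep_ring_product G R" for R
    using assms[of R] Rep_ring_product[of F] Rep_ring_product[of G]
    by (cases "ring R") (auto dest!: spec[of _ R])
  then show ?thesis by (simp add: Rep_ring_product_inject[symmetric] fun_eq_iff)
qed

instantiation ring_product :: (type) "{ring, monoid_mult}"
begin

lift_definition zero_ring_product :: "'a ring_product"
  is "\<lambda>R. if ring R then \<zero>\<^bsub>R\<^esub> else undefined" by (auto simp: ring.ring_simprules)

lift_definition one_ring_product :: "'a ring_product"
  is "\<lambda>R. if ring R then \<one>\<^bsub>R\<^esub> else undefined" by (auto simp: ring.ring_simprules)

lift_definition plus_ring_product :: "'a ring_product \<Rightarrow> 'a ring_product \<Rightarrow> 'a ring_product"
  is "\<lambda>F G R. if ring R then F R \<oplus>\<^bsub>R\<^esub> G R else undefined"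
  by (auto intro!: ring.ring_simprules split: if_splits)

lift_definition times_ring_product :: "'a ring_product \<Rightarrow> 'a ring_product \<Rightarrow> 'a ring_product"
  is "\<lambda>F G R. if ring R then F R \<otimes>\<^bsub>R\<^esub> G R else undefined"
  by (auto intro!: ring.ring_simprules split: if_splits)

lift_definition uminus_ring_product :: "'a ring_product \<Rightarrow> 'a ring_product"
  is "\<lambda>F R. if ring R then \<ominus>\<^bsub>R\<^esub> F R else undefined"
  by (auto intro!: ring.ring_simprules split: if_splits)

definition minus_ring_product :: "'a ring_product \<Rightarrow> 'a ring_product \<Rightarrow> 'a ring_product" where
  "minus_ring_product F G = F + - G"

instance
proof
  fix a b c :: "'a ring_product"
  note [simp] = Rep_ring_product_closed ring.ring_simprules zero_ring_product.rep_eq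
    one_ring_product.rep_eq plus_ring_product.rep_eq times_ring_product.rep_eq
    uminus_ring_product.rep_eq
  show "a + b + c = a + (b + c)" by (rule ring_product_eqI) simp
  show "a + b = b + a" by (rule ring_product_eqI) (simp add: ring.ring_simprules(10))
  show "0 + a = a" by (rule ring_product_eqI) simp
  show "- a + a = 0" by (rule ring_product_eqI) simp
  show "a - b = a + - b" by (simp add: minus_ring_product_def)
  show "a * b * c = a * (b * c)" by (rule ring_product_eqI) simp
  show "(a + b) * c = a * c + b * c" by (rule ring_product_eqI) simp
  show "a * (b + c) = a * b + a * c" by (rule ring_product_eqI) simp
  show "1 * a = a" by (rule ring_product_eqI) simp
  show "a * 1 = a" by (rule ring_product_eqI) (simp add: monoid.r_one ring.is_monoid)
qed

end

text \<open>Extension by zero to all other factors: additive and multiplicative, but not unital.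
  Arguments outside the carrier are sent to zero.\<close>

lift_definition ring_emb :: "'a ring \<Rightarrow> 'a \<Rightarrow> 'a ring_product"
  is "\<lambda>R a R'. if ring R' then if R' = R \<and> a \<in> carrier R then a else \<zero>\<^bsub>R'\<^esub> else undefined"
  by (auto simp: ring.ring_simprules)

lemma ring_emb_eq_iff:
  assumes "ring R" "a \<in> carrier R" "b \<in> carrier R"
  shows "ring_emb R a = ring_emb R b \<longleftrightarrow> a = b"
proof
  assume "ring_emb R a = ring_emb R b"
  then have "Rep_ring_product (ring_emb R a) R = Rep_ring_product (ring_emb R b) R" by simp
  then show "a = b" using assms by (simp add: ring_emb.rep_eq)
qed simp

lemma ring_emb_hom:
  assumes "ring R" "a \<in> carrier R" "b \<in> carrier R"
  shows "ring_emb R (a \<oplus>\<^bsub>R\<^esub> b) = ring_emb R a + ring_emb R b"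
    "ring_emb R (a \<otimes>\<^bsub>R\<^esub> b) = ring_emb R a * ring_emb R b"
    "ring_emb R \<zero>\<^bsub>R\<^esub> = 0"
  using assms
  by (auto intro!: ring_product_eqI simp: ring_emb.rep_eq plus_ring_product.rep_eq
      times_ring_product.rep_eq zero_ring_product.rep_eq ring.ring_simprules)

section \<open>The KLR algebra and the morphism \<open>\<diamondop>\<close>\<close>

lemma klr_class_closed:
  "f \<in> carrier (klr_free \<beta>) \<Longrightarrow> klr_class Q \<beta> f \<in> carrier (klr Q \<beta>)"
  unfolding klr_class_def klr_def FactRing_def A_RCOSETS_def' by auto

lemma klr_carrierE:
  assumes "y \<in> carrier (klr Q \<beta>)"
  obtains f where "f \<in> carrier (klr_free \<beta>)" "y = klr_class Q \<beta> f"
  using assms unfolding klr_class_def klr_def FactRing_def A_RCOSETS_def' by auto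

lemma klr_class_add:
  assumes "f \<in> carrier (klr_free \<beta>)" "g \<in> carrier (klr_free \<beta>)"
  shows "klr_class Q \<beta> (f + g) = klr_class Q \<beta> f \<oplus>\<^bsub>klr Q \<beta>\<^esub> klr_class Q \<beta> g"
proof -
  interpret I: ideal "klr_ideal Q \<beta>" "klr_free \<beta>" by (rule ideal_klr_ideal)
  show ?thesis
    using I.a_rcos_sum[OF assms] unfolding klr_class_def klr_def FactRing_def by simp
qed

lemma klr_class_mult:
  assumes "f \<in> carrier (klr_free \<beta>)" "g \<in> carrier (klr_free \<beta>)"
  shows "klr_class Q \<beta> (f * g) = klr_class Q \<beta> f \<otimes>\<^bsub>klr Q \<beta>\<^esub> klr_class Q \<beta> g"
proof -
  interpret I: ideal "klr_ideal Q \<beta>" "klr_free \<beta>" by (rule ideal_klr_ideal)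
  show ?thesis
    using I.rcoset_mult_add[OF assms] unfolding klr_class_def klr_def FactRing_def by simp
qed

lemma klr_class_0: "klr_class Q \<beta> 0 = \<zero>\<^bsub>klr Q \<beta>\<^esub>"
proof -
  interpret I: ideal "klr_ideal Q \<beta>" "klr_free \<beta>" by (rule ideal_klr_ideal)
  show ?thesis
    using I.a_coset_add_zero[OF I.a_subset] unfolding klr_class_def klr_def FactRing_def by simp
qed

lemma klr_class_1: "klr_class Q \<beta> 1 = \<one>\<^bsub>klr Q \<beta>\<^esub>"
  unfolding klr_class_def klr_def FactRing_def by simp

lemma a_minus_klr_free:
  assumes "f \<in> carrier (klr_free \<beta>)" "g \<in> carrier (klr_free \<beta>)"
  shows "f \<ominus>\<^bsub>klr_free \<beta>\<^esub> g = f - g"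
proof -
  interpret ring "klr_free \<beta>" by (rule ring_klr_free)
  have "(\<ominus>\<^bsub>klr_free \<beta>\<^esub> g) + g = 0" using l_neg[OF assms(2)] by simp
  then have "\<ominus>\<^bsub>klr_free \<beta>\<^esub> g = - g" by (simp add: eq_neg_iff_add_eq_0)
  then show ?thesis by (simp add: a_minus_def)
qed

lemma klr_class_eq_iff:
  assumes "f \<in> carrier (klr_free \<beta>)" "g \<in> carrier (klr_free \<beta>)"
  shows "klr_class Q \<beta> f = klr_class Q \<beta> g \<longleftrightarrow> f - g \<in> klr_ideal Q \<beta>"
proof -
  interpret ring "klr_free \<beta>" by (rule ring_klr_free)
  show ?thesis
    using quotient_eq_iff_same_a_r_cos[OF ideal_klr_ideal assms, of Q]
    unfolding a_minus_klr_free[OF assms] klr_class_def by simp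
qed

lemma klr_rel_class:
  assumes "klr_rel Q \<beta> a b"
  shows "klr_class Q \<beta> a = klr_class Q \<beta> b"
proof -
  interpret ring "klr_free \<beta>" by (rule ring_klr_free)
  have "a - b \<in> {a - b |a b. klr_rel Q \<beta> a b}" using assms by blast
  then have "a - b \<in> klr_ideal Q \<beta>"
    unfolding klr_ideal_def
    using genideal_self[of "{a - b |a b. klr_rel Q \<beta> a b}"] by (auto dest: klr_rel_closed)
  then show ?thesis using klr_class_eq_iff klr_rel_closed[OF assms] by blast
qed

text \<open>The class of \<open>f\<close>, placed in a ring of type class. On carrier elements,
  equations between such values are equations in the KLR algebra, by
  \<open>cl_eq_iff\<close>.\<close>

definition cl :: "('i \<Rightarrow> 'i \<Rightarrow> 'k::comm_ring_1 poly poly) \<Rightarrow> 'i multiset \<Rightarrow> ('i, 'k) free_alg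
    \<Rightarrow> ('i, 'k) klr_elt ring_product" where
  "cl Q \<beta> f = ring_emb (klr Q \<beta>) (klr_class Q \<beta> f)"

lemma cl_eq_iff:
  assumes "f \<in> carrier (klr_free \<beta>)" "g \<in> carrier (klr_free \<beta>)"
  shows "cl Q \<beta> f = cl Q \<beta> g \<longleftrightarrow> klr_class Q \<beta> f = klr_class Q \<beta> g"
  unfolding cl_def by (rule ring_emb_eq_iff) (auto intro: ring_klr klr_class_closed assms)

lemma cl_rel: "klr_rel Q \<beta> a b \<Longrightarrow> cl Q \<beta> a = cl Q \<beta> b"
  by (simp add: cl_def klr_rel_class)

lemma cl_0: "cl Q \<beta> 0 = 0"
  unfolding cl_def klr_class_0
  by (rule ring_emb_hom(3)[OF ring_klr ring.ring_simprules(2)[OF ring_klr] ring.ring_simprules(2)[OF ring_klr]])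

lemma cl_add:
  assumes "f \<in> carrier (klr_free \<beta>)" "g \<in> carrier (klr_free \<beta>)"
  shows "cl Q \<beta> (f + g) = cl Q \<beta> f + cl Q \<beta> g"
  unfolding cl_def klr_class_add[OF assms] using assms
  by (intro ring_emb_hom ring_klr klr_class_closed)

lemma cl_mult:
  assumes "f \<in> carrier (klr_free \<beta>)" "g \<in> carrier (klr_free \<beta>)"
  shows "cl Q \<beta> (f * g) = cl Q \<beta> f * cl Q \<beta> g"
  unfolding cl_def klr_class_mult[OF assms] using assms
  by (intro ring_emb_hom ring_klr klr_class_closed)

lemma cl_uminus:
  assumes "f \<in> carrier (klr_free \<beta>)"
  shows "cl Q \<beta> (- f) = - cl Q \<beta> f"
  using cl_add[OF assms klr_free_closed(5)[OF assms], of Q] cl_0[of Q \<beta>]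
  by (simp add: eq_neg_iff_add_eq_0 add.commute)

lemma cl_diff:
  assumes "f \<in> carrier (klr_free \<beta>)" "g \<in> carrier (klr_free \<beta>)"
  shows "cl Q \<beta> (f - g) = cl Q \<beta> f - cl Q \<beta> g"
  using cl_add[OF assms(1) klr_free_closed(5)[OF assms(2)], of Q] cl_uminus[OF assms(2), of Q] by simp

lemma cl_sum:
  "(\<And>a. a \<in> A \<Longrightarrow> F a \<in> carrier (klr_free \<beta>)) \<Longrightarrow> cl Q \<beta> (sum F A) = (\<Sum>a\<in>A. cl Q \<beta> (F a))"
proof (induction A rule: infinite_finite_induct)
  case (insert a A)
  then show ?case by (simp add: cl_add klr_free_sum)
qed (auto simp: cl_0)

lemma cl_power_mult:
  assumes "f \<in> carrier (klr_free \<beta>)" "g \<in> carrier (klr_free \<beta>)"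
  shows "cl Q \<beta> (f ^ s * g) = cl Q \<beta> f ^ s * cl Q \<beta> g"
proof (induction s)
  case (Suc s)
  then show ?case using assms by (simp add: mult.assoc cl_mult klr_free_closed klr_free_power)
qed simp

lemma cl_1_mult: "g \<in> carrier (klr_free \<beta>) \<Longrightarrow> cl Q \<beta> 1 * cl Q \<beta> g = cl Q \<beta> g"
  "g \<in> carrier (klr_free \<beta>) \<Longrightarrow> cl Q \<beta> g * cl Q \<beta> 1 = cl Q \<beta> g"
  using cl_mult[OF klr_free_closed(2), of g \<beta> Q] cl_mult[OF _ klr_free_closed(2), of g \<beta> Q] by simp_all

lemma cl_eval2:
  assumes "a \<in> carrier (klr_free \<beta>)" "b \<in> carrier (klr_free \<beta>)" "g \<in> carrier (klr_free \<beta>)"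
  shows "cl Q \<beta> (eval2 P a b * g) = ev2 (\<lambda>c. cl Q \<beta> (scalar c)) P (cl Q \<beta> a) (cl Q \<beta> b) * cl Q \<beta> g"
proof -
  have "cl Q \<beta> (scalar c * a ^ s * b ^ r * g) = cl Q \<beta> (scalar c) * cl Q \<beta> a ^ s * cl Q \<beta> b ^ r * cl Q \<beta> g"
    for c s r
    using assms by (simp add: mult.assoc cl_mult[OF klr_free_closed(7)] cl_power_mult klr_free_closed klr_free_power)
  then show ?thesis
    unfolding eval2_def ev2_def sum_distrib_right using assms
    by (subst cl_sum; (subst cl_sum)?; intro klr_free_sum klr_free_closed klr_free_power sum.cong refl; simp)
qed

lemma cl_divdiff:
  assumes "a \<in> carrier (klr_free \<beta>)" "b \<in> carrier (klr_free \<beta>)" "c \<in> carrier (klr_free \<beta>)"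
    "g \<in> carrier (klr_free \<beta>)"
  shows "cl Q \<beta> (divdiff P a b c * g)
    = dd2 (\<lambda>c. cl Q \<beta> (scalar c)) P (cl Q \<beta> a) (cl Q \<beta> b) (cl Q \<beta> c) * cl Q \<beta> g"
proof -
  have 1: "cl Q \<beta> (scalar e * (a ^ p * c ^ q) * b ^ r * g)
    = cl Q \<beta> (scalar e) * (cl Q \<beta> a ^ p * cl Q \<beta> c ^ q) * cl Q \<beta> b ^ r * cl Q \<beta> g"
    for e p q r
    using assms by (simp add: mult.assoc cl_mult[OF klr_free_closed(7)] cl_power_mult klr_free_closed klr_free_power)
  have "cl Q \<beta> (scalar e * (\<Sum>p<s. a ^ p * c ^ (s - 1 - p)) * b ^ r * g)
    = cl Q \<beta> (scalar e) * (\<Sum>p<s. cl Q \<beta> a ^ p * cl Q \<beta> c ^ (s - 1 - p)) * cl Q \<beta> b ^ r * cl Q \<beta> g"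
    for e s r
    unfolding sum_distrib_left sum_distrib_right using assms
    by (subst cl_sum) (auto intro!: klr_free_closed klr_free_power simp: 1)
  then show ?thesis
    unfolding divdiff_def dd2_def sum_distrib_right using assms
    by (subst cl_sum; (subst cl_sum)?; intro klr_free_sum klr_free_closed klr_free_power sum.cong refl; simp)
qed

lemma idm_closed: "\<nu> \<in> permutations_of_multiset \<beta> \<Longrightarrow> idm \<nu> \<in> carrier (klr_free \<beta>)"
  and xv_closed: "k \<in> {1..size \<beta>} \<Longrightarrow> xv k \<in> carrier (klr_free \<beta>)"
  and tau_closed: "k \<in> {1..<size \<beta>} \<Longrightarrow> tau k \<in> carrier (klr_free \<beta>)"
  by (auto intro!: klr_free_closed simp: klr_gens_def)

lemmas klr_closed = idm_closed xv_closed tau_closed klr_free_closed(1-7)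

lemma free_expansion: "f = (\<Sum>w\<in>Poly_Mapping.keys f. Poly_Mapping.single w (Poly_Mapping.lookup f w))"
  by (rule poly_mapping_eqI) (auto simp: lookup_sum lookup_single when_def in_keys_iff)

lemma scalar_mult_commute: "scalar c * f = f * (scalar c :: ('i, 'k::comm_ring_1) free_alg)"
proof -
  have "scalar c * Poly_Mapping.single w a = Poly_Mapping.single w a * (scalar c :: ('i, 'k) free_alg)" for w a
    by (simp add: scalar_def mult_single mult.commute)
  then have "scalar c * (\<Sum>w\<in>Poly_Mapping.keys f. Poly_Mapping.single w (Poly_Mapping.lookup f w))
      = (\<Sum>w\<in>Poly_Mapping.keys f. Poly_Mapping.single w (Poly_Mapping.lookup f w)) * scalar c"
    by (simp add: sum_distrib_left sum_distrib_right)
  then show ?thesis unfolding free_expansion[symmetric] .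
qed

lemma scalar_hom: "scalar (a + b) = (scalar a + scalar b :: ('i, 'k::comm_ring_1) free_alg)"
  "scalar (a * b) = (scalar a * scalar b :: ('i, 'k) free_alg)"
  "scalar 1 = (1 :: ('i, 'k) free_alg)" "scalar 0 = (0 :: ('i, 'k) free_alg)"
  by (simp_all add: scalar_def single_add mult_single)

text \<open>Each defining relation is transported along \<open>cl\<close>. The image of
  \<open>1\<close> acts as a unit only on images under \<open>cl\<close>, so the relation for the
  sum of the idempotents appears as \<open>X_unit\<close> and \<open>T_unit\<close>.\<close>

lemma klr_relations_cl:
  fixes Q :: "'i \<Rightarrow> 'i \<Rightarrow> 'k::comm_ring_1 poly poly"
  shows "klr_relations \<beta> Q (\<lambda>\<nu>. cl Q \<beta> (idm \<nu>)) (\<lambda>k. cl Q \<beta> (xv k)) (\<lambda>k. cl Q \<beta> (tau k))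
    (\<lambda>c. cl Q \<beta> (scalar c))"
proof
  fix \<nu> :: "'i list" assume \<nu>: "\<nu> \<in> permutations_of_multiset \<beta>"
  show "cl Q \<beta> (idm \<nu>) * cl Q \<beta> (idm \<mu>) = (if \<nu> = \<mu> then cl Q \<beta> (idm \<nu>) else 0)"
    if "\<mu> \<in> permutations_of_multiset \<beta>" for \<mu>
    using cl_rel[OF klr_rel.idem_idem[OF \<nu> that], of Q] \<nu> that
    by (auto simp: cl_mult cl_0 klr_closed split: if_splits)
  show "cl Q \<beta> (xv k) * cl Q \<beta> (idm \<nu>) = cl Q \<beta> (idm \<nu>) * cl Q \<beta> (xv k)"
    if "k \<in> {1..size \<beta>}" for k
    using cl_rel[OF klr_rel.x_idem[OF \<nu> that], of Q] \<nu> that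
    by (simp add: cl_mult klr_closed)
  show "cl Q \<beta> (scalar 1) * cl Q \<beta> (idm \<nu>) = cl Q \<beta> (idm \<nu>)"
    using \<nu> by (simp add: scalar_hom cl_1_mult klr_closed)
  show "cl Q \<beta> (scalar c) * cl Q \<beta> (idm \<nu>) = cl Q \<beta> (idm \<nu>) * cl Q \<beta> (scalar c)" for c
    using \<nu> by (simp add: cl_mult[symmetric] scalar_mult_commute klr_closed)
  fix k
  show "(cl Q \<beta> (tau (k + 1)) * cl Q \<beta> (tau k) * cl Q \<beta> (tau (k + 1))
      - cl Q \<beta> (tau k) * cl Q \<beta> (tau (k + 1)) * cl Q \<beta> (tau k)) * cl Q \<beta> (idm \<nu>) =
    (if cpt \<nu> k = cpt \<nu> (k + 2)
     then dd2 (\<lambda>c. cl Q \<beta> (scalar c)) (Q (cpt \<nu> k) (cpt \<nu> (k + 1))) (cl Q \<beta> (xv (k + 2)))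
        (cl Q \<beta> (xv (k + 1))) (cl Q \<beta> (xv k)) * cl Q \<beta> (idm \<nu>)
     else 0)" if k: "1 \<le> k" "k + 1 < size \<beta>"
  proof -
    note rel = cl_rel[OF klr_rel.braid[OF \<nu> k], of Q]
    have "cl Q \<beta> ((tau (k + 1) * tau k * tau (k + 1) - tau k * tau (k + 1) * tau k) * idm \<nu>)
      = (cl Q \<beta> (tau (k + 1)) * cl Q \<beta> (tau k) * cl Q \<beta> (tau (k + 1))
      - cl Q \<beta> (tau k) * cl Q \<beta> (tau (k + 1)) * cl Q \<beta> (tau k)) * cl Q \<beta> (idm \<nu>)"
      using \<nu> k by (simp add: cl_mult cl_diff klr_closed)
    then show ?thesis
      unfolding rel using \<nu> k by (auto simp: cl_0 cl_divdiff klr_closed)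
  qed
  assume k: "k \<in> {1..<size \<beta>}"
  show "cl Q \<beta> (tau k) * cl Q \<beta> (idm \<nu>) = cl Q \<beta> (idm (swap_cpt k \<nu>)) * cl Q \<beta> (tau k)"
    using cl_rel[OF klr_rel.tau_idem[OF \<nu> k], of Q] \<nu> k swap_cpt_permutation[OF \<nu> k]
    by (simp add: cl_mult klr_closed)
  show "cl Q \<beta> (tau k) * cl Q \<beta> (tau k) * cl Q \<beta> (idm \<nu>) =
    ev2 (\<lambda>c. cl Q \<beta> (scalar c)) (Q (cpt \<nu> k) (cpt \<nu> (k + 1))) (cl Q \<beta> (xv k)) (cl Q \<beta> (xv (k + 1)))
      * cl Q \<beta> (idm \<nu>)"
    using cl_rel[OF klr_rel.tau_square[OF \<nu> k], of Q] \<nu> k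
    by (simp add: cl_power_mult cl_eval2 power2_eq_square cl_mult klr_closed)
  show "(cl Q \<beta> (tau k) * cl Q \<beta> (xv l)
      - cl Q \<beta> (xv (transpose k (k + 1) l)) * cl Q \<beta> (tau k)) * cl Q \<beta> (idm \<nu>) =
    (if l = k + 1 \<and> cpt \<nu> k = cpt \<nu> (k + 1) then cl Q \<beta> (idm \<nu>)
     else if l = k \<and> cpt \<nu> k = cpt \<nu> (k + 1) then - cl Q \<beta> (idm \<nu>) else 0)"
    if l: "l \<in> {1..size \<beta>}" for l
  proof -
    have tr: "transpose k (k + 1) l \<in> {1..size \<beta>}" using k l by (auto simp: transpose_def)
    note rel = cl_rel[OF klr_rel.tau_x[OF \<nu> k l], of Q]
    have "cl Q \<beta> ((tau k * xv l - xv (transpose k (k + 1) l) * tau k) * idm \<nu>)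
      = (cl Q \<beta> (tau k) * cl Q \<beta> (xv l)
      - cl Q \<beta> (xv (transpose k (k + 1) l)) * cl Q \<beta> (tau k)) * cl Q \<beta> (idm \<nu>)"
      by (simp only: cl_mult cl_diff klr_closed \<nu> k l tr)
    then show ?thesis
      unfolding rel using \<nu> by (auto simp: cl_0 cl_uminus klr_closed)
  qed
next
  show "cl Q \<beta> (xv k) * cl Q \<beta> (xv l) = cl Q \<beta> (xv l) * cl Q \<beta> (xv k)"
    if "k \<in> {1..size \<beta>}" "l \<in> {1..size \<beta>}" for k l
    using cl_rel[OF klr_rel.x_x[OF that], of Q] that by (simp add: cl_mult klr_closed)
  show "cl Q \<beta> (tau k) * cl Q \<beta> (tau l) = cl Q \<beta> (tau l) * cl Q \<beta> (tau k)"
    if "k \<in> {1..<size \<beta>}" "l \<in> {1..<size \<beta>}" "k + 1 < l \<or> l + 1 < k" for k l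
    using cl_rel[OF klr_rel.tau_tau[OF that], of Q] that by (simp add: cl_mult klr_closed)
  have unit: "(\<Sum>\<nu>\<in>permutations_of_multiset \<beta>. cl Q \<beta> (idm \<nu>)) = cl Q \<beta> 1"
    using cl_rel[OF klr_rel.unit, of Q \<beta>] by (simp add: cl_sum klr_closed)
  show "cl Q \<beta> (xv k) * (\<Sum>\<nu>\<in>permutations_of_multiset \<beta>. cl Q \<beta> (idm \<nu>)) = cl Q \<beta> (xv k)"
    if "k \<in> {1..size \<beta>}" for k
    using that by (simp add: unit cl_1_mult klr_closed)
  show "cl Q \<beta> (tau k) * (\<Sum>\<nu>\<in>permutations_of_multiset \<beta>. cl Q \<beta> (idm \<nu>)) = cl Q \<beta> (tau k)"
    if "k \<in> {1..<size \<beta>}" for k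
    using that by (simp add: unit cl_1_mult klr_closed)
  show "cl Q \<beta> (scalar c) * cl Q \<beta> (xv k) = cl Q \<beta> (xv k) * cl Q \<beta> (scalar c)"
    if "k \<in> {1..size \<beta>}" for k c
    using that by (simp add: cl_mult[symmetric] scalar_mult_commute klr_closed)
  show "cl Q \<beta> (scalar c) * cl Q \<beta> (tau k) = cl Q \<beta> (tau k) * cl Q \<beta> (scalar c)"
    if "k \<in> {1..<size \<beta>}" for k c
    using that by (simp add: cl_mult[symmetric] scalar_mult_commute klr_closed)
  show "cl Q \<beta> (scalar (a + b)) = cl Q \<beta> (scalar a) + cl Q \<beta> (scalar b)"
    "cl Q \<beta> (scalar (a * b)) = cl Q \<beta> (scalar a) * cl Q \<beta> (scalar b)" for a b
    by (simp_all add: scalar_hom cl_add cl_mult klr_closed)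
qed

section \<open>Substitution homomorphisms of the free algebra\<close>

lemma free_subst_superset:
  assumes "finite A" "Poly_Mapping.keys f \<subseteq> A"
  shows "free_subst \<phi> f = (\<Sum>w\<in>A. scalar (Poly_Mapping.lookup f w) * prod_list (map \<phi> (letters w)))"
  unfolding free_subst_def using assms
  by (intro sum.mono_neutral_left) (auto simp: in_keys_iff scalar_hom)

lemma free_subst_add: "free_subst \<phi> (f + g) = free_subst \<phi> f + free_subst \<phi> g"
proof -
  let ?A = "Poly_Mapping.keys f \<union> Poly_Mapping.keys g"
  have "free_subst \<phi> h = (\<Sum>w\<in>?A. scalar (Poly_Mapping.lookup h w) * prod_list (map \<phi> (letters w)))"
    if "h \<in> {f, g, f + g}" for h
    using that keys_add[of f g] by (intro free_subst_superset) auto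
  then show ?thesis
    by (simp add: lookup_add scalar_hom distrib_right sum.distrib)
qed

lemma free_subst_0 [simp]: "free_subst \<phi> 0 = 0"
  by (simp add: free_subst_def)

lemma free_subst_uminus: "free_subst \<phi> (- f) = - free_subst \<phi> f"
  using free_subst_add[of \<phi> f "- f"] by (simp add: eq_neg_iff_add_eq_0 add.commute)

lemma free_subst_diff: "free_subst \<phi> (f - g) = free_subst \<phi> f - free_subst \<phi> g"
  using free_subst_add[of \<phi> f "- g"] by (simp add: free_subst_uminus)

lemma free_subst_sum: "free_subst \<phi> (sum F A) = (\<Sum>a\<in>A. free_subst \<phi> (F a))"
  by (induction A rule: infinite_finite_induct) (auto simp: free_subst_add)

lemma free_subst_single:
  "free_subst \<phi> (Poly_Mapping.single w c) = scalar c * prod_list (map \<phi> (letters w))"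
  by (subst free_subst_superset[of "{w}"]) auto

text \<open>Bilinearity reduces the claim to two words, whose product is their concatenation; the
  scalars are central and can be collected in front.\<close>

lemma free_subst_mult: "free_subst \<phi> (f * g) = free_subst \<phi> f * free_subst \<phi> g"
proof -
  have s: "free_subst \<phi> (Poly_Mapping.single v a * Poly_Mapping.single w b)
    = free_subst \<phi> (Poly_Mapping.single v a) * free_subst \<phi> (Poly_Mapping.single w b)" for v w a b
    unfolding mult_single free_subst_single plus_fword_def
    by (simp add: scalar_hom mult.assoc)
      (metis (no_types, lifting) mult.assoc scalar_mult_commute)
  let ?S = "\<lambda>f. \<Sum>w\<in>Poly_Mapping.keys f. Poly_Mapping.single w (Poly_Mapping.lookup f w)"
  have "free_subst \<phi> (?S f * ?S g) = free_subst \<phi> (?S f) * free_subst \<phi> (?S g)"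
    by (simp only: sum_distrib_left sum_distrib_right free_subst_sum s)
  then show ?thesis unfolding free_expansion[symmetric] .
qed

lemma free_subst_scalar [simp]: "free_subst \<phi> (scalar c) = scalar c"
  using free_subst_single[of \<phi> 0 c] by (simp add: scalar_def zero_fword_def)

lemma free_subst_1 [simp]: "free_subst \<phi> 1 = 1"
  using free_subst_scalar[of \<phi> 1] by (simp add: scalar_hom)

lemma free_subst_gen [simp]: "free_subst \<phi> (gen g) = \<phi> g"
  by (simp add: gen_def free_subst_single scalar_hom)

lemma free_subst_power: "free_subst \<phi> (f ^ s) = free_subst \<phi> f ^ s"
  by (induction s) (auto simp: free_subst_mult)

lemma free_subst_prod_list: "free_subst \<phi> (prod_list fs) = prod_list (map (free_subst \<phi>) fs)"
  by (induction fs) (auto simp: free_subst_mult)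

lemma free_subst_eval2: "free_subst \<phi> (eval2 P a b) = eval2 P (free_subst \<phi> a) (free_subst \<phi> b)"
  by (simp add: eval2_def free_subst_sum free_subst_mult free_subst_power)

lemma free_subst_divdiff:
  "free_subst \<phi> (divdiff P a b c) = divdiff P (free_subst \<phi> a) (free_subst \<phi> b) (free_subst \<phi> c)"
  by (simp add: divdiff_def free_subst_sum free_subst_mult free_subst_power)

lemmas free_subst_simps = free_subst_add free_subst_uminus free_subst_diff free_subst_sum free_subst_mult
  free_subst_power free_subst_eval2 free_subst_divdiff

lemma prod_list_closed:
  "(\<And>f. f \<in> set fs \<Longrightarrow> f \<in> carrier (klr_free \<beta>)) \<Longrightarrow> prod_list fs \<in> carrier (klr_free \<beta>)"
  by (induction fs) (auto intro: klr_free_closed)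

text \<open>Every element is a finite sum of scalar multiples of words. This allows statements on
  \<open>diamond\<close> and on the right action to be checked on the generators alone.\<close>

lemma free_alg_carrier_induct [consumes 1, case_names sum scalar mult gen]:
  assumes "f \<in> carrier (klr_free \<beta>)"
    and sum: "\<And>F A. (\<And>a. a \<in> A \<Longrightarrow> F a \<in> carrier (klr_free \<beta>) \<and> P (F a)) \<Longrightarrow> P (sum F (A :: 'i klr_gen fword set))"
    and scalar: "\<And>c. P (scalar c)"
    and mult: "\<And>f g. f \<in> carrier (klr_free \<beta>) \<Longrightarrow> g \<in> carrier (klr_free \<beta>) \<Longrightarrow> P f \<Longrightarrow> P g \<Longrightarrow> P (f * g)"
    and gen: "\<And>g. g \<in> klr_gens \<beta> \<Longrightarrow> P (gen g)"
  shows "P (f :: ('i, 'k::comm_ring_1) free_alg)"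
proof -
  have word: "(Poly_Mapping.single (Word ws) 1 :: ('i, 'k) free_alg) \<in> carrier (klr_free \<beta>)
      \<and> P (Poly_Mapping.single (Word ws) 1)" if "set ws \<subseteq> klr_gens \<beta>" for ws
    using that
  proof (induction ws)
    case Nil
    have "(Poly_Mapping.single (Word []) 1 :: ('i, 'k) free_alg) = scalar 1"
      by (simp add: scalar_def zero_fword_def)
    then show ?case using scalar[of 1] klr_free_closed(7)[of 1 \<beta>] by simp
  next
    case (Cons g ws)
    have "(Poly_Mapping.single (Word (g # ws)) 1 :: ('i, 'k) free_alg)
        = gen g * Poly_Mapping.single (Word ws) 1"
      by (simp add: gen_def mult_single plus_fword_def)
    then show ?case
      using Cons mult[of "gen g" "Poly_Mapping.single (Word ws) 1"] gen klr_free_closed(6,8)[of _ \<beta>] by auto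
  qed
  have "(Poly_Mapping.single w c :: ('i, 'k) free_alg) \<in> carrier (klr_free \<beta>) \<and> P (Poly_Mapping.single w c)"
    if "set (letters w) \<subseteq> klr_gens \<beta>" for w c
  proof -
    have "(Poly_Mapping.single w c :: ('i, 'k) free_alg) = scalar c * Poly_Mapping.single (Word (letters w)) 1"
      by (simp add: scalar_def mult_single)
    then show ?thesis
      using word[OF that] scalar[of c] mult[of "scalar c" "Poly_Mapping.single (Word (letters w)) 1"]
        klr_free_closed(6,7) by auto
  qed
  then have "P (\<Sum>w\<in>Poly_Mapping.keys f. Poly_Mapping.single w (Poly_Mapping.lookup f w))"
    using assms(1) by (intro sum) (auto simp: klr_free_def)
  then show ?thesis unfolding free_expansion[symmetric] .
qed

text \<open>A common generalisation of the left and the right factor of \<open>\<diamondop>\<close>: the generators of \<open>H\<^sub>\<beta>\<close> act on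
  the strands \<open>off + 1, \<dots>, off + |\<beta>|\<close>, and \<open>F \<nu>\<close> consists of the tuples that restrict to \<open>\<nu>\<close> there.\<close>

locale klr_block =
  fixes Q :: "'i \<Rightarrow> 'i \<Rightarrow> 'k::comm_ring_1 poly poly"
    and \<beta> \<beta>' :: "'i multiset" and off :: nat
    and F :: "'i list \<Rightarrow> 'i list set"
    and \<phi> :: "'i klr_gen \<Rightarrow> ('i, 'k) free_alg"
  assumes \<phi>_idm: "\<nu> \<in> permutations_of_multiset \<beta> \<Longrightarrow> \<phi> (IdemG \<nu>) = (\<Sum>w\<in>F \<nu>. idm w)"
    and \<phi>_xv: "\<phi> (XG k) = xv (off + k)"
    and \<phi>_tau: "\<phi> (TauG k) = tau (off + k)"
    and F_perm: "\<nu> \<in> permutations_of_multiset \<beta> \<Longrightarrow> F \<nu> \<subseteq> permutations_of_multiset \<beta>'"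
    and F_disjoint: "\<nu> \<in> permutations_of_multiset \<beta> \<Longrightarrow> \<mu> \<in> permutations_of_multiset \<beta> \<Longrightarrow>
      \<nu> \<noteq> \<mu> \<Longrightarrow> F \<nu> \<inter> F \<mu> = {}"
    and F_cpt: "\<nu> \<in> permutations_of_multiset \<beta> \<Longrightarrow> w \<in> F \<nu> \<Longrightarrow> k \<in> {1..size \<beta>} \<Longrightarrow>
      cpt w (off + k) = cpt \<nu> k"
    and F_swap: "\<nu> \<in> permutations_of_multiset \<beta> \<Longrightarrow> k \<in> {1..<size \<beta>} \<Longrightarrow>
      bij_betw (swap_cpt (off + k)) (F \<nu>) (F (swap_cpt k \<nu>))"
    and off: "off + size \<beta> \<le> size \<beta>'"
begin

abbreviation fs where "fs \<equiv> free_subst \<phi>"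
abbreviation c where "c \<equiv> cl Q \<beta>'"

definition EF :: "'i list \<Rightarrow> ('i, 'k) klr_elt ring_product" where
  "EF \<nu> = (\<Sum>w\<in>F \<nu>. c (idm w))"

definition J :: "('i, 'k) klr_elt ring_product" where
  "J = (\<Sum>\<nu>\<in>permutations_of_multiset \<beta>. EF \<nu>)"

text \<open>The images of the idempotents of \<open>\<beta>\<close> add up to \<open>J\<close>, not
  to \<open>1\<close>, so the relations of the smaller algebra hold only after truncation by
  \<open>J\<close>.\<close>

definition \<Phi> :: "('i, 'k) free_alg \<Rightarrow> ('i, 'k) klr_elt ring_product" where
  "\<Phi> f = c (fs f) * J"

interpretation R: klr_relations \<beta>' Q "\<lambda>\<nu>. c (idm \<nu>)" "\<lambda>k. c (xv k)" "\<lambda>k. c (tau k)" "\<lambda>a. c (scalar a)"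
  by (rule klr_relations_cl)

lemma F_permD: "\<nu> \<in> permutations_of_multiset \<beta> \<Longrightarrow> w \<in> F \<nu> \<Longrightarrow> w \<in> permutations_of_multiset \<beta>'"
  using F_perm by blast

lemma finite_F: "\<nu> \<in> permutations_of_multiset \<beta> \<Longrightarrow> finite (F \<nu>)"
  using finite_subset[OF F_perm] by simp

lemma EF_EF:
  assumes \<nu>: "\<nu> \<in> permutations_of_multiset \<beta>" and \<mu>: "\<mu> \<in> permutations_of_multiset \<beta>"
  shows "EF \<nu> * EF \<mu> = (if \<nu> = \<mu> then EF \<nu> else 0)"
proof -
  have "EF \<nu> * EF \<mu> = (\<Sum>w\<in>F \<nu>. \<Sum>v\<in>F \<mu>. c (idm w) * c (idm v))"
    unfolding EF_def by (simp add: sum_product)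
  also have "\<dots> = (\<Sum>w\<in>F \<nu>. \<Sum>v\<in>F \<mu>. if w = v then c (idm w) else 0)"
    by (intro sum.cong refl R.E_E F_permD[OF \<nu>] F_permD[OF \<mu>])
  also have "\<dots> = (\<Sum>w\<in>F \<nu>. if w \<in> F \<mu> then c (idm w) else 0)"
    using finite_F[OF \<mu>] by simp
  also have "\<dots> = (if \<nu> = \<mu> then EF \<nu> else 0)"
    using F_disjoint[OF \<nu> \<mu>] by (auto simp: EF_def intro!: sum.cong sum.neutral)
  finally show ?thesis .
qed

lemma EF_J: "\<nu> \<in> permutations_of_multiset \<beta> \<Longrightarrow> EF \<nu> * J = EF \<nu>"
  "\<nu> \<in> permutations_of_multiset \<beta> \<Longrightarrow> J * EF \<nu> = EF \<nu>"
  by (simp_all add: J_def sum_distrib_left sum_distrib_right EF_EF)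

lemma J_J: "J * J = J"
proof -
  have "(\<Sum>\<nu>\<in>permutations_of_multiset \<beta>. EF \<nu>) * J = (\<Sum>\<nu>\<in>permutations_of_multiset \<beta>. EF \<nu>)"
    unfolding sum_distrib_right by (intro sum.cong refl EF_J)
  then show ?thesis by (simp only: J_def[symmetric])
qed

lemma fs_idm: "\<nu> \<in> permutations_of_multiset \<beta> \<Longrightarrow> c (fs (idm \<nu>)) = EF \<nu>"
  by (auto simp: \<phi>_idm EF_def intro!: cl_sum idm_closed intro: F_permD)

lemma X_EF: "\<nu> \<in> permutations_of_multiset \<beta> \<Longrightarrow> k \<in> {1..size \<beta>} \<Longrightarrow>
    c (xv (off + k)) * EF \<nu> = EF \<nu> * c (xv (off + k))"
  unfolding EF_def sum_distrib_left sum_distrib_right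
  by (intro sum.cong refl R.X_E F_permD) (use off in auto)

lemma T_EF:
  assumes \<nu>: "\<nu> \<in> permutations_of_multiset \<beta>" and k: "k \<in> {1..<size \<beta>}"
  shows "c (tau (off + k)) * EF \<nu> = EF (swap_cpt k \<nu>) * c (tau (off + k))"
proof -
  have "c (tau (off + k)) * EF \<nu> = (\<Sum>w\<in>F \<nu>. c (idm (swap_cpt (off + k) w)) * c (tau (off + k)))"
    unfolding EF_def sum_distrib_left
    by (intro sum.cong refl R.T_E F_permD[OF \<nu>]) (use off k in auto)
  also have "\<dots> = (\<Sum>w\<in>F (swap_cpt k \<nu>). c (idm w) * c (tau (off + k)))"
    by (rule sum.reindex_bij_betw[OF F_swap[OF \<nu> k]])
  finally show ?thesis by (simp add: EF_def sum_distrib_right)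
qed

lemma swap_swap:
  assumes "\<nu> \<in> permutations_of_multiset \<beta>" "k \<in> {1..<size \<beta>}"
  shows "swap_cpt k (swap_cpt k \<nu>) = \<nu>"
proof (rule cpt_ext)
  fix p assume "1 \<le> p" "p \<le> length \<nu>"
  then show "cpt (swap_cpt k (swap_cpt k \<nu>)) p = cpt \<nu> p"
    using assms length_permutation[OF assms(1)] by (auto simp: cpt_swap_cpt transpose_def)
qed simp

text \<open>A crossing permutes the summands \<open>EF \<nu>\<close> of \<open>J\<close> along the
  involution \<open>swap_cpt k\<close>.\<close>

lemma T_J:
  assumes "k \<in> {1..<size \<beta>}"
  shows "c (tau (off + k)) * J = J * c (tau (off + k))"
proof -
  have "bij_betw (swap_cpt k) (permutations_of_multiset \<beta>) (permutations_of_multiset \<beta>)"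
    using swap_cpt_permutation[OF _ assms] swap_swap[OF _ assms]
    by (intro bij_betwI[where g = "swap_cpt k"]) auto
  then have "(\<Sum>\<nu>\<in>permutations_of_multiset \<beta>. EF (swap_cpt k \<nu>)) = J"
    unfolding J_def by (rule sum.reindex_bij_betw)
  then show ?thesis
    using T_EF[OF _ assms] by (simp add: J_def sum_distrib_left flip: sum_distrib_right)
qed

lemma X_J: "k \<in> {1..size \<beta>} \<Longrightarrow> c (xv (off + k)) * J = J * c (xv (off + k))"
  using X_EF by (simp add: J_def sum_distrib_left sum_distrib_right)

lemma fs_closed:
  assumes "f \<in> carrier (klr_free \<beta>)"
  shows "fs f \<in> carrier (klr_free \<beta>')"
  using assms
proof (induction f rule: free_alg_carrier_induct)
  case (gen g)
  then show ?case
    using off by (auto simp: klr_gens_def \<phi>_idm \<phi>_xv \<phi>_tau intro!: klr_free_sum idm_closed xv_closed tau_closed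
        intro: F_permD)
qed (auto simp: free_subst_simps intro!: klr_free_sum klr_closed)

lemma J_closed: "J = c (\<Sum>\<nu>\<in>permutations_of_multiset \<beta>. \<phi> (IdemG \<nu>))"
proof -
  have "fs (idm \<nu>) \<in> carrier (klr_free \<beta>')" if "\<nu> \<in> permutations_of_multiset \<beta>" for \<nu>
    using that by (intro fs_closed idm_closed)
  then show ?thesis using fs_idm by (simp add: J_def cl_sum)
qed

lemma fs_J:
  assumes "f \<in> carrier (klr_free \<beta>)"
  shows "c (fs f) * J = J * c (fs f)"
  using assms
proof (induction f rule: free_alg_carrier_induct)
  case (sum F A)
  then show ?case by (simp add: free_subst_sum cl_sum fs_closed sum_distrib_left sum_distrib_right)
next
  case (scalar a)
  have "J * c (scalar a) = c (scalar a) * J"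
    unfolding J_def EF_def sum_distrib_left sum_distrib_right
    by (intro sum.cong refl R.sc_E[symmetric] F_permD)
  then show ?case by simp
next
  case (mult f g)
  then show ?case by (simp add: free_subst_mult cl_mult fs_closed) (metis mult.assoc)
next
  case (gen g)
  then show ?case
    using X_J T_J EF_J fs_idm by (auto simp: klr_gens_def \<phi>_xv \<phi>_tau simp del: \<phi>_idm)
qed

lemma \<Phi>_mult:
  assumes "f \<in> carrier (klr_free \<beta>)" "g \<in> carrier (klr_free \<beta>)"
  shows "\<Phi> (f * g) = \<Phi> f * \<Phi> g"
proof -
  have "\<Phi> f * \<Phi> g = c (fs f) * (J * c (fs g)) * J" by (simp add: \<Phi>_def mult.assoc)
  also have "\<dots> = c (fs f) * c (fs g) * (J * J)"
    unfolding fs_J[OF assms(2), symmetric] by (simp only: mult.assoc)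
  finally show ?thesis using assms by (simp add: \<Phi>_def free_subst_mult cl_mult fs_closed J_J)
qed

lemma \<Phi>_add:
  assumes "f \<in> carrier (klr_free \<beta>)" "g \<in> carrier (klr_free \<beta>)"
  shows "\<Phi> (f + g) = \<Phi> f + \<Phi> g"
  using assms by (simp add: \<Phi>_def free_subst_add cl_add fs_closed distrib_right)

lemma \<Phi>_uminus: "f \<in> carrier (klr_free \<beta>) \<Longrightarrow> \<Phi> (- f) = - \<Phi> f"
  by (simp add: \<Phi>_def free_subst_uminus cl_uminus fs_closed)

lemma \<Phi>_diff:
  assumes "f \<in> carrier (klr_free \<beta>)" "g \<in> carrier (klr_free \<beta>)"
  shows "\<Phi> (f - g) = \<Phi> f - \<Phi> g"
  using assms by (simp add: \<Phi>_def free_subst_diff cl_diff fs_closed left_diff_distrib)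

lemma \<Phi>_0 [simp]: "\<Phi> 0 = 0"
  by (simp add: \<Phi>_def cl_0)

lemma \<Phi>_idm: "\<nu> \<in> permutations_of_multiset \<beta> \<Longrightarrow> \<Phi> (idm \<nu>) = EF \<nu>"
  using fs_idm EF_J by (simp add: \<Phi>_def)

lemma \<Phi>_EF:
  assumes "\<nu> \<in> permutations_of_multiset \<beta>" "f \<in> carrier (klr_free \<beta>)"
  shows "\<Phi> f * EF \<nu> = c (fs f) * EF \<nu>" "EF \<nu> * \<Phi> f = EF \<nu> * c (fs f)"
  unfolding \<Phi>_def using EF_J[OF assms(1)] fs_J[OF assms(2)]
  by (metis mult.assoc)+

text \<open>A relation at the tuple \<open>\<nu>\<close> of the smaller algebra decomposes into
  relations of the larger one, one for each tuple \<open>w\<close> restricting to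
  \<open>\<nu>\<close>.\<close>

lemma \<Phi>_eqI:
  assumes "\<nu> \<in> permutations_of_multiset \<beta>" "a \<in> carrier (klr_free \<beta>)" "b \<in> carrier (klr_free \<beta>)"
    and "\<And>w. w \<in> F \<nu> \<Longrightarrow> klr_rel Q \<beta>' (fs a * idm w) (fs b * idm w)"
  shows "\<Phi> (a * idm \<nu>) = \<Phi> (b * idm \<nu>)"
proof -
  have "\<Phi> (d * idm \<nu>) = (\<Sum>w\<in>F \<nu>. c (fs d * idm w))" if "d \<in> carrier (klr_free \<beta>)" for d
  proof -
    have "\<Phi> (d * idm \<nu>) = c (fs d) * EF \<nu>"
      using that assms(1) EF_J
      by (simp add: \<Phi>_def free_subst_mult cl_mult fs_closed idm_closed fs_idm mult.assoc del: free_subst_gen)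
    also have "\<dots> = (\<Sum>w\<in>F \<nu>. c (fs d * idm w))"
      unfolding EF_def sum_distrib_left using that F_perm[OF assms(1)]
      by (intro sum.cong refl cl_mult[symmetric] fs_closed idm_closed) auto
    finally show ?thesis .
  qed
  moreover have "(\<Sum>w\<in>F \<nu>. c (fs a * idm w)) = (\<Sum>w\<in>F \<nu>. c (fs b * idm w))"
    using assms(4) by (intro sum.cong refl cl_rel) auto
  ultimately show ?thesis using assms(2,3) by simp
qed

lemma eval2_closed:
  "a \<in> carrier (klr_free \<gamma>) \<Longrightarrow> b \<in> carrier (klr_free \<gamma>) \<Longrightarrow>
    eval2 P a b \<in> carrier (klr_free \<gamma>)"
  unfolding eval2_def by (intro klr_free_sum klr_free_closed klr_free_power)

lemma divdiff_closed:
  "a \<in> carrier (klr_free \<gamma>) \<Longrightarrow> b \<in> carrier (klr_free \<gamma>) \<Longrightarrow> d \<in> carrier (klr_free \<gamma>) \<Longrightarrow>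
    divdiff P a b d \<in> carrier (klr_free \<gamma>)"
  unfolding divdiff_def by (intro klr_free_sum klr_free_closed klr_free_power)

text \<open>Apart from the unit relation, each relation becomes the same relation with indices
  shifted by \<open>off\<close>; \<open>F_cpt\<close> ensures that the colours involved, and
  therefore the case distinctions on the right-hand sides, agree.\<close>

lemma \<Phi>_rel:
  assumes "klr_rel Q \<beta> a b"
  shows "\<Phi> a = \<Phi> b"
  using assms
proof cases
  case (idem_idem \<nu> \<mu>)
  then show ?thesis by (auto simp: \<Phi>_mult idm_closed \<Phi>_idm EF_EF)
next
  case unit
  have "(\<Sum>\<nu>\<in>permutations_of_multiset \<beta>. \<phi> (IdemG \<nu>)) \<in> carrier (klr_free \<beta>')"
    using fs_closed[OF idm_closed] by (intro klr_free_sum) simp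
  \<comment> \<open>The unit goes to the truncating idempotent, and the sum of the
    \<open>idm \<nu>\<close> does too, since \<open>J\<close> is idempotent.\<close>
  then have "\<Phi> 1 = J"
    by (simp add: \<Phi>_def J_closed cl_1_mult)
  moreover have "\<Phi> (\<Sum>\<nu>\<in>permutations_of_multiset \<beta>. idm \<nu>) = J * J"
    using fs_closed[OF idm_closed] fs_idm
    by (simp add: \<Phi>_def free_subst_sum cl_sum J_def del: free_subst_gen)
  ultimately show ?thesis using unit J_J by simp
next
  case (x_idem \<nu> k)
  then show ?thesis
    using X_EF by (simp add: \<Phi>_mult \<Phi>_idm klr_closed \<Phi>_EF \<phi>_xv)
next
  case (tau_idem \<nu> k)
  then show ?thesis
    using T_EF swap_cpt_permutation[of \<nu> \<beta> k]
    by (simp add: \<Phi>_mult \<Phi>_idm klr_closed \<Phi>_EF \<phi>_tau)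
next
  case (x_x k l)
  have "c (fs (xv k)) * c (fs (xv l)) = c (fs (xv l)) * c (fs (xv k))"
    using x_x off by (simp add: \<phi>_xv) (intro R.X_X; simp)
  then show ?thesis
    using x_x fs_closed[OF xv_closed] by (simp add: \<Phi>_def free_subst_mult cl_mult del: free_subst_gen)
next
  case (tau_square \<nu> k)
  have "klr_rel Q \<beta>' (fs (tau k ^ 2) * idm w)
      (fs (eval2 (Q (cpt \<nu> k) (cpt \<nu> (k + 1))) (xv k) (xv (k + 1))) * idm w)" if w: "w \<in> F \<nu>" for w
    using klr_rel.tau_square[of w \<beta>' "off + k" Q] w F_perm[OF tau_square(3)] off tau_square(4)
      F_cpt[OF tau_square(3) w, of k] F_cpt[OF tau_square(3) w, of "k + 1"]
    by (auto simp: free_subst_simps \<phi>_tau \<phi>_xv)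
  then show ?thesis
    unfolding tau_square(1,2) using tau_square(3,4)
    by (intro \<Phi>_eqI klr_free_power eval2_closed klr_closed) auto
next
  case (tau_x \<nu> k l)
  let ?b = "if l = k + 1 \<and> cpt \<nu> k = cpt \<nu> (k + 1) then 1
       else if l = k \<and> cpt \<nu> k = cpt \<nu> (k + 1) then - 1 else 0 :: ('i, 'k) free_alg"
  have b: "b = ?b * idm \<nu>" by (simp add: tau_x(2))
  have tr: "off + transpose k (k + 1) l = transpose (off + k) (off + k + 1) (off + l)"
    by (auto simp: transpose_def)
  have "klr_rel Q \<beta>' (fs (tau k * xv l - xv (transpose k (k + 1) l) * tau k) * idm w) (fs ?b * idm w)"
    if w: "w \<in> F \<nu>" for w
    using klr_rel.tau_x[of w \<beta>' "off + k" "off + l" Q] w F_perm[OF tau_x(3)] off tau_x(4,5)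
      F_cpt[OF tau_x(3) w, of k] F_cpt[OF tau_x(3) w, of "k + 1"]
    by (auto simp: free_subst_simps \<phi>_tau \<phi>_xv tr[simplified] split: if_splits)
  moreover have "transpose k (k + 1) l \<in> {1..size \<beta>}" using tau_x by (auto simp: transpose_def)
  moreover have "?b \<in> carrier (klr_free \<beta>)" by (auto intro: klr_free_closed)
  ultimately show ?thesis
    unfolding tau_x(1) b using tau_x(3-5)
    by (intro \<Phi>_eqI klr_closed) auto
next
  case (tau_tau k l)
  have "c (fs (tau k)) * c (fs (tau l)) = c (fs (tau l)) * c (fs (tau k))"
    using tau_tau off by (simp add: \<phi>_tau) (intro R.T_T; auto)
  then show ?thesis
    using tau_tau fs_closed[OF tau_closed] by (simp add: \<Phi>_def free_subst_mult cl_mult del: free_subst_gen)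
next
  case (braid \<nu> k)
  let ?b = "if cpt \<nu> k = cpt \<nu> (k + 2)
    then divdiff (Q (cpt \<nu> k) (cpt \<nu> (k + 1))) (xv (k + 2)) (xv (k + 1)) (xv k) else 0"
  have b: "b = ?b * idm \<nu>" by (simp add: braid(2))
  have "klr_rel Q \<beta>' (fs (tau (k + 1) * tau k * tau (k + 1) - tau k * tau (k + 1) * tau k) * idm w)
      (fs ?b * idm w)" if w: "w \<in> F \<nu>" for w
    using klr_rel.braid[of w \<beta>' "off + k" Q] w F_perm[OF braid(3)] off braid(4,5)
      F_cpt[OF braid(3) w, of k] F_cpt[OF braid(3) w, of "k + 1"] F_cpt[OF braid(3) w, of "k + 2"]
    by (auto simp: free_subst_simps \<phi>_tau \<phi>_xv split: if_splits)
  moreover have "?b \<in> carrier (klr_free \<beta>)"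
    using braid(4,5) by (auto intro!: divdiff_closed klr_closed)
  ultimately show ?thesis
    unfolding braid(1) b using braid(3-5)
    by (intro \<Phi>_eqI klr_closed) auto
qed

text \<open>The elements of the free algebra mapped to zero form an ideal that contains all
  differences of related elements.\<close>

lemma \<Phi>_ideal:
  assumes "f \<in> klr_ideal Q \<beta>"
  shows "\<Phi> f = 0"
proof -
  interpret ring "klr_free \<beta> :: ('i, 'k) free_alg ring" by (rule ring_klr_free)
  let ?I = "{f \<in> carrier (klr_free \<beta>). \<Phi> f = 0}"
  have inv: "inv\<^bsub>add_monoid (klr_free \<beta>)\<^esub> f = - f" if "f \<in> carrier (klr_free \<beta>)" for f :: "('i, 'k) free_alg"
  proof -
    have "\<ominus>\<^bsub>klr_free \<beta>\<^esub> f = - f"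
      using a_minus_klr_free[OF klr_free_closed(1) that] minus_eq[of 0 f] that l_zero[of "\<ominus>\<^bsub>klr_free \<beta>\<^esub> f"]
      by (auto intro: klr_free_closed)
    then show ?thesis by (simp add: a_inv_def)
  qed
  have "ideal ?I (klr_free \<beta>)"
  proof (rule idealI[OF ring_klr_free])
    show "subgroup ?I (add_monoid (klr_free \<beta>))"
    proof (rule group.subgroupI[OF add.is_group])
      have "0 \<in> ?I" by (simp add: klr_free_closed)
      then show "?I \<noteq> {}" by blast
      fix f assume f: "f \<in> ?I"
      then show "inv\<^bsub>add_monoid (klr_free \<beta>)\<^esub> f \<in> ?I"
        by (subst inv) (auto simp: \<Phi>_uminus intro: klr_free_closed)
      show "f \<otimes>\<^bsub>add_monoid (klr_free \<beta>)\<^esub> g \<in> ?I" if "g \<in> ?I" for g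
        using f that by (auto simp: \<Phi>_add intro: klr_free_closed)
    qed auto
  qed (auto simp: \<Phi>_mult intro: klr_free_closed)
  moreover have "{a - b |a b. klr_rel Q \<beta> a b} \<subseteq> ?I"
  proof -
    have "a - b \<in> ?I" if "klr_rel Q \<beta> a b" for a b
      using klr_rel_closed[OF that] \<Phi>_rel[OF that] \<Phi>_diff[of a b] by (simp add: klr_free_closed)
    then show ?thesis by blast
  qed
  ultimately have "klr_ideal Q \<beta> \<subseteq> ?I"
    unfolding klr_ideal_def by (rule genideal_minimal)
  then show ?thesis using assms by auto
qed

lemma \<Phi>_cong:
  assumes "f \<in> carrier (klr_free \<beta>)" "g \<in> carrier (klr_free \<beta>)" "klr_class Q \<beta> f = klr_class Q \<beta> g"
  shows "\<Phi> f = \<Phi> g"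
  using \<Phi>_ideal[of "f - g"] klr_class_eq_iff[OF assms(1,2), of Q] assms(3) \<Phi>_diff[OF assms(1,2)] by simp

end

lemma bij_betw_imageI_right:
  assumes "\<And>\<mu>. \<mu> \<in> A \<Longrightarrow> f (g \<mu>) = h \<mu>" "inj_on h A"
  shows "bij_betw f (g ` A) (h ` A)"
proof -
  have "inj_on f (g ` A)" by (rule inj_onI) (use assms in \<open>auto dest: inj_onD\<close>)
  then show ?thesis using assms(1) by (auto simp: bij_betw_def image_image)
qed

lemma swap_cpt_append_left:
  assumes "1 \<le> k" "k < length \<nu>"
  shows "swap_cpt (length \<mu> + k) (\<nu> @ \<mu>) = swap_cpt k \<nu> @ \<mu>"
proof (rule cpt_ext)
  fix p assume "1 \<le> p" "p \<le> length (swap_cpt k \<nu> @ \<mu>)"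
  then show "cpt (swap_cpt (length \<mu> + k) (\<nu> @ \<mu>)) p = cpt (swap_cpt k \<nu> @ \<mu>) p"
    using assms by (auto simp: cpt_swap_cpt cpt_append transpose_def)
qed simp

lemma swap_cpt_append_right:
  assumes "1 \<le> k" "k < length \<nu>"
  shows "swap_cpt k (\<mu> @ \<nu>) = \<mu> @ swap_cpt k \<nu>"
proof (rule cpt_ext)
  fix p assume "1 \<le> p" "p \<le> length (\<mu> @ swap_cpt k \<nu>)"
  then show "cpt (swap_cpt k (\<mu> @ \<nu>)) p = cpt (\<mu> @ swap_cpt k \<nu>) p"
    using assms by (auto simp: cpt_swap_cpt cpt_append transpose_def)
qed simp

lemma append_perm:
  "\<mu> \<in> permutations_of_multiset \<beta> \<Longrightarrow> \<nu> \<in> permutations_of_multiset \<gamma> \<Longrightarrow>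
    \<mu> @ \<nu> \<in> permutations_of_multiset (\<beta> + \<gamma>)"
  by (simp add: permutations_of_multiset_def)

text \<open>Places are counted from the right, so the left factor occupies those beyond
  \<open>size \<gamma>\<close>, while the right factor keeps its indices.\<close>

interpretation L: klr_block Q \<beta> "\<beta> + \<gamma>" "size \<gamma>"
    "\<lambda>\<nu>. (@) \<nu> ` permutations_of_multiset \<gamma>" "left_gen \<gamma>"
  for Q :: "'i \<Rightarrow> 'i \<Rightarrow> 'k::comm_ring_1 poly poly" and \<beta> \<gamma>
proof
  fix \<nu> assume \<nu>: "\<nu> \<in> permutations_of_multiset \<beta>"
  note len = length_permutation
  show "left_gen \<gamma> (IdemG \<nu>) = (\<Sum>w\<in>(@) \<nu> ` permutations_of_multiset \<gamma>. idm w)"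
    by (subst sum.reindex) (auto simp: inj_on_def)
  show "(@) \<nu> ` permutations_of_multiset \<gamma> \<subseteq> permutations_of_multiset (\<beta> + \<gamma>)"
    using \<nu> by (auto intro: append_perm)
  show "(@) \<nu> ` permutations_of_multiset \<gamma> \<inter> (@) \<mu> ` permutations_of_multiset \<gamma> = {}"
    if "\<mu> \<in> permutations_of_multiset \<beta>" "\<nu> \<noteq> \<mu>" for \<mu>
    using that len[OF \<nu>] len[OF that(1)] by auto
  show "cpt w (size \<gamma> + k) = cpt \<nu> k"
    if "w \<in> (@) \<nu> ` permutations_of_multiset \<gamma>" "k \<in> {1..size \<beta>}" for w k
    using that len[OF \<nu>] len[of _ \<gamma>] by (auto simp: cpt_append)
  show "bij_betw (swap_cpt (size \<gamma> + k)) ((@) \<nu> ` permutations_of_multiset \<gamma>)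
    ((@) (swap_cpt k \<nu>) ` permutations_of_multiset \<gamma>)" if "k \<in> {1..<size \<beta>}" for k
  proof (rule bij_betw_imageI_right)
    show "swap_cpt (size \<gamma> + k) (\<nu> @ \<mu>) = swap_cpt k \<nu> @ \<mu>"
      if "\<mu> \<in> permutations_of_multiset \<gamma>" for \<mu>
      using swap_cpt_append_left[of k \<nu> \<mu>] \<open>k \<in> {1..<size \<beta>}\<close> len[OF \<nu>] len[OF that] by simp
  qed (auto intro: inj_onI)
qed auto

interpretation R: klr_block Q \<gamma> "\<beta> + \<gamma>" 0
    "\<lambda>\<nu>. (\<lambda>\<mu>. \<mu> @ \<nu>) ` permutations_of_multiset \<beta>" "right_gen \<beta>"
  for Q :: "'i \<Rightarrow> 'i \<Rightarrow> 'k::comm_ring_1 poly poly" and \<beta> \<gamma>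
proof
  fix \<nu> assume \<nu>: "\<nu> \<in> permutations_of_multiset \<gamma>"
  note len = length_permutation
  show "right_gen \<beta> (IdemG \<nu>) = (\<Sum>w\<in>(\<lambda>\<mu>. \<mu> @ \<nu>) ` permutations_of_multiset \<beta>. idm w)"
    by (subst sum.reindex) (auto simp: inj_on_def)
  show "(\<lambda>\<mu>. \<mu> @ \<nu>) ` permutations_of_multiset \<beta> \<subseteq> permutations_of_multiset (\<beta> + \<gamma>)"
    using \<nu> by (auto intro: append_perm)
  show "(\<lambda>\<mu>. \<mu> @ \<nu>) ` permutations_of_multiset \<beta> \<inter> (\<lambda>\<mu>. \<mu> @ \<rho>) ` permutations_of_multiset \<beta> = {}"
    if "\<rho> \<in> permutations_of_multiset \<gamma>" "\<nu> \<noteq> \<rho>" for \<rho>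
    using that len[OF \<nu>] len[OF that(1)] by auto
  show "cpt w (0 + k) = cpt \<nu> k"
    if "w \<in> (\<lambda>\<mu>. \<mu> @ \<nu>) ` permutations_of_multiset \<beta>" "k \<in> {1..size \<gamma>}" for w k
    using that len[OF \<nu>] len[of _ \<beta>] by (auto simp: cpt_append)
  show "bij_betw (swap_cpt (0 + k)) ((\<lambda>\<mu>. \<mu> @ \<nu>) ` permutations_of_multiset \<beta>)
    ((\<lambda>\<mu>. \<mu> @ swap_cpt k \<nu>) ` permutations_of_multiset \<beta>)" if "k \<in> {1..<size \<gamma>}" for k
    using that len[OF \<nu>] swap_cpt_append_right[of k \<nu>]
    by (intro bij_betw_imageI_right) (auto intro: inj_onI)
qed auto

lemma idem2_closed: "idem2 \<beta> \<gamma> \<in> carrier (klr_free (\<beta> + \<gamma>))"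
  unfolding idem2_def by (intro klr_free_sum idm_closed append_perm)

lemma L_J: "L.J Q \<beta> \<gamma> = cl Q (\<beta> + \<gamma>) (idem2 \<beta> \<gamma>)"
  unfolding L.J_closed by (simp add: idem2_def)

lemma R_J: "R.J Q \<gamma> \<beta> = cl Q (\<beta> + \<gamma>) (idem2 \<beta> \<gamma>)"
  unfolding R.J_closed by (simp add: idem2_def sum.swap[of _ "permutations_of_multiset \<gamma>"])

lemma mem_klr_class:
  assumes "f \<in> carrier (klr_free \<beta>)"
  shows "f' \<in> klr_class Q \<beta> f \<longleftrightarrow> f' \<in> carrier (klr_free \<beta>) \<and> klr_class Q \<beta> f' = klr_class Q \<beta> f"
proof -
  interpret I: ideal "klr_ideal Q \<beta>" "klr_free \<beta>" by (rule ideal_klr_ideal)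
  show ?thesis
    using I.a_repr_independence'[OF _ assms] I.a_rcos_self
      I.a_elemrcos_carrier[OF assms] unfolding klr_class_def by metis
qed

text \<open>The truncated product is the product of the two maps \<open>\<Phi>\<close> for the left
  and the right factor: both have the same \<open>J\<close>, which is idempotent and commutes with
  the images. Each of them depends only on the class of its argument, so \<open>the_elem\<close> is
  applied to a singleton.\<close>

lemma diamond_class:
  assumes f: "f \<in> carrier (klr_free \<beta>)" and g: "g \<in> carrier (klr_free \<gamma>)"
  shows "diamond Q \<beta> \<gamma> (klr_class Q \<beta> f) (klr_class Q \<gamma> g) = klr_class Q (\<beta> + \<gamma>)
     (free_subst (left_gen \<gamma>) f * free_subst (right_gen \<beta>) g * idem2 \<beta> \<gamma>)"
proof -
  let ?D = "\<lambda>f g. free_subst (left_gen \<gamma>) f * free_subst (right_gen \<beta>) g * idem2 \<beta> \<gamma>"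
  have closed: "?D f' g' \<in> carrier (klr_free (\<beta> + \<gamma>))"
    if "f' \<in> carrier (klr_free \<beta>)" "g' \<in> carrier (klr_free \<gamma>)" for f' g'
    using that by (intro klr_free_closed L.fs_closed R.fs_closed idem2_closed)
  have D: "cl Q (\<beta> + \<gamma>) (?D f' g') = L.\<Phi> Q \<beta> \<gamma> f' * R.\<Phi> Q \<gamma> \<beta> g'"
    if "f' \<in> carrier (klr_free \<beta>)" "g' \<in> carrier (klr_free \<gamma>)" for f' g'
  proof -
    let ?J = "cl Q (\<beta> + \<gamma>) (idem2 \<beta> \<gamma>)"
    have JJ: "?J * ?J = ?J" using L.J_J[of Q \<beta> \<gamma>] by (simp add: L_J)
    have Jg: "cl Q (\<beta> + \<gamma>) (free_subst (right_gen \<beta>) g') * ?J = ?J * cl Q (\<beta> + \<gamma>) (free_subst (right_gen \<beta>) g')"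
      using R.fs_J[OF that(2), of Q \<beta>] by (simp add: R_J)
    have "L.\<Phi> Q \<beta> \<gamma> f' * R.\<Phi> Q \<gamma> \<beta> g'
      = cl Q (\<beta> + \<gamma>) (free_subst (left_gen \<gamma>) f') * (?J * cl Q (\<beta> + \<gamma>) (free_subst (right_gen \<beta>) g')) * ?J"
      by (simp add: L.\<Phi>_def R.\<Phi>_def L_J R_J mult.assoc)
    also have "\<dots> = cl Q (\<beta> + \<gamma>) (free_subst (left_gen \<gamma>) f') * cl Q (\<beta> + \<gamma>) (free_subst (right_gen \<beta>) g') * ?J"
      unfolding Jg[symmetric] by (simp add: mult.assoc JJ)
    also have "\<dots> = cl Q (\<beta> + \<gamma>) (?D f' g')"
      using that by (simp add: cl_mult klr_free_closed L.fs_closed R.fs_closed idem2_closed)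
    finally show ?thesis by simp
  qed
  have eq: "klr_class Q (\<beta> + \<gamma>) (?D f' g') = klr_class Q (\<beta> + \<gamma>) (?D f g)"
    if "f' \<in> klr_class Q \<beta> f" "g' \<in> klr_class Q \<gamma> g" for f' g'
  proof -
    have f': "f' \<in> carrier (klr_free \<beta>)" "klr_class Q \<beta> f' = klr_class Q \<beta> f"
      and g': "g' \<in> carrier (klr_free \<gamma>)" "klr_class Q \<gamma> g' = klr_class Q \<gamma> g"
      using that mem_klr_class[OF f] mem_klr_class[OF g] by auto
    have "cl Q (\<beta> + \<gamma>) (?D f' g') = cl Q (\<beta> + \<gamma>) (?D f g)"
      unfolding D[OF f'(1) g'(1)] D[OF f g]
      using L.\<Phi>_cong[OF f'(1) f f'(2), of \<gamma>] R.\<Phi>_cong[OF g'(1) g g'(2), of \<beta>] by simp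
    then show ?thesis using cl_eq_iff[OF closed[OF f'(1) g'(1)] closed[OF f g]] by blast
  qed
  have "f \<in> klr_class Q \<beta> f" "g \<in> klr_class Q \<gamma> g"
    using mem_klr_class f g by auto
  then have "(\<lambda>_. klr_class Q (\<beta> + \<gamma>) (?D f g)) ` (klr_class Q \<beta> f \<times> klr_class Q \<gamma> g)
      = {klr_class Q (\<beta> + \<gamma>) (?D f g)}" by auto
  moreover have "(\<lambda>(f, g). klr_class Q (\<beta> + \<gamma>) (?D f g)) ` (klr_class Q \<beta> f \<times> klr_class Q \<gamma> g)
      = (\<lambda>_. klr_class Q (\<beta> + \<gamma>) (?D f g)) ` (klr_class Q \<beta> f \<times> klr_class Q \<gamma> g)"
    by (rule image_cong[OF refl]) (clarsimp simp: eq)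
  ultimately show ?thesis unfolding diamond_def by simp
qed

section \<open>Functoriality of the tensor product\<close>

text \<open>The closure properties that place the generators of \<open>tensor_null\<close> in the
  free abelian group; imposed on both factors.\<close>

definition bilinear_closed :: "('r, 'x) ring_scheme \<Rightarrow> ('r, 'n, 'y) module_scheme \<Rightarrow> bool" where
  "bilinear_closed R N \<longleftrightarrow> (\<forall>a\<in>carrier N. \<forall>b\<in>carrier N. a \<oplus>\<^bsub>N\<^esub> b \<in> carrier N)
    \<and> (\<forall>r\<in>carrier R. \<forall>a\<in>carrier N. r \<odot>\<^bsub>N\<^esub> a \<in> carrier N)"

definition linear_map :: "('r, 'x) ring_scheme \<Rightarrow> ('r, 'n, 'y) module_scheme \<Rightarrow>
    ('r, 'n, 'y) module_scheme \<Rightarrow> ('n \<Rightarrow> 'n) \<Rightarrow> bool" where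
  "linear_map R N N' f \<longleftrightarrow> f \<in> carrier N \<rightarrow> carrier N'
    \<and> (\<forall>a\<in>carrier N. \<forall>b\<in>carrier N. f (a \<oplus>\<^bsub>N\<^esub> b) = f a \<oplus>\<^bsub>N'\<^esub> f b)
    \<and> (\<forall>r\<in>carrier R. \<forall>a\<in>carrier N. f (r \<odot>\<^bsub>N\<^esub> a) = r \<odot>\<^bsub>N'\<^esub> f a)"

abbreviation tensor_free :: "('r, 'n, 'y) module_scheme \<Rightarrow> ('r, 'm, 'z) module_scheme \<Rightarrow>
    ('n \<times> 'm \<Rightarrow>\<^sub>0 int) monoid" where
  "tensor_free N M \<equiv> free_Abelian_group (carrier N \<times> carrier M)"

abbreviation frag_map :: "('n \<Rightarrow> 'n) \<Rightarrow> ('n \<times> 'm \<Rightarrow>\<^sub>0 int) \<Rightarrow> ('n \<times> 'm \<Rightarrow>\<^sub>0 int)" where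
  "frag_map f \<equiv> frag_extend (\<lambda>(a, m). frag_of (f a, m))"

lemma keys_frag_add:
  "Poly_Mapping.keys a \<subseteq> S \<Longrightarrow> Poly_Mapping.keys b \<subseteq> S \<Longrightarrow> Poly_Mapping.keys (a + b) \<subseteq> S"
  "Poly_Mapping.keys a \<subseteq> S \<Longrightarrow> Poly_Mapping.keys b \<subseteq> S \<Longrightarrow> Poly_Mapping.keys (a - b) \<subseteq> S"
  for a b :: "'x \<Rightarrow>\<^sub>0 int"
  using keys_add[of a b] keys_diff[of a b] by auto

context
  fixes R :: "('r, 'x) ring_scheme" and M :: "('r, 'm, 'z) module_scheme"
  assumes M: "bilinear_closed R M"
begin

lemma tensor_null_subgroup:
  assumes N: "bilinear_closed R N"
  shows "subgroup (tensor_null R N M) (tensor_free N M)"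
  unfolding tensor_null_def
proof (rule group.generate_is_subgroup[OF group_free_Abelian_group])
  show "{frag_of (a \<oplus>\<^bsub>N\<^esub> b, m) - frag_of (a, m) - frag_of (b, m) |a b m.
         a \<in> carrier N \<and> b \<in> carrier N \<and> m \<in> carrier M} \<union>
      {frag_of (a, m \<oplus>\<^bsub>M\<^esub> l) - frag_of (a, m) - frag_of (a, l) |a m l.
         a \<in> carrier N \<and> m \<in> carrier M \<and> l \<in> carrier M} \<union>
      {frag_of (r \<odot>\<^bsub>N\<^esub> a, m) - frag_of (a, r \<odot>\<^bsub>M\<^esub> m) |r a m.
         r \<in> carrier R \<and> a \<in> carrier N \<and> m \<in> carrier M} \<subseteq> carrier (tensor_free N M)"
    (is "?X \<subseteq> _")
  proof
    fix h assume "h \<in> ?X"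
    then have "Poly_Mapping.keys h \<subseteq> carrier N \<times> carrier M"
      by (elim UnE CollectE exE conjE; hypsubst; intro keys_frag_add)
        (use M N in \<open>auto simp: bilinear_closed_def keys_frag_of\<close>)
    then show "h \<in> carrier (tensor_free N M)" by simp
  qed
qed

lemma tensor_null_normal:
  assumes "bilinear_closed R N"
  shows "tensor_null R N M \<lhd> tensor_free N M"
  using tensor_null_subgroup[OF assms] abelian_free_Abelian_group
  by (rule comm_group.normal_iff_subgroup[THEN iffD2, rotated])

lemma tensor_carrierE:
  assumes "T \<in> carrier (tensor_group R N M)"
  obtains c where "Poly_Mapping.keys c \<subseteq> carrier N \<times> carrier M" "T = tensor_class R N M c"
  using assms unfolding tensor_group_def tensor_class_def FactGroup_def RCOSETS_def by auto

lemma tensor_class_closed: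
  "Poly_Mapping.keys c \<subseteq> carrier N \<times> carrier M \<Longrightarrow>
    tensor_class R N M c \<in> carrier (tensor_group R N M)"
  unfolding tensor_group_def tensor_class_def FactGroup_def RCOSETS_def by auto

lemma tensor_class_add:
  assumes "bilinear_closed R N"
    and "Poly_Mapping.keys c \<subseteq> carrier N \<times> carrier M" "Poly_Mapping.keys d \<subseteq> carrier N \<times> carrier M"
  shows "tensor_class R N M c \<otimes>\<^bsub>tensor_group R N M\<^esub> tensor_class R N M d = tensor_class R N M (c + d)"
  using normal.rcos_sum[OF tensor_null_normal[OF assms(1)], of c d] assms(2,3)
  unfolding tensor_group_def tensor_class_def FactGroup_def by simp

lemma tensor_class_0:
  assumes "bilinear_closed R N"
  shows "\<one>\<^bsub>tensor_group R N M\<^esub> = tensor_class R N M 0"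
  using group.coset_mult_one[OF group_free_Abelian_group subgroup.subset[OF tensor_null_subgroup[OF assms]]]
  unfolding tensor_group_def tensor_class_def FactGroup_def by simp

lemma group_tensor_group: "bilinear_closed R N \<Longrightarrow> group (tensor_group R N M)"
  unfolding tensor_group_def by (intro normal.factorgroup_is_group tensor_null_normal)

lemma tensor_class_eqI:
  assumes N: "bilinear_closed R N"
    and "Poly_Mapping.keys c \<subseteq> carrier N \<times> carrier M" "Poly_Mapping.keys d \<subseteq> carrier N \<times> carrier M"
    and "c - d \<in> tensor_null R N M"
  shows "tensor_class R N M c = tensor_class R N M d"
proof -
  have "c \<in> tensor_null R N M #>\<^bsub>tensor_free N M\<^esub> d"
    unfolding r_coset_def using assms(4) by (auto intro!: bexI[of _ "c - d"])
  then show ?thesis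
    unfolding tensor_class_def
    using group.repr_independence[OF group_free_Abelian_group _ _ tensor_null_subgroup[OF N]] assms(3)
    by (metis carrier_free_Abelian_group_iff)
qed

lemma mem_tensor_class:
  assumes N: "bilinear_closed R N" and c: "Poly_Mapping.keys c \<subseteq> carrier N \<times> carrier M"
  shows "d \<in> tensor_class R N M c \<longleftrightarrow> d - c \<in> tensor_null R N M"
  unfolding tensor_class_def r_coset_def by (auto intro: bexI[of _ "d - c"])

lemma tensor_null_keys:
  assumes "bilinear_closed R N" "d \<in> tensor_null R N M"
  shows "Poly_Mapping.keys d \<subseteq> carrier N \<times> carrier M"
  using subsetD[OF subgroup.subset[OF tensor_null_subgroup[OF assms(1)]] assms(2)]
  by (simp only: carrier_free_Abelian_group_iff)

lemma frag_map_keys: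
  assumes "f \<in> carrier N \<rightarrow> carrier N'" "Poly_Mapping.keys c \<subseteq> carrier N \<times> carrier M"
  shows "Poly_Mapping.keys (frag_map f c) \<subseteq> carrier N' \<times> carrier M"
  using keys_frag_extend[of "\<lambda>(a, m). frag_of (f a, m)" c] assms by (fastforce simp: keys_frag_of)

text \<open>A linear \<open>f\<close> carries each kind of generator of \<open>tensor_null\<close>
  to a generator of the same kind.\<close>

lemma frag_map_null:
  assumes N: "bilinear_closed R N" and N': "bilinear_closed R N'" and f: "linear_map R N N' f"
    and d: "d \<in> tensor_null R N M"
  shows "frag_map f d \<in> tensor_null R N' M"
proof -
  interpret S: subgroup "tensor_null R N' M" "tensor_free N' M"
    by (rule tensor_null_subgroup[OF N'])
  let ?X = "\<lambda>N. {frag_of (a \<oplus>\<^bsub>N\<^esub> b, m) - frag_of (a, m) - frag_of (b, m) |a b m.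
         a \<in> carrier N \<and> b \<in> carrier N \<and> m \<in> carrier M} \<union>
      {frag_of (a, m \<oplus>\<^bsub>M\<^esub> l) - frag_of (a, m) - frag_of (a, l) |a m l.
         a \<in> carrier N \<and> m \<in> carrier M \<and> l \<in> carrier M} \<union>
      {frag_of (r \<odot>\<^bsub>N\<^esub> a, m) - frag_of (a, r \<odot>\<^bsub>M\<^esub> m) |r a m.
         r \<in> carrier R \<and> a \<in> carrier N \<and> m \<in> carrier M}"
  have gen: "frag_map f h \<in> tensor_null R N' M" if "h \<in> ?X N" for h
  proof -
    have fc: "f a \<in> carrier N'" if "a \<in> carrier N" for a
      using f that by (auto simp: linear_map_def)
    have "frag_map f h \<in> ?X N'"
      using that
    proof (elim UnE CollectE exE conjE)
      fix a b m assume *: "h = frag_of (a \<oplus>\<^bsub>N\<^esub> b, m) - frag_of (a, m) - frag_of (b, m)"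
        "a \<in> carrier N" "b \<in> carrier N" "m \<in> carrier M"
      have "frag_map f h = frag_of (f a \<oplus>\<^bsub>N'\<^esub> f b, m) - frag_of (f a, m) - frag_of (f b, m)"
        using f * by (simp add: frag_extend_diff linear_map_def)
      then show ?thesis using * fc by blast
    next
      fix a m l assume *: "h = frag_of (a, m \<oplus>\<^bsub>M\<^esub> l) - frag_of (a, m) - frag_of (a, l)"
        "a \<in> carrier N" "m \<in> carrier M" "l \<in> carrier M"
      have "frag_map f h = frag_of (f a, m \<oplus>\<^bsub>M\<^esub> l) - frag_of (f a, m) - frag_of (f a, l)"
        using * by (simp add: frag_extend_diff)
      then show ?thesis using * fc by blast
    next
      fix r a m assume *: "h = frag_of (r \<odot>\<^bsub>N\<^esub> a, m) - frag_of (a, r \<odot>\<^bsub>M\<^esub> m)"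
        "r \<in> carrier R" "a \<in> carrier N" "m \<in> carrier M"
      have "frag_map f h = frag_of (r \<odot>\<^bsub>N'\<^esub> f a, m) - frag_of (f a, r \<odot>\<^bsub>M\<^esub> m)"
        using f * by (simp add: frag_extend_diff linear_map_def)
      then show ?thesis using * fc by blast
    qed
    then show ?thesis unfolding tensor_null_def by (rule generate.incl)
  qed
  have "d \<in> generate (tensor_free N M) (?X N)" using d unfolding tensor_null_def .
  then show ?thesis
  proof induction
    case one
    then show ?case using S.one_closed by simp
  next
    case (incl h)
    then show ?case by (rule gen)
  next
    case (inv h)
    have "h \<in> tensor_null R N M" unfolding tensor_null_def by (rule generate.incl) (rule inv)
    then have "inv\<^bsub>tensor_free N M\<^esub> h = - h" using tensor_null_keys[OF N] by simp
    moreover have "frag_map f h \<in> tensor_null R N' M" using inv by (rule gen)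
    then have "- frag_map f h \<in> tensor_null R N' M"
      using S.m_inv_closed tensor_null_keys[OF N'] by fastforce
    ultimately show ?case by (simp add: frag_extend_minus)
  next
    case (eng h1 h2)
    then show ?case using S.m_closed by (simp add: frag_extend_add)
  qed
qed

lemma tensor_map_class:
  assumes N: "bilinear_closed R N" and N': "bilinear_closed R N'" and f: "linear_map R N N' f"
    and c: "Poly_Mapping.keys c \<subseteq> carrier N \<times> carrier M"
  shows "tensor_map R N' M f (tensor_class R N M c) = tensor_class R N' M (frag_map f c)"
proof -
  have f': "f \<in> carrier N \<rightarrow> carrier N'" using f by (simp add: linear_map_def)
  have eq: "tensor_class R N' M (frag_map f d) = tensor_class R N' M (frag_map f c)"
    if "d \<in> tensor_class R N M c" for d
  proof (rule tensor_class_eqI[OF N'])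
    have null: "d - c \<in> tensor_null R N M" using that mem_tensor_class[OF N c] by simp
    have "Poly_Mapping.keys (d - c + c) \<subseteq> carrier N \<times> carrier M"
      using tensor_null_keys[OF N null] c by (rule keys_frag_add)
    then show "Poly_Mapping.keys (frag_map f d) \<subseteq> carrier N' \<times> carrier M"
      by (intro frag_map_keys[OF f']) simp
    show "Poly_Mapping.keys (frag_map f c) \<subseteq> carrier N' \<times> carrier M"
      using c by (rule frag_map_keys[OF f'])
    show "frag_map f d - frag_map f c \<in> tensor_null R N' M"
      using frag_map_null[OF N N' f null] by (simp add: frag_extend_diff)
  qed
  have "c \<in> tensor_class R N M c"
    using mem_tensor_class[OF N c] subgroup.one_closed[OF tensor_null_subgroup[OF N]] by simp
  moreover have "(\<lambda>c. tensor_class R N' M (frag_map f c)) ` tensor_class R N M c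
      = (\<lambda>_. tensor_class R N' M (frag_map f c)) ` tensor_class R N M c"
    by (rule image_cong[OF refl]) (rule eq)
  ultimately have "(\<lambda>c. tensor_class R N' M (frag_map f c)) ` tensor_class R N M c
      = {tensor_class R N' M (frag_map f c)}" by auto
  then show ?thesis unfolding tensor_map_def by simp
qed

lemma tensor_map_closed:
  assumes "bilinear_closed R N" "bilinear_closed R N'" "linear_map R N N' f"
    "T \<in> carrier (tensor_group R N M)"
  shows "tensor_map R N' M f T \<in> carrier (tensor_group R N' M)"
proof -
  obtain c where c: "Poly_Mapping.keys c \<subseteq> carrier N \<times> carrier M" "T = tensor_class R N M c"
    using assms(4) by (rule tensor_carrierE)
  have "Poly_Mapping.keys (frag_map f c) \<subseteq> carrier N' \<times> carrier M"
    using c(1) assms(3) by (intro frag_map_keys) (auto simp: linear_map_def)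
  then show ?thesis
    unfolding c(2) tensor_map_class[OF assms(1-3) c(1)] by (rule tensor_class_closed)
qed

lemma tensor_map_add:
  assumes "bilinear_closed R N" "bilinear_closed R N'" "linear_map R N N' f"
    "S \<in> carrier (tensor_group R N M)" "T \<in> carrier (tensor_group R N M)"
  shows "tensor_map R N' M f (S \<otimes>\<^bsub>tensor_group R N M\<^esub> T)
    = tensor_map R N' M f S \<otimes>\<^bsub>tensor_group R N' M\<^esub> tensor_map R N' M f T"
proof -
  obtain c where c: "Poly_Mapping.keys c \<subseteq> carrier N \<times> carrier M" "S = tensor_class R N M c"
    using assms(4) by (rule tensor_carrierE)
  obtain d where d: "Poly_Mapping.keys d \<subseteq> carrier N \<times> carrier M" "T = tensor_class R N M d"
    using assms(5) by (rule tensor_carrierE)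
  have k: "Poly_Mapping.keys (frag_map f e) \<subseteq> carrier N' \<times> carrier M"
    if "Poly_Mapping.keys e \<subseteq> carrier N \<times> carrier M" for e
    using that assms(3) by (intro frag_map_keys) (auto simp: linear_map_def)
  show ?thesis
    using c(1) d(1) keys_frag_add(1)[OF c(1) d(1)]
    by (simp add: c(2) d(2) tensor_class_add assms(1,2) tensor_map_class[OF assms(1-3)] k frag_extend_add)
qed

lemma tensor_map_comp:
  assumes "bilinear_closed R N" "bilinear_closed R N'" "bilinear_closed R N''"
    "linear_map R N N' f" "linear_map R N' N'' g" "T \<in> carrier (tensor_group R N M)"
  shows "tensor_map R N'' M g (tensor_map R N' M f T) = tensor_map R N'' M (\<lambda>a. g (f a)) T"
proof -
  obtain c where c: "Poly_Mapping.keys c \<subseteq> carrier N \<times> carrier M" "T = tensor_class R N M c"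
    using assms(6) by (rule tensor_carrierE)
  have gf: "linear_map R N N'' (\<lambda>a. g (f a))"
    using assms(4,5) unfolding linear_map_def by (auto simp: Pi_iff)
  have "Poly_Mapping.keys (frag_map f c) \<subseteq> carrier N' \<times> carrier M"
    using c(1) assms(4) by (intro frag_map_keys) (auto simp: linear_map_def)
  moreover have "frag_map g (frag_map f c) = frag_map (\<lambda>a. g (f a)) c"
    using frag_extend_compose[of "\<lambda>(a, m). frag_of (g a, m)" "\<lambda>(a, m). (f a, m)" c]
    by (simp add: comp_def case_prod_unfold)
  ultimately show ?thesis
    unfolding c(2) tensor_map_class[OF assms(1,2,4) c(1)] tensor_map_class[OF assms(1,3) gf c(1)]
    by (simp add: tensor_map_class[OF assms(2,3,5)])
qed

text \<open>All representatives of a class are supported on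
  \<open>carrier N \<times> carrier M\<close>, so the values of the maps outside the carrier do not
  enter.\<close>

lemma tensor_map_cong:
  assumes "bilinear_closed R N" "T \<in> carrier (tensor_group R N M)"
    and "\<And>a. a \<in> carrier N \<Longrightarrow> f a = g a"
  shows "tensor_map R N' M f T = tensor_map R N' M g T"
proof -
  obtain c where c: "Poly_Mapping.keys c \<subseteq> carrier N \<times> carrier M" "T = tensor_class R N M c"
    using assms(2) by (rule tensor_carrierE)
  have "frag_map f d = frag_map g d" if "d \<in> T" for d
  proof (rule frag_extend_eq)
    have null: "d - c \<in> tensor_null R N M" using that c mem_tensor_class[OF assms(1) c(1)] by simp
    have "Poly_Mapping.keys (d - c + c) \<subseteq> carrier N \<times> carrier M"
      using tensor_null_keys[OF assms(1) null] c(1) by (rule keys_frag_add)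
    moreover fix x assume "x \<in> Poly_Mapping.keys d"
    ultimately show "(case x of (a, m) \<Rightarrow> frag_of (f a, m)) = (case x of (a, m) \<Rightarrow> frag_of (g a, m))"
      using assms(3) by auto
  qed
  then show ?thesis unfolding tensor_map_def by (simp cong: image_cong)
qed

text \<open>The defect \<open>frag_map h d - (frag_map f d + frag_map g d)\<close> is additive in
  \<open>d\<close>, and on a single pair it is a defining relation of the tensor product.\<close>

lemma tensor_map_sum:
  assumes "bilinear_closed R N" "bilinear_closed R N'" "linear_map R N N' f" "linear_map R N N' g"
    "linear_map R N N' h" "T \<in> carrier (tensor_group R N M)"
    and "\<And>a. a \<in> carrier N \<Longrightarrow> h a = f a \<oplus>\<^bsub>N'\<^esub> g a"
  shows "tensor_map R N' M f T \<otimes>\<^bsub>tensor_group R N' M\<^esub> tensor_map R N' M g T = tensor_map R N' M h T"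
proof -
  obtain c where c: "Poly_Mapping.keys c \<subseteq> carrier N \<times> carrier M" "T = tensor_class R N M c"
    using assms(6) by (rule tensor_carrierE)
  have k: "Poly_Mapping.keys (frag_map e d) \<subseteq> carrier N' \<times> carrier M"
    if "linear_map R N N' e" "Poly_Mapping.keys d \<subseteq> carrier N \<times> carrier M" for e d
    using that by (intro frag_map_keys) (auto simp: linear_map_def)
  interpret S: subgroup "tensor_null R N' M" "tensor_free N' M"
    by (rule tensor_null_subgroup[OF assms(2)])
  have "frag_map h d - (frag_map f d + frag_map g d) \<in> tensor_null R N' M"
    if "Poly_Mapping.keys d \<subseteq> carrier N \<times> carrier M" for d
    using that
  proof (induction d rule: frag_induction)
    case zero
    then show ?case using S.one_closed by simp
  next
    case (one x)
    obtain a m where x: "x = (a, m)" "a \<in> carrier N" "m \<in> carrier M" using one by (cases x) auto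
    have "f a \<in> carrier N'" "g a \<in> carrier N'" using assms(3,4) x by (auto simp: linear_map_def)
    then have "frag_of (f a \<oplus>\<^bsub>N'\<^esub> g a, m) - frag_of (f a, m) - frag_of (g a, m) \<in> tensor_null R N' M"
      unfolding tensor_null_def using x by (intro generate.incl UnI1) blast
    then show ?case using x assms(7) by (simp add: diff_diff_eq)
  next
    case (diff a b)
    let ?e = "\<lambda>d. frag_map h d - (frag_map f d + frag_map g d)"
    have "- ?e b \<in> tensor_null R N' M"
      using S.m_inv_closed[OF diff(2)] tensor_null_keys[OF assms(2) diff(2)] by simp
    from S.m_closed[OF diff(1) this] show ?case
      by (simp add: frag_extend_diff algebra_simps)
  qed
  from this[OF c(1)] have "tensor_class R N' M (frag_map h c) = tensor_class R N' M (frag_map f c + frag_map g c)"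
    using k[OF assms(5) c(1)] keys_frag_add(1)[OF k[OF assms(3) c(1)] k[OF assms(4) c(1)]]
    by (intro tensor_class_eqI[OF assms(2)])
  then show ?thesis
    unfolding c(2) tensor_map_class[OF assms(1,2,3) c(1)] tensor_map_class[OF assms(1,2,4) c(1)]
      tensor_map_class[OF assms(1,2,5) c(1)]
    using tensor_class_add[OF assms(2) k[OF assms(3) c(1)] k[OF assms(4) c(1)]] by simp
qed

end

section \<open>The complex\<close>

lemma perms_replicate: "permutations_of_multiset (replicate_mset a i) = {replicate a i}"
proof -
  have "xs = replicate a i" if "mset xs = replicate_mset a i" for xs
  proof -
    have "set xs \<subseteq> {i}" using that by (metis set_mset_mset set_mset_replicate_mset_subset empty_subsetI order_refl)
    moreover have "length xs = a" using that by (metis size_mset size_replicate_mset)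
    ultimately show ?thesis by (metis replicate_length_same singletonD subsetD)
  qed
  then show ?thesis by (auto simp: permutations_of_multiset_def)
qed

lemma klr_homog_closed:
  fixes a :: "('i, 'k::comm_ring_1) klr_elt"
  shows "klr_homog ip Q \<beta> d a \<Longrightarrow> a \<in> carrier (klr Q \<beta>)"
proof (induction rule: klr_homog.induct)
  case (zero d)
  then show ?case by (rule ring.ring_simprules(2)[OF ring_klr])
next
  case (add d a b)
  then show ?case by (intro ring.ring_simprules(1)[OF ring_klr])
next
  case (scale d a c)
  then show ?case by (intro ring.ring_simprules(5)[OF ring_klr] klr_class_closed klr_free_closed)
next
  case (mult d a e b)
  then show ?case by (intro ring.ring_simprules(5)[OF ring_klr])
qed (auto intro!: klr_class_closed klr_free_closed(6) klr_closed)

text \<open>The consequences of a KLR datum on which the argument runs. \<open>lam\<close> is the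
  leading coefficient of \<open>Q i j\<close> in \<open>u\<close> and \<open>mu\<close> its inverse;
  \<open>ip_ij\<close> and \<open>coroot\<close> express that the Cartan entry is
  \<open>- N\<close>, once for the degrees and once for the shifts.\<close>

locale klr_ad =
  fixes ip :: "'i \<Rightarrow> 'i \<Rightarrow> int" and Q :: "'i \<Rightarrow> 'i \<Rightarrow> 'k::comm_ring_1 poly poly"
    and i j :: 'i and m n N :: nat and lam mu :: 'k
  assumes ij: "i \<noteq> j"
    and Q_diag: "Q a a = 0"
    and Q_sym: "coeff (coeff (Q a b) r) s = coeff (coeff (Q b a) s) r"
    and Q_top: "coeff (Q i j) N = [:lam:]"
    and Q_deg: "s > N \<Longrightarrow> coeff (Q i j) s = 0"
    and unit: "lam * mu = 1"
    and n: "m * N < n"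
    and ip_ii: "ip i i = 2 * half_norm ip i"
    and ip_ij: "ip i j = - (half_norm ip i * int N)"
    and coroot: "cartan ip i j = - int N"
begin

abbreviation \<beta>0 :: "'i multiset" where "\<beta>0 \<equiv> replicate_mset m j"
abbreviation \<beta> :: "'i multiset" where "\<beta> \<equiv> replicate_mset m j + replicate_mset n i"
abbreviation H where "H \<equiv> klr Q \<beta>"
abbreviation R0 where "R0 \<equiv> klr Q \<beta>0"
abbreviation C where "C \<equiv> cl Q \<beta>"
abbreviation em where "em \<equiv> ring_emb H"

sublocale klr_string \<beta> Q "\<lambda>\<nu>. C (idm \<nu>)" "\<lambda>k. C (xv k)" "\<lambda>k. C (tau k)" "\<lambda>a. C (scalar a)" i j m n N lam
proof -
  interpret klr_relations \<beta> Q "\<lambda>\<nu>. C (idm \<nu>)" "\<lambda>k. C (xv k)" "\<lambda>k. C (tau k)" "\<lambda>a. C (scalar a)"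
    by (rule klr_relations_cl)
  show "klr_string \<beta> Q (\<lambda>\<nu>. C (idm \<nu>)) (\<lambda>k. C (xv k)) (\<lambda>k. C (tau k)) (\<lambda>a. C (scalar a)) i j m n N lam"
    by unfold_locales (use ij Q_diag Q_sym Q_top Q_deg n in auto)
qed

abbreviation u where "u k \<equiv> C (idm (vtx k))"

lemma flank_eq: "k \<le> n \<Longrightarrow> flank i (n - k) \<beta>0 k = \<beta>"
  by (rule multiset_eqI) auto

lemma em_hom:
  "a \<in> carrier H \<Longrightarrow> b \<in> carrier H \<Longrightarrow> em (a \<otimes>\<^bsub>H\<^esub> b) = em a * em b"
  "a \<in> carrier H \<Longrightarrow> b \<in> carrier H \<Longrightarrow> em (a \<oplus>\<^bsub>H\<^esub> b) = em a + em b"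
  using ring_emb_hom[OF ring_klr] by auto

lemma em_eq: "a \<in> carrier H \<Longrightarrow> b \<in> carrier H \<Longrightarrow> em a = em b \<Longrightarrow> a = b"
  using ring_emb_eq_iff[OF ring_klr] by blast

lemma em_class: "em (klr_class Q \<beta> f) = C f"
  by (simp add: cl_def)

text \<open>A tail \<open>g\<close> is carried along because \<open>C\<close> does not send the
  empty product to the ambient unit.\<close>

lemma C_prod_list:
  assumes "\<And>x g. x \<in> set xs \<Longrightarrow> g \<in> carrier (klr_free \<beta>) \<Longrightarrow>
      F x \<in> carrier (klr_free \<beta>) \<and> C (F x * g) = G x * C g"
    and "g \<in> carrier (klr_free \<beta>)"
  shows "prod_list (map F xs) * g \<in> carrier (klr_free \<beta>) \<and> C (prod_list (map F xs) * g) = prod_list (map G xs) * C g"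
  using assms(1)
proof (induction xs)
  case (Cons x xs)
  then have IH: "prod_list (map F xs) * g \<in> carrier (klr_free \<beta>)"
      "C (prod_list (map F xs) * g) = prod_list (map G xs) * C g" by auto
  show ?case
    using IH Cons.prems[of x "prod_list (map F xs) * g"] by (simp add: mult.assoc klr_free_closed(6))
qed (use assms(2) in simp)

lemma C_taus:
  assumes "set ks \<subseteq> {1..<m + n}" "g \<in> carrier (klr_free \<beta>)"
  shows "prod_list (map tau ks) * g \<in> carrier (klr_free \<beta>)"
    "C (prod_list (map tau ks) * g) = prod_list (map (\<lambda>k. C (tau k)) ks) * C g"
proof -
  have "prod_list (map tau ks) * g \<in> carrier (klr_free \<beta>)
    \<and> C (prod_list (map tau ks) * g) = prod_list (map (\<lambda>k. C (tau k)) ks) * C g"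
  proof (rule C_prod_list[OF _ assms(2)])
    fix x and g :: "('i, 'k) free_alg" assume "x \<in> set ks" "g \<in> carrier (klr_free \<beta>)"
    moreover from this have "(tau x :: ('i, 'k) free_alg) \<in> carrier (klr_free \<beta>)"
      using assms(1) by (intro tau_closed) auto
    ultimately show "(tau x :: ('i, 'k) free_alg) \<in> carrier (klr_free \<beta>) \<and> C (tau x * g) = C (tau x) * C g"
      by (simp add: cl_mult)
  qed
  then show "prod_list (map tau ks) * g \<in> carrier (klr_free \<beta>)"
    "C (prod_list (map tau ks) * g) = prod_list (map (\<lambda>k. C (tau k)) ks) * C g" by auto
qed

section \<open>The morphism from three blocks, made explicit\<close>

abbreviation subL where "subL k \<equiv> free_subst (left_gen (replicate_mset k i) :: _ \<Rightarrow> ('i, 'k) free_alg)"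
abbreviation subL' where "subL' \<equiv> free_subst (left_gen \<beta>0 :: _ \<Rightarrow> ('i, 'k) free_alg)"
abbreviation subR where "subR k \<equiv> free_subst (right_gen (replicate_mset (n - k) i) :: _ \<Rightarrow> ('i, 'k) free_alg)"
abbreviation subR' where "subR' k \<equiv> free_subst (right_gen (replicate_mset (n - k) i + \<beta>0) :: _ \<Rightarrow> ('i, 'k) free_alg)"
abbreviation J2 where "J2 k \<equiv> idem2 (replicate_mset (n - k) i + \<beta>0) (replicate_mset k i) :: ('i, 'k) free_alg"

text \<open>The map \<open>y \<mapsto> 1 \<diamondop> y \<diamondop> 1\<close> on representatives,
  before truncation: it shifts the indices by \<open>k\<close> and sends the only idempotent
  generator to \<open>idm (vtx k)\<close>.\<close>

abbreviation psi where "psi k f \<equiv> subL k (subR k f)"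

lemma sub_closed:
  assumes "k \<le> n"
  shows "f \<in> carrier (klr_free (replicate_mset (n - k) i)) \<Longrightarrow> subL k (subL' f) \<in> carrier (klr_free \<beta>)"
    "f \<in> carrier (klr_free \<beta>0) \<Longrightarrow> psi k f \<in> carrier (klr_free \<beta>)"
    "f \<in> carrier (klr_free (replicate_mset k i)) \<Longrightarrow> subR' k f \<in> carrier (klr_free \<beta>)"
    "J2 k \<in> carrier (klr_free \<beta>)"
  using L.fs_closed[of "subL' f" "replicate_mset (n - k) i + \<beta>0" "replicate_mset k i"]
    L.fs_closed[of f "replicate_mset (n - k) i" \<beta>0]
    L.fs_closed[of "subR k f" "replicate_mset (n - k) i + \<beta>0" "replicate_mset k i"]
    R.fs_closed[of f \<beta>0 "replicate_mset (n - k) i"]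
    R.fs_closed[of f "replicate_mset k i" "replicate_mset (n - k) i + \<beta>0"]
    idem2_closed[of "replicate_mset (n - k) i + \<beta>0" "replicate_mset k i"]
  by (simp_all add: flank_eq[OF assms])

text \<open>A block of a single colour has only one tuple, so all sums in the truncating idempotents
  collapse.\<close>

lemma subL_idem2: "subL k (idem2 (replicate_mset (n - k) i) \<beta>0) = idm (vtx k)"
  by (simp add: idem2_def perms_replicate vtx_def)

lemma u_J2:
  assumes "k \<le> n"
  shows "u k * C (J2 k) = u k" "C (J2 k) * u k = u k"
proof -
  let ?\<nu> = "replicate (n - k) i @ replicate m j"
  have \<nu>: "?\<nu> \<in> permutations_of_multiset (replicate_mset (n - k) i + \<beta>0)"
    by (simp add: permutations_of_multiset_def)
  show "u k * C (J2 k) = u k" "C (J2 k) * u k = u k"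
    using L.EF_J[OF \<nu>, of Q "replicate_mset k i"] unfolding L.EF_def L_J
    by (simp_all add: perms_replicate flank_eq[OF assms] vtx_def)
qed

lemma diamond3_class:
  assumes k: "k \<le> n" and f1: "f1 \<in> carrier (klr_free (replicate_mset (n - k) i))"
    and f: "f \<in> carrier (klr_free \<beta>0)" and f3: "f3 \<in> carrier (klr_free (replicate_mset k i))"
  shows "diamond3 Q (replicate_mset (n - k) i) \<beta>0 (replicate_mset k i)
      (klr_class Q (replicate_mset (n - k) i) f1) (klr_class Q \<beta>0 f) (klr_class Q (replicate_mset k i) f3)
    = klr_class Q \<beta> (subL k (subL' f1) * (psi k f * (idm (vtx k) * (subR' k f3 * J2 k))))"
proof -
  have "subL' f1 * subR k f * idem2 (replicate_mset (n - k) i) \<beta>0 \<in> carrier (klr_free (replicate_mset (n - k) i + \<beta>0))"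
    using f1 f by (intro klr_free_closed L.fs_closed R.fs_closed idem2_closed)
  then show ?thesis
    unfolding diamond3_def diamond_class[OF f1 f]
    by (simp add: diamond_class[OF _ f3] free_subst_mult subL_idem2 flank_eq[OF k] mult.assoc)
qed

definition D :: "nat \<Rightarrow> ('i, 'k) klr_elt \<Rightarrow> ('i, 'k) klr_elt" where
  "D k y = diamond3 Q (replicate_mset (n - k) i) \<beta>0 (replicate_mset k i)
     \<one>\<^bsub>klr Q (replicate_mset (n - k) i)\<^esub> y \<one>\<^bsub>klr Q (replicate_mset k i)\<^esub>"

lemma D_class:
  assumes k: "k \<le> n" and f: "f \<in> carrier (klr_free \<beta>0)"
  shows "D k (klr_class Q \<beta>0 f) \<in> carrier H" "em (D k (klr_class Q \<beta>0 f)) = C (psi k f) * u k"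
proof -
  have c: "idm (vtx k) \<in> carrier (klr_free \<beta>)" using k by (intro idm_closed vtx_perm)
  have eq: "D k (klr_class Q \<beta>0 f) = klr_class Q \<beta> (psi k f * (idm (vtx k) * J2 k))"
    using diamond3_class[OF k klr_free_closed(2) f klr_free_closed(2)]
    by (simp add: D_def klr_class_1)
  show "D k (klr_class Q \<beta>0 f) \<in> carrier H"
    unfolding eq using sub_closed[OF k] f c by (intro klr_class_closed klr_free_closed(6))
  show "em (D k (klr_class Q \<beta>0 f)) = C (psi k f) * u k"
    unfolding eq em_class
    by (simp only: cl_mult klr_free_closed(6) sub_closed(2)[OF k f] sub_closed(4)[OF k] c u_J2[OF k])
qed

lemma flank_idem_D: "flank_idem Q i (n - k) \<beta>0 k = D k \<one>\<^bsub>R0\<^esub>"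
  by (simp add: flank_idem_def D_def)

lemma flank_idem:
  assumes k: "k \<le> n"
  shows "flank_idem Q i (n - k) \<beta>0 k \<in> carrier H" "em (flank_idem Q i (n - k) \<beta>0 k) = u k"
proof -
  have c: "idm (vtx k) \<in> carrier (klr_free \<beta>)" using k by (intro idm_closed vtx_perm)
  show "flank_idem Q i (n - k) \<beta>0 k \<in> carrier H" "em (flank_idem Q i (n - k) \<beta>0 k) = u k"
    using D_class[OF k klr_free_closed(2)] cl_1_mult(1)[OF c]
    unfolding flank_idem_D klr_class_1[symmetric] by auto
qed

abbreviation dword :: "nat \<Rightarrow> ('i, 'k) free_alg" where
  "dword L \<equiv> prod_list (map (\<lambda>k. xv k ^ (k - 1)) [2..<Suc L]) * prod_list (map tau (longest_word L))"

lemma dword_closed: "dword L \<in> carrier (klr_free (replicate_mset L i))"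
  by (intro klr_free_closed prod_list_closed)
    (auto intro!: klr_free_power xv_closed tau_closed dest: set_longest_word)

lemma C_blk:
  assumes "off + L \<le> m + n" "g \<in> carrier (klr_free \<beta>)"
  shows "C (prod_list (map (\<lambda>q. xv (off + q) ^ (q - 1)) [2..<Suc L])
      * (prod_list (map (\<lambda>l. tau (off + l)) (longest_word L)) * g)) = blk off L * C g"
proof -
  let ?W = "prod_list (map tau (map ((+) off) (longest_word L)))"
  have W: "?W * g \<in> carrier (klr_free \<beta>)"
      "C (?W * g) = prod_list (map (\<lambda>k. C (tau k)) (map ((+) off) (longest_word L))) * C g"
    using C_taus[of "map ((+) off) (longest_word L)" g] assms set_longest_word by fastforce+
  have "C (prod_list (map (\<lambda>q. xv (off + q) ^ (q - 1)) [2..<Suc L]) * (?W * g))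
      = prod_list (map (\<lambda>q. C (xv (off + q)) ^ (q - 1)) [2..<Suc L]) * C (?W * g)"
  proof (rule conjunct2[OF C_prod_list[OF _ W(1)]])
    fix x and g :: "('i, 'k) free_alg" assume x: "x \<in> set [2..<Suc L]" and g: "g \<in> carrier (klr_free \<beta>)"
    have "(xv (off + x) :: ('i, 'k) free_alg) \<in> carrier (klr_free \<beta>)"
      using x assms(1) by (intro xv_closed) auto
    then show "(xv (off + x) ^ (x - 1) :: ('i, 'k) free_alg) \<in> carrier (klr_free \<beta>)
        \<and> C (xv (off + x) ^ (x - 1) * g) = C (xv (off + x)) ^ (x - 1) * C g"
      using g by (simp add: cl_power_mult klr_free_power)
  qed
  then show ?thesis
    unfolding W(2) by (simp add: blk_def mult.assoc comp_def)
qed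

lemma sub_dword:
  "subL k (subL' (dword L)) = prod_list (map (\<lambda>q. xv (k + m + q) ^ (q - 1)) [2..<Suc L])
      * prod_list (map (\<lambda>l. tau (k + m + l)) (longest_word L))"
  "subR' k (dword L) = prod_list (map (\<lambda>q. xv (0 + q) ^ (q - 1)) [2..<Suc L])
      * prod_list (map (\<lambda>l. tau (0 + l)) (longest_word L))"
  by (simp_all add: free_subst_mult free_subst_prod_list free_subst_power comp_def add.assoc)

definition epsilon :: "nat \<Rightarrow> ('i, 'k) klr_elt" where
  "epsilon k = diamond3 Q (replicate_mset (n - k) i) \<beta>0 (replicate_mset k i)
     (div_idem Q i (n - k)) \<one>\<^bsub>R0\<^esub> (div_idem Q i k)"

lemma epsilon:
  assumes k: "k \<le> n"
  shows "epsilon k \<in> carrier H" "em (epsilon k) = eps k"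
proof -
  have c: "idm (vtx k) \<in> carrier (klr_free \<beta>)" using k by (intro idm_closed vtx_perm)
  have eq: "epsilon k = klr_class Q \<beta> (subL k (subL' (dword (n - k))) * (idm (vtx k) * (subR' k (dword k) * J2 k)))"
    using diamond3_class[OF k dword_closed klr_free_closed(2) dword_closed]
    by (simp add: epsilon_def klr_class_1 div_idem_def)
  note cl = sub_closed(1)[OF k dword_closed] sub_closed(3)[OF k dword_closed] sub_closed(4)[OF k] c
  show "epsilon k \<in> carrier H"
    unfolding eq using cl by (intro klr_class_closed klr_free_closed(6))
  have "em (epsilon k) = blk (k + m) (n - k) * (u k * (blk 0 k * C (J2 k)))"
  proof -
    have "C (subR' k (dword k) * J2 k) = blk 0 k * C (J2 k)"
      unfolding sub_dword mult.assoc using k cl(3) by (intro C_blk) auto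
    moreover have "C (subL k (subL' (dword (n - k))) * (idm (vtx k) * (subR' k (dword k) * J2 k)))
      = blk (k + m) (n - k) * C (idm (vtx k) * (subR' k (dword k) * J2 k))"
      unfolding sub_dword(1) mult.assoc using k cl by (intro C_blk klr_free_closed(6)) auto
    ultimately show ?thesis
      unfolding eq em_class by (simp only: cl_mult klr_free_closed(6) cl)
  qed
  also have "\<dots> = blk (k + m) (n - k) * (u k * blk 0 k) * C (J2 k)"
    by (simp only: mult.assoc)
  also have "\<dots> = blk (k + m) (n - k) * blk 0 k * (u k * C (J2 k))"
    unfolding blk_vtx(2)[OF k] by (simp only: mult.assoc)
  finally show "em (epsilon k) = eps k"
    unfolding u_J2[OF k] by (simp only: eps_def)
qed

text \<open>Compatibility with all of the algebra on the strands \<open>j\<close> follows from that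
  with its generators; the single idempotent generator is covered by \<open>u\<close>.\<close>

lemma slide_all:
  assumes k: "k \<le> n" "l \<le> n" and w: "w \<in> carrier (klr_free \<beta>)"
    and u: "u k * C w = C w" "C w * u l = C w"
    and X: "\<And>q. q \<in> {1..m} \<Longrightarrow> intertwines (C w) (C (xv (k + q))) (C (xv (l + q)))"
    and T: "\<And>q. q \<in> {1..<m} \<Longrightarrow> intertwines (C w) (C (tau (k + q))) (C (tau (l + q)))"
    and f: "f \<in> carrier (klr_free \<beta>0)"
  shows "intertwines (C w) (C (psi k f)) (C (psi l f))"
  using f
proof (induction f rule: free_alg_carrier_induct)
  case (sum F A)
  then show ?case
    using sub_closed(2)[OF k(1)] sub_closed(2)[OF k(2)]
    by (simp add: free_subst_sum cl_sum intertwines_sum)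
next
  case (scalar c)
  have "C (scalar c) * C w = C w * C (scalar c)"
    using w by (simp add: cl_mult[symmetric] klr_free_closed scalar_mult_commute)
  then show ?case by (simp add: intertwines_def)
next
  case (mult f g)
  then show ?case
    using sub_closed(2)[OF k(1)] sub_closed(2)[OF k(2)]
    by (simp add: free_subst_mult cl_mult intertwines_mult)
next
  case (gen g)
  then consider "g = IdemG (replicate m j)" | q where "q \<in> {1..m}" "g = XG q"
    | q where "q \<in> {1..<m}" "g = TauG q"
    by (auto simp: klr_gens_def perms_replicate)
  then show ?case
  proof cases
    case 1
    have "psi k (gen g) = idm (vtx k)" for k
      unfolding 1 by (simp add: perms_replicate vtx_def)
    then show ?thesis using u by (simp add: intertwines_def)
  next
    case 2
    then show ?thesis using X[of q] by simp
  next
    case 3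
    then show ?thesis using T[of q] by simp
  qed
qed

section \<open>Representatives of the homotopy and of the differential\<close>

text \<open>The identities above produce \<open>(- 1) ^ (n - k - 1) * lam ^ m\<close>, and the
  differential contributes \<open>(- 1) ^ k\<close>. Together this is
  \<open>(- 1) ^ (n - 1) * lam ^ m\<close>, whose inverse is the scalar chosen here.\<close>

definition y_elt :: "nat \<Rightarrow> ('i, 'k) free_alg" where
  "y_elt k = scalar ((- 1) ^ (n - 1) * mu ^ m) * (prod_list (map tau (rev [k + 1..<k + 1 + m]))
     * (xv (k + 1) ^ x_exp * (prod_list (map tau (rev [1..<1 + k])) * idm (vtx (k + 1)))))"

lemma y_elt:
  assumes k: "k < n"
  shows "y_elt k \<in> carrier (klr_free \<beta>)"
    "C (y_elt k) = C (scalar ((- 1) ^ (n - 1) * mu ^ m)) * (Y k * u (k + 1))"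
proof -
  let ?g1 = "prod_list (map tau (rev [1..<1 + k])) * idm (vtx (k + 1)) :: ('i, 'k) free_alg"
  let ?g2 = "xv (k + 1) ^ x_exp * ?g1"
  have c: "idm (vtx (k + 1)) \<in> carrier (klr_free \<beta>)" using k by (intro idm_closed vtx_perm) auto
  have x: "(xv (k + 1) :: ('i, 'k) free_alg) \<in> carrier (klr_free \<beta>)" using k by (intro xv_closed) auto
  have g1: "?g1 \<in> carrier (klr_free \<beta>)" "C ?g1 = dn 1 k * u (k + 1)"
    using C_taus[OF _ c, of "rev [1..<1 + k]"] k by (auto simp: dn_def simp del: upt_Suc)
  have g2: "?g2 \<in> carrier (klr_free \<beta>)" "C ?g2 = C (xv (k + 1)) ^ x_exp * C ?g1"
    using x g1(1) by (simp_all add: cl_power_mult klr_free_closed(6) klr_free_power del: upt_Suc)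
  have g3: "prod_list (map tau (rev [k + 1..<k + 1 + m])) * ?g2 \<in> carrier (klr_free \<beta>)"
    "C (prod_list (map tau (rev [k + 1..<k + 1 + m])) * ?g2) = dn (k + 1) m * C ?g2"
    using C_taus[OF _ g2(1), of "rev [k + 1..<k + 1 + m]"] k by (auto simp: dn_def simp del: upt_Suc)
  show "y_elt k \<in> carrier (klr_free \<beta>)"
    unfolding y_elt_def by (intro klr_free_closed(6,7) g3)
  show "C (y_elt k) = C (scalar ((- 1) ^ (n - 1) * mu ^ m)) * (Y k * u (k + 1))"
    unfolding y_elt_def cl_mult[OF klr_free_closed(7) g3(1)] g3(2) g2(2) g1(2) Y_def
    by (simp only: mult.assoc)
qed

definition d_elt :: "nat \<Rightarrow> ('i, 'k) free_alg" where
  "d_elt k = scalar ((- 1) ^ (k - 1)) * tau_up k (n + size \<beta>0 - 1) * idm (vtx (k - 1))"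

lemma d_elt:
  assumes k: "1 \<le> k" "k \<le> n"
  shows "(scalar ((- 1) ^ (k - 1)) * tau_up k (n + size \<beta>0 - 1) :: ('i, 'k) free_alg) \<in> carrier (klr_free \<beta>)"
    "d_elt k \<in> carrier (klr_free \<beta>)"
    "C (d_elt k) = C (scalar ((- 1) ^ (k - 1))) * (\<delta> k * u (k - 1))"
proof -
  have c: "idm (vtx (k - 1)) \<in> carrier (klr_free \<beta>)" using k by (intro idm_closed vtx_perm) auto
  have t: "tau_up k (n + size \<beta>0 - 1) = (prod_list (map tau [k..<n + m]) :: ('i, 'k) free_alg)"
    using k by (simp add: tau_up_def del: upt_Suc)
  have "k + (m + n - k) = n + m" using k by simp
  then have \<delta>: "\<delta> k = prod_list (map (\<lambda>k. C (tau k)) [k..<n + m])"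
    by (simp add: \<delta>_def up_def)
  have sub: "set [k..<n + m] \<subseteq> {1..<m + n}" using k by auto
  have tc: "tau_up k (n + size \<beta>0 - 1) \<in> carrier (klr_free \<beta> :: ('i, 'k) free_alg ring)"
    unfolding t by (rule prod_list_closed) (use k in \<open>auto intro!: tau_closed\<close>)
  then show "(scalar ((- 1) ^ (k - 1)) * tau_up k (n + size \<beta>0 - 1) :: ('i, 'k) free_alg) \<in> carrier (klr_free \<beta>)"
    by (intro klr_free_closed(6,7))
  then show "d_elt k \<in> carrier (klr_free \<beta>)"
    unfolding d_elt_def by (rule klr_free_closed(6)[OF _ c])
  show "C (d_elt k) = C (scalar ((- 1) ^ (k - 1))) * (\<delta> k * u (k - 1))"
    unfolding d_elt_def mult.assoc
    using cl_mult[OF klr_free_closed(7) klr_free_closed(6)[OF tc c]] C_taus(2)[OF sub c]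
    by (simp only: t \<delta>)
qed

lemma scalar_central:
  "a \<in> carrier (klr_free \<beta>) \<Longrightarrow> C (scalar c) * C a = C a * C (scalar c)"
  by (simp add: cl_mult[symmetric] klr_free_closed(7) scalar_mult_commute)

lemma intertwines_scalar:
  assumes "intertwines w (C a) (C b)" "a \<in> carrier (klr_free \<beta>)"
  shows "intertwines (C (scalar c) * w) (C a) (C b)"
  using scalar_central[OF assms(2)] assms(1) by (intro intertwines_comp[where b = "C a"]) (simp add: intertwines_def)

lemma commute_sc:
  assumes "\<And>r. r \<in> {k..<k + l} \<Longrightarrow> r \<in> {1..<m + n}"
  shows "C (scalar c) * dn k l = dn k l * C (scalar c)" "C (scalar c) * up k l = up k l * C (scalar c)"
  by (rule commute_dn commute_up, rule sc_T, use assms in auto)+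

lemma y_elt_scalar:
  assumes k: "k < n"
  shows "C (scalar c) * (Y k * u (k + 1)) = (Y k * u (k + 1)) * C (scalar c)"
proof -
  let ?s = "C (scalar c)"
  have 1: "?s * dn (k + 1) m = dn (k + 1) m * ?s" "?s * dn 1 k = dn 1 k * ?s"
    by (rule commute_sc(1), use k in auto)+
  have 2: "?s * C (xv (k + 1)) ^ x_exp = C (xv (k + 1)) ^ x_exp * ?s"
    by (rule power_commute[symmetric]) (use k in \<open>auto intro!: sc_X[symmetric]\<close>)
  have 3: "?s * u (k + 1) = u (k + 1) * ?s" using k by (intro sc_E vtx_perm) auto
  have "intertwines ?s ((dn (k + 1) m * C (xv (k + 1)) ^ x_exp * dn 1 k) * u (k + 1))
      ((dn (k + 1) m * C (xv (k + 1)) ^ x_exp * dn 1 k) * u (k + 1))"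
    by (intro intertwines_mult) (simp_all only: intertwines_def 1 2 3)
  then show ?thesis by (simp only: intertwines_def Y_def)
qed

lemma d_elt_scalar:
  assumes k: "1 \<le> k" "k \<le> n"
  shows "C (scalar c) * (\<delta> k * u (k - 1)) = (\<delta> k * u (k - 1)) * C (scalar c)"
proof -
  have 1: "C (scalar c) * \<delta> k = \<delta> k * C (scalar c)"
    unfolding \<delta>_def by (rule commute_sc(2)) (use k in auto)
  have 2: "C (scalar c) * u (k - 1) = u (k - 1) * C (scalar c)" using k by (intro sc_E vtx_perm) auto
  have "intertwines (C (scalar c)) (\<delta> k * u (k - 1)) (\<delta> k * u (k - 1))"
    by (intro intertwines_mult) (simp_all only: intertwines_def 1 2)
  then show ?thesis by (simp only: intertwines_def)
qed

lemma y_elt_vtx: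
  assumes k: "k < n"
  shows "u k * C (y_elt k) = C (y_elt k)" "C (y_elt k) * u (k + 1) = C (y_elt k)"
proof -
  have E: "u k * (Y k * u (k + 1)) = Y k * u (k + 1)"
    using E_absorb[OF vtx_perm Y_vtx(2)[OF k]] k by simp
  have "u k * C (y_elt k) = C (scalar ((- 1) ^ (n - 1) * mu ^ m)) * (u k * (Y k * u (k + 1)))"
    unfolding y_elt(2)[OF k] using sc_E[OF vtx_perm[of k]] k by (simp only: mult.assoc[symmetric])
  then show "u k * C (y_elt k) = C (y_elt k)" unfolding E y_elt(2)[OF k] .
  show "C (y_elt k) * u (k + 1) = C (y_elt k)"
    unfolding y_elt(2)[OF k] using vtx_idem[of "k + 1"] k by (simp only: mult.assoc)
qed

lemma d_elt_vtx:
  assumes k: "1 \<le> k" "k \<le> n"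
  shows "u k * C (d_elt k) = C (d_elt k)" "C (d_elt k) * u (k - 1) = C (d_elt k)"
proof -
  have E: "u k * (\<delta> k * u (k - 1)) = \<delta> k * u (k - 1)"
    using E_absorb[OF vtx_perm \<delta>_vtx(2)[OF k]] k by simp
  have "u k * C (d_elt k) = C (scalar ((- 1) ^ (k - 1))) * (u k * (\<delta> k * u (k - 1)))"
    unfolding d_elt(3)[OF k] using sc_E[OF vtx_perm[OF k(2)]] by (simp only: mult.assoc[symmetric])
  then show "u k * C (d_elt k) = C (d_elt k)" unfolding E d_elt(3)[OF k] .
  show "C (d_elt k) * u (k - 1) = C (d_elt k)"
    unfolding d_elt(3)[OF k] using vtx_idem[of "k - 1"] k by (simp only: mult.assoc)
qed

lemma y_elt_slide:
  assumes k: "k < n" and f: "f \<in> carrier (klr_free \<beta>0)"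
  shows "C (psi k f) * C (y_elt k) = C (y_elt k) * C (psi (k + 1) f)"
proof -
  have "intertwines (C (y_elt k)) (C (psi k f)) (C (psi (k + 1) f))"
  proof (rule slide_all[OF _ _ y_elt(1)[OF k] y_elt_vtx[OF k] _ _ f])
    fix q assume q: "q \<in> {1..m}"
    show "intertwines (C (y_elt k)) (C (xv (k + q))) (C (xv (k + 1 + q)))"
      unfolding y_elt(2)[OF k] using k q by (intro intertwines_scalar Y_slide_X xv_closed) auto
  next
    fix q assume q: "q \<in> {1..<m}"
    show "intertwines (C (y_elt k)) (C (tau (k + q))) (C (tau (k + 1 + q)))"
      unfolding y_elt(2)[OF k] using k q by (intro intertwines_scalar Y_slide_T tau_closed) auto
  qed (use k in auto)
  then show ?thesis by (simp add: intertwines_def)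
qed

lemma d_elt_slide:
  assumes k: "1 \<le> k" "k \<le> n" and f: "f \<in> carrier (klr_free \<beta>0)"
  shows "C (psi k f) * C (d_elt k) = C (d_elt k) * C (psi (k - 1) f)"
proof -
  have "intertwines (C (d_elt k)) (C (psi k f)) (C (psi (k - 1) f))"
  proof (rule slide_all[OF _ _ d_elt(2)[OF k] d_elt_vtx[OF k] _ _ f])
    fix q assume q: "q \<in> {1..m}"
    show "intertwines (C (d_elt k)) (C (xv (k + q))) (C (xv (k - 1 + q)))"
      unfolding d_elt(3)[OF k] using k q by (intro intertwines_scalar \<delta>_slide_X xv_closed) auto
  next
    fix q assume q: "q \<in> {1..<m}"
    show "intertwines (C (d_elt k)) (C (tau (k + q))) (C (tau (k - 1 + q)))"
      unfolding d_elt(3)[OF k] using k q by (intro intertwines_scalar \<delta>_slide_T tau_closed) auto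
  qed (use k in auto)
  then show ?thesis by (simp add: intertwines_def)
qed

lemma homotopy_c:
  assumes k: "k < n" and z: "killed k z"
  shows "z * C (y_elt k) * C (d_elt (k + 1))
    = z * Y k * \<delta> (k + 1) * C (scalar ((- 1) ^ (n - 1) * mu ^ m * (- 1) ^ k))"
proof -
  let ?c = "(- 1) ^ (n - 1) * mu ^ m :: 'k" and ?s = "\<lambda>c. C (scalar c)"
  have zE: "z * u k = z" using z by (simp add: killed_def)
  have yE: "Y k * u (k + 1) = u k * Y k" using Y_vtx(2)[OF k] .
  have dE: "\<delta> (k + 1) * u k = u (k + 1) * \<delta> (k + 1)" using \<delta>_vtx(2)[of "k + 1"] k by simp
  have zY: "z * (Y k * u (k + 1)) = z * Y k"
    unfolding yE using zE by (simp add: mult.assoc[symmetric])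
  have y: "?s ?c * (Y k * u (k + 1)) = (Y k * u (k + 1)) * ?s ?c"
    using y_elt_scalar[OF k] .
  have d: "?s a * (\<delta> (k + 1) * u k) = (\<delta> (k + 1) * u k) * ?s a" for a
    using d_elt_scalar[of "k + 1"] k by simp
  have zYd: "z * Y k * (\<delta> (k + 1) * u k) = z * Y k * \<delta> (k + 1)"
    unfolding dE using zY by (simp add: mult.assoc[symmetric])
  have "z * C (y_elt k) * C (d_elt (k + 1))
      = z * ((Y k * u (k + 1)) * ?s ?c) * (?s ((- 1) ^ k) * (\<delta> (k + 1) * u k))"
    using k y_elt(2)[OF k] d_elt(3)[of "k + 1"] y by simp
  also have "\<dots> = z * Y k * (?s ?c * ?s ((- 1) ^ k) * (\<delta> (k + 1) * u k))"
    unfolding zY[symmetric] by (simp only: mult.assoc)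
  also have "\<dots> = z * Y k * (\<delta> (k + 1) * u k) * (?s (?c * (- 1) ^ k))"
    unfolding sc_mult[symmetric] d by (simp only: mult.assoc)
  finally show ?thesis unfolding zYd .
qed

lemma homotopy_c':
  assumes k: "1 \<le> k" "k \<le> n" and z: "killed k z"
  shows "z * C (d_elt k) * C (y_elt (k - 1))
    = z * \<delta> k * Y (k - 1) * C (scalar ((- 1) ^ (n - 1) * mu ^ m * (- 1) ^ (k - 1)))"
proof -
  let ?c = "(- 1) ^ (n - 1) * mu ^ m :: 'k" and ?s = "\<lambda>c. C (scalar c)"
  have zE: "z * u k = z" using z by (simp add: killed_def)
  have yE: "Y (k - 1) * u k = u (k - 1) * Y (k - 1)" using Y_vtx(2)[of "k - 1"] k by simp
  have dE: "\<delta> k * u (k - 1) = u k * \<delta> k" using \<delta>_vtx(2)[OF k] .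
  have zd: "z * (\<delta> k * u (k - 1)) = z * \<delta> k"
    unfolding dE using zE by (simp add: mult.assoc[symmetric])
  have y: "?s a * (Y (k - 1) * u k) = (Y (k - 1) * u k) * ?s a" for a
    using y_elt_scalar[of "k - 1"] k by simp
  have d: "?s a * (\<delta> k * u (k - 1)) = (\<delta> k * u (k - 1)) * ?s a" for a
    using d_elt_scalar[OF k] .
  have zdY: "z * \<delta> k * (Y (k - 1) * u k) = z * \<delta> k * Y (k - 1)"
    unfolding yE using zd by (simp add: mult.assoc[symmetric])
  have "z * C (d_elt k) * C (y_elt (k - 1))
      = z * ((\<delta> k * u (k - 1)) * ?s ((- 1) ^ (k - 1))) * (?s ?c * (Y (k - 1) * u k))"
    using k y_elt(2)[of "k - 1"] d_elt(3)[OF k] d by simp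
  also have "\<dots> = z * \<delta> k * (?s ((- 1) ^ (k - 1)) * ?s ?c * (Y (k - 1) * u k))"
    unfolding zd[symmetric] by (simp only: mult.assoc)
  also have "\<dots> = z * \<delta> k * (Y (k - 1) * u k) * (?s ((- 1) ^ (k - 1) * ?c))"
    unfolding sc_mult[symmetric] y by (simp only: mult.assoc)
  finally show ?thesis unfolding zdY by (simp add: mult.commute)
qed

lemma homotopy:
  assumes k: "k \<le> n" and z: "killed k z"
  shows "(if k < n then z * C (y_elt k) * C (d_elt (k + 1)) else 0)
    + (if 1 \<le> k then z * C (d_elt k) * C (y_elt (k - 1)) else 0) = z"
proof -
  let ?s = "\<lambda>c. C (scalar c)"
  have zE: "z * u k = z" using z by (simp add: killed_def)
  have z1: "z * ?s 1 = z" using sc_1_right[OF vtx_perm zE] k by simp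
  have unit_m: "lam ^ m * mu ^ m = 1" using unit by (simp add: power_mult_distrib[symmetric])
  have sq: "((- 1) ^ a * (- 1) ^ a :: 'k) = 1" for a
    by (simp add: power_mult_distrib[symmetric])
  have sgn: "(- 1) ^ (n - k - 1) * lam ^ m * ((- 1) ^ (n - 1) * mu ^ m * (- 1) ^ k) = (1 :: 'k)" if "k < n"
  proof -
    have "n - 1 = (n - k - 1) + k" using that by simp
    then have "(- 1) ^ (n - k - 1) * lam ^ m * ((- 1) ^ (n - 1) * mu ^ m * (- 1) ^ k)
      = ((- 1) ^ (n - k - 1) * (- 1) ^ (n - k - 1)) * ((- 1) ^ k * (- 1) ^ k) * (lam ^ m * mu ^ m :: 'k)"
      by (simp only: power_add ac_simps)
    then show ?thesis by (simp only: sq unit_m mult_1_left)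
  qed
  consider "k = 0" | "1 \<le> k" "k < n" | "k = n" using k by linarith
  then show ?thesis
  proof cases
    case 1
    have "z * C (y_elt 0) * C (d_elt 1) = z * ?s ((- 1) ^ (n - 1) * lam ^ m) * ?s ((- 1) ^ (n - 1) * mu ^ m * (- 1) ^ 0)"
      using homotopy_c[of 0 z] z homotopy_left[of z] 1 n by simp
    also have "\<dots> = z * ?s ((- 1) ^ (n - 0 - 1) * lam ^ m * ((- 1) ^ (n - 1) * mu ^ m * (- 1) ^ 0))"
      by (simp only: sc_mult mult.assoc diff_zero)
    also have "\<dots> = z" using sgn 1 n z1 by simp
    finally show ?thesis using 1 n by simp
  next
    case 2
    let ?c = "(- 1) ^ (n - 1) * mu ^ m * (- 1) ^ k :: 'k"
    \<comment> \<open>The differentials entering and leaving degree \<open>-k\<close> have opposite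
      signs, which turns the sum of the homotopy identity into the difference of
      \<open>homotopy_middle\<close>.\<close>
    have "(- 1) ^ (n - 1) * mu ^ m * (- 1) ^ (k - 1) = - ?c"
      using 2 by (cases k) auto
    then have "z * C (d_elt k) * C (y_elt (k - 1)) = - (z * \<delta> k * Y (k - 1) * ?s ?c)"
      using homotopy_c'[OF 2(1) k z] by (simp add: sc_uminus)
    then have "z * C (y_elt k) * C (d_elt (k + 1)) + z * C (d_elt k) * C (y_elt (k - 1))
      = (z * Y k * \<delta> (k + 1) - z * \<delta> k * Y (k - 1)) * ?s ?c"
      using homotopy_c[OF 2(2) z] by (simp add: left_diff_distrib)
    also have "\<dots> = z * ?s ((- 1) ^ (n - k - 1) * lam ^ m * ?c)"
      unfolding homotopy_middle[OF z 2] by (simp only: sc_mult mult.assoc)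
    also have "\<dots> = z" using sgn[OF 2(2)] z1 by simp
    finally show ?thesis using 2 by simp
  next
    case 3
    have "z * C (d_elt n) * C (y_elt (n - 1)) = z * ?s (lam ^ m) * ?s ((- 1) ^ (n - 1) * mu ^ m * (- 1) ^ (n - 1))"
      using homotopy_c'[of n z] z homotopy_right[of z] 3 n by simp
    also have "\<dots> = z * ?s (((- 1) ^ (n - 1) * (- 1) ^ (n - 1)) * (lam ^ m * mu ^ m))"
      by (simp only: sc_mult[symmetric] mult.assoc) (simp only: ac_simps)
    also have "\<dots> = z" by (simp only: sq unit_m mult_1_left z1)
    finally show ?thesis using 3 n by simp
  qed
qed

section \<open>Left and right multiplications on the tensor products\<close>

sublocale H: ring H by (rule ring_klr)

abbreviation M where "M \<equiv> E_pow ip Q j m"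
abbreviation NN where "NN k \<equiv> flank_bimod Q i (n - k) \<beta>0 k"
abbreviation TG where "TG k \<equiv> tensor_group R0 (NN k) M"
abbreviation rm where "rm l s \<equiv> tensor_map R0 (NN l) M (\<lambda>g. g \<otimes>\<^bsub>H\<^esub> s)"
abbreviation lm where "lm k h \<equiv> tensor_map R0 (NN k) M (\<lambda>g. h \<otimes>\<^bsub>H\<^esub> g)"
abbreviation ydiff where "ydiff k \<equiv> klr_class Q \<beta> (y_elt k)"
abbreviation ddiff where "ddiff k \<equiv> klr_class Q \<beta> (d_elt k)"

lemma NN_simps:
  assumes "k \<le> n"
  shows "carrier (NN k) = (\<lambda>h. h \<otimes>\<^bsub>H\<^esub> flank_idem Q i (n - k) \<beta>0 k) ` carrier H"
    "add (NN k) = add H" "smult (NN k) = (\<lambda>y h. h \<otimes>\<^bsub>H\<^esub> D k y)"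
  by (simp_all add: flank_bimod_def Let_def flank_eq[OF assms] D_def)

lemma mem_NN:
  assumes k: "k \<le> n"
  shows "g \<in> carrier (NN k) \<longleftrightarrow> g \<in> carrier H \<and> em g * u k = em g"
proof
  assume "g \<in> carrier (NN k)"
  then obtain h where h: "h \<in> carrier H" "g = h \<otimes>\<^bsub>H\<^esub> flank_idem Q i (n - k) \<beta>0 k"
    unfolding NN_simps[OF k] by auto
  then show "g \<in> carrier H \<and> em g * u k = em g"
    using flank_idem[OF k] vtx_idem[OF k] by (simp add: em_hom mult.assoc)
next
  assume g: "g \<in> carrier H \<and> em g * u k = em g"
  then have "g = g \<otimes>\<^bsub>H\<^esub> flank_idem Q i (n - k) \<beta>0 k"
    using flank_idem[OF k] by (intro em_eq) (simp_all add: em_hom)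
  then show "g \<in> carrier (NN k)" unfolding NN_simps[OF k] using g by auto
qed

lemma M_simps: "carrier M = carrier R0" "add M = add R0" "smult M = mult R0"
  "hcomp M d = {a. klr_homog ip Q \<beta>0 d a}"
  by (simp_all add: E_pow_def Let_def)

lemma bil_M: "bilinear_closed R0 M"
  unfolding bilinear_closed_def M_simps
  using ring.ring_simprules(1)[OF ring_klr] ring.ring_simprules(5)[OF ring_klr] by auto

lemma psi_u:
  assumes l: "l \<le> n" and f: "f \<in> carrier (klr_free \<beta>0)"
  shows "C (psi l f) * u l = u l * C (psi l f)"
proof -
  have "intertwines (u l) (C (psi l f)) (C (psi l f))"
  proof (rule slide_all[OF l l idm_closed[OF vtx_perm[OF l]] _ _ _ _ f])
    show "intertwines (u l) (C (xv (l + q))) (C (xv (l + q)))" if "q \<in> {1..m}" for q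
      using X_vtx[OF l, of "l + q"] that l by (simp add: intertwines_def)
    show "intertwines (u l) (C (tau (l + q))) (C (tau (l + q)))" if "q \<in> {1..<m}" for q
    proof -
      have "cpt (vtx l) (l + q) = cpt (vtx l) (l + q + 1)" using that l by (auto simp: cpt_vtx)
      then show ?thesis
        using E_T_same[OF vtx_perm[OF l], of "l + q"] that l by (simp add: intertwines_def)
    qed
  qed (simp_all only: vtx_idem[OF l])
  then show ?thesis by (simp add: intertwines_def)
qed

lemma D_closed: "k \<le> n \<Longrightarrow> y \<in> carrier R0 \<Longrightarrow> D k y \<in> carrier H"
  using D_class(1) by (metis klr_carrierE)

lemma bil_NN:
  assumes k: "k \<le> n"
  shows "bilinear_closed R0 (NN k)"
  unfolding bilinear_closed_def NN_simps(2,3)[OF k]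
proof (intro conjI ballI)
  show "a \<oplus>\<^bsub>H\<^esub> b \<in> carrier (NN k)" if "a \<in> carrier (NN k)" "b \<in> carrier (NN k)" for a b
    using that unfolding mem_NN[OF k] by (simp add: em_hom distrib_right)
  show "a \<otimes>\<^bsub>H\<^esub> D k r \<in> carrier (NN k)" if r: "r \<in> carrier R0" and a: "a \<in> carrier (NN k)" for r a
  proof -
    obtain f where f: "f \<in> carrier (klr_free \<beta>0)" "r = klr_class Q \<beta>0 f"
      using r by (rule klr_carrierE)
    have "em (D k r) * u k = em (D k r)"
      using D_class(2)[OF k f(1)] vtx_idem[OF k] by (simp add: f(2) mult.assoc)
    then show ?thesis
      using a D_closed[OF k r] unfolding mem_NN[OF k] by (simp add: em_hom mult.assoc)
  qed
qed

text \<open>The conditions under which right multiplication by \<open>s\<close> is a homomorphism of right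
  \<open>H\<^sub>m\<^sub>j\<close>-modules from \<open>H 1\<^sub>\<nu>\<close> to \<open>H 1\<^sub>\<mu>\<close> for \<open>\<nu> = vtx k\<close> and \<open>\<mu> = vtx l\<close>.\<close>

definition right_ok :: "nat \<Rightarrow> nat \<Rightarrow> ('i, 'k) klr_elt \<Rightarrow> bool" where
  "right_ok k l s \<longleftrightarrow> k \<le> n \<and> l \<le> n \<and> s \<in> carrier H \<and> u k * em s = em s \<and> em s * u l = em s
     \<and> (\<forall>f\<in>carrier (klr_free \<beta>0). C (psi k f) * em s = em s * C (psi l f))"

lemma right_ok_comp:
  assumes "right_ok k l s" "right_ok l l' t"
  shows "right_ok k l' (s \<otimes>\<^bsub>H\<^esub> t)"
proof -
  have "C (psi k f) * (em s * em t) = em s * em t * C (psi l' f)" if "f \<in> carrier (klr_free \<beta>0)" for f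
  proof -
    have "C (psi k f) * (em s * em t) = em s * (C (psi l f) * em t)"
      using assms(1) that unfolding right_ok_def by (simp add: mult.assoc[symmetric])
    then show ?thesis using assms(2) that unfolding right_ok_def by (simp add: mult.assoc)
  qed
  moreover have "u k * (em s * em t) = em s * em t"
    using assms(1) unfolding right_ok_def by (simp add: mult.assoc[symmetric])
  ultimately show ?thesis
    using assms unfolding right_ok_def by (simp add: em_hom mult.assoc)
qed

lemma right_ok_add:
  assumes "right_ok k l s" "right_ok k l t"
  shows "right_ok k l (s \<oplus>\<^bsub>H\<^esub> t)"
  using assms unfolding right_ok_def by (simp add: em_hom distrib_left distrib_right)

lemma right_ok_y: "k < n \<Longrightarrow> right_ok k (k + 1) (ydiff k)"
  using y_elt(1) y_elt_vtx y_elt_slide by (simp add: right_ok_def em_class klr_class_closed)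

lemma right_ok_d: "1 \<le> k \<Longrightarrow> k \<le> n \<Longrightarrow> right_ok k (k - 1) (ddiff k)"
  using d_elt(2) d_elt_vtx d_elt_slide by (simp add: right_ok_def em_class klr_class_closed)

text \<open>The words of both blocks involve only strands \<open>i\<close>, so they commute with all
  generators on the strands \<open>j\<close>.\<close>

lemma right_ok_epsilon:
  assumes k: "k \<le> n"
  shows "right_ok k k (epsilon k)"
proof -
  obtain w where w: "w \<in> carrier (klr_free \<beta>)" "epsilon k = klr_class Q \<beta> w"
    using epsilon(1)[OF k] by (rule klr_carrierE)
  have Cw: "C w = eps k" using epsilon(2)[OF k] by (simp add: w(2) em_class)
  have comm: "intertwines (eps k) a a"
    if "a * blk (k + m) (n - k) = blk (k + m) (n - k) * a" "a * blk 0 k = blk 0 k * a" "a * u k = u k * a" for a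
    unfolding eps_def using that
    by (intro intertwines_comp[where b = a]) (simp_all add: intertwines_def)
  have "intertwines (C w) (C (psi k f)) (C (psi k f))" if f: "f \<in> carrier (klr_free \<beta>0)" for f
  proof (rule slide_all[OF k k w(1) _ _ _ _ f])
    show "u k * C w = C w" "C w * u k = C w" unfolding Cw by (rule eps_vtx[OF k])+
    show "intertwines (C w) (C (xv (k + q))) (C (xv (k + q)))" if "q \<in> {1..m}" for q
      unfolding Cw
    proof (rule comm)
      show "C (xv (k + q)) * blk (k + m) (n - k) = blk (k + m) (n - k) * C (xv (k + q))"
        "C (xv (k + q)) * blk 0 k = blk 0 k * C (xv (k + q))"
        by (rule commute_blk, use that k in \<open>auto intro!: X_X T_X_commute[symmetric]\<close>)+
      show "C (xv (k + q)) * u k = u k * C (xv (k + q))"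
        using that k by (intro X_vtx) auto
    qed
    show "intertwines (C w) (C (tau (k + q))) (C (tau (k + q)))" if "q \<in> {1..<m}" for q
      unfolding Cw
    proof (rule comm)
      show "C (tau (k + q)) * blk (k + m) (n - k) = blk (k + m) (n - k) * C (tau (k + q))"
        "C (tau (k + q)) * blk 0 k = blk 0 k * C (tau (k + q))"
        by (rule commute_blk, use that k in \<open>auto intro!: T_X_commute T_T\<close>)+
      show "C (tau (k + q)) * u k = u k * C (tau (k + q))"
        using that k by (intro E_T_same vtx_perm) (auto simp: cpt_vtx)
    qed
  qed
  then show ?thesis
    using k epsilon[OF k] eps_vtx[OF k] by (simp add: right_ok_def Cw intertwines_def)
qed

lemma linear_right:
  assumes s: "right_ok k l s"
  shows "linear_map R0 (NN k) (NN l) (\<lambda>g. g \<otimes>\<^bsub>H\<^esub> s)"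
proof -
  have k: "k \<le> n" and l: "l \<le> n" and sH: "s \<in> carrier H" using s by (auto simp: right_ok_def)
  show ?thesis
    unfolding linear_map_def NN_simps(2,3)[OF k] NN_simps(2,3)[OF l]
  proof (intro conjI ballI)
    show "(\<lambda>g. g \<otimes>\<^bsub>H\<^esub> s) \<in> carrier (NN k) \<rightarrow> carrier (NN l)"
      using s by (auto simp: Pi_iff mem_NN[OF k] mem_NN[OF l] right_ok_def em_hom mult.assoc)
    show "(a \<oplus>\<^bsub>H\<^esub> b) \<otimes>\<^bsub>H\<^esub> s = a \<otimes>\<^bsub>H\<^esub> s \<oplus>\<^bsub>H\<^esub> b \<otimes>\<^bsub>H\<^esub> s"
      if "a \<in> carrier (NN k)" "b \<in> carrier (NN k)" for a b
      using that sH unfolding mem_NN[OF k] by (simp add: H.l_distr)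
    fix r a assume r: "r \<in> carrier R0" and a: "a \<in> carrier (NN k)"
    obtain f where f: "f \<in> carrier (klr_free \<beta>0)" "r = klr_class Q \<beta>0 f"
      using r by (rule klr_carrierE)
    have aH: "a \<in> carrier H" using a unfolding mem_NN[OF k] by simp
    note DH = D_closed[OF k r] D_closed[OF l r]
    have "em (D k r) * em s = em s * em (D l r)"
    proof -
      have "em (D k r) * em s = C (psi k f) * (u k * em s)"
        using D_class(2)[OF k f(1)] by (simp add: f(2) mult.assoc)
      also have "\<dots> = em s * C (psi l f)" using s f(1) by (simp add: right_ok_def)
      also have "\<dots> = em s * (u l * C (psi l f))"
        using s by (simp add: right_ok_def mult.assoc[symmetric])
      finally show ?thesis
        using D_class(2)[OF l f(1)] psi_u[OF l f(1)] by (simp add: f(2))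
    qed
    then show "a \<otimes>\<^bsub>H\<^esub> D k r \<otimes>\<^bsub>H\<^esub> s = a \<otimes>\<^bsub>H\<^esub> s \<otimes>\<^bsub>H\<^esub> D l r"
      using aH sH DH by (intro em_eq) (simp_all add: em_hom mult.assoc)
  qed
qed

lemma linear_left:
  assumes k: "k \<le> n" and h: "h \<in> carrier H"
  shows "linear_map R0 (NN k) (NN k) (\<lambda>g. h \<otimes>\<^bsub>H\<^esub> g)"
  unfolding linear_map_def NN_simps(2,3)[OF k]
proof (intro conjI ballI)
  show "(\<lambda>g. h \<otimes>\<^bsub>H\<^esub> g) \<in> carrier (NN k) \<rightarrow> carrier (NN k)"
    using h by (auto simp: Pi_iff mem_NN[OF k] em_hom mult.assoc)
  show "h \<otimes>\<^bsub>H\<^esub> (a \<oplus>\<^bsub>H\<^esub> b) = h \<otimes>\<^bsub>H\<^esub> a \<oplus>\<^bsub>H\<^esub> h \<otimes>\<^bsub>H\<^esub> b"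
    if "a \<in> carrier (NN k)" "b \<in> carrier (NN k)" for a b
    using that h unfolding mem_NN[OF k] by (simp add: H.r_distr)
  show "h \<otimes>\<^bsub>H\<^esub> (a \<otimes>\<^bsub>H\<^esub> D k r) = h \<otimes>\<^bsub>H\<^esub> a \<otimes>\<^bsub>H\<^esub> D k r"
    if "r \<in> carrier R0" "a \<in> carrier (NN k)" for r a
    using that h D_closed[OF k] unfolding mem_NN[OF k] by (simp add: H.m_assoc)
qed

lemma NN_H: "k \<le> n \<Longrightarrow> g \<in> carrier (NN k) \<Longrightarrow> g \<in> carrier H"
  by (simp add: mem_NN)

lemma rm_closed:
  assumes "right_ok k l s" "v \<in> carrier (TG k)"
  shows "rm l s v \<in> carrier (TG l)"
  using assms(1) by (intro tensor_map_closed[OF bil_M _ _ linear_right[OF assms(1)] assms(2)] bil_NN)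
    (auto simp: right_ok_def)

lemma rm_add:
  assumes "right_ok k l s" "v \<in> carrier (TG k)" "v' \<in> carrier (TG k)"
  shows "rm l s (v \<otimes>\<^bsub>TG k\<^esub> v') = rm l s v \<otimes>\<^bsub>TG l\<^esub> rm l s v'"
  using assms(1) by (intro tensor_map_add[OF bil_M _ _ linear_right[OF assms(1)] assms(2,3)] bil_NN)
    (auto simp: right_ok_def)

lemma rm_comp:
  assumes s: "right_ok k l s" and t: "right_ok l l' t" and v: "v \<in> carrier (TG k)"
  shows "rm l' t (rm l s v) = rm l' (s \<otimes>\<^bsub>H\<^esub> t) v"
proof -
  have le: "k \<le> n" "l \<le> n" "l' \<le> n" and H: "s \<in> carrier H" "t \<in> carrier H"
    using s t by (auto simp: right_ok_def)
  have "rm l' t (rm l s v) = tensor_map R0 (NN l') M (\<lambda>g. g \<otimes>\<^bsub>H\<^esub> s \<otimes>\<^bsub>H\<^esub> t) v"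
    by (rule tensor_map_comp[OF bil_M bil_NN[OF le(1)] bil_NN[OF le(2)] bil_NN[OF le(3)]
          linear_right[OF s] linear_right[OF t] v])
  also have "\<dots> = rm l' (s \<otimes>\<^bsub>H\<^esub> t) v"
    using H NN_H[OF le(1)] by (intro tensor_map_cong[OF bil_M bil_NN[OF le(1)] v]) (simp add: H.m_assoc)
  finally show ?thesis .
qed

lemma rm_sum:
  assumes s: "right_ok k l s" and t: "right_ok k l t" and v: "v \<in> carrier (TG k)"
  shows "rm l s v \<otimes>\<^bsub>TG l\<^esub> rm l t v = rm l (s \<oplus>\<^bsub>H\<^esub> t) v"
proof -
  have le: "k \<le> n" "l \<le> n" and H: "s \<in> carrier H" "t \<in> carrier H"
    using s t by (auto simp: right_ok_def)
  show ?thesis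
    by (rule tensor_map_sum[OF bil_M bil_NN[OF le(1)] bil_NN[OF le(2)] linear_right[OF s] linear_right[OF t]
          linear_right[OF right_ok_add[OF s t]] v])
      (use H NN_H[OF le(1)] in \<open>simp add: NN_simps(2)[OF le(2)] H.r_distr\<close>)
qed

lemma rm_lm:
  assumes s: "right_ok k l s" and h: "h \<in> carrier H" and v: "v \<in> carrier (TG k)"
  shows "rm l s (lm k h v) = lm l h (rm l s v)"
proof -
  have le: "k \<le> n" "l \<le> n" and H: "s \<in> carrier H"
    using s by (auto simp: right_ok_def)
  have "rm l s (lm k h v) = tensor_map R0 (NN l) M (\<lambda>g. (h \<otimes>\<^bsub>H\<^esub> g) \<otimes>\<^bsub>H\<^esub> s) v"
    by (rule tensor_map_comp[OF bil_M bil_NN[OF le(1)] bil_NN[OF le(1)] bil_NN[OF le(2)]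
          linear_left[OF le(1) h] linear_right[OF s] v])
  also have "\<dots> = tensor_map R0 (NN l) M (\<lambda>g. h \<otimes>\<^bsub>H\<^esub> (g \<otimes>\<^bsub>H\<^esub> s)) v"
    using H h NN_H[OF le(1)] by (intro tensor_map_cong[OF bil_M bil_NN[OF le(1)] v]) (simp add: H.m_assoc)
  also have "\<dots> = lm l h (rm l s v)"
    by (rule tensor_map_comp[symmetric, OF bil_M bil_NN[OF le(1)] bil_NN[OF le(2)] bil_NN[OF le(2)]
          linear_right[OF s] linear_left[OF le(2) h] v])
  finally show ?thesis .
qed

lemma tensor_map_one:
  assumes "k \<le> n" "l \<le> n" "linear_map R0 (NN k) (NN l) f"
  shows "tensor_map R0 (NN l) M f \<one>\<^bsub>TG k\<^esub> = \<one>\<^bsub>TG l\<^esub>"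
  unfolding tensor_class_0[OF bil_M bil_NN[OF assms(1)]] tensor_class_0[OF bil_M bil_NN[OF assms(2)]]
  using tensor_map_class[OF bil_M bil_NN[OF assms(1)] bil_NN[OF assms(2)] assms(3), of 0] by simp

lemma killed_sc:
  assumes k: "k \<le> n" and z: "killed k z"
  shows "killed k (z * C (scalar c))"
proof -
  have "z * C (scalar c) * u k = z * u k * C (scalar c)"
    using sc_E[OF vtx_perm[OF k]] by (simp add: mult.assoc)
  moreover have "z * C (scalar c) * C (tau l) = z * C (tau l) * C (scalar c)" if "l \<in> {1..<m + n}" for l
    using sc_T[of l] that by (simp add: mult.assoc)
  ultimately show ?thesis using z k unfolding killed_def by auto
qed

text \<open>This makes the homotopy land in the image of the next idempotent: by
  \<open>Y_killed\<close> the product on the right is killed at \<open>k + 1\<close>, and killed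
  elements absorb \<open>eps (k + 1)\<close>.\<close>

lemma epsilon_y:
  assumes k: "k < n"
  shows "epsilon k \<otimes>\<^bsub>H\<^esub> ydiff k \<otimes>\<^bsub>H\<^esub> epsilon (k + 1) = epsilon k \<otimes>\<^bsub>H\<^esub> ydiff k"
proof -
  have kn: "k \<le> n" "k + 1 \<le> n" using k by auto
  have z: "killed k (eps k)"
    using killed_eps[OF kn(1), of "u k"] eps_vtx(2)[OF kn(1)] by simp
  have yE: "eps k * (Y k * u (k + 1)) = eps k * Y k"
    unfolding Y_vtx(2)[OF k] using eps_vtx(1)[OF kn(1)] by (simp add: mult.assoc[symmetric])
  have "eps k * C (y_elt k) = eps k * Y k * C (scalar ((- 1) ^ (n - 1) * mu ^ m))"
    unfolding y_elt(2)[OF k] y_elt_scalar[OF k] using yE by (simp add: mult.assoc[symmetric])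
  then have "killed (k + 1) (eps k * C (y_elt k))"
    using killed_sc[OF kn(2) Y_killed[OF k z]] by simp
  then have "eps k * C (y_elt k) * eps (k + 1) = eps k * C (y_elt k)"
    by (rule absorb_eps[OF kn(2)])
  then show ?thesis
    using epsilon[OF kn(1)] epsilon[OF kn(2)] y_elt(1)[OF k]
    by (intro em_eq) (simp_all add: em_hom em_class klr_class_closed)
qed

lemma homotopy_H:
  assumes k: "k \<le> n"
  shows "k = 0 \<Longrightarrow> epsilon k \<otimes>\<^bsub>H\<^esub> ydiff k \<otimes>\<^bsub>H\<^esub> ddiff (k + 1) = epsilon k"
    "1 \<le> k \<Longrightarrow> k < n \<Longrightarrow> epsilon k \<otimes>\<^bsub>H\<^esub> ydiff k \<otimes>\<^bsub>H\<^esub> ddiff (k + 1)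
      \<oplus>\<^bsub>H\<^esub> epsilon k \<otimes>\<^bsub>H\<^esub> ddiff k \<otimes>\<^bsub>H\<^esub> ydiff (k - 1) = epsilon k"
    "k = n \<Longrightarrow> epsilon k \<otimes>\<^bsub>H\<^esub> ddiff k \<otimes>\<^bsub>H\<^esub> ydiff (k - 1) = epsilon k"
proof -
  have z: "killed k (eps k)"
    using killed_eps[OF k, of "u k"] eps_vtx(2)[OF k] by simp
  note h = homotopy[OF k z]
  have y: "ydiff k \<in> carrier H" if "k < n" for k using y_elt(1)[OF that] by (rule klr_class_closed)
  have d: "ddiff k \<in> carrier H" if "1 \<le> k" "k \<le> n" for k using d_elt(2)[OF that] by (rule klr_class_closed)
  show "k = 0 \<Longrightarrow> epsilon k \<otimes>\<^bsub>H\<^esub> ydiff k \<otimes>\<^bsub>H\<^esub> ddiff (k + 1) = epsilon k"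
    using h epsilon[OF k] y[of k] d[of "k + 1"] n by (intro em_eq) (auto simp: em_hom em_class)
  show "1 \<le> k \<Longrightarrow> k < n \<Longrightarrow> epsilon k \<otimes>\<^bsub>H\<^esub> ydiff k \<otimes>\<^bsub>H\<^esub> ddiff (k + 1)
      \<oplus>\<^bsub>H\<^esub> epsilon k \<otimes>\<^bsub>H\<^esub> ddiff k \<otimes>\<^bsub>H\<^esub> ydiff (k - 1) = epsilon k"
    using h epsilon[OF k] y[of k] d[of "k + 1"] d[of k] y[of "k - 1"] by (intro em_eq) (auto simp: em_hom em_class)
  show "k = n \<Longrightarrow> epsilon k \<otimes>\<^bsub>H\<^esub> ddiff k \<otimes>\<^bsub>H\<^esub> ydiff (k - 1) = epsilon k"
    using h epsilon[OF k] d[of k] y[of "k - 1"] n by (intro em_eq) (auto simp: em_hom em_class)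
qed

section \<open>Degrees\<close>

definition homog :: "int \<Rightarrow> ('i, 'k) free_alg \<Rightarrow> bool" where
  "homog d f \<longleftrightarrow> f \<in> carrier (klr_free \<beta>) \<and> klr_homog ip Q \<beta> d (klr_class Q \<beta> f)"

lemma homog_mult_eq:
  assumes "homog d f" "homog e g" "h \<in> carrier (klr_free \<beta>)" "C h = C f * C g"
  shows "homog (d + e) h"
proof -
  have "klr_class Q \<beta> h = klr_class Q \<beta> f \<otimes>\<^bsub>H\<^esub> klr_class Q \<beta> g"
    using assms by (intro em_eq) (auto simp: homog_def em_hom em_class klr_class_closed)
  then show ?thesis
    using assms klr_homog.mult[of ip Q \<beta> d "klr_class Q \<beta> f" e "klr_class Q \<beta> g"] by (simp add: homog_def)
qed

text \<open>Words are built up from the left, with an idempotent at their right end. Appending a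
  letter replaces this idempotent by the one on the other side of the crossing.\<close>

lemma homog_tau:
  assumes \<nu>: "\<nu> \<in> permutations_of_multiset \<beta>" and k: "k \<in> {1..<m + n}"
    and f: "f \<in> carrier (klr_free \<beta>)" and h: "homog d (f * idm (swap_cpt k \<nu>))"
  shows "homog (d - ip (cpt \<nu> k) (cpt \<nu> (k + 1))) (f * tau k * idm \<nu>)"
proof -
  have c: "(idm (swap_cpt k \<nu>) :: ('i, 'k) free_alg) \<in> carrier (klr_free \<beta>)" "(idm \<nu> :: ('i, 'k) free_alg) \<in> carrier (klr_free \<beta>)"
      "(tau k :: ('i, 'k) free_alg) \<in> carrier (klr_free \<beta>)"
    using \<nu> k by (auto intro!: idm_closed tau_closed swap_cpt_permutation)
  have "homog (- ip (cpt \<nu> k) (cpt \<nu> (k + 1))) (tau k * idm \<nu>)"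
    using klr_homog.tau[OF \<nu>, where ip = ip and Q = Q and k = k] k c by (simp add: homog_def klr_free_closed(6))
  moreover have "C (f * tau k * idm \<nu>) = C (f * idm (swap_cpt k \<nu>)) * C (tau k * idm \<nu>)"
    using T_E_E[OF \<nu>, of k] k f c by (simp add: cl_mult klr_free_closed(6) mult.assoc)
  ultimately show ?thesis
    using homog_mult_eq[OF h, of "- ip (cpt \<nu> k) (cpt \<nu> (k + 1))" "tau k * idm \<nu>" "f * tau k * idm \<nu>"] f c
    by (simp add: klr_free_closed(6))
qed

lemma homog_xv:
  assumes \<nu>: "\<nu> \<in> permutations_of_multiset \<beta>" and k: "k \<in> {1..m + n}"
    and f: "f \<in> carrier (klr_free \<beta>)" and h: "homog d (f * idm \<nu>)"
  shows "homog (d + ip (cpt \<nu> k) (cpt \<nu> k)) (f * xv k * idm \<nu>)"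
proof -
  have c: "(idm \<nu> :: ('i, 'k) free_alg) \<in> carrier (klr_free \<beta>)" "(xv k :: ('i, 'k) free_alg) \<in> carrier (klr_free \<beta>)"
    using \<nu> k by (auto intro!: idm_closed xv_closed)
  have x: "homog (ip (cpt \<nu> k) (cpt \<nu> k)) (xv k * idm \<nu>)"
    using klr_homog.x[OF \<nu>, where ip = ip and Q = Q and k = k] k c by (simp add: homog_def klr_free_closed(6))
  have "C (f * idm \<nu>) * C (xv k * idm \<nu>) = C f * (C (idm \<nu>) * (C (idm \<nu>) * C (xv k)))"
    using X_E[OF \<nu>, of k] k f c by (simp add: cl_mult mult.assoc)
  also have "\<dots> = C (f * xv k * idm \<nu>)"
    using X_E[OF \<nu>, of k] E_E[OF \<nu> \<nu>] k f c
    by (simp add: cl_mult klr_free_closed(6) mult.assoc[symmetric]) (simp add: mult.assoc)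
  finally show ?thesis
    using homog_mult_eq[OF h x, of "f * xv k * idm \<nu>"] f c by (simp add: klr_free_closed(6))
qed

lemma homog_xv_power:
  assumes \<nu>: "\<nu> \<in> permutations_of_multiset \<beta>" and k: "k \<in> {1..m + n}"
    and f: "f \<in> carrier (klr_free \<beta>)" and h: "homog d (f * idm \<nu>)"
  shows "homog (d + int p * ip (cpt \<nu> k) (cpt \<nu> k)) (f * xv k ^ p * idm \<nu>)"
proof (induction p)
  case 0
  then show ?case using h by simp
next
  case (Suc p)
  have "(xv k :: ('i, 'k) free_alg) \<in> carrier (klr_free \<beta>)" using k by (intro xv_closed) auto
  then have "f * xv k ^ p \<in> carrier (klr_free \<beta>)" using f by (intro klr_free_closed(6) klr_free_power)
  from homog_xv[OF \<nu> k this Suc] show ?case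
    by (simp add: algebra_simps power_Suc2 del: power_Suc)
qed

lemma homog_taus:
  assumes \<nu>: "\<nu> \<in> permutations_of_multiset \<beta>" and k: "1 \<le> k" "k + l \<le> m + n"
    and f: "f \<in> carrier (klr_free \<beta>)" and h: "homog d (f * idm (swap_dn k l \<nu>))"
  shows "homog (d - (\<Sum>p\<in>{k<..k + l}. ip (cpt \<nu> k) (cpt \<nu> p)))
    (f * prod_list (map tau (rev [k..<k + l])) * idm \<nu>)"
  using k(2) f h
proof (induction l arbitrary: f d)
  case (Suc l)
  let ?\<mu> = "swap_dn k l \<nu>"
  have c: "(tau (k + l) :: ('i, 'k) free_alg) \<in> carrier (klr_free \<beta>)"
    using Suc.prems k by (intro tau_closed) auto
  have \<mu>: "?\<mu> \<in> permutations_of_multiset \<beta>" using Suc.prems k \<nu> by (intro swap_dn_perm) auto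
  have "homog (d - ip (cpt ?\<mu> (k + l)) (cpt ?\<mu> (k + l + 1))) (f * tau (k + l) * idm ?\<mu>)"
    using Suc.prems k by (intro homog_tau[OF \<mu>]) auto
  moreover have "cpt ?\<mu> (k + l) = cpt \<nu> k" "cpt ?\<mu> (k + l + 1) = cpt \<nu> (k + l + 1)"
    using cpt_swap_dn[OF length_permutation[OF \<nu>], of k l] k Suc.prems by auto
  ultimately have "homog (d - ip (cpt \<nu> k) (cpt \<nu> (k + l + 1))
      - (\<Sum>p\<in>{k<..k + l}. ip (cpt \<nu> k) (cpt \<nu> p)))
      (f * tau (k + l) * prod_list (map tau (rev [k..<k + l])) * idm \<nu>)"
    using Suc.prems c by (intro Suc.IH klr_free_closed(6)) auto
  moreover have "{k<..k + Suc l} = insert (k + l + 1) {k<..k + l}" by auto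
  ultimately show ?case by (simp add: algebra_simps)
qed simp

text \<open>The \<open>m\<close> crossings with \<open>j\<close> contribute
  \<open>- m * ip i j\<close>, the dots \<open>x_exp * ip i i\<close>, and the \<open>k\<close>
  crossings inside the right block \<open>- k * ip i i\<close>.\<close>

lemma y_homog:
  assumes k: "k < n"
  shows "klr_homog ip Q \<beta> (half_norm ip i * (2 * (int n - 1) - int m * int N - 2 * int k)) (ydiff k)"
proof -
  let ?v = "vtx (k + 1)"
  let ?t1 = "prod_list (map tau (rev [k + 1..<k + 1 + m])) :: ('i, 'k) free_alg"
  let ?t2 = "prod_list (map tau (rev [1..<1 + k])) :: ('i, 'k) free_alg"
  have v: "?v \<in> permutations_of_multiset \<beta>" using k by (intro vtx_perm) auto
  have t1: "?t1 \<in> carrier (klr_free \<beta>)"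
    by (rule prod_list_closed) (use k in \<open>auto intro!: tau_closed\<close>)
  have "(xv (k + 1) :: ('i, 'k) free_alg) \<in> carrier (klr_free \<beta>)" using k by (intro xv_closed) auto
  then have t1x: "?t1 * xv (k + 1) ^ x_exp \<in> carrier (klr_free \<beta>)"
    using t1 by (intro klr_free_closed(6) klr_free_power)
  have "homog 0 (1 * idm (swap_dn (k + 1) m ?v))"
    unfolding swap_dn_vtx[OF k] using klr_homog.idem[OF vtx_perm[of k]] k
    by (simp add: homog_def idm_closed vtx_perm)
  then have "homog (0 - (\<Sum>p\<in>{k + 1<..k + 1 + m}. ip (cpt ?v (k + 1)) (cpt ?v p))) (1 * ?t1 * idm ?v)"
    using k by (intro homog_taus v klr_free_closed(2)) auto
  then have "homog (0 - (\<Sum>p\<in>{k + 1<..k + 1 + m}. ip (cpt ?v (k + 1)) (cpt ?v p))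
      + int x_exp * ip (cpt ?v (k + 1)) (cpt ?v (k + 1))) (?t1 * xv (k + 1) ^ x_exp * idm ?v)"
    using k t1 by (intro homog_xv_power v) auto
  then have "homog (0 - (\<Sum>p\<in>{k + 1<..k + 1 + m}. ip (cpt ?v (k + 1)) (cpt ?v p))
      + int x_exp * ip (cpt ?v (k + 1)) (cpt ?v (k + 1))
      - (\<Sum>p\<in>{1<..1 + k}. ip (cpt ?v 1) (cpt ?v p))) (?t1 * xv (k + 1) ^ x_exp * ?t2 * idm ?v)"
    using k t1x swap_dn_vtx_right[OF k] by (intro homog_taus v) auto
  moreover have "(\<Sum>p\<in>{k + 1<..k + 1 + m}. ip (cpt ?v (k + 1)) (cpt ?v p)) = int m * ip i j"
  proof -
    have "ip (cpt ?v (k + 1)) (cpt ?v p) = ip i j" if "p \<in> {k + 1<..k + 1 + m}" for p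
      using that k by (simp add: cpt_vtx)
    then show ?thesis by simp
  qed
  moreover have "(\<Sum>p\<in>{1<..1 + k}. ip (cpt ?v 1) (cpt ?v p)) = int k * ip i i"
  proof -
    have "ip (cpt ?v 1) (cpt ?v p) = ip i i" if "p \<in> {1<..1 + k}" for p
      using that k by (simp add: cpt_vtx)
    then show ?thesis by simp
  qed
  moreover have "cpt ?v (k + 1) = i" using k by (simp add: cpt_vtx)
  ultimately have h: "homog (0 - int m * ip i j + int x_exp * ip i i - int k * ip i i)
      (?t1 * xv (k + 1) ^ x_exp * ?t2 * idm ?v)"
    by simp
  have x: "int x_exp = int n - 1 - int m * int N" using n by (simp add: x_exp_def of_nat_diff)
  have deg: "0 - int m * ip i j + int x_exp * ip i i - int k * ip i i
      = half_norm ip i * (2 * (int n - 1) - int m * int N - 2 * int k)"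
    unfolding ip_ii ip_ij x by (simp add: algebra_simps)
  have "ydiff k = klr_class Q \<beta> (scalar ((- 1) ^ (n - 1) * mu ^ m))
      \<otimes>\<^bsub>H\<^esub> klr_class Q \<beta> (?t1 * xv (k + 1) ^ x_exp * ?t2 * idm ?v)"
    using h unfolding y_elt_def homog_def
    by (simp add: klr_class_mult[symmetric] klr_free_closed(7) mult.assoc del: upt_Suc)
  then show ?thesis
    using h unfolding deg homog_def by (simp add: klr_homog.scale del: upt_Suc)
qed

definition shift :: "nat \<Rightarrow> int" where
  "shift k = half_norm ip i * (int k * (int n - int m * int N - 1))
    - half_norm ip i * int ((n - k) * (n - k - 1) div 2 + k * (k - 1) div 2)"

text \<open>The jump of the total shift is the degree of \<open>ydiff k\<close>, so the homotopy
  preserves degrees. The term linear in \<open>k\<close> comes from the triangular numbers in the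
  shifts of the two divided powers.\<close>

lemma shift_Suc:
  assumes "k < n"
  shows "shift (k + 1) = shift k + half_norm ip i * (2 * (int n - 1) - int m * int N - 2 * int k)"
proof -
  have tri: "Suc a * a div 2 = a + a * (a - 1) div 2" for a :: nat
  proof -
    have "Suc a * a = 2 * a + a * (a - 1)" by (cases a) (auto simp: algebra_simps)
    then show ?thesis by simp
  qed
  obtain a where a: "n = Suc a + k" using assms less_iff_Suc_add by (metis add.commute add_Suc)
  have "(n - k) * (n - k - 1) div 2 = a + (n - (k + 1)) * (n - (k + 1) - 1) div 2"
    using tri[of a] by (simp add: a)
  moreover have "(k + 1) * (k + 1 - 1) div 2 = k + k * (k - 1) div 2"
    using tri[of k] by simp
  ultimately have "int ((n - (k + 1)) * (n - (k + 1) - 1) div 2 + (k + 1) * (k + 1 - 1) div 2)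
    = int ((n - k) * (n - k - 1) div 2 + k * (k - 1) div 2) + int k - int a"
    by simp
  then show ?thesis
    unfolding shift_def by (simp only:) (simp add: a algebra_simps)
qed

section \<open>The complex and its contraction\<close>

abbreviation obj where "obj p \<equiv> Ad_obj ip Q i n \<beta>0 M p"

definition Hc :: "nat \<Rightarrow> int \<Rightarrow> ('i, 'k, ('i, 'k) klr_elt) flank_elt set" where
  "Hc k d = generate (TG k) {tensor_class R0 (NN k) M (frag_of (g, y)) |g y p q.
        g \<in> carrier (NN k) \<and> klr_homog ip Q \<beta> p g \<and> y \<in> hcomp M q \<and> p + q = d}"

lemma obj_simps:
  assumes k: "k \<le> n"
  shows "carrier (obj (- int k)) = rm k (epsilon k) ` carrier (TG k)"
    "add (obj (- int k)) = mult (TG k)"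
    "\<zero>\<^bsub>obj (- int k)\<^esub> = \<one>\<^bsub>TG k\<^esub>"
    "smult (obj (- int k)) = lm k"
    "hcomp (obj (- int k)) d = rm k (epsilon k) ` carrier (TG k) \<inter> Hc k (d + shift k)"
proof -
  have w: "coroot_pairing ip i \<beta>0 = - (int m * int N)"
    by (simp add: coroot_pairing_def coroot)
  have sh: "d + - half_norm ip i * int ((n - k) * (n - k - 1) div 2 + k * (k - 1) div 2)
      + half_norm ip i * (int k * (int n + - (int m * int N) - 1)) = d + shift k" for d
    by (simp add: shift_def)
  have sh': "d + half_norm ip i * (int k * (int n + - (int m * int N) - 1))
      + - half_norm ip i * int ((n - k) * (n - k - 1) div 2 + k * (k - 1) div 2) = d + shift k" for d
    by (simp add: shift_def)
  have "obj (- int k) = q_shift (half_norm ip i * (int k * (int n + - (int m * int N) - 1)))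
      (EME_div ip Q i (n - k) \<beta>0 M k)"
    using k by (simp add: Ad_obj_def Let_def w)
  then show "carrier (obj (- int k)) = rm k (epsilon k) ` carrier (TG k)"
    "add (obj (- int k)) = mult (TG k)"
    "\<zero>\<^bsub>obj (- int k)\<^esub> = \<one>\<^bsub>TG k\<^esub>"
    "smult (obj (- int k)) = lm k"
    "hcomp (obj (- int k)) d = rm k (epsilon k) ` carrier (TG k) \<inter> Hc k (d + shift k)"
    by (simp_all only: EME_div_def EME_def Let_def q_shift_def flank_eq[OF k] epsilon_def[symmetric]
        Hc_def[symmetric] sh sh' graded_module.simps module.simps ring.simps monoid.simps partial_object.simps)
qed

lemma obj_zero: "p < - int n \<or> p > 0 \<Longrightarrow> obj p = zero_gmod"
  by (auto simp: Ad_obj_def)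

lemma diff_eq:
  assumes k: "1 \<le> k" "k \<le> n" and v: "v \<in> carrier (TG k)"
  shows "Ad_diff ip Q i n \<beta>0 M (- int k) v = rm (k - 1) (ddiff k) v"
proof -
  have c: "(idm (vtx (k - 1)) :: ('i, 'k) free_alg) \<in> carrier (klr_free \<beta>)" using k by (intro idm_closed vtx_perm) auto
  let ?t = "klr_class Q \<beta> (scalar ((- 1) ^ (k - 1)) * tau_up k (n + size \<beta>0 - 1))"
  have t: "?t \<in> carrier H" using d_elt(1)[OF k] by (rule klr_class_closed)
  have fl: "flank_idem Q i (n - (k - 1)) \<beta>0 (k - 1) = klr_class Q \<beta> (idm (vtx (k - 1)))"
    using flank_idem[of "k - 1"] k c by (intro em_eq) (auto simp: em_class klr_class_closed)
  have dd: "ddiff k = ?t \<otimes>\<^bsub>H\<^esub> klr_class Q \<beta> (idm (vtx (k - 1)))"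
    unfolding d_elt_def by (rule klr_class_mult[OF d_elt(1)[OF k] c])
  have nk: "n - k + 1 = n - (k - 1)" using k by simp
  have "Ad_diff ip Q i n \<beta>0 M (- int k) v = tensor_map R0 (NN (k - 1)) M
      (\<lambda>h. h \<otimes>\<^bsub>H\<^esub> ?t \<otimes>\<^bsub>H\<^esub> flank_idem Q i (n - (k - 1)) \<beta>0 (k - 1)) v"
    using k unfolding Ad_diff_def Let_def by (simp add: nk[simplified])
  also have "\<dots> = rm (k - 1) (ddiff k) v"
    unfolding fl dd using k t NN_H[OF k(2)] klr_class_closed[OF c]
    by (intro tensor_map_cong[OF bil_M bil_NN[OF k(2)] v]) (simp add: H.m_assoc)
  finally show ?thesis .
qed

text \<open>The lower bound is strict because the target of the homotopy in degree
  \<open>- n\<close> is the zero module.\<close>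

definition htpy :: "int \<Rightarrow> ('i, 'k, ('i, 'k) klr_elt) flank_elt \<Rightarrow> ('i, 'k, ('i, 'k) klr_elt) flank_elt" where
  "htpy p v = (if - int n < p \<and> p \<le> 0 then rm (nat (- p) + 1) (ydiff (nat (- p))) v
     else \<zero>\<^bsub>obj (p - 1)\<^esub>)"

text \<open>The target is the zero module except for \<open>p = 1\<close>, where it is the last term
  of the complex; there the zero must be seen to be homogeneous of every degree and fixed by
  \<open>H\<close>.\<close>

lemma const_zero_hom: "p \<le> - int n \<or> p > 0 \<Longrightarrow> (\<lambda>_. \<zero>\<^bsub>obj (p - 1)\<^esub>) \<in> graded_hom H A (obj (p - 1))"
proof -
  assume "p \<le> - int n \<or> p > 0"
  then consider "obj (p - 1) = zero_gmod" | "p = 1"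
    using obj_zero[of "p - 1"] by linarith
  then show "(\<lambda>_. \<zero>\<^bsub>obj (p - 1)\<^esub>) \<in> graded_hom H A (obj (p - 1))"
  proof cases
    case 1
    then show ?thesis by (auto simp: graded_hom_def zero_gmod_def)
  next
    case 2
    have p: "p - 1 = - int 0" using 2 by simp
    have z: "(0 :: nat) \<le> n" by simp
    have rm: "rm 0 (epsilon 0) \<one>\<^bsub>TG 0\<^esub> = \<one>\<^bsub>TG 0\<^esub>"
      by (rule tensor_map_one[OF z z linear_right[OF right_ok_epsilon[OF z]]])
    interpret T: group "TG 0" by (rule group_tensor_group[OF bil_M bil_NN[OF z]])
    have one: "\<one>\<^bsub>TG 0\<^esub> \<in> rm 0 (epsilon 0) ` carrier (TG 0)"
      by (rule image_eqI[of _ "rm 0 (epsilon 0)", OF rm[symmetric] T.one_closed])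
    have lm: "lm 0 h \<one>\<^bsub>TG 0\<^esub> = \<one>\<^bsub>TG 0\<^esub>" if "h \<in> carrier H" for h
      by (rule tensor_map_one[OF z z linear_left[OF z that]])
    have Hc: "\<one>\<^bsub>TG 0\<^esub> \<in> Hc 0 d" for d unfolding Hc_def by (rule generate.one)
    have "\<one>\<^bsub>TG 0\<^esub> \<otimes>\<^bsub>TG 0\<^esub> \<one>\<^bsub>TG 0\<^esub> = \<one>\<^bsub>TG 0\<^esub>" by (rule T.r_one[OF T.one_closed])
    then show ?thesis
      unfolding p graded_hom_def obj_simps[OF z] using one lm Hc by (simp add: image_subset_iff)
  qed
qed

text \<open>On pure tensors the homogeneous left entry is multiplied by a homogeneous element, and a
  homomorphism maps a generated subgroup to the subgroup generated by the image.\<close>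

lemma rm_Hc:
  assumes k: "k < n" and v: "v \<in> Hc k d"
  shows "rm (k + 1) (ydiff k) v
    \<in> Hc (k + 1) (d + half_norm ip i * (2 * (int n - 1) - int m * int N - 2 * int k))"
proof -
  have kn: "k \<le> n" "k + 1 \<le> n" using k by auto
  let ?e = "half_norm ip i * (2 * (int n - 1) - int m * int N - 2 * int k)"
  let ?S = "\<lambda>k d. {tensor_class R0 (NN k) M (frag_of (g, y)) |g y p q.
        g \<in> carrier (NN k) \<and> klr_homog ip Q \<beta> p g \<and> y \<in> hcomp M q \<and> p + q = d}"
  interpret T: group "TG k" by (rule group_tensor_group[OF bil_M bil_NN[OF kn(1)]])
  interpret T': group "TG (k + 1)" by (rule group_tensor_group[OF bil_M bil_NN[OF kn(2)]])
  interpret G: group_hom "TG k" "TG (k + 1)" "rm (k + 1) (ydiff k)"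
    by unfold_locales (intro homI rm_closed[OF right_ok_y[OF k]] rm_add[OF right_ok_y[OF k]])
  have keys: "Poly_Mapping.keys (frag_of (g, y)) \<subseteq> carrier (NN k) \<times> carrier M"
    if "g \<in> carrier (NN k)" "y \<in> hcomp M q" for g y q
    using that klr_homog_closed by (auto simp: M_simps)
  have sub: "?S k d \<subseteq> carrier (TG k)"
    using keys tensor_class_closed[OF bil_M] by blast
  have "rm (k + 1) (ydiff k) ` ?S k d \<subseteq> ?S (k + 1) (d + ?e)"
  proof
    fix w assume "w \<in> rm (k + 1) (ydiff k) ` ?S k d"
    then obtain g y p q where g: "g \<in> carrier (NN k)" "klr_homog ip Q \<beta> p g" and y: "y \<in> hcomp M q"
      and d: "p + q = d" and w: "w = rm (k + 1) (ydiff k) (tensor_class R0 (NN k) M (frag_of (g, y)))"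
      by blast
    have "w = tensor_class R0 (NN (k + 1)) M (frag_of (g \<otimes>\<^bsub>H\<^esub> ydiff k, y))"
      using tensor_map_class[OF bil_M bil_NN[OF kn(1)] bil_NN[OF kn(2)] linear_right[OF right_ok_y[OF k]]
          keys[OF g(1) y]] by (simp add: w)
    moreover have "g \<otimes>\<^bsub>H\<^esub> ydiff k \<in> carrier (NN (k + 1))"
      using linear_right[OF right_ok_y[OF k]] g(1) unfolding linear_map_def by blast
    moreover have "klr_homog ip Q \<beta> (p + ?e) (g \<otimes>\<^bsub>H\<^esub> ydiff k)"
      by (rule klr_homog.mult[OF g(2) y_homog[OF k]])
    moreover have "p + ?e + q = d + ?e" using d by simp
    ultimately show "w \<in> ?S (k + 1) (d + ?e)" using y by blast
  qed
  then have "generate (TG (k + 1)) (rm (k + 1) (ydiff k) ` ?S k d) \<subseteq> Hc (k + 1) (d + ?e)"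
    unfolding Hc_def by (rule T'.mono_generate)
  then have "rm (k + 1) (ydiff k) ` Hc k d \<subseteq> Hc (k + 1) (d + ?e)"
    using G.generate_img[OF sub] unfolding Hc_def by simp
  then show ?thesis using v by blast
qed

lemma rm_epsilon_closed: "k \<le> n \<Longrightarrow> v \<in> rm k (epsilon k) ` carrier (TG k) \<Longrightarrow> v \<in> carrier (TG k)"
  using rm_closed[OF right_ok_epsilon] by blast

lemma htpy_hom: "htpy p \<in> graded_hom H (obj p) (obj (p - 1))"
proof (cases "- int n < p \<and> p \<le> 0")
  case False
  then have "htpy p = (\<lambda>_. \<zero>\<^bsub>obj (p - 1)\<^esub>)" by (auto simp: htpy_def)
  then show ?thesis using const_zero_hom[of p] False by auto
next
  case True
  define k where "k = nat (- p)"
  have p: "p = - int k" and k: "k < n" using True by (auto simp: k_def)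
  have kn: "k \<le> n" "k + 1 \<le> n" using k by auto
  have p': "- int k - 1 = - int (k + 1)" by simp
  have ht: "htpy (- int k) = rm (k + 1) (ydiff k)"
    using k by (auto simp: htpy_def)
  note ok = right_ok_y[OF k] right_ok_epsilon[OF kn(1)] right_ok_epsilon[OF kn(2)]
  have W: "rm (k + 1) (ydiff k) v \<in> rm (k + 1) (epsilon (k + 1)) ` carrier (TG (k + 1))"
    if "v \<in> rm k (epsilon k) ` carrier (TG k)" for v
  proof -
    obtain w where w: "w \<in> carrier (TG k)" "v = rm k (epsilon k) w" using \<open>v \<in> _\<close> by auto
    note ey = right_ok_comp[OF ok(2) ok(1)]
    have "rm (k + 1) (ydiff k) v = rm (k + 1) (epsilon k \<otimes>\<^bsub>H\<^esub> ydiff k) w"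
      unfolding w(2) by (rule rm_comp[OF ok(2) ok(1) w(1)])
    \<comment> \<open>By \<open>epsilon_y\<close> the element is fixed by right multiplication by
      \<open>epsilon (k + 1)\<close> and so lies in its image.\<close>
    also have "\<dots> = rm (k + 1) (epsilon (k + 1)) (rm (k + 1) (epsilon k \<otimes>\<^bsub>H\<^esub> ydiff k) w)"
      unfolding rm_comp[OF ey ok(3) w(1)] epsilon_y[OF k] ..
    finally show ?thesis using rm_closed[OF ey w(1)] by blast
  qed
  show ?thesis
    unfolding p unfolding p' ht graded_hom_def obj_simps(1,2,4,5)[OF kn(1)] obj_simps(1,2,4,5)[OF kn(2)]
  proof (intro CollectI conjI ballI allI funcsetI subsetI, goal_cases)
    case (1 v)
    then show ?case by (rule W)
  next
    case (2 a b)
    then show ?case by (intro rm_add[OF ok(1)] rm_epsilon_closed kn)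
  next
    case (3 h a)
    then show ?case by (intro rm_lm[OF ok(1)] rm_epsilon_closed kn)
  next
    case (4 d v)
    then show ?case
      unfolding shift_Suc[OF k] using W rm_Hc[OF k, of _ "d + shift k"] by (auto simp: add.assoc)
  qed
qed

lemma htpy_eq:
  assumes "a \<in> carrier (obj p)"
  shows "a = Ad_diff ip Q i n \<beta>0 M (p - 1) (htpy p a)
    \<oplus>\<^bsub>obj p\<^esub> htpy (p + 1) (Ad_diff ip Q i n \<beta>0 M p a)"
proof (cases "- int n \<le> p \<and> p \<le> 0")
  case False
  then have "obj p = zero_gmod" by (intro obj_zero) auto
  then show ?thesis using assms by (auto simp: zero_gmod_def)
next
  case True
  define k where "k = nat (- p)"
  have p: "p = - int k" and k: "k \<le> n" using True by (auto simp: k_def)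
  obtain w where w: "w \<in> carrier (TG k)" "a = rm k (epsilon k) w"
    using assms unfolding p obj_simps(1)[OF k] by auto
  interpret T: group "TG k" by (rule group_tensor_group[OF bil_M bil_NN[OF k]])
  note ok = right_ok_epsilon[OF k]
  have a: "a \<in> carrier (TG k)" unfolding w(2) by (rule rm_closed[OF ok w(1)])
  \<comment> \<open>The default value \<open>\<one>\<close> of the multiplicatively written tensor
    group is the zero of the module.\<close>
  have left: "Ad_diff ip Q i n \<beta>0 M (p - 1) (htpy p a)
      = (if k < n then rm k (epsilon k \<otimes>\<^bsub>H\<^esub> ydiff k \<otimes>\<^bsub>H\<^esub> ddiff (k + 1)) w else \<one>\<^bsub>TG k\<^esub>)"
  proof (cases "k < n")
    case kn: True
    have okd: "right_ok (k + 1) k (ddiff (k + 1))" using right_ok_d[of "k + 1"] kn by simp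
    note ey = right_ok_comp[OF ok right_ok_y[OF kn]]
    have "htpy p a = rm (k + 1) (ydiff k) a" using kn by (auto simp: htpy_def p)
    also have "\<dots> = rm (k + 1) (epsilon k \<otimes>\<^bsub>H\<^esub> ydiff k) w"
      unfolding w(2) by (rule rm_comp[OF ok right_ok_y[OF kn] w(1)])
    finally have h: "htpy p a = rm (k + 1) (epsilon k \<otimes>\<^bsub>H\<^esub> ydiff k) w" .
    have p1: "p - 1 = - int (k + 1)" by (simp add: p)
    have "Ad_diff ip Q i n \<beta>0 M (p - 1) (htpy p a) = rm k (ddiff (k + 1)) (rm (k + 1) (epsilon k \<otimes>\<^bsub>H\<^esub> ydiff k) w)"
      unfolding h p1 using kn diff_eq[of "k + 1", OF _ _ rm_closed[OF ey w(1)]] by simp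
    also have "\<dots> = rm k (epsilon k \<otimes>\<^bsub>H\<^esub> ydiff k \<otimes>\<^bsub>H\<^esub> ddiff (k + 1)) w"
      by (rule rm_comp[OF ey okd w(1)])
    finally show ?thesis using kn by simp
  next
    case False
    then have "k = n" using k by simp
    then show ?thesis using obj_simps(3)[OF k] by (simp add: Ad_diff_def p)
  qed
  have right: "htpy (p + 1) (Ad_diff ip Q i n \<beta>0 M p a)
      = (if 1 \<le> k then rm k (epsilon k \<otimes>\<^bsub>H\<^esub> ddiff k \<otimes>\<^bsub>H\<^esub> ydiff (k - 1)) w else \<one>\<^bsub>TG k\<^esub>)"
  proof (cases "1 \<le> k")
    case k1: True
    have oky: "right_ok (k - 1) k (ydiff (k - 1))" using right_ok_y[of "k - 1"] k1 k by simp
    note ed = right_ok_comp[OF ok right_ok_d[OF k1 k]]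
    have "Ad_diff ip Q i n \<beta>0 M p a = rm (k - 1) (ddiff k) a"
      unfolding p by (rule diff_eq[OF k1 k a])
    also have "\<dots> = rm (k - 1) (epsilon k \<otimes>\<^bsub>H\<^esub> ddiff k) w"
      unfolding w(2) by (rule rm_comp[OF ok right_ok_d[OF k1 k] w(1)])
    finally have d: "Ad_diff ip Q i n \<beta>0 M p a = rm (k - 1) (epsilon k \<otimes>\<^bsub>H\<^esub> ddiff k) w" .
    have "nat (- (p + 1)) = k - 1" using k1 by (simp add: p)
    then have "htpy (p + 1) (Ad_diff ip Q i n \<beta>0 M p a)
        = rm k (ydiff (k - 1)) (rm (k - 1) (epsilon k \<otimes>\<^bsub>H\<^esub> ddiff k) w)"
      unfolding d using k1 k by (simp add: htpy_def p)
    also have "\<dots> = rm k (epsilon k \<otimes>\<^bsub>H\<^esub> ddiff k \<otimes>\<^bsub>H\<^esub> ydiff (k - 1)) w"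
      by (rule rm_comp[OF ed oky w(1)])
    finally show ?thesis using k1 by simp
  next
    case False
    then show ?thesis using obj_simps(3)[OF k] by (simp add: htpy_def p)
  qed
  have cl: "rm k s w \<in> carrier (TG k)" if "right_ok k k s" for s using rm_closed[OF that w(1)] .
  have sum: "(if k < n then rm k (epsilon k \<otimes>\<^bsub>H\<^esub> ydiff k \<otimes>\<^bsub>H\<^esub> ddiff (k + 1)) w else \<one>\<^bsub>TG k\<^esub>)
     \<otimes>\<^bsub>TG k\<^esub> (if 1 \<le> k then rm k (epsilon k \<otimes>\<^bsub>H\<^esub> ddiff k \<otimes>\<^bsub>H\<^esub> ydiff (k - 1)) w else \<one>\<^bsub>TG k\<^esub>) = a"
  proof -
    consider "k = 0" | "1 \<le> k" "k < n" | "k = n" using k by linarith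
    then show ?thesis
    proof cases
      case 1
      have kn: "k < n" and k1: "\<not> 1 \<le> k" using 1 n by auto
      show ?thesis
        by (simp only: kn k1 if_True if_False homotopy_H(1)[OF k 1] T.r_one[OF cl[OF ok]] w(2))
    next
      case 2
      have okd: "right_ok (k + 1) k (ddiff (k + 1))" using right_ok_d[of "k + 1"] 2 by simp
      have oky: "right_ok (k - 1) k (ydiff (k - 1))" using right_ok_y[of "k - 1"] 2 by simp
      show ?thesis
        using rm_sum[OF right_ok_comp[OF right_ok_comp[OF ok right_ok_y[OF 2(2)]] okd]
            right_ok_comp[OF right_ok_comp[OF ok right_ok_d[OF 2(1) k]] oky] w(1)] 2
          homotopy_H(2)[OF k 2] by (simp add: w(2))
    next
      case 3
      have kn: "\<not> k < n" and k1: "1 \<le> k" using 3 n by auto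
      show ?thesis
        by (simp only: kn k1 if_True if_False homotopy_H(3)[OF k 3] T.l_one[OF cl[OF ok]] w(2))
    qed
  qed
  show ?thesis unfolding left right using sum obj_simps(2)[OF k] by (simp add: p)
qed

theorem null_homotopic_Ad: "null_homotopic H obj (Ad_diff ip Q i n \<beta>0 M)"
  unfolding null_homotopic_def using htpy_hom htpy_eq by blast

end

theorem theorem6p8:
  fixes ip :: "'i \<Rightarrow> 'i \<Rightarrow> int"
    and t :: "'i \<Rightarrow> 'i \<Rightarrow> 'k::comm_ring_1"
    and Q :: "'i \<Rightarrow> 'i \<Rightarrow> 'k poly poly"
    and i j :: 'i
    and m n :: nat
  assumes "klr_datum ip t Q"
    and "j \<noteq> i"
    and "int n > - (int m * cartan ip i j)"
  shows "null_homotopic (klr Q (replicate_mset m j + replicate_mset n i))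
    (Ad_obj ip Q i n (replicate_mset m j) (E_pow ip Q j m))
    (Ad_diff ip Q i n (replicate_mset m j) (E_pow ip Q j m))"
proof -
  interpret K: klr_datum ip t Q by (rule assms(1))
  have ij: "i \<noteq> j" using assms(2) by simp
  define N where "N = nat (- cartan ip i j)"
  have N: "cartan ip i j = - int N" using K.cartan_nonpos[OF ij] by (simp add: N_def)
  have ip_ii: "ip a a = 2 * half_norm ip a" for a
    using K.ip_even[of a] by (simp add: half_norm_def)
  have pos: "half_norm ip a > 0" for a using K.ip_pos[of a] ip_ii[of a] by simp
  have "2 * ip i j = ip i i * cartan ip i j"
    using K.cartan_integral[OF ij] by (simp add: cartan_def)
  then have ip_ij: "ip i j = - (half_norm ip i * int N)" by (simp add: ip_ii N)
  obtain lam mu where unit: "lam * mu = 1" and top: "coeff (Q i j) N = [:lam:]"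
    and deg: "\<And>s. s > N \<Longrightarrow> coeff (Q i j) s = 0"
  proof (cases "cartan ip i j = 0")
    case True
    obtain c where c: "c dvd 1" "Q i j = [:[:c:]:]" using K.Q_zero[OF ij True] by auto
    obtain c' where "c * c' = 1" using c(1) by (metis dvdE)
    moreover have "N = 0" using True by (simp add: N_def)
    ultimately show ?thesis using that[of c c'] c(2) by (simp add: coeff_pCons split: nat.splits)
  next
    case False
    then have neg: "cartan ip i j < 0" using K.cartan_nonpos[OF ij] by simp
    obtain P where P: "Q i j = monom [:t i j:] N + [:monom (t j i) (nat (- cartan ip j i)):] + P"
      "\<And>a b. coeff (coeff P a) b \<noteq> 0 \<Longrightarrow>
        0 < a \<and> 0 < b \<and> half_norm ip i * int a + half_norm ip j * int b = - ip i j"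
      using K.Q_neg[OF ij neg] unfolding N_def by blast
    \<comment> \<open>The remaining terms of \<open>Q i j\<close> satisfy
      \<open>d_i a + d_j b = d_i N\<close> with \<open>b > 0\<close>, so they are of lower degree in
      the first variable and leave \<open>t i j\<close> as leading coefficient.\<close>
    have small: "a < N" if "coeff (coeff P a) b \<noteq> 0" for a b
    proof -
      have "half_norm ip i * int a < half_norm ip i * int N"
        using P(2)[OF that] pos[of j] ip_ij by (smt (verit) mult_pos_pos of_nat_0_less_iff)
      then show ?thesis using pos[of i] by simp
    qed
    have P0: "coeff P s = 0" if "s \<ge> N" for s
      by (rule poly_eqI) (use small[of s] that in fastforce)
    have "N > 0" using neg by (simp add: N_def)
    then have "coeff (Q i j) N = [:t i j:]" "\<And>s. s > N \<Longrightarrow> coeff (Q i j) s = 0"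
      using P0 by (auto simp: P(1) coeff_pCons split: nat.splits)
    moreover obtain mu where "t i j * mu = 1" using K.t_unit[OF ij neg] by (metis dvdE)
    ultimately show ?thesis using that[of "t i j" mu] by blast
  qed
  have "int (m * N) < int n" using assms(3) by (simp add: N)
  then have n: "m * N < n" by linarith
  interpret klr_ad ip Q i j m n N lam mu
    by unfold_locales (use ij K.Q_diag K.Q_sym top deg unit n ip_ii ip_ij N in auto)
  show ?thesis by (rule null_homotopic_Ad)
qed

end
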